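(* Let $p \in \mathbb{R}/\pi\mathbb{Z}$ with $p \neq 0$. There exists $\lambda_p > 0$ such that the following statements hold. (i) For any $\lambda \geq \lambda_p$, one has $\mathcal{I}_\lambda(p) = \mathfrak{I}(p)$, and the dark soliton $\mathfrak{u}_{c_p}$ (seen as a function on $\mathbb{R}\times\mathbb{T}$ that does not depend on $y$) is a minimizer of the problem defining $\mathcal{I}_\lambda(p)$. When $\lambda > \lambda_p$, it is the unique minimizer up to translation and phase shift (i.e. every minimizer is of the form $(x,y) \mapsto e^{i\theta}\,\mathfrak{u}_{c_p}(x-a)$ with $a, \theta \in \mathbb{R}$). (ii) For any $0 < \lambda < \lambda_p$, one has $\mathcal{I}_\lambda(p) < \mathfrak{I}(p)$, and there does not exist any minimizer of the problem defining $\mathcal{I}_\lambda(p)$ which depends only on the variable $x$.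
   Context: Notation: $\langle z_1, z_2\rangle_{\mathbb{C}} = \mathrm{Re}(z_1\bar z_2)$ for $z_1,z_2\in\mathbb{C}$; $\mathbb{T} = \mathbb{R}/\mathbb{Z}$; functions are complex-valued. One-dimensional objects. $X(\mathbb{R}) = \{\psi \in H^1_{\mathrm{loc}}(\mathbb{R}) : \psi' \in L^2(\mathbb{R}),\ 1-|\psi|^2 \in L^2(\mathbb{R})\}$ and $E(\psi) = \frac12\int_{\mathbb{R}}|\psi'|^2 + \frac14\int_{\mathbb{R}}(1-|\psi|^2)^2$. Every $\psi\in X(\mathbb{R})$ is continuous and bounded with $|\psi(x)|\to 1$ as $x \to \pm\infty$. The untwisted momentum $[P](\psi)\in\mathbb{R}/\pi\mathbb{Z}$ is defined as follows: choose $R>0$ with $|\psi|\ge 1/2$ for $|x|\geq R$, a continuous $\theta$ on $(-\infty,-R]\cup[R,+\infty)$ with $\psi = |\psi|e^{i\theta}$ there, a smooth $\chi:\mathbb{R}\to[0,1]$ with $\chi(x)=0$ for $|x|\le 1$ and $\chi(x)=1$ for $|x|\ge 2$, a number $r>R$, set $\chi_r(x)=\chi(x/r)$, and let $[P](\psi) = \frac12\int_{\mathbb{R}}\big(\langle i\psi',\psi\rangle_{\mathbb{C}} + (\chi_r\theta)'\big)$ modulo $\pi$; this does not depend on the choices. For $p\in\mathbb{R}/\pi\mathbb{Z}$, $\mathfrak{I}(p) = \inf\{E(\psi) : \psi\in X(\mathbb{R}),\ [P](\psi)=p\}$. Dark solitons: for $|c|<\sqrt2$, $\mathfrak{u}_c(x)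 = \sqrt{\frac{2-c^2}{2}}\tanh\big(\frac{\sqrt{2-c^2}}{2}x\big) + i\frac{c}{\sqrt2}$. For $p\in\mathbb{R}/\pi\mathbb{Z}$, $p\ne0$, $c_p$ is the unique number in $(-\sqrt2,\sqrt2)$ with $[P](\mathfrak{u}_{c_p})=p$. Two-dimensional objects. $H^1_{\mathrm{loc}}(\mathbb{R}\times\mathbb{T})$ is the set of functions in $H^1_{\mathrm{loc}}(\mathbb{R}^2)$ that are $1$-periodic in the second variable $y$. $X(\mathbb{R}\times\mathbb{T}) = \{\psi\in H^1_{\mathrm{loc}}(\mathbb{R}\times\mathbb{T}) : \nabla\psi\in L^2(\mathbb{R}\times\mathbb{T}),\ 1-|\psi|^2\in L^2(\mathbb{R}\times\mathbb{T})\}$. For $\lambda>0$, $E_\lambda(\psi) = \frac12\int_{\mathbb{R}\times\mathbb{T}}(|\partial_x\psi|^2+\lambda^2|\partial_y\psi|^2) + \frac14\int_{\mathbb{R}\times\mathbb{T}}(1-|\psi|^2)^2$. For $\psi\in X(\mathbb{R}\times\mathbb{T})$ put $\hat\psi_0(x)=\int_0^1\psi(x,y)\,dy$ and $w_0=\psi-\hat\psi_0$; then $\hat\psi_0\in X(\mathbb{R})$, $w_0\in H^1(\mathbb{R}\times\mathbb{T})$, and $[P](\psi) = [P](\hat\psi_0)+\frac12\int_{\mathbb{R}\times\mathbb{T}}\langle i\partial_xw_0,w_0\rangle_{\mathbb{C}}$ modulo $\pi$. For $p\in\mathbb{R}/\pi\mathbb{Z}$, $\mathcal{I}_\lambda(p)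 = \inf\{E_\lambda(\psi) : \psi\in X(\mathbb{R}\times\mathbb{T}),\ [P](\psi)=p\}$. *)

theory Defs
  imports "HOL-Analysis.Analysis" "HOL-Library.Real_Mod"
begin

text \<open>
  Elements of Sobolev-type spaces are represented by Borel functions, identified when they agree
  almost everywhere; accordingly, pointwise conditions on them are stated almost everywhere.
  An element of \<open>\<real>/\<pi>\<int>\<close> is represented by a real number, and equality there is
  \<open>[_ = _] (rmod pi)\<close>.
\<close>

primrec C_k :: "nat \<Rightarrow> ('a::euclidean_space \<Rightarrow> real) \<Rightarrow> bool" where
  "C_k 0 f \<longleftrightarrow> continuous_on UNIV f"
| "C_k (Suc k) f \<longleftrightarrow> (\<exists>g. (\<forall>x. GDERIV f x :> g x) \<and> (\<forall>b\<in>Basis. C_k k (\<lambda>x. g x \<bullet> b)))"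

definition smooth :: "('a::euclidean_space \<Rightarrow> real) \<Rightarrow> bool" where
  "smooth f \<longleftrightarrow> (\<forall>k. C_k k f)"

definition test_function :: "('a::euclidean_space \<Rightarrow> real) \<Rightarrow> bool" where
  "test_function \<phi> \<longleftrightarrow> smooth \<phi> \<and> compact (closure {x. \<phi> x \<noteq> 0})"

definition L1_loc :: "('a::euclidean_space \<Rightarrow> 'b::{banach, second_countable_topology}) \<Rightarrow> bool" where
  "L1_loc f \<longleftrightarrow> (\<forall>K. compact K \<longrightarrow> set_integrable lborel K f)"

definition L2_loc :: "('a::euclidean_space \<Rightarrow> 'b::{banach, second_countable_topology}) \<Rightarrow> bool" where
  "L2_loc f \<longleftrightarrow> f \<in> borel_measurable borel \<and>
     (\<forall>K. compact K \<longrightarrow> set_integrable lborel K (\<lambda>x. (norm (f x))\<^sup>2))"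

definition has_weak_deriv ::
  "'a::euclidean_space \<Rightarrow> ('a \<Rightarrow> 'b::{banach, second_countable_topology}) \<Rightarrow> ('a \<Rightarrow> 'b) \<Rightarrow> bool" where
  "has_weak_deriv b f g \<longleftrightarrow> L1_loc f \<and> L1_loc g \<and>
     (\<forall>\<phi>. test_function \<phi> \<longrightarrow>
        (LINT x|lborel. frechet_derivative \<phi> (at x) b *\<^sub>R f x) = - (LINT x|lborel. \<phi> x *\<^sub>R g x))"

text \<open>The weak derivative in direction \<open>b\<close>, unique up to null sets when it exists.\<close>

definition weak_deriv ::
  "'a::euclidean_space \<Rightarrow> ('a \<Rightarrow> 'b::{banach, second_countable_topology}) \<Rightarrow> 'a \<Rightarrow> 'b" where
  "weak_deriv b f = (SOME g. has_weak_deriv b f g)"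

definition H1_loc :: "('a::euclidean_space \<Rightarrow> 'b::{banach, second_countable_topology}) set" where
  "H1_loc = {f. L2_loc f \<and> (\<forall>b\<in>Basis. \<exists>g. has_weak_deriv b f g \<and> L2_loc g)}"

definition cdot :: "complex \<Rightarrow> complex \<Rightarrow> real" where
  "cdot z w = Re (z * cnj w)"


definition X_line :: "(real \<Rightarrow> complex) set" where
  "X_line = {\<psi> \<in> H1_loc.
     integrable lborel (\<lambda>x. (norm (weak_deriv 1 \<psi> x))\<^sup>2) \<and>
     integrable lborel (\<lambda>x. (1 - (norm (\<psi> x))\<^sup>2)\<^sup>2)}"

definition E_line :: "(real \<Rightarrow> complex) \<Rightarrow> real" where
  "E_line \<psi> = 1 / 2 * (LINT x|lborel. (norm (weak_deriv 1 \<psi> x))\<^sup>2)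
     + 1 / 4 * (LINT x|lborel. (1 - (norm (\<psi> x))\<^sup>2)\<^sup>2)"

text \<open>
  Only the values of \<open>\<theta>\<close> on \<open>\<bar>x\<bar> \<ge> R\<close> matter, as the cut-off vanishes on \<open>\<bar>x\<bar> \<le> r\<close> and \<open>r > R\<close>.
\<close>

definition momentum_line_value :: "(real \<Rightarrow> complex) \<Rightarrow> real \<Rightarrow> bool" where
  "momentum_line_value \<psi> m \<longleftrightarrow> (\<exists>R \<theta> \<eta> r.
     R > 0 \<and>
     (AE x in lborel. \<bar>x\<bar> \<ge> R \<longrightarrow> norm (\<psi> x) \<ge> 1 / 2) \<and>
     continuous_on ({..-R} \<union> {R..}) \<theta> \<and>
     (AE x in lborel. \<bar>x\<bar> \<ge> R \<longrightarrow> \<psi> x = of_real (norm (\<psi> x)) * exp (\<i> * of_real (\<theta> x))) \<and>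
     smooth \<eta> \<and> range \<eta> \<subseteq> {0..1} \<and>
     (\<forall>x. \<bar>x\<bar> \<le> 1 \<longrightarrow> \<eta> x = 0) \<and> (\<forall>x. \<bar>x\<bar> \<ge> 2 \<longrightarrow> \<eta> x = 1) \<and>
     r > R \<and>
     m = 1 / 2 * (LINT x|lborel. cdot (\<i> * weak_deriv 1 \<psi> x) (\<psi> x)
                                + weak_deriv 1 (\<lambda>t. \<eta> (t / r) * \<theta> t) x))"

text \<open>A real representative of the untwisted momentum; it is meaningful only modulo \<open>\<pi>\<close>.\<close>

definition momentum_line :: "(real \<Rightarrow> complex) \<Rightarrow> real" where
  "momentum_line \<psi> = (SOME m. momentum_line_value \<psi> m)"

definition I_line :: "real \<Rightarrow> real" where
  "I_line p = Inf {E_line \<psi> | \<psi>. \<psi> \<in> X_line \<and> [momentum_line \<psi> = p] (rmod pi)}"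

definition dark_soliton :: "real \<Rightarrow> real \<Rightarrow> complex" where
  "dark_soliton c x =
     of_real (sqrt ((2 - c\<^sup>2) / 2) * tanh (sqrt (2 - c\<^sup>2) / 2 * x)) + \<i> * of_real (c / sqrt 2)"

definition soliton_speed :: "real \<Rightarrow> real" where
  "soliton_speed p =
     (THE c. - sqrt 2 < c \<and> c < sqrt 2 \<and> [momentum_line (dark_soliton c) = p] (rmod pi))"


text \<open>
  Functions on \<open>\<real> \<times> \<real>/\<int>\<close> are functions on the plane that are 1-periodic in the second variable;
  integrals over the cylinder are taken over the fundamental domain \<open>cyl\<close>.
\<close>

definition cyl :: "(real \<times> real) set" where
  "cyl = UNIV \<times> {0..<1}"

definition H1_loc_cyl :: "(real \<times> real \<Rightarrow> complex) set" where
  "H1_loc_cyl = {\<psi> \<in> H1_loc. AE z in lborel. \<psi> (fst z, snd z + 1) = \<psi> z}"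

definition X_cyl :: "(real \<times> real \<Rightarrow> complex) set" where
  "X_cyl = {\<psi> \<in> H1_loc_cyl.
     set_integrable lborel cyl (\<lambda>z. (norm (weak_deriv (1, 0) \<psi> z))\<^sup>2) \<and>
     set_integrable lborel cyl (\<lambda>z. (norm (weak_deriv (0, 1) \<psi> z))\<^sup>2) \<and>
     set_integrable lborel cyl (\<lambda>z. (1 - (norm (\<psi> z))\<^sup>2)\<^sup>2)}"

definition E_cyl :: "real \<Rightarrow> (real \<times> real \<Rightarrow> complex) \<Rightarrow> real" where
  "E_cyl lam \<psi> =
     1 / 2 * (LINT z:cyl|lborel. (norm (weak_deriv (1, 0) \<psi> z))\<^sup>2
                               + lam\<^sup>2 * (norm (weak_deriv (0, 1) \<psi> z))\<^sup>2)
     + 1 / 4 * (LINT z:cyl|lborel. (1 - (norm (\<psi> z))\<^sup>2)\<^sup>2)"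

definition mean_y :: "(real \<times> real \<Rightarrow> complex) \<Rightarrow> real \<Rightarrow> complex" where
  "mean_y \<psi> x = (LINT y:{0..1}|lborel. \<psi> (x, y))"

definition osc_y :: "(real \<times> real \<Rightarrow> complex) \<Rightarrow> real \<times> real \<Rightarrow> complex" where
  "osc_y \<psi> z = \<psi> z - mean_y \<psi> (fst z)"

definition momentum_cyl :: "(real \<times> real \<Rightarrow> complex) \<Rightarrow> real" where
  "momentum_cyl \<psi> = momentum_line (mean_y \<psi>)
     + 1 / 2 * (LINT z:cyl|lborel. cdot (\<i> * weak_deriv (1, 0) (osc_y \<psi>) z) (osc_y \<psi> z))"

definition I_cyl :: "real \<Rightarrow> real \<Rightarrow> real" where
  "I_cyl lam p = Inf {E_cyl lam \<psi> | \<psi>. \<psi> \<in> X_cyl \<and> [momentum_cyl \<psi> = p] (rmod pi)}"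

definition is_minimizer_cyl :: "real \<Rightarrow> real \<Rightarrow> (real \<times> real \<Rightarrow> complex) \<Rightarrow> bool" where
  "is_minimizer_cyl lam p \<psi> \<longleftrightarrow>
     \<psi> \<in> X_cyl \<and> [momentum_cyl \<psi> = p] (rmod pi) \<and> E_cyl lam \<psi> = I_cyl lam p"

end

theory Submission
  imports Defs
begin

text \<open>
  On the line, a function of finite energy traces a path in the plane whose ends approach the unit circle. Modulo \<open>\<pi>\<close>,
  its momentum is the area between this path and the circle, and the energy dominates \<open>1/\<surd>2\<close> times the length of
  the path for the weight \<open>\<bar>1 - \<bar>\<psi>\<bar>\<^sup>2\<bar>\<close>. The minimisation of the energy at fixed momentum is thus an isoperimetric
  problem, solved by the chords of the disc, which are the traces of the dark solitons. It is calibrated by the field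
  of directions of the lines tangent to a concentric circle; strict concavity of the chord energy as a function of the
  area selects the chord and gives rigidity.

  On the cylinder, the mean of \<open>\<psi>\<close> over the circle is compared with the line problem. The oscillation changes the momentum
  by at most a quadratic quantity, which \<open>\<partial>\<^sub>x w\<close> and Poincare's inequality \<open>\<integral>\<bar>w\<bar>\<^sup>2 \<le> \<integral>\<bar>\<partial>\<^sub>y \<psi>\<bar>\<^sup>2\<close> (constant 1) absorb
  once \<open>\<lambda>\<^sup>2 \<ge> 3/2\<close>; so both minimal energies agree for large \<open>\<lambda>\<close>. For small \<open>\<lambda>\<close> a function that winds slowly around the circle
  on an arc of values of \<open>y\<close>, and is constant off that arc, has any prescribed nonzero momentum and small energy. As the energy
  is affine and nondecreasing in \<open>\<lambda>\<^sup>2\<close>, the threshold is the infimum of the \<open>\<lambda>\<close> with equal minima, and above it a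
  minimizer cannot depend on \<open>y\<close>.
\<close>

subsection \<open>Smooth functions and cut-offs\<close>

text \<open>The density \<open>(1 - |v|^2) Im (cnj v * v') / |v|^2\<close> of the area is singular
  at the origin, so the momentum is such an integral only for functions bounded away from 0. The
  circle of the calibration is therefore adapted to the function: its radius is the minimum of
  \<open>|v|\<close>, or 1 if \<open>|v|\<close> is never below 1. All points of the path then lie
  on or outside it, where tangent lines exist, and if the minimum is 0 the factor in front of the
  area is 0 as well, so nothing singular is integrated. The resulting inequality is the tangent line
  of the energy-area curve at the chord touching that circle. This need not be the chord of the
  prescribed momentum; concavity makes up for the difference.

  On the cylinder, let D be the integral of \<open>|w|^2\<close>. The change of momentum, weighted
  by \<open>sqrt 2\<close>, costs D/4 beyond what the x-derivative of w pays, replacing the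
  potential of \<psi> by that of its mean costs D/2, and the transverse energy returns at least
  \<open>lam^2\<close> times D/2. This is the origin of the condition
  \<open>lam^2 >= 3/2\<close>.\<close>

lemma C_k_continuous: "C_k k f \<Longrightarrow> continuous_on UNIV f"
proof (cases k)
  case (Suc n)
  assume "C_k k f"
  then obtain g where "\<forall>x. GDERIV f x :> g x" using Suc by auto
  then have "\<forall>x. isCont f x" unfolding gderiv_def using has_derivative_continuous by blast
  then show ?thesis by (simp add: continuous_at_imp_continuous_on)
qed simp

lemma C_k_Suc_imp: "C_k (Suc k) f \<Longrightarrow> C_k k f"
proof (induction k arbitrary: f)
  case 0 then show ?case using C_k_continuous[of "Suc 0" f] by simp
next
  case (Suc k)
  from Suc.prems obtain g where g: "\<forall>x. GDERIV f x :> g x" and "\<forall>b\<in>Basis. C_k (Suc k) (\<lambda>x. g x \<bullet> b)"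
    using C_k.simps(2)[of "Suc k" f] by blast
  then have "\<forall>b\<in>Basis. C_k k (\<lambda>x. g x \<bullet> b)" using Suc.IH by blast
  then show ?case using g C_k.simps(2) by blast
qed

lemma C_k_const: "C_k k (\<lambda>x. c)"
proof (induction k arbitrary: c)
  case (Suc k)
  have "\<forall>x. GDERIV (\<lambda>x. c) x :> 0" by (simp add: GDERIV_const)
  moreover have "\<forall>b\<in>Basis. C_k k (\<lambda>x::'a. 0 \<bullet> b)" using Suc by simp
  ultimately show ?case unfolding C_k.simps by (intro exI[of _ "\<lambda>x. 0"]) simp
qed simp

lemma C_k_add: "C_k k f \<Longrightarrow> C_k k g \<Longrightarrow> C_k k (\<lambda>x. f x + g x)"
proof (induction k arbitrary: f g)
  case 0 then show ?case by (simp add: continuous_on_add)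
next
  case (Suc k)
  then obtain df dg where df: "\<forall>x. GDERIV f x :> df x" "\<forall>b\<in>Basis. C_k k (\<lambda>x. df x \<bullet> b)"
    and dg: "\<forall>x. GDERIV g x :> dg x" "\<forall>b\<in>Basis. C_k k (\<lambda>x. dg x \<bullet> b)" by auto
  have "\<forall>b\<in>Basis. C_k k (\<lambda>x. (df x + dg x) \<bullet> b)" using Suc.IH df dg by (auto simp: inner_add_left)
  then show ?case unfolding C_k.simps using df dg by (intro exI[of _ "\<lambda>x. df x + dg x"]) (simp add: GDERIV_add)
qed

lemma C_k_mult: "C_k k f \<Longrightarrow> C_k k g \<Longrightarrow> C_k k (\<lambda>x. f x * g x)"
proof (induction k arbitrary: f g)
  case 0 then show ?case by (simp add: continuous_on_mult)
next
  case (Suc k)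
  then obtain df dg where df: "\<forall>x. GDERIV f x :> df x" "\<forall>b\<in>Basis. C_k k (\<lambda>x. df x \<bullet> b)"
    and dg: "\<forall>x. GDERIV g x :> dg x" "\<forall>b\<in>Basis. C_k k (\<lambda>x. dg x \<bullet> b)" by auto
  have "C_k k f" "C_k k g" using Suc.prems C_k_Suc_imp by blast+
  then have "\<forall>b\<in>Basis. C_k k (\<lambda>x. (f x *\<^sub>R dg x + g x *\<^sub>R df x) \<bullet> b)"
    using Suc.IH df dg by (auto simp: inner_add_left intro!: C_k_add)
  then show ?case unfolding C_k.simps using df dg
    by (intro exI[of _ "\<lambda>x. f x *\<^sub>R dg x + g x *\<^sub>R df x"]) (simp add: GDERIV_mult)
qed

lemma C_k_cmult: "C_k k f \<Longrightarrow> C_k k (\<lambda>x. c * f x)"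
  by (intro C_k_mult C_k_const)

lemma C_k_prod: "finite B \<Longrightarrow> (\<And>b. b \<in> B \<Longrightarrow> C_k k (f b)) \<Longrightarrow> C_k k (\<lambda>x. \<Prod>b\<in>B. f b x)"
  by (induction B rule: finite_induct) (auto intro: C_k_const C_k_mult)

lemma C_k_coordinate:
  fixes b :: "'a::euclidean_space" and f :: "real \<Rightarrow> real"
  shows "C_k k f \<Longrightarrow> C_k k (\<lambda>x. f (x \<bullet> b))"
proof (induction k arbitrary: f)
  case 0
  then show ?case by (auto intro!: continuous_intros continuous_on_compose2[of UNIV f])
next
  case (Suc k)
  then obtain df where df: "\<forall>x. DERIV f x :> df x" "C_k k (\<lambda>x. df x)" by auto
  have 1: "GDERIV (\<lambda>x. f (x \<bullet> b)) x :> df (x \<bullet> b) *\<^sub>R b" for x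
    by (rule GDERIV_DERIV_compose) (use df in \<open>auto simp: gderiv_def inner_commute intro!: derivative_eq_intros\<close>)
  have "C_k k (\<lambda>x. df (x \<bullet> b) *\<^sub>R b \<bullet> c)" for c
    using C_k_mult[OF Suc.IH[OF df(2)] C_k_const[of k "b \<bullet> c"]] by simp
  then show ?case unfolding C_k.simps using 1 by (intro exI[of _ "\<lambda>x. df (x \<bullet> b) *\<^sub>R b"]) simp
qed

lemma C_k_affine:
  fixes f :: "real \<Rightarrow> real"
  shows "C_k k f \<Longrightarrow> C_k k (\<lambda>x. f (a * x + c))"
proof (induction k arbitrary: f)
  case 0
  then show ?case by (auto intro!: continuous_intros continuous_on_compose2[of UNIV f])
next
  case (Suc k)
  then obtain df where df: "\<forall>x. DERIV f x :> df x" "C_k k (\<lambda>x. df x)" by auto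
  have "DERIV (\<lambda>x. f (a * x + c)) x :> df (a * x + c) * a" for x
    by (rule DERIV_chain2[OF df(1)[rule_format]]) (auto intro!: derivative_eq_intros)
  then have 1: "DERIV (\<lambda>x. f (a * x + c)) x :> a * df (a * x + c)" for x
    by (simp add: mult.commute[of a "df _"])
  then show ?case unfolding C_k.simps using Suc.IH[OF df(2)] 
    by (intro exI[of _ "\<lambda>x. a * df (a * x + c)"]) (auto intro!: C_k_cmult)
qed

lemma C_k_SucI:
  fixes f :: "real \<Rightarrow> real"
  assumes "\<And>x. DERIV f x :> df x" "C_k k df"
  shows "C_k (Suc k) f"
  unfolding C_k.simps using assms by (intro exI[of _ df]) auto

text \<open>\<open>C_k\<close> supplies a derivative for each order separately. Uniqueness of
  derivatives identifies all of them with \<open>deriv f\<close>, so one function serves every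
  order.\<close>

lemma smooth_deriv:
  fixes f :: "real \<Rightarrow> real"
  assumes "smooth f"
  shows "DERIV f x :> deriv f x" "smooth (deriv f)" 
proof -
  have "\<exists>df. (\<forall>x. DERIV f x :> df x) \<and> C_k k df" for k
    using assms[unfolded smooth_def, rule_format, of "Suc k"] by auto
  then have *: "(\<forall>x. DERIV f x :> deriv f x) \<and> C_k k (deriv f)" for k
    by (metis DERIV_imp_deriv ext)
  then show "DERIV f x :> deriv f x" "smooth (deriv f)" unfolding smooth_def by auto
qed

lemma smoothI_deriv:
  fixes f :: "real \<Rightarrow> real"
  assumes "\<And>x. DERIV f x :> df x" "smooth df"
  shows "smooth f"
proof -
  have "C_k k f" for k using C_k_Suc_imp[OF C_k_SucI[OF assms(1)]] assms(2) by (auto simp: smooth_def)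
  then show ?thesis by (simp add: smooth_def)
qed

lemma smooth_continuous: "smooth f \<Longrightarrow> continuous_on UNIV f"
  unfolding smooth_def using C_k_continuous by blast

lemma poly_exp_tendsto: "((\<lambda>t::real. poly P t * exp (- t)) \<longlongrightarrow> 0) at_top"
proof -
  have 1: "((\<lambda>t::real. coeff P i * (t ^ i * exp (- t))) \<longlongrightarrow> coeff P i * 0) at_top" for i
    by (intro tendsto_mult tendsto_const) (simp add: tendsto_power_div_exp_0 exp_minus divide_inverse[symmetric])
  have "((\<lambda>t::real. \<Sum>i\<le>degree P. coeff P i * (t ^ i * exp (- t))) \<longlongrightarrow> (\<Sum>i\<le>degree P. coeff P i * 0)) at_top"
    by (intro tendsto_sum 1)
  then show ?thesis by (simp add: poly_altdef sum_distrib_right mult.assoc)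
qed

text \<open>Functions \<open>P(1/x) exp(-1/x)\<close> for \<open>x > 0\<close>, with \<open>P\<close> a polynomial, form a class closed
  under differentiation.\<close>

definition flat :: "real poly \<Rightarrow> real \<Rightarrow> real" where
  "flat P x = (if x > 0 then poly P (1 / x) * exp (- (1 / x)) else 0)"

text \<open>With \<open>t = 1/x\<close> the chain rule turns \<open>P(t) exp(-t)\<close> into
  \<open>t^2 (P(t) - P'(t)) exp(-t)\<close>, hence the polynomial. At 0 the right difference
  quotient is \<open>t P(t) exp(-t)\<close> with \<open>t\<close> going to infinity, which tends to
  0.\<close>

lemma flat_DERIV: "DERIV (flat P) x :> flat ([:0, 0, 1:] * (P - pderiv P)) x"
proof -
  consider "x > 0" | "x < 0" | "x = 0" by linarith
  then show ?thesis
  proof cases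
    case 1
    have i: "DERIV (\<lambda>x. 1 / x) x :> - (1 / x)\<^sup>2" 
      using 1 by (auto intro!: derivative_eq_intros simp: power2_eq_square)
    have "DERIV (\<lambda>x. poly P (1 / x)) x :> poly (pderiv P) (1 / x) * - (1 / x)\<^sup>2"
      by (rule DERIV_chain2[OF poly_DERIV i])
    moreover have "DERIV (\<lambda>x. exp (- (1 / x))) x :> exp (- (1 / x)) * - (- (1 / x)\<^sup>2)"
      by (rule DERIV_chain2[OF DERIV_exp DERIV_minus[OF i]])
    ultimately have "DERIV (\<lambda>x. poly P (1 / x) * exp (- (1 / x))) x :>
        (poly (pderiv P) (1 / x) * - (1 / x)\<^sup>2) * exp (- (1 / x)) + (exp (- (1 / x)) * - (- (1 / x)\<^sup>2)) * poly P (1 / x)"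
      by (rule DERIV_mult)
    moreover have "(poly (pderiv P) (1 / x) * - (1 / x)\<^sup>2) * exp (- (1 / x)) + (exp (- (1 / x)) * - (- (1 / x)\<^sup>2)) * poly P (1 / x)
       = flat ([:0, 0, 1:] * (P - pderiv P)) x"
      using 1 by (simp add: flat_def algebra_simps power2_eq_square)
    ultimately have "DERIV (\<lambda>x. poly P (1 / x) * exp (- (1 / x))) x :> flat ([:0, 0, 1:] * (P - pderiv P)) x" by simp
    then show ?thesis
      by (rule has_field_derivative_transform_within_open[where S="{0<..}"]) (use 1 in \<open>auto simp: flat_def\<close>)
  next
    case 2
    have "DERIV (\<lambda>x. 0) x :> flat ([:0, 0, 1:] * (P - pderiv P)) x" using 2 by (simp add: flat_def)
    then show ?thesis
      by (rule has_field_derivative_transform_within_open[where S="{..<0}"]) (use 2 in \<open>auto simp: flat_def\<close>)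
  next
    case 3
    have "((\<lambda>h. flat P h / h) \<longlongrightarrow> 0) (at 0)"
    proof (rule filterlim_split_at)
      show "((\<lambda>h. flat P h / h) \<longlongrightarrow> 0) (at_left 0)"
        by (rule tendsto_eventually) (auto simp: flat_def eventually_at_filter)
      have "((\<lambda>h. poly ([:0,1:] * P) (inverse h) * exp (- (inverse h))) \<longlongrightarrow> 0) (at_right (0::real))"
        by (rule filterlim_compose[OF poly_exp_tendsto filterlim_inverse_at_top_right])
      then show "((\<lambda>h. flat P h / h) \<longlongrightarrow> 0) (at_right 0)"
        by (rule Lim_transform_eventually) (auto simp: flat_def eventually_at_filter field_simps)
    qed
    then show ?thesis using 3 by (simp add: DERIV_def flat_def)
  qed
qed

lemma smooth_flat: "smooth (flat P)"
proof -
  have "C_k k (flat P)" for k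
  proof (induction k arbitrary: P)
    case 0
    show ?case using flat_DERIV by (auto intro!: continuous_at_imp_continuous_on DERIV_isCont simp: )
  next
    case (Suc k) then show ?case using C_k_SucI[OF flat_DERIV] by blast
  qed
  then show ?thesis by (simp add: smooth_def)
qed

definition bump :: "real \<Rightarrow> real" where "bump x = flat 1 x * flat 1 (1 - x)"

lemma smooth_bump: "smooth bump"
proof -
  have "C_k k (\<lambda>x. flat 1 x * flat 1 ((-1) * x + 1))" for k
    using smooth_flat[of 1] by (intro C_k_mult C_k_affine) (auto simp: smooth_def)
  then show ?thesis unfolding smooth_def bump_def[abs_def] by simp
qed

lemma bump_pos: "0 < x \<Longrightarrow> x < 1 \<Longrightarrow> bump x > 0"
  and bump_zero: "x \<le> 0 \<or> x \<ge> 1 \<Longrightarrow> bump x = 0"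
  and bump_nonneg: "bump x \<ge> 0"
  by (auto simp: bump_def flat_def)

lemma continuous_bump: "continuous_on S bump"
  using smooth_continuous[OF smooth_bump] continuous_on_subset by blast

definition bump_int :: real where "bump_int = integral {0..1} bump"

lemma bump_int_pos: "bump_int > 0"
proof -
  have "bump_int \<noteq> 0"
  proof
    assume "bump_int = 0"
    then have "\<forall>x\<in>cbox 0 1. bump x = 0"
      unfolding bump_int_def using integral_eq_0_iff[of 0 1 bump] continuous_bump bump_nonneg by auto
    then have "bump (1/2) = 0" by auto
    then show False using bump_pos[of "1/2"] by simp
  qed
  moreover have "bump_int \<ge> 0" unfolding bump_int_def
    by (intro integral_nonneg integrable_continuous_interval continuous_bump) (simp add: bump_nonneg)
  ultimately show ?thesis by simp
qed

text \<open>The primitive that vanishes at 0. The second case is there because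
  \<open>integral {0..x}\<close> runs over the empty set when \<open>x\<close> is negative.\<close>

definition antider :: "(real \<Rightarrow> 'b::banach) \<Rightarrow> real \<Rightarrow> 'b" where
  "antider g x = (if 0 \<le> x then integral {0..x} g else - integral {x..0} g)"

lemma antider_diff:
  assumes "\<And>a b. g integrable_on {a..b}" "a \<le> b"
  shows "antider g b - antider g a = integral {a..b} g"
proof -
  consider "0 \<le> a" | "a < 0" "0 \<le> b" | "b < 0" by linarith
  then show ?thesis
  proof cases
    case 1
    then have "integral {0..a} g + integral {a..b} g = integral {0..b} g"
      using assms by (intro Henstock_Kurzweil_Integration.integral_combine) auto
    then show ?thesis using 1 assms(2) add_diff_cancel_left'[of "integral {0..a} g" "integral {a..b} g"] by (simp add: antider_def)
  next
    case 2
    then have "integral {a..0} g + integral {0..b} g = integral {a..b} g"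
      using assms by (intro Henstock_Kurzweil_Integration.integral_combine) auto
    then show ?thesis using 2 by (simp add: antider_def add.commute)
  next
    case 3
    then have "integral {a..b} g + integral {b..0} g = integral {a..0} g"
      using assms by (intro Henstock_Kurzweil_Integration.integral_combine) auto
    then show ?thesis using 3 assms(2) add_diff_cancel_right'[of "integral {a..b} g" "integral {b..0} g"] by (simp add: antider_def)
  qed
qed

lemma antider_deriv:
  fixes g :: "real \<Rightarrow> real"
  assumes "continuous_on UNIV g"
  shows "DERIV (antider g) x :> g x"
proof -
  have i: "g integrable_on {a..b}" for a b
    using assms continuous_on_subset by (blast intro: integrable_continuous_interval)
  have "((\<lambda>u. integral {x - 1..u} g) has_real_derivative g x) (at x within {x-1..x+1})"
    by (rule integral_has_real_derivative) (use continuous_on_subset[OF assms] in auto)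
  then have "((\<lambda>u. integral {x - 1..u} g) has_real_derivative g x) (at x)"
    by (simp add: at_within_Icc_at[of "x - 1" x "x + 1"])
  then have "((\<lambda>u. integral {x - 1..u} g + antider g (x - 1)) has_real_derivative g x) (at x)"
    by (auto intro!: derivative_eq_intros)
  then show ?thesis
  proof (rule has_field_derivative_transform_within_open[where S="{x-1<..}"])
    fix y assume "y \<in> {x - 1<..}"
    then show "integral {x - 1..y} g + antider g (x - 1) = antider g y"
      using antider_diff[OF i, of "x-1" y] by simp
  qed auto
qed

lemma smooth_antider: "smooth g \<Longrightarrow> smooth (antider g)"
  using smoothI_deriv[OF antider_deriv] smooth_continuous by blast

text \<open>The smooth transition from 0 to 1 across the unit interval; cut-offs, windows, plateaus
  and phase ramps are all built from it.\<close>

definition step :: "real \<Rightarrow> real" where "step x = antider bump x / bump_int"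

lemma bump_integrable: "bump integrable_on {a..b}"
  by (simp add: continuous_bump integrable_continuous_interval)

lemma step_mono: "x \<le> y \<Longrightarrow> step x \<le> step y"
  using antider_diff[OF bump_integrable, of x y] integral_nonneg[OF bump_integrable bump_nonneg, of x y]
    bump_int_pos by (auto simp: step_def divide_right_mono)

lemma step_0: "x \<le> 0 \<Longrightarrow> step x = 0"
proof -
  assume x: "x \<le> 0"
  have "integral {x..0} bump = integral {x..0} (\<lambda>x. 0)"
    by (rule integral_cong) (auto simp: bump_zero)
  then show ?thesis using x by (auto simp: step_def antider_def)
qed

lemma step_1: "x \<ge> 1 \<Longrightarrow> step x = 1"
proof -
  assume x: "x \<ge> 1"
  have "integral {1..x} bump = integral {1..x} (\<lambda>x. 0)"
    by (rule integral_cong) (auto simp: bump_zero)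
  then show ?thesis using x bump_int_pos antider_diff[OF bump_integrable, of 1 x] 
    by (auto simp: step_def antider_def bump_int_def)
qed

lemma step_range: "0 \<le> step x" "step x \<le> 1"
  using step_mono[of "min x 0" x] step_mono[of x "max x 1"] step_0[of "min x 0"] step_1[of "max x 1"] by auto

lemma smooth_step: "smooth step"
proof -
  have "C_k k (\<lambda>x. (1 / bump_int) * antider bump x)" for k
    using smooth_antider[OF smooth_bump] by (intro C_k_cmult) (auto simp: smooth_def)
  then show ?thesis unfolding smooth_def step_def[abs_def] by simp
qed

lemma smooth_affine: "smooth (f::real\<Rightarrow>real) \<Longrightarrow> smooth (\<lambda>x. f (a * x + c))"
  by (auto simp: smooth_def C_k_affine)

lemma smooth_mult: "smooth f \<Longrightarrow> smooth g \<Longrightarrow> smooth (\<lambda>x. f x * g x)"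
  by (auto simp: smooth_def C_k_mult)

lemma smooth_add: "smooth f \<Longrightarrow> smooth g \<Longrightarrow> smooth (\<lambda>x. f x + g x)"
  by (auto simp: smooth_def C_k_add)

lemma smooth_const: "smooth (\<lambda>x. c)"
  by (auto simp: smooth_def C_k_const)

text \<open>The definition of the momentum quantifies existentially over such a cut-off; without
  one, no real number would be a value of the momentum.\<close>

lemma ex_cutoff:
  "\<exists>\<eta>::real\<Rightarrow>real. smooth \<eta> \<and> range \<eta> \<subseteq> {0..1} \<and> (\<forall>x. \<bar>x\<bar> \<le> 1 \<longrightarrow> \<eta> x = 0) \<and> (\<forall>x. \<bar>x\<bar> \<ge> 2 \<longrightarrow> \<eta> x = 1)"
proof (intro exI conjI)
  let ?e = "\<lambda>x. step (1 * x + (- 1)) + step ((- 1) * x + (- 1))"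
  show "smooth ?e" by (intro smooth_add smooth_affine smooth_step)
  show "range ?e \<subseteq> {0..1}"
  proof
    fix y assume "y \<in> range ?e"
    then obtain x where "y = ?e x" by blast
    then show "y \<in> {0..1}" using step_range[of "x - 1"] step_range[of "-x-1"] step_0[of "x-1"] step_0[of "-x-1"]
      by (cases "x \<ge> 0") auto
  qed
  show "\<forall>x. \<bar>x\<bar> \<le> 1 \<longrightarrow> ?e x = 0" using step_0 by auto
  show "\<forall>x. \<bar>x\<bar> \<ge> 2 \<longrightarrow> ?e x = 1"
  proof (intro allI impI)
    fix x :: real assume "\<bar>x\<bar> \<ge> 2"
    then show "?e x = 1" using step_1[of "x-1"] step_1[of "-x-1"] step_0[of "x-1"] step_0[of "-x-1"] 
      by (cases "x \<ge> 0") auto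
  qed
qed

lemma test_functionI:
  fixes f :: "'a::euclidean_space \<Rightarrow> real"
  assumes "smooth f" "\<And>x. x \<notin> cbox a b \<Longrightarrow> f x = 0"
  shows "test_function f"
proof -
  have "{x. f x \<noteq> 0} \<subseteq> cbox a b" using assms(2) by blast
  then have "closure {x. f x \<noteq> 0} \<subseteq> cbox a b" by (rule closure_minimal) (rule closed_cbox)
  then have "bounded (closure {x. f x \<noteq> 0})" using bounded_subset bounded_cbox by blast
  then show ?thesis using assms(1) unfolding test_function_def by (simp add: compact_eq_bounded_closed)
qed

lemma test_function_support:
  fixes f :: "'a::euclidean_space \<Rightarrow> real"
  assumes "test_function f"
  obtains M where "M > 0" "\<And>x. norm x > M \<Longrightarrow> f x = 0"
proof -
  have "bounded (closure {x. f x \<noteq> 0})" using assms by (simp add: test_function_def compact_imp_bounded)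
  then obtain M where M: "M > 0" "\<forall>x\<in>closure {x. f x \<noteq> 0}. norm x \<le> M" using bounded_pos by blast
  have "norm x > M \<Longrightarrow> f x = 0" for x
    using M(2) closure_subset[of "{x. f x \<noteq> 0}"] by fastforce
  then show ?thesis using that M(1) by blast
qed

text \<open>Products of one-variable functions suffice to identify a locally integrable function,
  and they make separation of variables available.\<close>

lemma test_function_prod:
  fixes f :: "'a::euclidean_space \<Rightarrow> real \<Rightarrow> real"
  assumes "\<And>b. b \<in> Basis \<Longrightarrow> test_function (f b)"
  shows "test_function (\<lambda>x. \<Prod>b\<in>Basis. f b (x \<bullet> b))"
proof -
  have "\<forall>b\<in>Basis. \<exists>M>0. \<forall>x. norm x > M \<longrightarrow> f b x = 0"
    using assms test_function_support by metis
  then obtain M where M: "\<forall>b\<in>Basis. M b > 0 \<and> (\<forall>x. norm x > M b \<longrightarrow> f b x = 0)" by metis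
  let ?c = "\<Sum>b\<in>Basis. M b *\<^sub>R b"
  show ?thesis
  proof (rule test_functionI[where a = "- ?c" and b = ?c])
    show "smooth (\<lambda>x. \<Prod>b\<in>Basis. f b (x \<bullet> b))"
      using assms unfolding smooth_def test_function_def by (auto intro!: C_k_prod C_k_coordinate)
    fix x assume "x \<notin> cbox (- ?c) ?c"
    then obtain b where b: "b \<in> Basis" "\<bar>x \<bullet> b\<bar> > M b" unfolding mem_box by (auto simp: not_le)
    then have "f b (x \<bullet> b) = 0" using M by auto
    then show "(\<Prod>b\<in>Basis. f b (x \<bullet> b)) = 0" using b by (auto intro!: prod_zero)
  qed
qed

subsection \<open>Locally integrable functions\<close>

lemma L1_locD: "L1_loc f \<Longrightarrow> compact K \<Longrightarrow> set_integrable lborel K f"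
  by (simp add: L1_loc_def)

text \<open>Integrability on a ball gives measurability of the truncation only; the function is the
  pointwise limit of its truncations to growing balls.\<close>

lemma L1_loc_measurable [measurable_dest]:
  fixes f :: "'a::euclidean_space \<Rightarrow> 'b::{banach, second_countable_topology}"
  assumes "L1_loc f"
  shows "f \<in> borel_measurable borel"
proof (rule borel_measurable_LIMSEQ_metric)
  fix n :: nat
  show "(\<lambda>x. indicator (cball 0 (real n)) x *\<^sub>R f x) \<in> borel_measurable borel"
    using L1_locD[OF assms, of "cball 0 (real n)"] unfolding set_integrable_def by auto
next
  fix x :: 'a
  obtain N where N: "norm x \<le> real N" using real_arch_simple by blast
  have "\<forall>n\<ge>N. indicator (cball 0 (real n)) x *\<^sub>R f x = f x"
  proof (intro allI impI)
    fix n assume "n \<ge> N"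
    then have "real N \<le> real n" by simp
    then have "norm x \<le> real n" using N by linarith
    then show "indicator (cball 0 (real n)) x *\<^sub>R f x = f x" by simp
  qed
  then show "(\<lambda>n. indicator (cball 0 (real n)) x *\<^sub>R f x) \<longlonglongrightarrow> f x"
    by (intro tendsto_eventually) (auto simp: eventually_sequentially)
qed

lemma set_borel_measurable_lborel:
  fixes f :: "'a::euclidean_space \<Rightarrow> 'b::{real_normed_vector, second_countable_topology}"
  shows "f \<in> borel_measurable borel \<Longrightarrow> A \<in> sets borel \<Longrightarrow> set_borel_measurable lborel A f"
  unfolding set_borel_measurable_def by (simp add: borel_measurable_indicator borel_measurable_scaleR)

lemma L1_loc_bound:
  assumes "L1_loc f" "g \<in> borel_measurable borel"
    and "\<And>K. compact K \<Longrightarrow> \<exists>C. \<forall>x\<in>K. norm (g x) \<le> C * norm (f x)"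
  shows "L1_loc g"
  unfolding L1_loc_def
proof (intro allI impI)
  fix K :: "'a set" assume K: "compact K"
  then obtain C where C: "\<forall>x\<in>K. norm (g x) \<le> C * norm (f x)" using assms(3) by blast
  have "set_integrable lborel K (\<lambda>x. C *\<^sub>R f x)" using L1_locD[OF assms(1) K] by simp
  then show "set_integrable lborel K g"
    by (rule set_integrable_bound)
      (use C K assms(2) in \<open>auto intro!: set_borel_measurable_lborel AE_I2 simp: borel_compact abs_mult intro: order_trans[OF _ mult_right_mono[OF abs_ge_self]]\<close>)
qed

lemma L1_loc_cong_AE:
  assumes "L1_loc f" "g \<in> borel_measurable borel" "AE x in lborel. g x = f x"
  shows "L1_loc g"
  unfolding L1_loc_def
proof (intro allI impI)
  fix K :: "'a set" assume K: "compact K"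
  show "set_integrable lborel K g"
    by (rule set_integrable_bound[OF L1_locD[OF assms(1) K]])
      (use K assms in \<open>auto intro!: set_borel_measurable_lborel simp: borel_compact\<close>)
qed

lemma L1_loc_continuous: "continuous_on UNIV f \<Longrightarrow> L1_loc f"
  unfolding L1_loc_def set_integrable_def
  using borel_integrable_compact continuous_on_subset by blast

lemma L1_loc_add: "L1_loc f \<Longrightarrow> L1_loc g \<Longrightarrow> L1_loc (\<lambda>x. f x + g x)"
  unfolding L1_loc_def by simp

lemma L1_loc_diff: "L1_loc f \<Longrightarrow> L1_loc g \<Longrightarrow> L1_loc (\<lambda>x. f x - g x)"
  unfolding L1_loc_def by simp

lemma L1_loc_bilinear:
  fixes q :: "'a::{real_normed_vector, second_countable_topology} \<Rightarrow> 'b::{banach, second_countable_topology} \<Rightarrow> 'c::{banach, second_countable_topology}"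
    and h :: "'d::euclidean_space \<Rightarrow> 'a"
  assumes q: "bounded_bilinear q" and h: "continuous_on UNIV h" and g: "L1_loc g"
  shows "L1_loc (\<lambda>x. q (h x) (g x))"
proof (rule L1_loc_bound[OF g])
  have hm: "h \<in> borel_measurable borel" using h by (rule borel_measurable_continuous_onI)
  have gm: "g \<in> borel_measurable borel" using g by (rule L1_loc_measurable)
  have "continuous_on UNIV (\<lambda>z. q (fst z) (snd z))"
    by (intro bounded_bilinear.continuous_on[OF q] continuous_intros)
  from borel_measurable_continuous_on[OF this, of "\<lambda>x. (h x, g x)"] hm gm
  show "(\<lambda>x. q (h x) (g x)) \<in> borel_measurable borel" by (simp add: borel_measurable_Pair)
  fix K :: "'d set" assume K: "compact K"
  obtain B where B: "B > 0" "\<And>a b. norm (q a b) \<le> norm a * norm b * B" 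
    using bounded_bilinear.pos_bounded[OF q] by blast
  have "compact (h ` K)" using K h continuous_on_subset by (blast intro: compact_continuous_image)
  then obtain C where C: "\<forall>x\<in>K. norm (h x) \<le> C" using compact_imp_bounded bounded_iff by (metis imageI)
  have "norm (q (h x) (g x)) \<le> (C * B) * norm (g x)" if "x \<in> K" for x
  proof -
    have "norm (h x) * norm (g x) * B \<le> C * norm (g x) * B"
      using C that B(1) by (intro mult_right_mono) auto
    then show ?thesis using B(2)[of "h x" "g x"] by (simp add: mult_ac)
  qed
  then show "\<exists>C. \<forall>x\<in>K. norm (q (h x) (g x)) \<le> C * norm (g x)" by blast
qed

lemma L1_loc_scaleR: "continuous_on UNIV h \<Longrightarrow> L1_loc g \<Longrightarrow> L1_loc (\<lambda>x. h x *\<^sub>R g x)"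
  by (rule L1_loc_bilinear[OF bounded_bilinear_scaleR])

lemma L1_loc_mult: 
  fixes g :: "_ \<Rightarrow> 'b::{real_normed_algebra, banach, second_countable_topology}"
  shows "continuous_on UNIV h \<Longrightarrow> L1_loc g \<Longrightarrow> L1_loc (\<lambda>x. h x * g x)"
  by (rule L1_loc_bilinear[OF bounded_bilinear_mult])

lemma L1_loc_linear:
  assumes "bounded_linear T" "L1_loc g"
  shows "L1_loc (\<lambda>x. T (g x))"
proof (rule L1_loc_bound[OF assms(2)])
  show "(\<lambda>x. T (g x)) \<in> borel_measurable borel"
    using borel_measurable_continuous_on[OF linear_continuous_on[OF assms(1), of UNIV] L1_loc_measurable[OF assms(2)]] .
  obtain B where "\<And>x. norm (T x) \<le> norm x * B" using bounded_linear.bounded[OF assms(1)] by blast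
  then show "\<exists>C. \<forall>x\<in>K. norm (T (g x)) \<le> C * norm (g x)" for K by (auto simp: mult.commute)
qed

lemma L1_loc_integrable: "integrable lborel f \<Longrightarrow> L1_loc f"
  unfolding L1_loc_def set_integrable_def
  using integrable_mult_indicator borel_compact by (metis sets_lborel)

lemma L1_loc_norm: "L1_loc f \<Longrightarrow> L1_loc (\<lambda>x. norm (f x))"
  by (rule L1_loc_bound[where f = f]) (auto intro!: exI[of _ 1] dest: L1_loc_measurable)

lemma L1_loc_Icc:
  fixes g :: "real \<Rightarrow> 'a::euclidean_space"
  assumes "L1_loc g"
  shows "set_integrable lborel {a..b} g" "g integrable_on {a..b}"
    "(LINT x:{a..b}|lborel. g x) = integral {a..b} g"
    "(\<lambda>x. norm (g x)) integrable_on {a..b}"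
  using L1_locD[OF assms, of "{a..b}"] set_borel_integral_eq_integral[of "{a..b}" g]
    set_borel_integral_eq_integral[of "{a..b}" "\<lambda>x. norm (g x)"] L1_locD[OF L1_loc_norm[OF assms], of "{a..b}"]
  by auto

subsection \<open>Primitives of locally integrable functions\<close>

text \<open>Absolute continuity in integrated form, with the derivative as an explicit companion
  that may be changed on null sets. Pointwise differentiability is not part of it, and the rules of
  calculus below are proved for increments.\<close>

definition ac :: "(real \<Rightarrow> 'a::euclidean_space) \<Rightarrow> (real \<Rightarrow> 'a) \<Rightarrow> bool" where
  "ac f g \<longleftrightarrow> L1_loc g \<and> (\<forall>a b. a \<le> b \<longrightarrow> f b - f a = integral {a..b} g)"

lemma acD: "ac f g \<Longrightarrow> L1_loc g" "ac f g \<Longrightarrow> a \<le> b \<Longrightarrow> f b - f a = integral {a..b} g"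
  by (auto simp: ac_def)

lemma ac_antider: "L1_loc g \<Longrightarrow> ac (antider g) g"
  unfolding ac_def using antider_diff L1_loc_Icc(2) by blast

lemma ac_continuous_on: "ac f g \<Longrightarrow> continuous_on UNIV f"
proof -
  assume f: "ac f g"
  have "continuous_on {- real n <..< real n} f" for n
  proof -
    have "continuous_on {- real n .. real n} (\<lambda>x. f (- real n) + integral {- real n .. x} g)"
      using f by (intro continuous_intros indefinite_integral_continuous_1 L1_loc_Icc acD)
    moreover have "f (- real n) + integral {- real n .. x} g = f x" if "x \<in> {- real n .. real n}" for x
      using acD(2)[OF f, of "- real n" x] that by (simp add: algebra_simps)
    ultimately have "continuous_on {- real n .. real n} f" by (rule continuous_on_eq)
    then show ?thesis by (rule continuous_on_subset) auto
  qed
  then have "continuous_on (\<Union>n. {- real n <..< real n}) f" by (intro continuous_on_open_UN) auto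
  moreover have "(\<Union>n. {- real n <..< real n}) = UNIV"
  proof (intro set_eqI iffI UNIV_I)
    fix x :: real
    obtain n where "\<bar>x\<bar> < real n" using reals_Archimedean2 by blast
    then show "x \<in> (\<Union>n. {- real n <..< real n})" by (auto intro!: exI[of _ n])
  qed
  ultimately show ?thesis by simp
qed

lemma ac_isCont: "ac f g \<Longrightarrow> isCont f x"
  using ac_continuous_on continuous_on_eq_continuous_at open_UNIV by blast

lemma ac_cong_AE:
  assumes "ac f g" "g' \<in> borel_measurable borel" "AE x in lborel. g' x = g x"
  shows "ac f g'"
proof -
  have L: "L1_loc g'" using L1_loc_cong_AE[OF acD(1)[OF assms(1)] assms(2,3)] .
  have "integral {a..b} g' = integral {a..b} g" for a b
    unfolding L1_loc_Icc(3)[OF L, symmetric] L1_loc_Icc(3)[OF acD(1)[OF assms(1)], symmetric]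
    by (rule set_lebesgue_integral_cong_AE) (use assms acD(1)[OF assms(1)] in \<open>auto dest: L1_loc_measurable\<close>)
  then show ?thesis using L assms(1) by (simp add: ac_def)
qed

lemma ac_linear:
  assumes "bounded_linear T" "ac f g"
  shows "ac (\<lambda>x. T (f x)) (\<lambda>x. T (g x))"
  unfolding ac_def
proof (intro conjI allI impI)
  show "L1_loc (\<lambda>x. T (g x))" using assms L1_loc_linear acD by blast
  fix a b :: real assume "a \<le> b"
  then show "T (f b) - T (f a) = integral {a..b} (\<lambda>x. T (g x))"
    using integral_linear[OF L1_loc_Icc(2)[OF acD(1)[OF assms(2)]] assms(1), of a b] acD(2)[OF assms(2)]
    by (simp add: o_def bounded_linear.linear[OF assms(1)] linear_diff[symmetric])
qed

lemma ac_add: "ac f g \<Longrightarrow> ac f' g' \<Longrightarrow> ac (\<lambda>x. f x + f' x) (\<lambda>x. g x + g' x)"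
  unfolding ac_def
proof (intro conjI allI impI)
  assume 1: "L1_loc g \<and> (\<forall>a b. a \<le> b \<longrightarrow> f b - f a = integral {a..b} g)"
    and 2: "L1_loc g' \<and> (\<forall>a b. a \<le> b \<longrightarrow> f' b - f' a = integral {a..b} g')"
  then show "L1_loc (\<lambda>x. g x + g' x)" using L1_loc_add by blast
  fix a b :: real assume "a \<le> b"
  then have "f b - f a = integral {a..b} g" "f' b - f' a = integral {a..b} g'" using 1 2 by auto
  then show "f b + f' b - (f a + f' a) = integral {a..b} (\<lambda>x. g x + g' x)"
    using Henstock_Kurzweil_Integration.integral_add[OF L1_loc_Icc(2) L1_loc_Icc(2), of g g' a b] 1 2
    by (simp add: add_diff_add)
qed

lemma ac_const: "ac (\<lambda>x. c) (\<lambda>x. 0)"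
  by (auto simp: ac_def intro!: L1_loc_continuous)

lemma ac_C1:
  assumes "\<And>x. (f has_vector_derivative g x) (at x)" "continuous_on UNIV g"
  shows "ac f g"
  unfolding ac_def
proof (intro conjI allI impI)
  show "L1_loc g" using assms(2) by (rule L1_loc_continuous)
  fix a b :: real assume "a \<le> b"
  then have "(g has_integral f b - f a) {a..b}"
    by (rule fundamental_theorem_of_calculus) (use assms(1) has_vector_derivative_at_within in blast)
  then show "f b - f a = integral {a..b} g" by (simp add: integral_unique)
qed

text \<open>A substitute for differentiation almost everywhere. If locally the increments of
  \<open>H\<close> are bounded by \<open>e\<close> times those of a fixed \<open>G\<close>,
  bisection adds the bounds up over the whole interval, and \<open>e\<close> tends to 0. In the
  applications \<open>H\<close> is the defect in a product or chain rule and \<open>G\<close>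
  integrates the norms of the derivatives.\<close>

lemma increment_zero:
  fixes H :: "real \<Rightarrow> 'a::real_normed_vector" and G :: "real \<Rightarrow> real"
  assumes "a \<le> b"
    and loc: "\<And>e x. e > 0 \<Longrightarrow> a \<le> x \<Longrightarrow> x \<le> b \<Longrightarrow>
      \<exists>d>0. \<forall>u v. a \<le> u \<and> u \<le> x \<and> x \<le> v \<and> v \<le> b \<and> v - u < d \<longrightarrow> norm (H v - H u) \<le> e * (G v - G u)"
  shows "H b = H a"
proof -
  have bd: "norm (H b - H a) \<le> e * (G b - G a)" if e: "e > 0" for e
  proof -
    have "a \<le> a \<and> b \<le> b \<longrightarrow> norm (H b - H a) \<le> e * (G b - G a)"
      using \<open>a \<le> b\<close>
    proof (induction rule: Bolzano[where P="\<lambda>u v. a \<le> u \<and> v \<le> b \<longrightarrow> norm (H v - H u) \<le> e * (G v - G u)"])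
      case (trans x y z)
      show ?case
      proof
        assume "a \<le> x \<and> z \<le> b"
        then have "norm (H y - H x) \<le> e * (G y - G x)" "norm (H z - H y) \<le> e * (G z - G y)" using trans by auto
        moreover have "norm (H z - H x) \<le> norm (H z - H y) + norm (H y - H x)"
          using norm_triangle_ineq[of "H z - H y" "H y - H x"] by simp
        ultimately show "norm (H z - H x) \<le> e * (G z - G x)" by (simp add: algebra_simps)
      qed
    next
      case (local x)
      then show ?case using loc[OF e local] by blast
    qed
    then show ?thesis by simp
  qed
  have "norm (H b - H a) \<le> 0"
  proof (rule field_le_epsilon)
    fix e :: real assume e: "e > 0"
    have "norm (H b - H a) \<le> (e / (\<bar>G b - G a\<bar> + 1)) * (G b - G a)" using e by (intro bd) simp
    also have "\<dots> \<le> (e / (\<bar>G b - G a\<bar> + 1)) * (\<bar>G b - G a\<bar> + 1)" using e by (intro mult_left_mono) auto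
    also have "\<dots> = e" by simp
    finally show "norm (H b - H a) \<le> 0 + e" by simp
  qed
  then show ?thesis by simp
qed

lemma ac_increment_bound:
  assumes "ac f g" "u \<le> v" shows "norm (f v - f u) \<le> integral {u..v} (\<lambda>x. norm (g x))"
  unfolding acD(2)[OF assms] using L1_loc_Icc[OF acD(1)[OF assms(1)]]
  by (intro integral_norm_bound_integral) auto

text \<open>The increment of the product over \<open>[u, v]\<close> is exactly that of
  \<open>f1\<close> paired with \<open>f2 v\<close> plus \<open>f1 u\<close> paired with that of
  \<open>f2\<close>. So the defect in the product rule is an integral in which \<open>g1\<close> and
  \<open>g2\<close> are paired with oscillations of \<open>f2\<close> and \<open>f1\<close>, and
  these are small by continuity.\<close>

lemma ac_bilinear:
  assumes b: "bounded_bilinear pr" and 1: "ac f1 g1" and 2: "ac f2 g2"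
  shows "ac (\<lambda>x. pr (f1 x) (f2 x)) (\<lambda>x. pr (g1 x) (f2 x) + pr (f1 x) (g2 x))"
proof -
  interpret bounded_bilinear pr by fact
  have La: "L1_loc (\<lambda>x. pr (g1 x) (f2 x))" "L1_loc (\<lambda>x. pr (f1 x) (g2 x))"
    using L1_loc_bilinear[OF bounded_bilinear.flip[OF b] ac_continuous_on[OF 2] acD(1)[OF 1]]
      L1_loc_bilinear[OF b ac_continuous_on[OF 1] acD(1)[OF 2]] by auto
  note L = L1_loc_add[OF La]
  let ?g = "\<lambda>x. pr (g1 x) (f2 x) + pr (f1 x) (g2 x)"
  show ?thesis unfolding ac_def
  proof (intro conjI L allI impI)
    fix a b :: real assume ab: "a \<le> b"
    define H where "H y = pr (f1 y) (f2 y) - integral {a..y} ?g" for y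
    define G where "G y = integral {a..y} (\<lambda>x. norm (g1 x) + norm (g2 x))" for y
    obtain K where K: "K > 0" "\<And>x y. norm (pr x y) \<le> norm x * norm y * K" using pos_bounded by blast
    have N: "L1_loc (\<lambda>x. norm (g1 x) + norm (g2 x))" by (intro L1_loc_add L1_loc_norm acD(1)[OF 1] acD(1)[OF 2])
    have "H b = H a"
    proof (rule increment_zero[OF ab])
      fix e x :: real assume e: "e > 0" and x: "a \<le> x" "x \<le> b"
      obtain d1 where d1: "d1 > 0" "\<And>y. \<bar>y - x\<bar> < d1 \<Longrightarrow> norm (f1 y - f1 x) < e / (2*K)"
        using ac_isCont[OF 1, of x] e K unfolding continuous_at_eps_delta dist_norm real_norm_def 
        by (metis divide_pos_pos mult_pos_pos zero_less_numeral)
      obtain d2 where d2: "d2 > 0" "\<And>y. \<bar>y - x\<bar> < d2 \<Longrightarrow> norm (f2 y - f2 x) < e / (2*K)"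
        using ac_isCont[OF 2, of x] e K unfolding continuous_at_eps_delta dist_norm real_norm_def 
        by (metis divide_pos_pos mult_pos_pos zero_less_numeral)
      show "\<exists>d>0. \<forall>u v. a \<le> u \<and> u \<le> x \<and> x \<le> v \<and> v \<le> b \<and> v - u < d \<longrightarrow> norm (H v - H u) \<le> e * (G v - G u)"
      proof (intro exI conjI allI impI)
        show "min d1 d2 > 0" using d1 d2 by simp
        fix u v assume uv: "a \<le> u \<and> u \<le> x \<and> x \<le> v \<and> v \<le> b \<and> v - u < min d1 d2"
        have n1: "norm (f1 y - f1 z) \<le> e / K" "norm (f2 y - f2 z) \<le> e / K" if "y \<in> {u..v}" "z \<in> {u..v}" for y z
        proof -
          have "\<bar>y - x\<bar> < min d1 d2" "\<bar>z - x\<bar> < min d1 d2" using uv that by auto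
          then have "norm (f1 y - f1 x) < e / (2*K)" "norm (f1 z - f1 x) < e / (2*K)" 
             "norm (f2 y - f2 x) < e / (2*K)" "norm (f2 z - f2 x) < e / (2*K)" using d1 d2 by auto
          moreover have "e / (2*K) + e / (2*K) = e / K" using K by (simp add: field_simps)
          ultimately show "norm (f1 y - f1 z) \<le> e / K" "norm (f2 y - f2 z) \<le> e / K"
            using norm_triangle_ineq4[of "f1 y - f1 x" "f1 z - f1 x"] norm_triangle_ineq4[of "f2 y - f2 x" "f2 z - f2 x"] by auto
        qed
        have uv': "u \<le> v" using uv by simp
        have GG: "G v - G u = integral {u..v} (\<lambda>x. norm (g1 x) + norm (g2 x))"
          using Henstock_Kurzweil_Integration.integral_combine[of a u v "\<lambda>x. norm (g1 x) + norm (g2 x)"] uv L1_loc_Icc(2)[OF N] 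
          by (simp add: G_def algebra_simps)
        have HH: "H v - H u = pr (f1 v) (f2 v) - pr (f1 u) (f2 u) - integral {u..v} ?g"
          using Henstock_Kurzweil_Integration.integral_combine[of a u v ?g] uv L1_loc_Icc(2)[OF L] 
          by (simp add: H_def algebra_simps)
        have i1: "integral {u..v} (\<lambda>t. pr (g1 t) (f2 v)) = pr (f1 v - f1 u) (f2 v)"
          using integral_linear[OF L1_loc_Icc(2)[OF acD(1)[OF 1]] bounded_linear_left[of "f2 v"], of u v] acD(2)[OF 1 uv'] 
          by (simp add: o_def)
        have i2: "integral {u..v} (\<lambda>t. pr (f1 u) (g2 t)) = pr (f1 u) (f2 v - f2 u)"
          using integral_linear[OF L1_loc_Icc(2)[OF acD(1)[OF 2]] bounded_linear_right[of "f1 u"], of u v] acD(2)[OF 2 uv'] 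
          by (simp add: o_def)
        have j1: "(\<lambda>t. pr (g1 t) (f2 v)) integrable_on {u..v}"
          using integrable_linear[OF L1_loc_Icc(2)[OF acD(1)[OF 1]] bounded_linear_left[of "f2 v"], of u v] by (simp add: o_def)
        have j2: "(\<lambda>t. pr (f1 u) (g2 t)) integrable_on {u..v}"
          using integrable_linear[OF L1_loc_Icc(2)[OF acD(1)[OF 2]] bounded_linear_right[of "f1 u"], of u v] by (simp add: o_def)
        let ?k = "\<lambda>t. (pr (g1 t) (f2 v) + pr (f1 u) (g2 t)) - ?g t"
        have "pr (f1 v) (f2 v) - pr (f1 u) (f2 u) = pr (f1 v - f1 u) (f2 v) + pr (f1 u) (f2 v - f2 u)"
          by (simp add: diff_left diff_right)
        also have "\<dots> = integral {u..v} (\<lambda>t. pr (g1 t) (f2 v) + pr (f1 u) (g2 t))"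
          unfolding Henstock_Kurzweil_Integration.integral_add[OF j1 j2] i1 i2 ..
        finally have "H v - H u = integral {u..v} ?k"
          unfolding HH using Henstock_Kurzweil_Integration.integral_diff[OF integrable_add[OF j1 j2] L1_loc_Icc(2)[OF L]] by simp
        also have "norm \<dots> \<le> integral {u..v} (\<lambda>t. e * (norm (g1 t) + norm (g2 t)))"
        proof (rule integral_norm_bound_integral)
          show "?k integrable_on {u..v}" by (intro integrable_diff integrable_add j1 j2 L1_loc_Icc(2)[OF L]) 
          show "(\<lambda>t. e * (norm (g1 t) + norm (g2 t))) integrable_on {u..v}"
            using L1_loc_Icc(2)[OF N] by (rule integrable_on_mult_right)
          fix t assume t: "t \<in> {u..v}"
          have "?k t = pr (g1 t) (f2 v - f2 t) + pr (f1 u - f1 t) (g2 t)" by (simp add: diff_left diff_right)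
          also have "norm \<dots> \<le> norm (g1 t) * norm (f2 v - f2 t) * K + norm (f1 u - f1 t) * norm (g2 t) * K"
            by (intro order_trans[OF norm_triangle_ineq] add_mono K)
          also have "\<dots> \<le> norm (g1 t) * (e/K) * K + (e/K) * norm (g2 t) * K"
            using n1[OF _ t] uv' K(1) by (intro add_mono mult_right_mono mult_left_mono) auto
          also have "\<dots> = e * (norm (g1 t) + norm (g2 t))" using K(1) by (simp add: field_simps)
          finally show "norm (?k t) \<le> e * (norm (g1 t) + norm (g2 t))" .
        qed
        also have "\<dots> = e * (G v - G u)" unfolding GG by simp
        finally show "norm (H v - H u) \<le> e * (G v - G u)" .
      qed
    qed
    then show "pr (f1 b) (f2 b) - pr (f1 a) (f2 a) = integral {a..b} ?g" by (simp add: H_def algebra_simps)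
  qed
qed

text \<open>Differentiability of \<open>F\<close> is required only at the values taken on the
  interval, because \<open>F\<close> will involve a square root that is not differentiable at 0. The
  defect in the chain rule has increments of order \<open>e\<close> times the integral of
  \<open>|g|\<close>.\<close>

lemma ac_chain:
  fixes f g :: "real \<Rightarrow> 'a::{real_normed_field, euclidean_space}"
  assumes f: "ac f g" and ab: "a \<le> b"
    and D: "\<And>x. x \<in> {a..b} \<Longrightarrow> (F has_field_derivative F' (f x)) (at (f x))"
    and C: "\<And>x. x \<in> {a..b} \<Longrightarrow> isCont F' (f x)"
  shows "set_integrable lborel {a..b} (\<lambda>x. F' (f x) * g x)" (is ?I)
    and "F (f b) - F (f a) = integral {a..b} (\<lambda>x. F' (f x) * g x)" (is ?E)
proof -
  have cf: "continuous_on {a..b} (\<lambda>x. F' (f x))"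
    by (intro continuous_at_imp_continuous_on ballI isCont_o2[OF ac_isCont[OF f]] C)
  \<comment> \<open>Clamping the argument to \<open>[a, b]\<close> extends the outer derivative
    continuously to the whole line, so that the integrand is locally integrable everywhere.\<close>
  define F1 where "F1 x = F' (f (max a (min x b)))" for x
  have "continuous_on UNIV F1" unfolding F1_def
    by (rule continuous_on_compose2[OF cf]) (use ab in \<open>auto intro!: continuous_intros\<close>)
  then have L: "L1_loc (\<lambda>x. F1 x * g x)" using f by (intro L1_loc_mult acD(1))
  have F1: "F1 x = F' (f x)" if "x \<in> {a..b}" for x using that by (simp add: F1_def)
  show ?I using L1_loc_Icc(1)[OF L, of a b] F1 by (subst set_integrable_cong) auto
  define H where "H y = F (f y) - integral {a..y} (\<lambda>x. F1 x * g x)" for y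
  define G where "G y = integral {a..y} (\<lambda>x. norm (g x))" for y
  have N: "L1_loc (\<lambda>x. norm (g x))" by (intro L1_loc_norm acD(1)[OF f])
  have "H b = H a"
  proof (rule increment_zero[OF ab])
    fix e x :: real assume e: "e > 0" and x: "a \<le> x" "x \<le> b"
    have "(F has_derivative (*) (F' (f x))) (at (f x))" using D[of x] x by (simp add: has_field_derivative_def)
    then obtain r where r: "r > 0" "\<And>z. norm (z - f x) < r \<Longrightarrow> norm (F z - F (f x) - F' (f x) * (z - f x)) \<le> e/2 * norm (z - f x)"
      using e unfolding has_derivative_at_alt by (metis half_gt_zero)
    obtain r2 where r2: "r2 > 0" "\<And>z. norm (z - f x) < r2 \<Longrightarrow> norm (F' z - F' (f x)) < e/2"
      using C[of x] x e unfolding continuous_at_eps_delta dist_norm by (metis atLeastAtMost_iff half_gt_zero)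
    have "min r r2 > 0" using r r2 by simp
    then obtain d where d: "d > 0" "\<And>y. \<bar>y - x\<bar> < d \<Longrightarrow> norm (f y - f x) < min r r2"
      using ac_isCont[OF f, of x] unfolding continuous_at_eps_delta dist_norm real_norm_def by blast
    show "\<exists>d>0. \<forall>u v. a \<le> u \<and> u \<le> x \<and> x \<le> v \<and> v \<le> b \<and> v - u < d \<longrightarrow> norm (H v - H u) \<le> e * (G v - G u)"
    proof (intro exI conjI allI impI)
      show "d > 0" by fact
      fix u v assume uv: "a \<le> u \<and> u \<le> x \<and> x \<le> v \<and> v \<le> b \<and> v - u < d"
      then have uv': "u \<le> v" by simp
      have nr: "norm (f y - f x) < min r r2" if "y \<in> {u..v}" for y using d(2)[of y] uv that by auto
      have G2: "G v - G u = integral {u..v} (\<lambda>x. norm (g x))"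
        using Henstock_Kurzweil_Integration.integral_combine[of a u v "\<lambda>x. norm (g x)"] uv L1_loc_Icc(2)[OF N] 
        by (simp add: G_def algebra_simps)
      have HH: "H v - H u = F (f v) - F (f u) - integral {u..v} (\<lambda>x. F1 x * g x)"
        using Henstock_Kurzweil_Integration.integral_combine[of a u v "\<lambda>x. F1 x * g x"] uv L1_loc_Icc(2)[OF L] 
        by (simp add: H_def algebra_simps)
      define c where "c = F' (f x)"
      have ic: "integral {u..v} (\<lambda>t. c * g t) = c * (f v - f u)" 
        using acD(2)[OF f uv'] by simp
      have icc: "(\<lambda>t. c * g t) integrable_on {u..v}" using L1_loc_Icc(2)[OF acD(1)[OF f]] by (rule integrable_on_mult_right)
      have A: "norm (F (f v) - F (f x) - c * (f v - f x)) \<le> e/2 * integral {x..v} (\<lambda>x. norm (g x))"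
        using r(2)[of "f v"] nr[of v] uv ac_increment_bound[OF f, of x v] e unfolding c_def
        by (smt (verit, best) atLeastAtMost_iff half_gt_zero mult_left_mono)
      have B: "norm (F (f u) - F (f x) - c * (f u - f x)) \<le> e/2 * integral {u..x} (\<lambda>x. norm (g x))"
        using r(2)[of "f u"] nr[of u] uv ac_increment_bound[OF f, of u x] e unfolding c_def
        by (smt (verit, best) atLeastAtMost_iff half_gt_zero mult_left_mono norm_minus_commute)
      have GI: "integral {u..x} (\<lambda>x. norm (g x)) + integral {x..v} (\<lambda>x. norm (g x)) = G v - G u"
        unfolding G2 using uv L1_loc_Icc(2)[OF N] by (intro Henstock_Kurzweil_Integration.integral_combine) auto
      have eq: "F (f v) - F (f u) - c * (f v - f u) = (F (f v) - F (f x) - c * (f v - f x)) - (F (f u) - F (f x) - c * (f u - f x))"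
        by (simp add: algebra_simps)
      have "norm (F (f v) - F (f u) - c * (f v - f u)) \<le> e/2 * integral {x..v} (\<lambda>x. norm (g x)) + e/2 * integral {u..x} (\<lambda>x. norm (g x))"
        using norm_triangle_ineq4[of "F (f v) - F (f x) - c * (f v - f x)" "F (f u) - F (f x) - c * (f u - f x)"] A B
        unfolding eq by linarith
      then have AB: "norm (F (f v) - F (f u) - c * (f v - f u)) \<le> e/2 * (G v - G u)"
        unfolding GI[symmetric] by (simp add: distrib_left add.commute)
      have "norm (integral {u..v} (\<lambda>t. c * g t - F1 t * g t)) \<le> integral {u..v} (\<lambda>t. e/2 * norm (g t))"
      proof (rule integral_norm_bound_integral)
        show "(\<lambda>t. c * g t - F1 t * g t) integrable_on {u..v}" by (intro integrable_diff icc L1_loc_Icc(2)[OF L])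
        show "(\<lambda>t. e/2 * norm (g t)) integrable_on {u..v}" using L1_loc_Icc(2)[OF N] by (rule integrable_on_mult_right)
        fix t assume t: "t \<in> {u..v}"
        have "norm (c - F1 t) \<le> e/2" using r2(2)[of "f t"] nr[OF t] F1[of t] t uv by (simp add: c_def norm_minus_commute)
        then show "norm (c * g t - F1 t * g t) \<le> e/2 * norm (g t)"
          unfolding left_diff_distrib[symmetric] norm_mult by (intro mult_right_mono) auto
      qed
      also have "\<dots> = e/2 * (G v - G u)" unfolding G2 by simp
      finally have CC: "norm (c * (f v - f u) - integral {u..v} (\<lambda>x. F1 x * g x)) \<le> e/2 * (G v - G u)"
        unfolding Henstock_Kurzweil_Integration.integral_diff[OF icc L1_loc_Icc(2)[OF L]] ic .
      show "norm (H v - H u) \<le> e * (G v - G u)"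
      proof -
        have "H v - H u = (F (f v) - F (f u) - c * (f v - f u)) + (c * (f v - f u) - integral {u..v} (\<lambda>x. F1 x * g x))"
          unfolding HH by simp
        then show ?thesis using norm_add_rule_thm[OF AB CC] by simp
      qed
    qed
  qed
  then have "F (f b) - F (f a) = integral {a..b} (\<lambda>x. F1 x * g x)" by (simp add: H_def algebra_simps)
  also have "\<dots> = integral {a..b} (\<lambda>x. F' (f x) * g x)" by (rule integral_cong) (simp add: F1)
  finally show ?E .
qed

lemma ac_chain_UNIV:
  fixes f g :: "real \<Rightarrow> 'a::{real_normed_field, euclidean_space}"
  assumes f: "ac f g"
    and D: "\<And>x. (F has_field_derivative F' (f x)) (at (f x))"
    and C: "\<And>x. isCont F' (f x)"
  shows "ac (\<lambda>x. F (f x)) (\<lambda>x. F' (f x) * g x)"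
  unfolding ac_def
proof (intro conjI allI impI)
  have "continuous_on UNIV (\<lambda>x. F' (f x))"
    by (intro continuous_at_imp_continuous_on ballI isCont_o2[OF ac_isCont[OF f]] C)
  then show "L1_loc (\<lambda>x. F' (f x) * g x)" using f by (intro L1_loc_mult acD(1))
qed (use ac_chain[OF f _ D C] in auto)

lemma ac_parts:
  assumes f: "ac f g" and \<phi>: "ac \<phi> \<phi>'" and M: "M > 0" "\<And>x. \<bar>x\<bar> > M \<Longrightarrow> \<phi> x = 0 \<and> \<phi>' x = 0"
  shows "integrable lborel (\<lambda>x. \<phi>' x *\<^sub>R f x)" "integrable lborel (\<lambda>x. \<phi> x *\<^sub>R g x)"
    "(LINT x|lborel. \<phi>' x *\<^sub>R f x) = - (LINT x|lborel. \<phi> x *\<^sub>R g x)"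
proof -
  note b = ac_bilinear[OF bounded_bilinear_scaleR \<phi> f]
  have La: "L1_loc (\<lambda>x. \<phi>' x *\<^sub>R f x)" "L1_loc (\<lambda>x. \<phi> x *\<^sub>R g x)"
    using L1_loc_bilinear[OF bounded_bilinear.flip[OF bounded_bilinear_scaleR] ac_continuous_on[OF f] acD(1)[OF \<phi>]]
      L1_loc_scaleR[OF ac_continuous_on[OF \<phi>] acD(1)[OF f]] by auto
  \<comment> \<open>The functions are known to vanish only strictly outside \<open>[-M, M]\<close>.
    Integrating up to \<open>M + 1\<close> makes the boundary terms zero.\<close>
  have eq: "indicator {-(M+1)..M+1} x *\<^sub>R (\<phi>' x *\<^sub>R f x) = \<phi>' x *\<^sub>R f x" 
    "indicator {-(M+1)..M+1} x *\<^sub>R (\<phi> x *\<^sub>R g x) = \<phi> x *\<^sub>R g x" for x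
    using M(2)[of x] by (cases "\<bar>x\<bar> > M"; force simp: indicator_def)+
  show "integrable lborel (\<lambda>x. \<phi>' x *\<^sub>R f x)" "integrable lborel (\<lambda>x. \<phi> x *\<^sub>R g x)"
    using L1_loc_Icc(1)[OF La(1), of "-(M+1)" "M+1"] L1_loc_Icc(1)[OF La(2), of "-(M+1)" "M+1"]
    unfolding set_integrable_def eq by auto
  have e1: "(LINT x|lborel. \<phi>' x *\<^sub>R f x) = integral {-(M+1)..M+1} (\<lambda>x. \<phi>' x *\<^sub>R f x)"
    "(LINT x|lborel. \<phi> x *\<^sub>R g x) = integral {-(M+1)..M+1} (\<lambda>x. \<phi> x *\<^sub>R g x)"
    using L1_loc_Icc(3)[OF La(1), of "-(M+1)" "M+1"] L1_loc_Icc(3)[OF La(2), of "-(M+1)" "M+1"]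
    unfolding set_lebesgue_integral_def eq by auto
  have "0 = integral {-(M+1)..M+1} (\<lambda>x. \<phi>' x *\<^sub>R f x + \<phi> x *\<^sub>R g x)"
    using acD(2)[OF b, of "-(M+1)" "M+1"] M(1) M(2)[of "M+1"] M(2)[of "-(M+1)"] by simp
  then show "(LINT x|lborel. \<phi>' x *\<^sub>R f x) = - (LINT x|lborel. \<phi> x *\<^sub>R g x)"
    unfolding e1 using Henstock_Kurzweil_Integration.integral_add[OF L1_loc_Icc(2)[OF La(1)] L1_loc_Icc(2)[OF La(2)], of "-(M+1)" "M+1"]
    by (simp add: eq_neg_iff_add_eq_0)
qed

subsection \<open>The fundamental lemma of the calculus of variations\<close>

text \<open>Boxes generate the Borel sets and are stable under intersection, and the sets with
  vanishing integral are closed under complements and disjoint countable unions: a pi-lambda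
  argument for a signed integrand.\<close>

lemma set_integral_sets_zero:
  fixes h :: "'a::euclidean_space \<Rightarrow> real"
  assumes h: "integrable lborel h" and z: "(LINT x|lborel. h x) = 0"
    and box: "\<And>a b. (LINT x:box a b|lborel. h x) = 0" and A: "A \<in> sets borel"
  shows "(LINT x:A|lborel. h x) = 0"
proof -
  have si: "set_integrable lborel B h" if "B \<in> sets borel" for B
    unfolding set_integrable_def using h that by (intro integrable_mult_indicator) auto
  have "Int_stable (range (\<lambda>(a, b). box a b :: 'a set))"
    by (auto simp: Int_stable_def box_Int_box)
  moreover have "range (\<lambda>(a, b). box a b :: 'a set) \<subseteq> Pow UNIV" by simp
  moreover have "A \<in> sigma_sets UNIV (range (\<lambda>(a, b). box a b))"
    using A unfolding borel_eq_box by simp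
  ultimately show ?thesis
  proof (induction rule: sigma_sets_induct_disjoint)
    case (basic A)
    then show ?case using box by auto
  next
    case empty
    show ?case by (simp add: set_lebesgue_integral_def)
  next
    case (compl A)
    then have A: "A \<in> sets borel" by (simp add: borel_eq_box)
    have "(LINT x:A \<union> (UNIV - A)|lborel. h x) = (LINT x:A|lborel. h x) + (LINT x:UNIV - A|lborel. h x)"
      by (rule set_integral_Un) (use A si in auto)
    then show ?case using z compl by (simp add: set_lebesgue_integral_def)
  next
    case (union F)
    then have F: "F i \<in> sets borel" for i by (auto simp: borel_eq_box)
    have U: "(LINT x:(\<Union>i<n. F i)|lborel. h x) = 0" for n
    proof (induction n)
      case 0 show ?case by (simp add: set_lebesgue_integral_def)
    next
      case (Suc n)
      have "F i \<inter> F n = {}" if "i < n" for i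
        using union(1) that unfolding disjoint_family_on_def by (metis UNIV_I less_irrefl)
      then have "(\<Union>i<n. F i) \<inter> F n = {}" by blast
      moreover have "(\<Union>i<Suc n. F i) = (\<Union>i<n. F i) \<union> F n" by (auto simp: less_Suc_eq)
      ultimately have "(LINT x:(\<Union>i<Suc n. F i)|lborel. h x) = (LINT x:(\<Union>i<n. F i)|lborel. h x) + (LINT x:F n|lborel. h x)"
        by (simp only:) (rule set_integral_Un, use F in \<open>auto intro!: si sets.countable_UN'\<close>)
      then show ?case using Suc union by simp
    qed
    have "(\<lambda>n. LINT x:(\<Union>i<n. F i)|lborel. h x) \<longlonglongrightarrow> (LINT x:(\<Union>n. \<Union>i<n. F i)|lborel. h x)"
    proof (rule set_integral_cont_up)
      show "incseq (\<lambda>n. \<Union>i<n. F i)" unfolding incseq_def by (intro allI impI UN_mono) auto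
    qed (use F in \<open>auto intro!: si sets.countable_UN'\<close>)
    moreover have "(\<Union>n. \<Union>i<n. F i) = \<Union>(F ` UNIV)" by auto
    ultimately show ?case using U by (simp add: LIMSEQ_const_iff)
  qed
qed

text \<open>Density uniqueness requires global integrability, so it is applied to the truncations of
  \<open>h\<close> to the boxes of an exhaustion of the space.\<close>

lemma AE_zero_boxes:
  fixes h :: "'a::euclidean_space \<Rightarrow> real"
  assumes h: "L1_loc h" and box: "\<And>a b. (LINT x:box a b|lborel. h x) = 0"
  shows "AE x in lborel. h x = 0"
proof -
  let ?B = "\<lambda>n::nat. box (- (real n *\<^sub>R One)) (real n *\<^sub>R One) :: 'a set"
  have "AE x in lborel. indicator (?B n) x *\<^sub>R h x = 0" for n
  proof (rule density_unique_real)
    have sub: "?B n \<subseteq> cbox (- (real n *\<^sub>R One)) (real n *\<^sub>R One)" by (rule box_subset_cbox)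
    have "set_integrable lborel (?B n) h"
      by (rule set_integrable_subset[OF L1_locD[OF h compact_cbox]]) (use sub in auto)
    then show i: "integrable lborel (\<lambda>x. indicator (?B n) x *\<^sub>R h x)" by (simp add: set_integrable_def)
    show "integrable lborel (\<lambda>x::'a. 0::real)" by simp
    fix A :: "'a set" assume "A \<in> sets lborel"
    then show "(LINT x:A|lborel. indicator (?B n) x *\<^sub>R h x) = (LINT x:A|lborel. 0)"
    proof (subst set_integral_sets_zero[OF i])
      show "(LINT x|lborel. indicator (?B n) x *\<^sub>R h x) = 0" using box[of "- (real n *\<^sub>R One)" "real n *\<^sub>R One"] by (simp add: set_lebesgue_integral_def)
      fix a b :: 'a
      have "(LINT x:box a b|lborel. indicator (?B n) x *\<^sub>R h x) = (LINT x:box a b \<inter> ?B n|lborel. h x)"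
        by (simp add: set_lebesgue_integral_def indicator_inter_arith mult.assoc)
      then show "(LINT x:box a b|lborel. indicator (?B n) x *\<^sub>R h x) = 0" using box by (simp add: box_Int_box)
    qed auto
  qed
  then have "AE x in lborel. \<forall>n. indicator (?B n) x *\<^sub>R h x = 0" unfolding AE_all_countable by blast
  then show ?thesis
  proof eventually_elim
    fix x assume x: "\<forall>n. indicator (?B n) x *\<^sub>R h x = 0"
    have "x \<in> (\<Union>n. ?B n)" using UN_box_eq_UNIV by blast
    then obtain n where "x \<in> ?B n" by blast
    then show "h x = 0" using x[rule_format, of n] by simp
  qed
qed

lemma smooth_window: "smooth (\<lambda>t. step (c * (t - a)) * step (c * (b - t)))"
proof -
  have "smooth (\<lambda>t. step (c * t + - (c * a)) * step ((- c) * t + (c * b)))"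
    by (intro smooth_mult smooth_affine smooth_step)
  then show ?thesis by (simp add: algebra_simps)
qed

lemma test_window: "c > 0 \<Longrightarrow> test_function (\<lambda>t. step (c * (t - a)) * step (c * (b - t)))"
proof (rule test_functionI[where a=a and b=b, OF smooth_window])
  fix x assume "c > 0" "x \<notin> cbox a b"
  then show "step (c * (x - a)) * step (c * (b - x)) = 0"
    using step_0[of "c * (x - a)"] step_0[of "c * (b - x)"] by (auto simp: not_le mult_le_0_iff)
qed

lemma window_tendsto:
  "(\<lambda>n. step (real (Suc n) * (t - a)) * step (real (Suc n) * (b - t))) \<longlonglongrightarrow> indicator {a<..<b} t"
proof (cases "t \<in> {a<..<b}")
  case True
  have ev: "eventually (\<lambda>n. step (real (Suc n) * d) = 1) sequentially" if "d > 0" for d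
  proof -
    obtain N where "1 / d < real N" using reals_Archimedean2 by blast
    then have "step (real (Suc n) * d) = 1" if "n \<ge> N" for n
      using \<open>d > 0\<close> that by (intro step_1) (smt (verit) of_nat_Suc of_nat_mono pos_divide_less_eq mult_right_mono)
    then show ?thesis unfolding eventually_sequentially by blast
  qed
  have "eventually (\<lambda>n. step (real (Suc n) * (t - a)) = 1) sequentially" 
    "eventually (\<lambda>n. step (real (Suc n) * (b - t)) = 1) sequentially" using ev True by auto
  then have "eventually (\<lambda>n. step (real (Suc n) * (t - a)) * step (real (Suc n) * (b - t)) = 1) sequentially"
    by eventually_elim (simp only: mult_1)
  then show ?thesis using True by (intro tendsto_eventually) auto
next
  case False
  then have eq: "step (real (Suc n) * (t - a)) * step (real (Suc n) * (b - t)) = 0" for n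
    using step_0[of "real (Suc n) * (t - a)"] step_0[of "real (Suc n) * (b - t)"] by (auto simp: not_less mult_le_0_iff)
  show ?thesis unfolding eq using False by simp
qed

text \<open>Products of smooth windows tend boundedly to the indicator of an open box, so the
  integrals over boxes vanish for each component of \<open>h\<close>. Testing with tensor products
  only is what permits separation of variables in the plane.\<close>

lemma AE_zero_test:
  fixes h :: "'a::euclidean_space \<Rightarrow> 'b::euclidean_space"
  assumes h: "L1_loc h"
    and z: "\<And>\<beta>. (\<And>b. b \<in> Basis \<Longrightarrow> test_function (\<beta> b)) \<Longrightarrow> (LINT x|lborel. (\<Prod>b\<in>Basis. \<beta> b (x \<bullet> b)) *\<^sub>R h x) = 0"
  shows "AE x in lborel. h x = 0"
proof -
  have "AE x in lborel. h x \<bullet> e = 0" for e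
  proof (rule AE_zero_boxes)
    show he: "L1_loc (\<lambda>x. h x \<bullet> e)" using L1_loc_linear[OF bounded_linear_inner_left h] .
    fix a b :: 'a
    let ?w = "\<lambda>n x. \<Prod>i\<in>Basis. step (real (Suc n) * (x \<bullet> i - a \<bullet> i)) * step (real (Suc n) * (b \<bullet> i - x \<bullet> i))"
    have "continuous_on UNIV (?w n)" for n
      using test_function_prod[of "\<lambda>i t. step (real (Suc n) * (t - a \<bullet> i)) * step (real (Suc n) * (b \<bullet> i - t))", OF test_window]
      by (auto simp: test_function_def intro: smooth_continuous)
    then have wm: "?w n \<in> borel_measurable borel" for n by (rule borel_measurable_continuous_onI)
    have hm: "h \<in> borel_measurable borel" using h by (rule L1_loc_measurable)
    have w0: "0 \<le> ?w n x" "?w n x \<le> 1" for n x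
      by (auto intro!: prod_nonneg prod_le_1 mult_nonneg_nonneg mult_le_one step_range)
    have ws: "?w n x = 0" if nx: "x \<notin> cbox a b" for n x
    proof -
      obtain i where i: "i \<in> Basis" "x \<bullet> i < a \<bullet> i \<or> b \<bullet> i < x \<bullet> i" using nx unfolding mem_box by (meson not_le)
      then have "step (real (Suc n) * (x \<bullet> i - a \<bullet> i)) * step (real (Suc n) * (b \<bullet> i - x \<bullet> i)) = 0"
        using step_0[of "real (Suc n) * (x \<bullet> i - a \<bullet> i)"] step_0[of "real (Suc n) * (b \<bullet> i - x \<bullet> i)"] 
        by (auto simp: mult_le_0_iff)
      then show ?thesis using i by (auto intro!: prod_zero)
    qed
    have dom: "integrable lborel (\<lambda>x. indicator (cbox a b) x *\<^sub>R norm (h x))"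
      using L1_locD[OF L1_loc_norm[OF h] compact_cbox[of a b]] by (simp add: set_integrable_def)
    have bd: "norm (?w n x *\<^sub>R h x) \<le> indicator (cbox a b) x *\<^sub>R norm (h x)" for n x
    proof (cases "x \<in> cbox a b")
      case True
      have "norm (?w n x *\<^sub>R h x) = ?w n x * norm (h x)" by (simp only: norm_scaleR abs_of_nonneg[OF w0(1)])
      also have "\<dots> \<le> 1 * norm (h x)" by (intro mult_right_mono w0) simp
      finally show ?thesis using True by simp
    next
      case False
      show ?thesis unfolding ws[OF False] using False by simp
    qed
    have "(\<lambda>n. LINT x|lborel. ?w n x *\<^sub>R h x) \<longlonglongrightarrow> (LINT x|lborel. indicator (box a b) x *\<^sub>R h x)"
    proof (rule integral_dominated_convergence[OF _ _ dom])
      show "AE x in lborel. (\<lambda>n. ?w n x *\<^sub>R h x) \<longlonglongrightarrow> indicator (box a b) x *\<^sub>R h x"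
      proof (intro AE_I2 tendsto_scaleR tendsto_const)
        fix x
        have "(\<lambda>n. ?w n x) \<longlonglongrightarrow> (\<Prod>i\<in>Basis. indicator {a \<bullet> i<..<b \<bullet> i} (x \<bullet> i))"
          by (intro tendsto_prod window_tendsto)
        also have "(\<Prod>i\<in>Basis. indicator {a \<bullet> i<..<b \<bullet> i} (x \<bullet> i)) = (indicator (box a b) x :: real)"
        proof (cases "x \<in> box a b")
          case False
          then obtain i where "i \<in> Basis" "x \<bullet> i \<notin> {a \<bullet> i<..<b \<bullet> i}" by (auto simp: mem_box)
          then have "(\<Prod>i\<in>Basis. indicator {a \<bullet> i<..<b \<bullet> i} (x \<bullet> i)) = (0::real)"
            by (intro prod_zero) (auto intro!: bexI[of _ i])
          then show ?thesis using False by simp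
        qed (auto simp: mem_box)
        finally show "(\<lambda>n. ?w n x) \<longlonglongrightarrow> indicator (box a b) x" .
      qed
      show "AE x in lborel. norm (?w n x *\<^sub>R h x) \<le> indicator (cbox a b) x *\<^sub>R norm (h x)" for n
        by (intro AE_I2 bd)
    qed (use wm hm in auto)
    moreover have "(LINT x|lborel. ?w n x *\<^sub>R h x) = 0" for n
      using z[of "\<lambda>i t. step (real (Suc n) * (t - a \<bullet> i)) * step (real (Suc n) * (b \<bullet> i - t))", OF test_window] by simp
    ultimately have 0: "(LINT x|lborel. indicator (box a b) x *\<^sub>R h x) = 0" by (simp add: LIMSEQ_const_iff)
    have "integrable lborel (\<lambda>x. indicator (box a b) x *\<^sub>R h x)"
      using set_integrable_subset[OF L1_locD[OF h compact_cbox[of a b]] _ box_subset_cbox] by (simp add: set_integrable_def)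
    then have "(LINT x|lborel. (indicator (box a b) x *\<^sub>R h x) \<bullet> e) = (LINT x|lborel. indicator (box a b) x *\<^sub>R h x) \<bullet> e"
      by (rule integral_inner_left)
    then show "(LINT x:box a b|lborel. h x \<bullet> e) = 0" using 0 by (simp add: set_lebesgue_integral_def)
  qed
  then have "AE x in lborel. \<forall>e\<in>Basis. h x \<bullet> e = 0" by (simp add: AE_ball_countable countable_finite)
  then show ?thesis by eventually_elim (rule euclidean_eqI, simp)
qed

subsection \<open>Weak derivatives\<close>

lemma test_mult_integrable:
  assumes t: "continuous_on UNIV \<phi>" and s: "\<And>x. norm x > M \<Longrightarrow> \<phi> x = 0" and g: "L1_loc g"
  shows "integrable lborel (\<lambda>x. \<phi> x *\<^sub>R g x)"
proof -
  have "set_integrable lborel (cball 0 M) (\<lambda>x. \<phi> x *\<^sub>R g x)"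
    by (intro L1_locD L1_loc_scaleR t g) simp
  moreover have "(\<lambda>x. indicator (cball 0 M) x *\<^sub>R \<phi> x *\<^sub>R g x) = (\<lambda>x. \<phi> x *\<^sub>R g x)"
  proof
    fix x show "indicator (cball 0 M) x *\<^sub>R \<phi> x *\<^sub>R g x = \<phi> x *\<^sub>R g x"
      using s[of x] by (cases "norm x \<le> M") auto
  qed
  ultimately show ?thesis unfolding set_integrable_def by argo
qed

lemma test_continuous: "test_function \<phi> \<Longrightarrow> continuous_on UNIV \<phi>"
  by (auto simp: test_function_def intro: smooth_continuous)

lemma test_integrable: "test_function \<phi> \<Longrightarrow> L1_loc g \<Longrightarrow> integrable lborel (\<lambda>x. \<phi> x *\<^sub>R g x)"
  using test_function_support[of \<phi>] test_mult_integrable[OF test_continuous, of \<phi>] by metis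

lemma test_gradient:
  fixes \<phi> :: "'a::euclidean_space \<Rightarrow> real"
  assumes "test_function \<phi>"
  obtains G M where "\<And>x. (\<phi> has_derivative (\<lambda>h. h \<bullet> G x)) (at x)" "\<And>x b. frechet_derivative \<phi> (at x) b = G x \<bullet> b"
    "\<And>b. b \<in> Basis \<Longrightarrow> continuous_on UNIV (\<lambda>x. G x \<bullet> b)"
    "M > 0" "\<And>x. norm x > M \<Longrightarrow> \<phi> x = 0" "\<And>x. norm x > M \<Longrightarrow> G x = 0"
proof -
  have "C_k (Suc 0) \<phi>" using assms by (auto simp: test_function_def smooth_def)
  then obtain G where G: "\<And>x. GDERIV \<phi> x :> G x" "\<And>b. b \<in> Basis \<Longrightarrow> continuous_on UNIV (\<lambda>x. G x \<bullet> b)" by auto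
  have d: "(\<phi> has_derivative (\<lambda>h. h \<bullet> G x)) (at x)" for x using G(1)[of x] by (simp add: gderiv_def)
  then have f: "frechet_derivative \<phi> (at x) b = G x \<bullet> b" for x b
    using frechet_derivative_at[OF d, of x] by (metis inner_commute)
  obtain M where M: "M > 0" "\<And>x. norm x > M \<Longrightarrow> \<phi> x = 0" using test_function_support[OF assms] by blast
  have "G x = 0" if "norm x > M" for x
  proof -
    have "((\<lambda>x. 0) has_derivative (\<lambda>h. 0)) (at x)" by simp
    then have "(\<phi> has_derivative (\<lambda>h. 0)) (at x)"
      by (rule has_derivative_transform_within_open[where s="- cball 0 M"]) (use that M in auto)
    then have "(\<lambda>h. h \<bullet> G x) = (\<lambda>h. 0)" using d has_derivative_unique by blast
    then have "G x \<bullet> G x = 0" by metis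
    then show ?thesis by simp
  qed
  then show ?thesis using that[of G M] d f G M by blast
qed

lemma test_deriv_integrable:
  assumes "test_function \<phi>" "L1_loc f" "b \<in> Basis"
  shows "integrable lborel (\<lambda>x. frechet_derivative \<phi> (at x) b *\<^sub>R f x)"
proof -
  obtain G M where G: "\<And>x b. frechet_derivative \<phi> (at x) b = G x \<bullet> b"
    "\<And>b. b \<in> Basis \<Longrightarrow> continuous_on UNIV (\<lambda>x. G x \<bullet> b)" "\<And>x. norm x > M \<Longrightarrow> G x = 0"
    using test_gradient[OF assms(1)] by metis
  show ?thesis unfolding G(1) by (rule test_mult_integrable[OF G(2)[OF assms(3)] _ assms(2), of M]) (simp add: G(3))
qed

lemma has_weak_derivD:
  assumes "has_weak_deriv b f g"
  shows "L1_loc f" "L1_loc g" 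
    "test_function \<phi> \<Longrightarrow> (LINT x|lborel. frechet_derivative \<phi> (at x) b *\<^sub>R f x) = - (LINT x|lborel. \<phi> x *\<^sub>R g x)"
  using assms by (auto simp: has_weak_deriv_def)

lemma has_weak_deriv_unique:
  fixes f :: "'a::euclidean_space \<Rightarrow> 'b::euclidean_space"
  assumes "has_weak_deriv b f g" "has_weak_deriv b f g'"
  shows "AE x in lborel. g x = g' x"
proof -
  note L = has_weak_derivD(2)[OF assms(1)] has_weak_derivD(2)[OF assms(2)]
  have "AE x in lborel. g x - g' x = 0"
  proof (rule AE_zero_test[OF L1_loc_diff[OF L]])
    fix \<beta> :: "'a \<Rightarrow> real \<Rightarrow> real" assume "\<And>b. b \<in> Basis \<Longrightarrow> test_function (\<beta> b)"
    then have t: "test_function (\<lambda>x::'a. \<Prod>b\<in>Basis. \<beta> b (x \<bullet> b))" by (rule test_function_prod)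
    show "(LINT x|lborel. (\<Prod>b\<in>Basis. \<beta> b (x \<bullet> b)) *\<^sub>R (g x - g' x)) = 0"
      using has_weak_derivD(3)[OF assms(1) t] has_weak_derivD(3)[OF assms(2) t] test_integrable[OF t L(1)] test_integrable[OF t L(2)]
      by (simp add: scaleR_diff_right)
  qed
  then show ?thesis by simp
qed

lemma has_weak_deriv_cong_AE:
  assumes "has_weak_deriv b f g" "f' \<in> borel_measurable borel" "AE x in lborel. f' x = f x"
    "g' \<in> borel_measurable borel" "AE x in lborel. g' x = g x" "b \<in> Basis"
  shows "has_weak_deriv b f' g'"
  unfolding has_weak_deriv_def
proof (intro conjI allI impI)
  note L = has_weak_derivD(1,2)[OF assms(1)]
  show L': "L1_loc f'" "L1_loc g'" using L1_loc_cong_AE L assms by blast+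
  fix \<phi> :: "'a \<Rightarrow> real" assume t: "test_function \<phi>"
  have "(LINT x|lborel. frechet_derivative \<phi> (at x) b *\<^sub>R f' x) = (LINT x|lborel. frechet_derivative \<phi> (at x) b *\<^sub>R f x)"
    using assms(3) borel_measurable_integrable[OF test_deriv_integrable[OF t L'(1) assms(6)]] 
      borel_measurable_integrable[OF test_deriv_integrable[OF t L(1) assms(6)]] by (intro integral_cong_AE) auto
  moreover have "(LINT x|lborel. \<phi> x *\<^sub>R g' x) = (LINT x|lborel. \<phi> x *\<^sub>R g x)"
    using assms(5) borel_measurable_integrable[OF test_integrable[OF t L'(2)]] 
      borel_measurable_integrable[OF test_integrable[OF t L(2)]] by (intro integral_cong_AE) auto
  ultimately show "(LINT x|lborel. frechet_derivative \<phi> (at x) b *\<^sub>R f' x) = - (LINT x|lborel. \<phi> x *\<^sub>R g' x)"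
    using has_weak_derivD(3)[OF assms(1) t] by simp
qed

lemma has_weak_deriv_diff:
  assumes "has_weak_deriv b f g" "has_weak_deriv b f' g'" "b \<in> Basis"
  shows "has_weak_deriv b (\<lambda>x. f x - f' x) (\<lambda>x. g x - g' x)"
  unfolding has_weak_deriv_def
proof (intro conjI allI impI)
  note L = has_weak_derivD(1,2)[OF assms(1)] has_weak_derivD(1,2)[OF assms(2)]
  show "L1_loc (\<lambda>x. f x - f' x)" "L1_loc (\<lambda>x. g x - g' x)" using L1_loc_diff L by blast+
  fix \<phi> :: "'a \<Rightarrow> real" assume t: "test_function \<phi>"
  show "(LINT x|lborel. frechet_derivative \<phi> (at x) b *\<^sub>R (f x - f' x)) = - (LINT x|lborel. \<phi> x *\<^sub>R (g x - g' x))"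
    using has_weak_derivD(3)[OF assms(1) t] has_weak_derivD(3)[OF assms(2) t] 
      test_deriv_integrable[OF t L(1) assms(3)] test_deriv_integrable[OF t L(3) assms(3)] 
      test_integrable[OF t L(2)] test_integrable[OF t L(4)]
    by (simp add: scaleR_diff_right)
qed

lemma weak_deriv_works: "has_weak_deriv b f g \<Longrightarrow> has_weak_deriv b f (weak_deriv b f)"
  unfolding weak_deriv_def by (rule someI[of "has_weak_deriv b f"])

lemma weak_deriv_AE:
  fixes f :: "'a::euclidean_space \<Rightarrow> 'b::euclidean_space"
  shows "has_weak_deriv b f g \<Longrightarrow> AE x in lborel. weak_deriv b f x = g x"
  using weak_deriv_works has_weak_deriv_unique by blast

lemma test_deriv_real:
  fixes \<phi> :: "real \<Rightarrow> real"
  assumes "test_function \<phi>"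
  shows "DERIV \<phi> x :> deriv \<phi> x" "frechet_derivative \<phi> (at x) 1 = deriv \<phi> x" "test_function (deriv \<phi>)"
proof -
  have s: "smooth \<phi>" using assms by (simp add: test_function_def)
  then show d: "DERIV \<phi> x :> deriv \<phi> x" for x using smooth_deriv by blast
  show "frechet_derivative \<phi> (at x) 1 = deriv \<phi> x"
    using frechet_derivative_at[OF d[unfolded has_field_derivative_def], of x] by (metis mult_1_right)
  obtain G M where G: "\<And>x. (\<phi> has_derivative (\<lambda>h. h \<bullet> G x)) (at x)" "\<And>x. norm x > M \<Longrightarrow> G x = 0"
    using test_gradient[OF assms] by metis
  have "deriv \<phi> x = G x" for x
    using has_derivative_unique[OF d[unfolded has_field_derivative_def] G(1)] by (metis inner_real_def mult_1 mult_1_right)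
  then show "test_function (deriv \<phi>)"
    by (intro test_functionI[where a="-M" and b=M] smooth_deriv(2) s) (use G(2) in auto)
qed

lemma ac_test: "test_function \<phi> \<Longrightarrow> ac \<phi> (deriv \<phi>)"
  by (intro ac_C1) (auto simp: test_deriv_real has_real_derivative_iff_has_vector_derivative[symmetric] 
      intro!: test_continuous)

lemma ac_weak_deriv:
  assumes "ac f g"
  shows "has_weak_deriv 1 f g"
  unfolding has_weak_deriv_def
proof (intro conjI allI impI)
  show "L1_loc f" using ac_continuous_on[OF assms] by (rule L1_loc_continuous)
  show "L1_loc g" using assms by (rule acD)
  fix \<phi> :: "real \<Rightarrow> real" assume t: "test_function \<phi>"
  obtain M where M: "M > 0" "\<And>x. norm x > M \<Longrightarrow> \<phi> x = 0" using test_function_support[OF t] by blast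
  obtain M' where M': "M' > 0" "\<And>x. norm x > M' \<Longrightarrow> deriv \<phi> x = 0" using test_function_support[OF test_deriv_real(3)[OF t]] by blast
  show "(LINT x|lborel. frechet_derivative \<phi> (at x) 1 *\<^sub>R f x) = - (LINT x|lborel. \<phi> x *\<^sub>R g x)"
    unfolding test_deriv_real(2)[OF t] 
    by (rule ac_parts(3)[OF assms ac_test[OF t], of "max M M'"]) (use M M' in auto)
qed

text \<open>Any test function differs from a multiple of the fixed one \<open>bump\<close> by the derivative of a test function.\<close>

lemma test_primitive:
  fixes \<xi> :: "real \<Rightarrow> real"
  assumes t: "test_function \<xi>"
  obtains X where "test_function X" "\<And>y. deriv X y = \<xi> y - integral\<^sup>L lborel \<xi> * (bump y / bump_int)"
proof -
  obtain M where M: "M > 0" "\<And>x. norm x > M \<Longrightarrow> \<xi> x = 0" using test_function_support[OF t] by blast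
  define K where "K = M + 2"
  define c where "c = integral\<^sup>L lborel \<xi>"
  define g where "g y = \<xi> y + (- c / bump_int) * bump y" for y
  have sg: "smooth g" unfolding g_def[abs_def]
    by (intro smooth_add smooth_mult smooth_const smooth_bump) (use t in \<open>simp add: test_function_def\<close>)
  have gi: "g integrable_on {a..b}" for a b
    using smooth_continuous[OF sg] continuous_on_subset by (blast intro: integrable_continuous_interval)
  have g0: "g y = 0" if "\<bar>y\<bar> > M + 1" for y
  proof -
    have "bump y = 0" using that M(1) by (intro bump_zero) linarith
    moreover have "\<xi> y = 0" using that M(2)[of y] by simp
    ultimately show ?thesis by (simp add: g_def)
  qed
  have "c = integral {-K..K} \<xi>"
  proof -
    have "L1_loc \<xi>" using test_continuous[OF t] by (rule L1_loc_continuous)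
    from L1_loc_Icc(3)[OF this, of "-K" K] have "(LINT x:{-K..K}|lborel. \<xi> x) = integral {-K..K} \<xi>" .
    moreover have "(\<lambda>x. indicator {-K..K} x *\<^sub>R \<xi> x) = \<xi>"
    proof
      fix x show "indicator {-K..K} x *\<^sub>R \<xi> x = \<xi> x" using M(2)[of x] by (cases "\<bar>x\<bar> > M"; force simp: indicator_def K_def)
    qed
    ultimately show ?thesis unfolding set_lebesgue_integral_def c_def by simp
  qed
  moreover have "integral {-K..K} bump = bump_int"
  proof -
    have "integral {-K..K} bump = integral {-K..K} (\<lambda>x. if x \<in> {0..1} then bump x else 0)"
      by (rule integral_cong) (auto simp: bump_zero)
    also have "\<dots> = integral {0..1} bump"
    proof -
      have "{0..1} \<inter> {-K..K} = {0..1}" "{-K..K} \<inter> {0..1} = {0..1}" using M(1) by (auto simp: K_def)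
      then show ?thesis by (simp only: integral_restrict_Int)
    qed
    finally show ?thesis by (simp add: bump_int_def)
  qed
  moreover have "integral {-K..K} g = integral {-K..K} \<xi> + integral {-K..K} (\<lambda>y. (- c / bump_int) * bump y)"
    unfolding g_def[abs_def] using t bump_integrable
    by (intro Henstock_Kurzweil_Integration.integral_add integrable_on_mult_right bump_integrable)
      (auto intro!: integrable_continuous_interval continuous_on_subset[OF test_continuous])
  ultimately have gK: "integral {-K..K} g = 0" using bump_int_pos by simp
  define X where "X y = antider g y + (- antider g (-K))" for y
  have dX: "DERIV X y :> g y" for y unfolding X_def
    using antider_deriv[OF smooth_continuous[OF sg]] by (auto intro!: derivative_eq_intros)
  have X0: "X y = 0" if "y \<notin> cbox (-K) K" for y
  proof (cases "y < -K")
    case True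
    have "integral {y..-K} g = integral {y..-K} (\<lambda>y. 0)" by (rule integral_cong) (use M(1) in \<open>auto intro!: g0 simp: K_def\<close>)
    then show ?thesis using antider_diff[OF gi, of y "-K"] True by (simp add: X_def)
  next
    case False
    then have "y > K" using that by auto
    have "integral {K..y} g = integral {K..y} (\<lambda>y. 0)" by (rule integral_cong) (use M(1) in \<open>auto intro!: g0 simp: K_def\<close>)
    then show ?thesis using antider_diff[OF gi, of K y] antider_diff[OF gi, of "-K" K] gK \<open>y > K\<close> M(1) by (simp add: X_def K_def)
  qed
  show ?thesis
  proof (rule that)
    show "test_function X" by (rule test_functionI[OF smoothI_deriv[OF dX sg] X0])
    show "deriv X y = \<xi> y - integral\<^sup>L lborel \<xi> * (bump y / bump_int)" for y
      using DERIV_imp_deriv[OF dX[of y]] by (simp add: g_def c_def)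
  qed
qed

lemma test_bump: "test_function bump"
  by (rule test_functionI[OF smooth_bump, of 0 1]) (use bump_zero in auto)

text \<open>Subtracting a primitive of \<open>g\<close> leaves a function \<open>h\<close> with zero
  weak derivative. By \<open>test_primitive\<close> every test function is a multiple of
  \<open>bump\<close> plus the derivative of a test function, so \<open>h\<close> acts on it as the
  constant \<open>c\<close> does, where \<open>c\<close> is the average of \<open>h\<close> against
  the normalised \<open>bump\<close>.\<close>

lemma weak_deriv_ac:
  fixes f :: "real \<Rightarrow> 'b::euclidean_space"
  assumes w: "has_weak_deriv 1 f g"
  obtains v where "ac v g" "AE x in lborel. f x = v x"
proof -
  note L = has_weak_derivD(1,2)[OF w]
  have aG: "ac (antider g) g" using L(2) by (rule ac_antider)
  define h where "h x = f x - antider g x" for x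
  have LG: "L1_loc (antider g)" using L1_loc_continuous[OF ac_continuous_on[OF aG]] .
  have Lh: "L1_loc h" unfolding h_def[abs_def] by (rule L1_loc_diff[OF L(1) LG])
  have "has_weak_deriv 1 h (\<lambda>x. g x - g x)"
    unfolding h_def[abs_def] by (rule has_weak_deriv_diff[OF w ac_weak_deriv[OF aG]]) simp
  then have h0: "(LINT x|lborel. deriv \<phi> x *\<^sub>R h x) = 0" if "test_function \<phi>" for \<phi>
    using has_weak_derivD(3)[OF _ that, of 1 h] test_deriv_real(2)[OF that] by simp
  define c where "c = (LINT x|lborel. bump x *\<^sub>R h x) /\<^sub>R bump_int"
  have "AE x in lborel. h x - c = 0"
  proof (rule AE_zero_test)
    have Lc: "L1_loc (\<lambda>x::real. c)" by (rule L1_loc_continuous) simp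
    then show "L1_loc (\<lambda>x. h x - c)" using Lh L1_loc_diff by blast
    fix \<beta> :: "real \<Rightarrow> real \<Rightarrow> real" assume "\<And>b. b \<in> Basis \<Longrightarrow> test_function (\<beta> b)"
    then have t: "test_function (\<beta> 1)" by simp
    define k where "k = integral\<^sup>L lborel (\<beta> 1)"
    obtain X where X: "test_function X" "\<And>y. deriv X y = \<beta> 1 y - k * (bump y / bump_int)"
      using test_primitive[OF t] unfolding k_def by blast
    have "0 = (LINT x|lborel. \<beta> 1 x *\<^sub>R h x - (k / bump_int) *\<^sub>R (bump x *\<^sub>R h x))"
      using h0[OF X(1)] unfolding X(2) by (simp add: scaleR_diff_left)
    also have "\<dots> = (LINT x|lborel. \<beta> 1 x *\<^sub>R h x) - (k / bump_int) *\<^sub>R (LINT x|lborel. bump x *\<^sub>R h x)"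
      by (simp only: Bochner_Integration.integral_diff[OF test_integrable[OF t Lh] integrable_scaleR_right[OF test_integrable[OF test_bump Lh]]] integral_scaleR_right)
    finally have "(LINT x|lborel. \<beta> 1 x *\<^sub>R h x) = k *\<^sub>R c" by (simp add: c_def divide_inverse)
    moreover have "(LINT x|lborel. \<beta> 1 x *\<^sub>R c) = k *\<^sub>R c"
      unfolding k_def using test_integrable[OF t, of "\<lambda>x. 1::real"] L1_loc_continuous[of "\<lambda>x::real. 1::real"] by simp
    ultimately have "(LINT x|lborel. \<beta> 1 x *\<^sub>R (h x - c)) = 0"
      using test_integrable[OF t Lh] test_integrable[OF t Lc] by (simp add: scaleR_diff_right)
    then show "(LINT x|lborel. (\<Prod>b\<in>Basis. \<beta> b (x \<bullet> b)) *\<^sub>R (h x - c)) = 0" by simp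
  qed
  then have "AE x in lborel. f x = antider g x + c" by eventually_elim (simp add: h_def algebra_simps)
  moreover have "ac (\<lambda>x. antider g x + c) (\<lambda>x. g x + 0)" by (intro ac_add aG ac_const)
  ultimately show ?thesis using that[of "\<lambda>x. antider g x + c"] by simp
qed

subsection \<open>Functions of finite energy on the line\<close>

text \<open>Finite energy for a fixed continuous representative \<open>v\<close> together with its
  derivative \<open>g\<close>. The geometric argument speaks about values at points, such as the
  minimum of \<open>|v|\<close>, which have no meaning for a class of functions.\<close>

definition finen :: "(real \<Rightarrow> complex) \<Rightarrow> (real \<Rightarrow> complex) \<Rightarrow> bool" where
  "finen v g \<longleftrightarrow> ac v g \<and> integrable lborel (\<lambda>x. (norm (g x))\<^sup>2) \<and> integrable lborel (\<lambda>x. (1 - (norm (v x))\<^sup>2)\<^sup>2)"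

definition dens :: "(real \<Rightarrow> complex) \<Rightarrow> (real \<Rightarrow> complex) \<Rightarrow> real \<Rightarrow> real" where
  "dens v g x = (norm (g x))\<^sup>2 / 2 + (1 - (norm (v x))\<^sup>2)\<^sup>2 / 4"

text \<open>This is \<open>|v|^2\<close> times the derivative of the phase of \<open>v\<close>. The
  term \<open>cdot\<close> in the integrand of the momentum is its negative.\<close>

definition curr :: "(real \<Rightarrow> complex) \<Rightarrow> (real \<Rightarrow> complex) \<Rightarrow> real \<Rightarrow> real" where
  "curr v g x = Im (cnj (v x) * g x)"

lemma finenD:
  assumes "finen v g"
  shows "ac v g" "integrable lborel (\<lambda>x. (norm (g x))\<^sup>2)" "integrable lborel (\<lambda>x. (1 - (norm (v x))\<^sup>2)\<^sup>2)"
    "v \<in> borel_measurable borel" "g \<in> borel_measurable borel" "continuous_on UNIV v" "integrable lborel (dens v g)"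
  using assms ac_continuous_on[of v g] acD(1)[of v g] L1_loc_measurable[of g]
  by (auto simp: finen_def dens_def[abs_def] intro: borel_measurable_continuous_onI)

lemma X_line_rep:
  assumes "\<psi> \<in> X_line"
  obtains v where "finen v (weak_deriv 1 \<psi>)" "AE x in lborel. \<psi> x = v x" "\<psi> \<in> borel_measurable borel"
    "E_line \<psi> = integral\<^sup>L lborel (dens v (weak_deriv 1 \<psi>))"
proof -
  let ?g = "weak_deriv 1 \<psi>"
  have H: "\<psi> \<in> H1_loc" "integrable lborel (\<lambda>x. (norm (?g x))\<^sup>2)" "integrable lborel (\<lambda>x. (1 - (norm (\<psi> x))\<^sup>2)\<^sup>2)"
    using assms by (auto simp: X_line_def)
  then obtain g where "has_weak_deriv 1 \<psi> g" by (auto simp: H1_loc_def)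
  then have w: "has_weak_deriv 1 \<psi> ?g" by (rule weak_deriv_works)
  then obtain v where v: "ac v ?g" "AE x in lborel. \<psi> x = v x" by (rule weak_deriv_ac)
  have pm: "\<psi> \<in> borel_measurable borel" using has_weak_derivD(1)[OF w] by (rule L1_loc_measurable)
  have vm: "v \<in> borel_measurable borel" using ac_continuous_on[OF v(1)] by (rule borel_measurable_continuous_onI)
  have e: "AE x in lborel. (1 - (norm (\<psi> x))\<^sup>2)\<^sup>2 = (1 - (norm (v x))\<^sup>2)\<^sup>2" using v(2) by eventually_elim simp
  have m: "(\<lambda>x. (1 - (norm (\<psi> x))\<^sup>2)\<^sup>2) \<in> borel_measurable lborel" "(\<lambda>x. (1 - (norm (v x))\<^sup>2)\<^sup>2) \<in> borel_measurable lborel"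
    using pm vm by simp_all
  have i: "integrable lborel (\<lambda>x. (1 - (norm (v x))\<^sup>2)\<^sup>2)" using H(3) integrable_cong_AE[OF m e] by simp
  have f: "finen v ?g" using v H i by (simp add: finen_def)
  have "E_line \<psi> = integral\<^sup>L lborel (dens v ?g)"
    unfolding E_line_def dens_def[abs_def] using H(2) i integral_cong_AE[OF m e] by simp
  then show ?thesis using that f v(2) pm by blast
qed

lemma X_lineI:
  assumes f: "finen v g" and \<psi>: "\<psi> \<in> borel_measurable borel" "AE x in lborel. \<psi> x = v x"
  shows "\<psi> \<in> X_line" "AE x in lborel. weak_deriv 1 \<psi> x = g x" "E_line \<psi> = integral\<^sup>L lborel (dens v g)"
proof -
  note F = finenD[OF f]
  have w: "has_weak_deriv 1 \<psi> g"
    by (rule has_weak_deriv_cong_AE[OF ac_weak_deriv[OF F(1)] \<psi>]) (use F in auto)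
  note ww = weak_deriv_works[OF w]
  show AE: "AE x in lborel. weak_deriv 1 \<psi> x = g x" using weak_deriv_AE[OF w] .
  have wm: "weak_deriv 1 \<psi> \<in> borel_measurable borel" using L1_loc_measurable[OF has_weak_derivD(2)[OF ww]] .
  have m1: "(\<lambda>x. (norm (weak_deriv 1 \<psi> x))\<^sup>2) \<in> borel_measurable lborel" "(\<lambda>x. (norm (g x))\<^sup>2) \<in> borel_measurable lborel"
    using wm F by simp_all
  have e1: "AE x in lborel. (norm (weak_deriv 1 \<psi> x))\<^sup>2 = (norm (g x))\<^sup>2" using AE by eventually_elim simp
  have m2: "(\<lambda>x. (1 - (norm (\<psi> x))\<^sup>2)\<^sup>2) \<in> borel_measurable lborel" "(\<lambda>x. (1 - (norm (v x))\<^sup>2)\<^sup>2) \<in> borel_measurable lborel"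
    using \<psi> F by simp_all
  have e2: "AE x in lborel. (1 - (norm (\<psi> x))\<^sup>2)\<^sup>2 = (1 - (norm (v x))\<^sup>2)\<^sup>2" using \<psi>(2) by eventually_elim simp
  have i: "integrable lborel (\<lambda>x. (norm (weak_deriv 1 \<psi> x))\<^sup>2)" "integrable lborel (\<lambda>x. (1 - (norm (\<psi> x))\<^sup>2)\<^sup>2)"
    using F(2,3) integrable_cong_AE[OF m1 e1] integrable_cong_AE[OF m2 e2] by simp_all
  have L2psi: "L2_loc \<psi>"
  proof -
    have "L1_loc (\<lambda>x. (norm (v x))\<^sup>2)" by (intro L1_loc_continuous continuous_intros F)
    then have "L1_loc (\<lambda>x. (norm (\<psi> x))\<^sup>2)"
      by (rule L1_loc_cong_AE) (use \<psi> in \<open>auto elim: eventually_mono\<close>)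
    then show ?thesis using \<psi> by (simp add: L2_loc_def L1_loc_def)
  qed
  have "L2_loc (weak_deriv 1 \<psi>)" using wm L1_loc_integrable[OF i(1)] by (simp add: L2_loc_def L1_loc_def)
  then show "\<psi> \<in> X_line" using i ww L2psi by (auto simp: X_line_def H1_loc_def)
  show "E_line \<psi> = integral\<^sup>L lborel (dens v g)"
    unfolding E_line_def dens_def[abs_def] using F(2,3) integral_cong_AE[OF m1 e1] integral_cong_AE[OF m2 e2] by simp
qed

lemma integral_tendsto_Icc:
  fixes F :: "real \<Rightarrow> 'a::euclidean_space"
  assumes F: "integrable lborel F"
  shows "(\<lambda>n. integral {- real n..real n} F) \<longlonglongrightarrow> integral\<^sup>L lborel F"
proof -
  have "(\<lambda>n. LINT x|lborel. indicator {- real n..real n} x *\<^sub>R F x) \<longlonglongrightarrow> integral\<^sup>L lborel F"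
  proof (rule integral_dominated_convergence[where w="\<lambda>x. norm (F x)"])
    show "AE x in lborel. (\<lambda>n. indicator {- real n..real n} x *\<^sub>R F x) \<longlonglongrightarrow> F x"
    proof (intro AE_I2 tendsto_eventually)
      fix x :: real
      obtain N where N: "\<bar>x\<bar> \<le> real N" using real_arch_simple by blast
      have "indicator {- real n..real n} x *\<^sub>R F x = F x" if "n \<ge> N" for n
      proof -
        have "real N \<le> real n" using that by simp
        then show ?thesis using N by (simp add: abs_le_iff)
      qed
      then show "\<forall>\<^sub>F n in sequentially. indicator {- real n..real n} x *\<^sub>R F x = F x"
        unfolding eventually_sequentially by blast
    qed
  qed (use F in \<open>auto simp: indicator_def\<close>)
  then show ?thesis using L1_loc_Icc(3)[OF L1_loc_integrable[OF F]] by (simp add: set_lebesgue_integral_def)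
qed

lemma integral_tail_small:
  fixes f :: "real \<Rightarrow> real"
  assumes f: "integrable lborel f" and nn: "\<And>x. f x \<ge> 0" and e: "e > 0"
  obtains R where "R > 0" "\<And>a b. a \<le> b \<Longrightarrow> R \<le> a \<or> b \<le> - R \<Longrightarrow> integral {a..b} f < e"
proof -
  have "\<forall>\<^sub>F n in sequentially. dist (integral {- real n..real n} f) (integral\<^sup>L lborel f) < e"
    using integral_tendsto_Icc[OF f] e by (rule tendstoD)
  then obtain N where N: "dist (integral {- real N..real N} f) (integral\<^sup>L lborel f) < e" by (auto simp: eventually_sequentially)
  have L: "L1_loc f" using f by (rule L1_loc_integrable)
  show ?thesis
  proof (rule that)
    show "real N + 1 > 0" by simp
    fix a b :: real assume ab: "a \<le> b" "real N + 1 \<le> a \<or> b \<le> - (real N + 1)"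
    have "(LINT x|lborel. indicator {- real N..real N} x *\<^sub>R f x + indicator {a..b} x *\<^sub>R f x) \<le> integral\<^sup>L lborel f"
    proof (rule integral_mono)
      show "integrable lborel (\<lambda>x. indicator {- real N..real N} x *\<^sub>R f x + indicator {a..b} x *\<^sub>R f x)"
        using L1_loc_Icc(1)[OF L] by (auto simp: set_integrable_def)
      fix x show "indicator {- real N..real N} x *\<^sub>R f x + indicator {a..b} x *\<^sub>R f x \<le> f x"
        using ab nn[of x] by (auto simp: indicator_def)
    qed (rule f)
    moreover have "(LINT x|lborel. indicator {- real N..real N} x *\<^sub>R f x + indicator {a..b} x *\<^sub>R f x) 
      = integral {- real N..real N} f + integral {a..b} f"
      using L1_loc_Icc(1)[OF L] L1_loc_Icc(3)[OF L, symmetric] by (simp add: set_integrable_def set_lebesgue_integral_def)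
    ultimately show "integral {a..b} f < e" using N by (simp add: dist_real_def)
  qed
qed

text \<open>Far out, the integral of \<open>|g|^2 + (1 - |v|^2)^2\<close> over each unit interval is
  below \<open>e^2/8\<close>. There Young's inequality bounds the integral of \<open>|g|\<close> by
  \<open>e/2\<close>, so \<open>|v|\<close> oscillates by at most \<open>e/2\<close>. A point where
  \<open>|v|\<close> differs from 1 by at least \<open>e\<close> would then force
  \<open>(1 - |v|^2)^2 >= e^2/4\<close> on the whole unit interval, which is too much.\<close>

lemma finen_norm_tendsto:
  assumes f: "finen v g" and e: "e > 0"
  obtains R where "R > 0" "\<And>x. \<bar>x\<bar> \<ge> R \<Longrightarrow> \<bar>norm (v x) - 1\<bar> < e"
proof -
  note F = finenD[OF f]
  let ?f = "\<lambda>x. (norm (g x))\<^sup>2 + (1 - (norm (v x))\<^sup>2)\<^sup>2"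
  have fi: "integrable lborel ?f" using F by simp
  obtain R where R: "R > 0" "\<And>a b. a \<le> b \<Longrightarrow> R \<le> a \<or> b \<le> - R \<Longrightarrow> integral {a..b} ?f < e\<^sup>2/8"
    using integral_tail_small[OF fi, of "e\<^sup>2/8"] e by (auto simp: add_nonneg_nonneg)
  have L1: "L1_loc (\<lambda>x. (norm (g x))\<^sup>2)" "L1_loc (\<lambda>x. (1 - (norm (v x))\<^sup>2)\<^sup>2)" "L1_loc ?f" "L1_loc g" "L1_loc (\<lambda>x. norm (g x))"
    using F L1_loc_integrable fi L1_loc_norm acD(1) by auto
  have key: False if I: "u \<le> y" "y \<le> u + 1" "R \<le> u \<or> u + 1 \<le> - R" and bad: "\<bar>norm (v y) - 1\<bar> \<ge> e" for u y
  proof -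
    have small: "integral {u..u+1} ?f < e\<^sup>2/8" using R(2)[of u "u+1"] I by simp
    have ge: "integral {u..u+1} (\<lambda>x. (norm (g x))\<^sup>2) \<le> integral {u..u+1} ?f"
      by (intro integral_le L1_loc_Icc L1) auto
    have "integral {u..u+1} (\<lambda>x. norm (g x)) \<le> integral {u..u+1} (\<lambda>x. e/4 + (1/e) * (norm (g x))\<^sup>2)"
    proof (rule integral_le)
      show "(\<lambda>x. e/4 + (1/e) * (norm (g x))\<^sup>2) integrable_on {u..u+1}"
        by (intro integrable_add integrable_on_mult_right integrable_const_ivl L1_loc_Icc L1)
      fix x
      have "0 \<le> (e/2 - norm (g x))\<^sup>2" by simp
      then have "e * norm (g x) \<le> e\<^sup>2/4 + (norm (g x))\<^sup>2" by (simp add: power2_eq_square algebra_simps)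
      then show "norm (g x) \<le> e/4 + (1/e) * (norm (g x))\<^sup>2" using e by (simp add: field_simps power2_eq_square)
    qed (intro L1_loc_Icc L1)
    also have "\<dots> = e/4 + (1/e) * integral {u..u+1} (\<lambda>x. (norm (g x))\<^sup>2)"
      using integrable_on_mult_right[OF L1_loc_Icc(2)[OF L1(1)], of "1/e" u "u+1"]
      by (subst Henstock_Kurzweil_Integration.integral_add) auto
    also have "\<dots> \<le> e/4 + (1/e) * (e\<^sup>2/8)" using small ge e by (intro add_left_mono mult_left_mono) auto
    also have "\<dots> \<le> e/2" using e by (simp add: power2_eq_square)
    finally have gi: "integral {u..u+1} (\<lambda>x. norm (g x)) \<le> e/2" .
    have inc: "norm (v b - v a) \<le> e/2" if "u \<le> a" "a \<le> b" "b \<le> u+1" for a b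
    proof -
      have "norm (v b - v a) \<le> integral {a..b} (\<lambda>x. norm (g x))" by (rule ac_increment_bound[OF F(1) that(2)])
      also have "\<dots> \<le> integral {u..u+1} (\<lambda>x. norm (g x))"
        by (rule integral_subset_le) (use that L1_loc_Icc(2)[OF L1(5)] in auto)
      finally show ?thesis using gi by simp
    qed
    have lo: "(1 - (norm (v x))\<^sup>2)\<^sup>2 \<ge> e\<^sup>2/4" if x: "x \<in> {u..u+1}" for x
    proof -
      have "norm (v x - v y) \<le> e/2" using inc[of x y] inc[of y x] x I by (cases "x \<le> y") (auto simp: norm_minus_commute)
      then have "\<bar>norm (v x) - norm (v y)\<bar> \<le> e/2" using norm_triangle_ineq3 order_trans by blast
      then have 1: "\<bar>norm (v x) - 1\<bar> \<ge> e/2" using bad by linarith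
      have "1 - (norm (v x))\<^sup>2 = (1 - norm (v x)) * (1 + norm (v x))" by (simp add: power2_eq_square algebra_simps)
      then have "\<bar>1 - (norm (v x))\<^sup>2\<bar> = \<bar>norm (v x) - 1\<bar> * (1 + norm (v x))" by (simp add: abs_mult abs_minus_commute)
      also have "\<dots> \<ge> \<bar>norm (v x) - 1\<bar> * 1" by (intro mult_left_mono) auto
      finally have "\<bar>1 - (norm (v x))\<^sup>2\<bar> \<ge> e/2" using 1 by simp
      then have "\<bar>1 - (norm (v x))\<^sup>2\<bar>\<^sup>2 \<ge> (e/2)\<^sup>2" using e by (intro power_mono) auto
      then show ?thesis by (simp add: power_divide)
    qed
    have "e\<^sup>2/4 = integral {u..u+1} (\<lambda>x. e\<^sup>2/4)" by simp
    also have "\<dots> \<le> integral {u..u+1} ?f"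
    proof (rule integral_le)
      fix x assume "x \<in> {u..u+1}"
      then show "e\<^sup>2/4 \<le> ?f x" using lo[of x] by (simp add: add_increasing)
    qed (intro L1_loc_Icc L1 integrable_const_ivl)+
    finally have "e\<^sup>2/4 < e\<^sup>2/8" using small by linarith
    then show False using e by simp
  qed
  show ?thesis
  proof (rule that[of R])
    show "R > 0" by fact
    fix x assume "\<bar>x\<bar> \<ge> R"
    then show "\<bar>norm (v x) - 1\<bar> < e" using key[of x x] key[of "x - 1" x] R(1) by (cases "x \<ge> 0") (auto simp: not_less[symmetric])
  qed
qed

subsection \<open>Phases\<close>

text \<open>The logarithm is obtained by integrating \<open>g / v\<close>, starting from
  \<open>Ln (v 0)\<close>: the product \<open>v exp(-L)\<close> has derivative 0 and equals 1 at
  0.\<close>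

lemma ac_log:
  assumes v: "ac v g" and nz: "\<And>x. v x \<noteq> (0::complex)"
  obtains L where "ac L (\<lambda>x. g x / v x)" "\<And>x. exp (L x) = v x"
proof -
  have "continuous_on UNIV (\<lambda>x. 1 / v x)" using ac_continuous_on[OF v] nz by (intro continuous_intros) auto
  from L1_loc_mult[OF this acD(1)[OF v]] have gl: "L1_loc (\<lambda>x. g x / v x)" by simp
  define L where "L x = antider (\<lambda>x. g x / v x) x + Ln (v 0)" for x
  have aL: "ac L (\<lambda>x. g x / v x)" unfolding L_def using ac_add[OF ac_antider[OF gl] ac_const] by simp
  have "ac (\<lambda>x. exp (- L x)) (\<lambda>x. - exp (- L x) * (g x / v x))"
    by (rule ac_chain_UNIV[OF aL, of "\<lambda>z. exp (- z)" "\<lambda>z. - exp (- z)"]) (auto intro!: derivative_eq_intros continuous_intros)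
  from ac_bilinear[OF bounded_bilinear_mult v this]
  have "ac (\<lambda>x. v x * exp (- L x)) (\<lambda>x. g x * exp (- L x) + v x * (- exp (- L x) * (g x / v x)))" .
  moreover have "g x * exp (- L x) + v x * (- exp (- L x) * (g x / v x)) = 0" for x using nz[of x] by simp
  ultimately have a0: "ac (\<lambda>x. v x * exp (- L x)) (\<lambda>x. 0)" by simp
  have "v x * exp (- L x) = v 0 * exp (- L 0)" for x
    using acD(2)[OF a0, of 0 x] acD(2)[OF a0, of x 0] by (cases "0 \<le> x") auto
  moreover have "v 0 * exp (- L 0) = 1" using nz[of 0] by (simp add: L_def antider_def exp_minus)
  ultimately have "exp (L x) = v x" for x by (metis exp_minus_inverse mult.commute mult_cancel_left exp_not_eq_zero)
  then show ?thesis using that aL by blast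
qed

text \<open>Freezing \<open>v\<close> to the left of \<open>R\<close> turns a tail without zeros
  into a function without zeros on the whole line, to which the logarithm applies.\<close>

lemma ac_max:
  assumes "ac v g" shows "ac (\<lambda>x. v (max x R)) (\<lambda>x. indicator {R..} x *\<^sub>R g x)"
  unfolding ac_def
proof (intro conjI allI impI)
  have gm: "g \<in> borel_measurable borel" using acD(1)[OF assms] by (rule L1_loc_measurable)
  show "L1_loc (\<lambda>x. indicator {R..} x *\<^sub>R g x)"
    by (rule L1_loc_bound[OF acD(1)[OF assms]]) (use gm in \<open>auto intro!: exI[of _ 1] simp: indicator_def\<close>)
  fix a b :: real assume ab: "a \<le> b"
  have e: "integral {a..b} (\<lambda>x. indicator {R..} x *\<^sub>R g x) = integral ({R..} \<inter> {a..b}) g"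
    unfolding integral_restrict_Int[symmetric] by (rule integral_cong) (auto simp: indicator_def)
  show "v (max b R) - v (max a R) = integral {a..b} (\<lambda>x. indicator {R..} x *\<^sub>R g x)"
  proof (cases "b < R")
    case True
    then have "{R..} \<inter> {a..b} = {}" by auto
    then show ?thesis unfolding e using True ab by simp
  next
    case False
    then have "{R..} \<inter> {a..b} = {max a R..b}" by auto
    then show ?thesis unfolding e using acD(2)[OF assms, of "max a R" b] False ab by simp
  qed
qed

lemma ac_reflect:
  assumes "ac v g" shows "ac (\<lambda>x. v (- x)) (\<lambda>x. - g (- x))"
  unfolding ac_def
proof (intro conjI allI impI)
  have gm: "g \<in> borel_measurable borel" using acD(1)[OF assms] by (rule L1_loc_measurable)
  show "L1_loc (\<lambda>x. - g (- x))"
  proof -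
    have "set_integrable lborel K (\<lambda>x. g (- x))" if K: "compact K" for K
    proof -
      have "integrable lborel (\<lambda>x. indicator (uminus ` K) x *\<^sub>R g x)"
        using L1_locD[OF acD(1)[OF assms] compact_negations[OF K]] by (simp add: set_integrable_def)
      from lborel_integrable_real_affine[OF this, of "-1" 0]
      have "integrable lborel (\<lambda>x. indicator (uminus ` K) (- x) *\<^sub>R g (- x))" by simp
      moreover have "indicator (uminus ` K) (- x) = (indicator K x :: real)" for x by (auto simp: indicator_def)
      ultimately show ?thesis by (simp add: set_integrable_def)
    qed
    then show ?thesis unfolding L1_loc_def by (auto simp: set_integrable_def)
  qed
  fix a b :: real assume "a \<le> b"
  then have 1: "v (- a) - v (- b) = integral {-b..-a} g" using acD(2)[OF assms, of "-b" "-a"] by simp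
  have 2: "integral {a..b} (\<lambda>x. g (- x)) = integral {-b..-a} g"
    using Henstock_Kurzweil_Integration.integral_reflect_real[of "-a" "-b" g] by simp
  show "v (- b) - v (- a) = integral {a..b} (\<lambda>x. - g (- x))"
    unfolding Henstock_Kurzweil_Integration.integral_neg 2 1[symmetric] by simp
qed

lemma AE_dense: "AE x in lborel. P x \<Longrightarrow> (a::real) < b \<Longrightarrow> \<exists>x\<in>{a<..<b}. P x"
proof (rule ccontr)
  assume AE: "AE x in lborel. P x" and ab: "a < b" and "\<not> (\<exists>x\<in>{a<..<b}. P x)"
  then have "AE x in lborel. x \<notin> {a<..<b}" by (auto elim: eventually_mono)
  then have "emeasure lborel {a<..<b} = 0" by (subst (asm) AE_iff_measurable[where N="{a<..<b}"]) auto
  then show False using ab by simp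
qed

text \<open>The definition of the momentum constrains \<psi> and \<theta> almost everywhere only; by
  density its conditions hold at every point of the tails for the continuous representative.\<close>

lemma AE_tail_eq:
  fixes f :: "real \<Rightarrow> 'a::t2_space"
  assumes AE: "AE x in lborel. \<bar>x\<bar> \<ge> R \<longrightarrow> f x = g x"
    and c: "continuous_on ({..-R} \<union> {R..}) f" "continuous_on ({..-R} \<union> {R..}) g" and x: "\<bar>x\<bar> \<ge> R" "R > 0"
  shows "f x = g x"
proof -
  let ?S = "{y. \<bar>y\<bar> \<ge> R \<and> f y = g y}"
  have "\<exists>s. s \<in> {y. \<bar>y\<bar> \<ge> R \<and> f y = g y} \<and> \<bar>s - x\<bar> < e" if ep: "e > 0" for e
  proof (cases "x \<ge> 0")
    case True
    obtain s where "s \<in> {x<..<x+e}" "\<bar>s\<bar> \<ge> R \<longrightarrow> f s = g s" using AE_dense[OF AE, of x "x + e"] ep by auto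
    then show ?thesis using True x by (intro exI[of _ s]) auto
  next
    case False
    obtain s where "s \<in> {x-e<..<x}" "\<bar>s\<bar> \<ge> R \<longrightarrow> f s = g s" using AE_dense[OF AE, of "x - e" x] ep by auto
    then show ?thesis using False x by (intro exI[of _ s]) auto
  qed
  then have "\<forall>n. \<exists>s. s \<in> ?S \<and> \<bar>s - x\<bar> < 1 / real (Suc n)" by simp
  then obtain s where s: "\<And>n. s n \<in> ?S" "\<And>n. \<bar>s n - x\<bar> < 1 / real (Suc n)" by metis
  have "(\<lambda>n. s n - x) \<longlonglongrightarrow> 0"
    by (rule Lim_null_comparison[OF _ LIMSEQ_Suc[OF lim_const_over_n[of 1]]]) (use s(2) in \<open>auto intro!: less_imp_le eventuallyI\<close>)
  then have sx: "s \<longlonglongrightarrow> x" by (simp add: LIM_zero_cancel)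
  have T: "x \<in> {..-R} \<union> {R..}" "\<And>n. s n \<in> {..-R} \<union> {R..}" 
  proof -
    have "y \<in> {..-R} \<union> {R..}" if "\<bar>y\<bar> \<ge> R" for y :: real using that by (cases "y \<ge> 0") auto
    then show "x \<in> {..-R} \<union> {R..}" "\<And>n. s n \<in> {..-R} \<union> {R..}" using x s(1) by blast+
  qed
  have "(\<lambda>n. f (s n)) \<longlonglongrightarrow> f x" "(\<lambda>n. g (s n)) \<longlonglongrightarrow> g x"
    using continuous_on_tendsto_compose[OF c(1) sx T(1)] continuous_on_tendsto_compose[OF c(2) sx T(1)] T(2) by auto
  moreover have "f (s n) = g (s n)" for n using s(1) by auto
  ultimately show ?thesis using LIMSEQ_unique[of "\<lambda>n. f (s n)" "f x" "g x"] by simp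
qed

text \<open>The difference of the phases is continuous with values in the multiples of
  \<open>2 * pi\<close>, a discrete set, hence constant on a connected set.\<close>

lemma phase_const:
  fixes \<theta> \<phi> :: "real \<Rightarrow> real"
  assumes "connected S" "continuous_on S \<theta>" "continuous_on S \<phi>" "\<And>x. x \<in> S \<Longrightarrow> cis (\<theta> x) = cis (\<phi> x)"
  obtains c where "\<And>x. x \<in> S \<Longrightarrow> \<theta> x = \<phi> x + c"
proof -
  have k: "\<exists>n::int. \<theta> x - \<phi> x = of_int n * (2 * pi)" if "x \<in> S" for x
  proof -
    have "exp (\<i> * of_real (\<theta> x - \<phi> x)) = 1"
      using assms(4)[OF that] by (simp add: cis_conv_exp right_diff_distrib exp_diff)
    then obtain n :: int where "\<theta> x - \<phi> x = of_int (2 * n) * pi" using exp_eq_1 by auto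
    then show ?thesis by (intro exI[of _ n]) simp
  qed
  have "(\<lambda>x. \<theta> x - \<phi> x) constant_on S"
  proof (rule continuous_discrete_range_constant[OF assms(1)])
    show "continuous_on S (\<lambda>x. \<theta> x - \<phi> x)" by (intro continuous_intros assms)
    fix x assume x: "x \<in> S"
    obtain n :: int where n: "\<theta> x - \<phi> x = of_int n * (2 * pi)" using k[OF x] by blast
    show "\<exists>e>0. \<forall>y. y \<in> S \<and> \<theta> y - \<phi> y \<noteq> \<theta> x - \<phi> x \<longrightarrow> e \<le> norm ((\<theta> y - \<phi> y) - (\<theta> x - \<phi> x))"
    proof (intro exI[of _ "2*pi"] conjI allI impI)
      fix y assume y: "y \<in> S \<and> \<theta> y - \<phi> y \<noteq> \<theta> x - \<phi> x"
      then obtain m :: int where m: "\<theta> y - \<phi> y = of_int m * (2 * pi)" using k by blast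
      have "m \<noteq> n" using y n m by auto
      then have "1 \<le> \<bar>m - n\<bar>" by simp
      then have "1 \<le> \<bar>real_of_int m - real_of_int n\<bar>" by (metis of_int_1_le_iff of_int_abs of_int_diff)
      then have "1 * (2*pi) \<le> \<bar>real_of_int m - real_of_int n\<bar> * (2*pi)" by (intro mult_right_mono) auto
      then show "2*pi \<le> norm ((\<theta> y - \<phi> y) - (\<theta> x - \<phi> x))" unfolding n m 
        by (simp add: abs_mult left_diff_distrib[symmetric])
    qed simp
  qed
  then obtain c where "\<And>x. x \<in> S \<Longrightarrow> \<theta> x - \<phi> x = c" by (auto simp: constant_on_def)
  then show ?thesis using that[of c] by (metis add_diff_cancel_left' add_diff_eq diff_add_cancel)
qed

text \<open>Doubling turns a class modulo \<pi> into a point of the unit circle, where equality of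
  classes passes to limits and addition becomes multiplication.\<close>

lemma rcong_pi_iff: "[a = b] (rmod pi) \<longleftrightarrow> cis (2 * a) = cis (2 * b)"
proof -
  have "[a = b] (rmod pi) \<longleftrightarrow> (\<exists>n. b = a + of_int n * pi)" by (simp add: rcong_altdef)
  also have "\<dots> \<longleftrightarrow> (\<exists>n. 2 * b = 2 * a + of_int (2 * n) * pi)" by (intro iff_exI) (auto simp: algebra_simps)
  also have "\<dots> \<longleftrightarrow> cis (2 * b) = cis (2 * a)"
  proof -
    have "cis (2 * b) = cis (2 * a) \<longleftrightarrow> exp (\<i> * of_real (2 * b)) = exp (\<i> * of_real (2 * a))" by (simp add: cis_conv_exp)
    also have "\<dots> \<longleftrightarrow> (\<exists>n::int. \<i> * of_real (2 * b) = \<i> * of_real (2 * a) + (of_int (2 * n) * pi) * \<i>)" by (rule exp_eq)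
    also have "\<dots> \<longleftrightarrow> (\<exists>n::int. 2 * b = 2 * a + of_int (2 * n) * pi)" by (simp add: complex_eq_iff)
    finally show ?thesis by simp
  qed
  finally show ?thesis by auto
qed

subsection \<open>The untwisted momentum\<close>

text \<open>The class of the momentum modulo \<open>\<pi>\<close> is determined by the limit of this sequence, which is \<open>cis (2 * momentum)\<close>.\<close>

definition mseq :: "(real \<Rightarrow> complex) \<Rightarrow> (real \<Rightarrow> complex) \<Rightarrow> nat \<Rightarrow> complex" where
  "mseq v g n = sgn (v (real n)) * cnj (sgn (v (- real n))) * cis (- integral {- real n..real n} (curr v g))"

lemma curr_L1_loc: "ac v g \<Longrightarrow> L1_loc (curr v g)"
proof -
  assume v: "ac v g"
  have "L1_loc (\<lambda>x. cnj (v x) * g x)"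
    using ac_continuous_on[OF v] acD(1)[OF v] by (intro L1_loc_mult continuous_intros)
  then show ?thesis unfolding curr_def[abs_def] by (rule L1_loc_linear[OF bounded_linear_Im])
qed

lemma measurable_cnj [measurable (raw)]:
  assumes "f \<in> borel_measurable M" shows "(\<lambda>x. cnj (f x)) \<in> borel_measurable M"
  by (rule borel_measurable_continuous_on[OF _ assms]) (intro continuous_intros)

lemma curr_bound: "\<bar>curr v g x\<bar> \<le> norm (v x) * norm (g x)"
  using abs_Im_le_cmod[of "cnj (v x) * g x"] by (simp add: curr_def norm_mult)

lemma Im_divide_curr: "Im (g x / v x) = curr v g x / (norm (v x))\<^sup>2"
  by (simp add: complex_div_cnj[of "g x"] curr_def mult.commute)

text \<open>The phase in the definition of the momentum is merely continuous, yet its weak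
  derivative is integrated. It differs by a constant from the imaginary part of a logarithm, hence
  is absolutely continuous with a known derivative.\<close>

lemma tail_phase:
  assumes v: "ac v g" and nz: "\<And>x. x \<ge> R \<Longrightarrow> v x \<noteq> 0"
    and c: "continuous_on {R..} \<theta>" and ph: "\<And>x. x \<ge> R \<Longrightarrow> v x = of_real (norm (v x)) * cis (\<theta> x)"
  obtains \<Theta> k where "ac \<Theta> k" "\<And>x. x \<ge> R \<Longrightarrow> \<Theta> x = \<theta> x" "\<And>x. x \<ge> R \<Longrightarrow> k x = curr v g x / (norm (v x))\<^sup>2"
proof -
  obtain L where L: "ac L (\<lambda>x. (indicator {R..} x *\<^sub>R g x) / v (max x R))" "\<And>x. exp (L x) = v (max x R)"
    using ac_log[OF ac_max[OF v, of R]] nz by (metis max.cobounded2)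
  have aI: "ac (\<lambda>x. Im (L x)) (\<lambda>x. Im ((indicator {R..} x *\<^sub>R g x) / v (max x R)))"
    by (rule ac_linear[OF bounded_linear_Im L(1)])
  have eq: "cis (\<theta> x) = cis (Im (L x))" if "x \<in> {R..}" for x
  proof -
    have "of_real (norm (v x)) * cis (\<theta> x) = v x" using ph that by simp
    also have "v x = exp (L x)" using L(2)[of x] that by (simp add: max_absorb1)
    also have "\<dots> = of_real (exp (Re (L x))) * cis (Im (L x))" by (simp add: exp_eq_polar)
    also have "exp (Re (L x)) = norm (exp (L x))" by simp
    also have "exp (L x) = v x" using L(2)[of x] that by (simp add: max_absorb1)
    finally show ?thesis using nz that by simp
  qed
  obtain c where c: "\<And>x. x \<in> {R..} \<Longrightarrow> \<theta> x = Im (L x) + c"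
    using phase_const[OF connected_Ici c continuous_on_subset[OF ac_continuous_on[OF aI]] eq] by auto
  show ?thesis
  proof (rule that)
    show "ac (\<lambda>x. Im (L x) + c) (\<lambda>x. Im ((indicator {R..} x *\<^sub>R g x) / v (max x R)) + 0)" by (intro ac_add aI ac_const)
    show "Im (L x) + c = \<theta> x" if "x \<ge> R" for x using c that by simp
    show "Im ((indicator {R..} x *\<^sub>R g x) / v (max x R)) + 0 = curr v g x / (norm (v x))\<^sup>2" if "x \<ge> R" for x
      using that Im_divide_curr[of g x v] by (simp add: max_absorb1)
  qed
qed

text \<open>The two tails carry unrelated phases, so the cut-off is split into a right and a left
  half, each of which multiplies its own extension of the phase.\<close>

lemma half_cutoff:
  fixes \<eta> :: "real \<Rightarrow> real"
  assumes s: "smooth \<eta>" and 0: "\<And>x. 0 \<le> x \<Longrightarrow> x \<le> 1 \<Longrightarrow> \<eta> x = 0" and 1: "\<And>x. x \<ge> 2 \<Longrightarrow> \<eta> x = 1" and r: "r > 0"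
  obtains e' where "ac (\<lambda>t. if t > 0 then \<eta> (t / r) else 0) e'" "\<And>t. t < r \<or> t > 2 * r \<Longrightarrow> e' t = 0"
proof -
  let ?e = "\<lambda>t. if t > 0 then \<eta> (t / r) else 0"
  define e' where "e' t = (if t > 0 then deriv \<eta> (t / r) * (1 / r) else 0)" for t
  have D: "DERIV \<eta> x :> deriv \<eta> x" for x using smooth_deriv(1)[OF s] .
  have dc: "continuous_on UNIV (deriv \<eta>)" using smooth_continuous[OF smooth_deriv(2)[OF s]] .
  have z: "deriv \<eta> x = 0" if "0 < x" "x < 1" for x
  proof -
    have "DERIV (\<lambda>x. 0) x :> 0" by simp
    then have "DERIV \<eta> x :> 0"
      by (rule has_field_derivative_transform_within_open[where S="{0<..<1}"]) (use that 0 in auto)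
    then show ?thesis by (rule DERIV_imp_deriv)
  qed
  have z2: "deriv \<eta> x = 0" if "x > 2" for x
  proof -
    have "DERIV (\<lambda>x. 1) x :> 0" by simp
    then have "DERIV \<eta> x :> 0"
      by (rule has_field_derivative_transform_within_open[where S="{2<..}"]) (use that 1 in auto)
    then show ?thesis by (rule DERIV_imp_deriv)
  qed
  have e0: "e' t = 0" if "t < r" for t
    using that z[of "t/r"] r by (auto simp: e'_def)
  have e2: "e' t = 0" if "t > 2 * r" for t
    using that z2[of "t/r"] r by (auto simp: e'_def field_simps)
  have dd: "DERIV ?e t :> e' t" for t
  proof (cases "t < r")
    case True
    have "DERIV (\<lambda>x. 0) t :> e' t" using e0[OF True] by simp
    then show ?thesis
      by (rule has_field_derivative_transform_within_open[where S="{..<r}"]) (use True 0 r in \<open>auto\<close>)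
  next
    case False
    then have t: "t > 0" using r by simp
    have "DERIV (\<lambda>t. \<eta> (t / r)) t :> deriv \<eta> (t / r) * (1 / r)"
      by (rule DERIV_chain2[OF D]) (use r in \<open>auto intro!: derivative_eq_intros\<close>)
    then have "DERIV (\<lambda>t. \<eta> (t / r)) t :> e' t" using t by (simp add: e'_def)
    then show ?thesis
      by (rule has_field_derivative_transform_within_open[where S="{0<..}"]) (use t in auto)
  qed
  have "continuous_on ({..<r} \<union> {0<..}) e'"
  proof (rule continuous_on_open_Un)
    show "continuous_on {..<r} e'" by (rule continuous_on_eq[OF continuous_on_const[of _ 0]]) (use e0 in auto)
    have "continuous_on {0<..} (\<lambda>t. deriv \<eta> (t / r) * (1 / r))"
      by (intro continuous_intros continuous_on_compose2[OF dc]) (use r in auto)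
    then show "continuous_on {0<..} e'" by (rule continuous_on_eq) (auto simp: e'_def)
  qed auto
  moreover have "{..<r} \<union> {0<..} = UNIV" using r by auto
  ultimately have "continuous_on UNIV e'" by simp
  then have "ac ?e e'" using dd by (intro ac_C1) (simp_all add: has_real_derivative_iff_has_vector_derivative[symmetric])
  then show ?thesis using that e0 e2 by blast
qed

lemma integrable_L1_loc_tail:
  fixes F :: "real \<Rightarrow> 'a::euclidean_space" and G :: "real \<Rightarrow> real"
  assumes L: "L1_loc F" and G: "integrable lborel G" and b: "\<And>x. \<bar>x\<bar> > M \<Longrightarrow> norm (F x) \<le> G x"
  shows "integrable lborel F"
proof -
  have Fm: "F \<in> borel_measurable borel" using L by (rule L1_loc_measurable)
  have i: "integrable lborel (\<lambda>x. indicator {-M..M} x *\<^sub>R norm (F x) + norm (G x))"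
    using L1_loc_Icc(1)[OF L1_loc_norm[OF L], of "-M" M] G by (auto simp: set_integrable_def)
  show ?thesis
  proof (rule Bochner_Integration.integrable_bound[OF i])
    have "norm (F x) \<le> norm (indicator {-M..M} x *\<^sub>R norm (F x) + norm (G x))" for x
    proof (cases "\<bar>x\<bar> > M")
      case True
      then show ?thesis using b[OF True] by (auto simp: indicator_def)
    next
      case False
      then have "x \<in> {-M..M}" by auto
      then show ?thesis by simp
    qed
    then show "AE x in lborel. norm (F x) \<le> norm (indicator {-M..M} x *\<^sub>R norm (F x) + norm (G x))" by blast
  qed (use Fm in simp)
qed

lemma sgn_polar: "z \<noteq> 0 \<Longrightarrow> z = of_real (norm z) * cis t \<Longrightarrow> sgn z = cis t"
  by (metis mult.commute mult_cancel_right2 nonzero_mult_div_cancel_right norm_eq_zero of_real_eq_0_iff sgn_eq)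

text \<open>Twice the momentum is the integral of the derivative of \<eta>\<theta> minus the
  current. Over \<open>[-n, n]\<close> with large \<open>n\<close> the first term integrates to the
  phase difference of the end points, so the exponential of the integral is
  \<open>mseq v g n\<close>, which mentions neither the cut-off nor the phase. Hence all admissible
  choices give the same class.\<close>

lemma momentum_value_limit:
  assumes f: "finen v g" and g: "g = weak_deriv 1 \<psi>" and \<psi>: "AE x in lborel. \<psi> x = v x" "\<psi> \<in> borel_measurable borel"
    and m: "momentum_line_value \<psi> m"
  shows "mseq v g \<longlonglongrightarrow> cis (2 * m)"
proof -
  note F = finenD[OF f]
  obtain R \<theta> \<eta> r where R: "R > 0" and b: "AE x in lborel. \<bar>x\<bar> \<ge> R \<longrightarrow> norm (\<psi> x) \<ge> 1 / 2"
    and c: "continuous_on ({..-R} \<union> {R..}) \<theta>"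
    and p: "AE x in lborel. \<bar>x\<bar> \<ge> R \<longrightarrow> \<psi> x = of_real (norm (\<psi> x)) * exp (\<i> * of_real (\<theta> x))"
    and s: "smooth \<eta>" and e0: "\<forall>x. \<bar>x\<bar> \<le> 1 \<longrightarrow> \<eta> x = 0" and e1: "\<forall>x. \<bar>x\<bar> \<ge> 2 \<longrightarrow> \<eta> x = 1" and r: "r > R"
    and meq: "m = 1 / 2 * (LINT x|lborel. cdot (\<i> * weak_deriv 1 \<psi> x) (\<psi> x) + weak_deriv 1 (\<lambda>t. \<eta> (t / r) * \<theta> t) x)"
    using m unfolding momentum_line_value_def by (elim exE conjE) (rule that)
  have cv: "continuous_on ({..-R} \<union> {R..}) v" using F(6) continuous_on_subset by blast
  have nb: "norm (v x) \<ge> 1/2" if "\<bar>x\<bar> \<ge> R" for x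
  proof -
    have "min 0 (norm (v x) - 1/2) = 0"
    proof (rule AE_tail_eq[OF _ _ _ that R, of "\<lambda>x. min 0 (norm (v x) - 1/2)" "\<lambda>x. 0"])
      show "AE x in lborel. R \<le> \<bar>x\<bar> \<longrightarrow> min 0 (norm (v x) - 1 / 2) = 0" using b \<psi>(1) by eventually_elim auto
    qed (intro continuous_intros cv)+
    then show ?thesis by simp
  qed
  have ph: "v x = of_real (norm (v x)) * cis (\<theta> x)" if "\<bar>x\<bar> \<ge> R" for x
  proof (rule AE_tail_eq[OF _ _ _ that R, of v "\<lambda>x. of_real (norm (v x)) * cis (\<theta> x)"])
    show "AE x in lborel. R \<le> \<bar>x\<bar> \<longrightarrow> v x = of_real (norm (v x)) * cis (\<theta> x)"
      using p \<psi>(1) by eventually_elim (auto simp: cis_conv_exp)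
    show "continuous_on ({..- R} \<union> {R..}) (\<lambda>x. complex_of_real (cmod (v x)) * cis (\<theta> x))"
      unfolding cis_conv_exp by (intro continuous_intros cv c)
  qed (rule cv)
  have nz: "v x \<noteq> 0" if "\<bar>x\<bar> \<ge> R" for x using nb[OF that] by auto
  obtain \<Theta>p kp where P: "ac \<Theta>p kp" "\<And>x. x \<ge> R \<Longrightarrow> \<Theta>p x = \<theta> x" "\<And>x. x \<ge> R \<Longrightarrow> kp x = curr v g x / (norm (v x))\<^sup>2"
    by (rule tail_phase[OF F(1), of R \<theta>]) (use nz ph R continuous_on_subset[OF c] in auto)
  obtain \<Theta>n kn where N: "ac \<Theta>n kn" "\<And>x. x \<ge> R \<Longrightarrow> \<Theta>n x = \<theta> (-x)" 
    "\<And>x. x \<ge> R \<Longrightarrow> kn x = curr (\<lambda>x. v (-x)) (\<lambda>x. - g (-x)) x / (norm (v (-x)))\<^sup>2"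
  proof (rule tail_phase[OF ac_reflect[OF F(1)], of R "\<lambda>x. \<theta> (-x)"])
    show "continuous_on {R..} (\<lambda>x. \<theta> (- x))"
      by (rule continuous_on_compose2[OF c]) (auto intro!: continuous_intros)
  qed (use nz ph R in auto)
  have ep: "\<exists>e'. ac (\<lambda>t. if t > 0 then \<eta> (t / r) else 0) e' \<and> (\<forall>t. t < r \<or> t > 2 * r \<longrightarrow> e' t = 0)"
    by (rule half_cutoff[OF s, of r]) (use e0 e1 R r in auto)
  have en: "\<exists>e'. ac (\<lambda>t. if t > 0 then \<eta> (- 1 * (t / r) + 0) else 0) e' \<and> (\<forall>t. t < r \<or> t > 2 * r \<longrightarrow> e' t = 0)"
    by (rule half_cutoff[OF smooth_affine[OF s, of "-1" 0], of r]) (use e0 e1 R r in auto)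
  obtain ep' where ep': "ac (\<lambda>t. if t > 0 then \<eta> (t / r) else 0) ep'" "\<And>t. t < r \<or> t > 2 * r \<Longrightarrow> ep' t = 0" using ep by blast
  obtain en' where en': "ac (\<lambda>t. if t > 0 then \<eta> (- 1 * (t / r) + 0) else 0) en'" "\<And>t. t < r \<or> t > 2 * r \<Longrightarrow> en' t = 0" using en by blast
  define ep where "ep t = (if t > 0 then \<eta> (t / r) else 0)" for t
  define en where "en t = (if - t > 0 then \<eta> (- 1 * (- t / r) + 0) else 0)" for t
  have aep: "ac ep ep'" using ep'(1) unfolding ep_def .
  have aen: "ac en (\<lambda>x. - en' (- x))" using ac_reflect[OF en'(1)] unfolding en_def .
  have aN: "ac (\<lambda>x. \<Theta>n (-x)) (\<lambda>x. - kn (-x))" by (rule ac_reflect[OF N(1)])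
  \<comment> \<open>The derivative of \<eta>\<theta>, by the product rule on each half. The left
    half is a reflected right half, hence the signs.\<close>
  define T where "T x = (ep' x * \<Theta>p x + ep x * kp x) + ((- en' (- x)) * \<Theta>n (-x) + en x * (- kn (-x)))" for x
  have "ac (\<lambda>x. ep x * \<Theta>p x + en x * \<Theta>n (-x)) T"
    unfolding T_def by (intro ac_add ac_bilinear bounded_bilinear_mult aep aen P(1) aN)
  moreover have "ep x * \<Theta>p x + en x * \<Theta>n (-x) = \<eta> (x / r) * \<theta> x" for x
  proof -
    consider "x \<ge> R" | "x \<le> -R" | "\<bar>x\<bar> < R" by linarith
    then show ?thesis
    proof cases
      case 1 then show ?thesis using R P(2)[of x] by (simp add: ep_def en_def)
    next
      case 2 then show ?thesis using R N(2)[of "-x"] by (simp add: ep_def en_def)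
    next
      case 3
      then have "\<bar>x / r\<bar> \<le> 1" using r R by (simp add: abs_divide)
      then have "\<eta> (x / r) = 0" "\<eta> (- 1 * (- x / r) + 0) = 0" using e0 by auto
      then show ?thesis by (simp add: ep_def en_def)
    qed
  qed
  ultimately have aB: "ac (\<lambda>x. \<eta> (x / r) * \<theta> x) T" by simp
  define FF where "FF x = T x - curr v g x" for x
  have LT: "L1_loc T" using acD(1)[OF aB] .
  note Lc = curr_L1_loc[OF F(1)]
  have LF: "L1_loc FF" unfolding FF_def by (rule L1_loc_diff[OF LT Lc])
  have Ttail: "T x = curr v g x / (norm (v x))\<^sup>2" if "\<bar>x\<bar> > 2 * r" for x
  proof (cases "x > 0")
    case True
    have x2: "x > 2 * r" using that True by simp
    then have "\<bar>x / r\<bar> \<ge> 2" using R r by (simp add: field_simps)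
    then have e: "ep x = 1" "ep' x = 0" "en x = 0" "en' (-x) = 0"
      using e1 True ep'(2)[of x] en'(2)[of "-x"] x2 R r by (auto simp: ep_def en_def)
    show ?thesis unfolding T_def e using P(3)[of x] x2 R r by simp
  next
    case False
    have x2: "- x > 2 * r" using that False R r by simp
    then have "\<bar>- 1 * (- x / r) + 0\<bar> \<ge> 2" using R r by (simp add: field_simps)
    then have e: "en x = 1" "en' (-x) = 0" "ep x = 0" "ep' x = 0"
      using e1 ep'(2)[of x] en'(2)[of "-x"] x2 R r by (auto simp: ep_def en_def)
    have "- kn (-x) = curr v g x / (norm (v x))\<^sup>2" using N(3)[of "-x"] x2 R r by (simp add: curr_def minus_divide_left)
    then show ?thesis unfolding T_def e by simp
  qed
  \<comment> \<open>Neither \<open>T\<close> nor the current need be integrable. Beyond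
    \<open>2 r\<close> their difference is \<open>1 - |v|^2\<close> times the derivative of the
    phase, a product of two square integrable functions.\<close>
  have FFi: "integrable lborel FF"
  proof (rule integrable_L1_loc_tail[OF LF])
    show "integrable lborel (\<lambda>x. (norm (g x))\<^sup>2 + (1 - (norm (v x))\<^sup>2)\<^sup>2)" using F by simp
    fix x assume x: "\<bar>x\<bar> > 2 * r"
    have n: "norm (v x) \<ge> 1/2" using nb x r R by simp
    then have n0: "norm (v x) > 0" by linarith
    have "FF x = (curr v g x / (norm (v x))\<^sup>2) * (1 - (norm (v x))\<^sup>2)"
      unfolding FF_def Ttail[OF x] using n0 by (simp add: field_simps)
    then have "norm (FF x) = (\<bar>curr v g x\<bar> / (norm (v x))\<^sup>2) * \<bar>1 - (norm (v x))\<^sup>2\<bar>" by (simp add: abs_mult)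
    also have "\<dots> \<le> (norm (v x) * norm (g x) / (norm (v x))\<^sup>2) * \<bar>1 - (norm (v x))\<^sup>2\<bar>"
      by (intro mult_right_mono divide_right_mono curr_bound) auto
    also have "\<dots> = (norm (g x) / norm (v x)) * \<bar>1 - (norm (v x))\<^sup>2\<bar>" using n0 by (simp add: power2_eq_square)
    also have "\<dots> \<le> (norm (g x) * 2) * \<bar>1 - (norm (v x))\<^sup>2\<bar>"
      using n n0 mult_left_mono[OF n, of "2 * norm (g x)"] by (intro mult_right_mono) (auto simp: field_simps)
    also have "\<dots> \<le> (norm (g x))\<^sup>2 + \<bar>1 - (norm (v x))\<^sup>2\<bar>\<^sup>2"
      using sum_squares_bound[of "norm (g x)" "\<bar>1 - (norm (v x))\<^sup>2\<bar>"] by (simp add: mult_ac)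
    finally show "norm (FF x) \<le> (norm (g x))\<^sup>2 + (1 - (norm (v x))\<^sup>2)\<^sup>2" by simp
  qed
  have wB: "has_weak_deriv 1 (\<lambda>x. \<eta> (x / r) * \<theta> x) T" by (rule ac_weak_deriv[OF aB])
  have "m = 1/2 * integral\<^sup>L lborel FF"
  proof -
    have "(LINT x|lborel. cdot (\<i> * weak_deriv 1 \<psi> x) (\<psi> x) + weak_deriv 1 (\<lambda>t. \<eta> (t / r) * \<theta> t) x) = integral\<^sup>L lborel FF"
    proof (rule integral_cong_AE)
      have "weak_deriv 1 (\<lambda>t. \<eta> (t / r) * \<theta> t) \<in> borel_measurable borel"
        using L1_loc_measurable[OF has_weak_derivD(2)[OF weak_deriv_works[OF wB]]] .
      then show "(\<lambda>x. cdot (\<i> * weak_deriv 1 \<psi> x) (\<psi> x) + weak_deriv 1 (\<lambda>t. \<eta> (t / r) * \<theta> t) x) \<in> borel_measurable lborel"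
        using F(5) \<psi>(2) unfolding g cdot_def measurable_lborel1 by measurable
      show "FF \<in> borel_measurable lborel" using FFi by simp
      show "AE x in lborel. cdot (\<i> * weak_deriv 1 \<psi> x) (\<psi> x) + weak_deriv 1 (\<lambda>t. \<eta> (t / r) * \<theta> t) x = FF x"
        using \<psi>(1) weak_deriv_AE[OF wB]
        by eventually_elim (simp add: FF_def cdot_def curr_def g[symmetric] mult.commute)
    qed
    then show ?thesis unfolding meq by simp
  qed
  then have m2: "integral\<^sup>L lborel FF = 2 * m" by simp
  have "(\<lambda>n. cis (integral {- real n..real n} FF)) \<longlonglongrightarrow> cis (integral\<^sup>L lborel FF)"
    unfolding cis_conv_exp by (intro tendsto_intros integral_tendsto_Icc FFi)
  moreover have "eventually (\<lambda>n. cis (integral {- real n..real n} FF) = mseq v g n) sequentially"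
  proof -
    obtain N where N: "2 * r < real N" using reals_Archimedean2 by blast
    have "cis (integral {- real n..real n} FF) = mseq v g n" if "n \<ge> N" for n
    proof -
      have n: "2 * r < real n" using N that by (meson less_le_trans of_nat_mono)
      then have "\<bar>real n / r\<bar> \<ge> 2" "\<bar>- real n / r\<bar> \<ge> 2" using R r by (auto simp: field_simps)
      then have "\<eta> (real n / r) = 1" "\<eta> (- real n / r) = 1" using e1 by auto
      then have iT: "integral {- real n..real n} T = \<theta> (real n) - \<theta> (- real n)"
        using acD(2)[OF aB, of "- real n" "real n"] n R r by simp
      have "integral {- real n..real n} FF = \<theta> (real n) + (- \<theta> (- real n)) + (- integral {- real n..real n} (curr v g))"
        unfolding FF_def using Henstock_Kurzweil_Integration.integral_diff[OF L1_loc_Icc(2)[OF LT] L1_loc_Icc(2)[OF Lc], of "- real n" "real n"] iT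
        by simp
      then have "cis (integral {- real n..real n} FF) = cis (\<theta> (real n)) * cnj (cis (\<theta> (- real n))) * cis (- integral {- real n..real n} (curr v g))"
        by (simp only: cis_mult cis_cnj)
      moreover have "sgn (v (real n)) = cis (\<theta> (real n))" "sgn (v (- real n)) = cis (\<theta> (- real n))"
        using sgn_polar[OF nz ph, of "real n"] sgn_polar[OF nz ph, of "- real n"] n r R by auto
      ultimately show ?thesis by (simp add: mseq_def)
    qed
    then show ?thesis unfolding eventually_sequentially by blast
  qed
  ultimately show ?thesis unfolding m2 by (rule Lim_transform_eventually)
qed

text \<open>Guarantees that the choice operator in \<open>momentum_line\<close> picks an actual
  value. The phase comes from logarithms of the two frozen tails.\<close>

lemma momentum_value_exists:
  assumes f: "finen v g" and \<psi>: "AE x in lborel. \<psi> x = v x"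
  shows "\<exists>m. momentum_line_value \<psi> m"
proof -
  note F = finenD[OF f]
  obtain R where R: "R > 0" "\<And>x. \<bar>x\<bar> \<ge> R \<Longrightarrow> \<bar>norm (v x) - 1\<bar> < 1/2" using finen_norm_tendsto[OF f, of "1/2"] by auto
  have nb: "norm (v x) \<ge> 1/2" if "\<bar>x\<bar> \<ge> R" for x using R(2)[OF that] by (simp add: abs_if split: if_splits)
  then have nz: "v x \<noteq> 0" if "\<bar>x\<bar> \<ge> R" for x using nb[OF that] by auto
  have "\<bar>max x R\<bar> \<ge> R" "\<bar>- max x R\<bar> \<ge> R" for x by auto
  then have nz2: "v (max x R) \<noteq> 0" "v (- max x R) \<noteq> 0" for x using nz by blast+
  obtain L1 D1 where L1: "ac L1 D1" "\<And>x. exp (L1 x) = v (max x R)" using ac_log[OF ac_max[OF F(1), of R] nz2(1)] by blast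
  obtain L2 D2 where L2: "ac L2 D2" "\<And>x. exp (L2 x) = v (- max x R)" using ac_log[OF ac_max[OF ac_reflect[OF F(1)], of R] nz2(2)] by blast
  define \<theta> where "\<theta> x = (if x > 0 then Im (L1 x) else Im (L2 (-x)))" for x
  have c: "continuous_on ({R..} \<union> {..-R}) \<theta>"
    unfolding \<theta>_def
  proof (rule continuous_on_cases)
    show "continuous_on {R..} (\<lambda>x. Im (L1 x))" 
      using continuous_on_subset[OF ac_continuous_on[OF L1(1)]] by (auto intro!: continuous_intros)
    show "continuous_on {..-R} (\<lambda>x. Im (L2 (-x)))" 
      by (intro continuous_intros continuous_on_compose2[OF ac_continuous_on[OF L2(1)]]) auto
  qed (use R in auto)
  have ph: "v x = of_real (norm (v x)) * exp (\<i> * of_real (\<theta> x))" if "\<bar>x\<bar> \<ge> R" for x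
  proof -
    have "\<exists>z. exp z = v x \<and> \<theta> x = Im z"
    proof (cases "x > 0")
      case True then show ?thesis using L1(2)[of x] that by (auto simp: \<theta>_def max_absorb1)
    next
      case False then show ?thesis using L2(2)[of "-x"] that by (auto simp: \<theta>_def max_absorb1)
    qed
    then obtain z where z: "exp z = v x" "\<theta> x = Im z" by blast
    have "exp z = of_real (norm (exp z)) * cis (Im z)" by (simp add: exp_eq_polar norm_mult)
    then show ?thesis unfolding z(1) z(2)[symmetric] by (simp only: cis_conv_exp)
  qed
  obtain \<eta> :: "real \<Rightarrow> real" where e: "smooth \<eta>" "range \<eta> \<subseteq> {0..1}" "\<forall>x. \<bar>x\<bar> \<le> 1 \<longrightarrow> \<eta> x = 0" "\<forall>x. \<bar>x\<bar> \<ge> 2 \<longrightarrow> \<eta> x = 1"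
    using ex_cutoff by blast
  have "momentum_line_value \<psi> (1 / 2 * (LINT x|lborel. cdot (\<i> * weak_deriv 1 \<psi> x) (\<psi> x) + weak_deriv 1 (\<lambda>t. \<eta> (t / (R+1)) * \<theta> t) x))"
    unfolding momentum_line_value_def
  proof (rule exI[of _ R], rule exI[of _ \<theta>], rule exI[of _ \<eta>], rule exI[of _ "R+1"], intro conjI e R(1) refl)
    show "AE x in lborel. R \<le> \<bar>x\<bar> \<longrightarrow> 1 / 2 \<le> cmod (\<psi> x)" using \<psi> by eventually_elim (auto dest: nb)
    show "AE x in lborel. R \<le> \<bar>x\<bar> \<longrightarrow> \<psi> x = complex_of_real (cmod (\<psi> x)) * exp (\<i> * complex_of_real (\<theta> x))"
      using \<psi> by eventually_elim (auto dest: ph)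
    show "continuous_on ({..-R} \<union> {R..}) \<theta>" using c by (simp add: Un_commute)
  qed simp
  then show ?thesis by blast
qed

text \<open>The companion \<open>g\<close> may be any version of the derivative:
  \<open>weak_deriv\<close> selects an unknown one, and the two currents agree almost
  everywhere.\<close>

lemma mseq_tendsto:
  assumes f: "finen v g" and \<psi>: "\<psi> \<in> borel_measurable borel" "AE x in lborel. \<psi> x = v x"
  shows "mseq v g \<longlonglongrightarrow> cis (2 * momentum_line \<psi>)"
proof -
  let ?g = "weak_deriv 1 \<psi>"
  have AE: "AE x in lborel. ?g x = g x" using X_lineI[OF f \<psi>] by blast
  have "\<psi> \<in> X_line" using X_lineI[OF f \<psi>] by blast
  then have gm: "?g \<in> borel_measurable borel" using X_line_rep finenD(5) by metis
  have av: "ac v ?g" by (rule ac_cong_AE[OF finenD(1)[OF f] gm AE])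
  have "integrable lborel (\<lambda>x. (norm (?g x))\<^sup>2)"
  proof (rule integrable_cong_AE_imp[OF finenD(2)[OF f]])
    show "AE x in lborel. (norm (g x))\<^sup>2 = (norm (?g x))\<^sup>2" using AE by eventually_elim simp
  qed (use gm in simp)
  then have f': "finen v ?g" using av finenD[OF f] by (simp add: finen_def)
  have "mseq v ?g \<longlonglongrightarrow> cis (2 * momentum_line \<psi>)"
    by (rule momentum_value_limit[OF f' refl \<psi>(2,1)])
      (unfold momentum_line_def, rule someI_ex[OF momentum_value_exists[OF f \<psi>(2)]])
  moreover have "integral {- real n..real n} (curr v ?g) = integral {- real n..real n} (curr v g)" for n
  proof -
    note L = curr_L1_loc[OF av] curr_L1_loc[OF finenD(1)[OF f]]
    show ?thesis unfolding L1_loc_Icc(3)[OF L(1), symmetric] L1_loc_Icc(3)[OF L(2), symmetric]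
    proof (rule set_lebesgue_integral_cong_AE)
      show "AE x\<in>{- real n..real n} in lborel. curr v ?g x = curr v g x" using AE by eventually_elim (simp add: curr_def)
    qed (use L1_loc_measurable[OF L(1)] L1_loc_measurable[OF L(2)] in auto)
  qed
  ultimately show ?thesis by (simp add: mseq_def[abs_def])
qed

lemma momentum_cong:
  assumes "finen v g" "\<psi> \<in> borel_measurable borel" "AE x in lborel. \<psi> x = v x" "mseq v g \<longlonglongrightarrow> cis (2 * m)"
  shows "[momentum_line \<psi> = m] (rmod pi)"
  unfolding rcong_pi_iff using LIMSEQ_unique[OF mseq_tendsto[OF assms(1-3)] assms(4)] .

text \<open>With a logarithm on the whole line, the phase difference of the end points is the
  integral of \<open>curr / |v|^2\<close>, and subtracting the current gives the integrand. Its
  integral represents twice the momentum; the lower bound on \<open>|v|\<close> makes it absolutely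
  convergent.\<close>

lemma nonvanishing_momentum:
  assumes f: "finen v g" and m: "m > 0" "\<And>x. norm (v x) \<ge> m"
  shows "integrable lborel (\<lambda>x. (1 - (norm (v x))\<^sup>2) * curr v g x / (norm (v x))\<^sup>2)" (is "integrable lborel ?f")
    and "mseq v g \<longlonglongrightarrow> cis (LINT x|lborel. (1 - (norm (v x))\<^sup>2) * curr v g x / (norm (v x))\<^sup>2)"
proof -
  note F = finenD[OF f]
  have nz: "v x \<noteq> 0" for x using m(2)[of x] m(1) by auto
  note Lc = curr_L1_loc[OF F(1)]
  obtain L where L: "ac L (\<lambda>x. g x / v x)" "\<And>x. exp (L x) = v x" using ac_log[OF F(1) nz] by blast
  have aI: "ac (\<lambda>x. Im (L x)) (\<lambda>x. curr v g x / (norm (v x))\<^sup>2)"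
    using ac_linear[OF bounded_linear_Im L(1)] by (simp add: Im_divide_curr)
  have feq: "?f x = curr v g x / (norm (v x))\<^sup>2 - curr v g x" for x using nz[of x] by (simp add: field_simps)
  have fm: "?f \<in> borel_measurable borel" 
    unfolding feq using L1_loc_measurable[OF acD(1)[OF aI]] L1_loc_measurable[OF Lc] by simp
  show fi: "integrable lborel ?f"
  proof (rule Bochner_Integration.integrable_bound)
    show "integrable lborel (\<lambda>x. (1/m) * ((norm (g x))\<^sup>2 + (1 - (norm (v x))\<^sup>2)\<^sup>2))" using F by simp
    show "AE x in lborel. norm (?f x) \<le> norm ((1/m) * ((norm (g x))\<^sup>2 + (1 - (norm (v x))\<^sup>2)\<^sup>2))"
    proof (rule AE_I2)
      fix x
      have n0: "norm (v x) > 0" using nz by simp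
      have "norm (?f x) = (\<bar>curr v g x\<bar> / (norm (v x))\<^sup>2) * \<bar>1 - (norm (v x))\<^sup>2\<bar>" by (simp add: abs_mult)
      also have "\<dots> \<le> (norm (v x) * norm (g x) / (norm (v x))\<^sup>2) * \<bar>1 - (norm (v x))\<^sup>2\<bar>"
        by (intro mult_right_mono divide_right_mono curr_bound) auto
      also have "\<dots> = (norm (g x) / norm (v x)) * \<bar>1 - (norm (v x))\<^sup>2\<bar>" using n0 by (simp add: power2_eq_square)
      also have "\<dots> \<le> (norm (g x) / m) * \<bar>1 - (norm (v x))\<^sup>2\<bar>"
        using m by (intro mult_right_mono divide_left_mono) (auto intro: mult_pos_pos n0)
      also have "\<dots> = (1/m) * (norm (g x) * \<bar>1 - (norm (v x))\<^sup>2\<bar>)" by simp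
      also have "\<dots> \<le> (1/m) * ((norm (g x))\<^sup>2 + (1 - (norm (v x))\<^sup>2)\<^sup>2)"
      proof (intro mult_left_mono)
        have "2 * norm (g x) * \<bar>1 - (norm (v x))\<^sup>2\<bar> \<le> (norm (g x))\<^sup>2 + \<bar>1 - (norm (v x))\<^sup>2\<bar>\<^sup>2" by (rule sum_squares_bound)
        moreover have "0 \<le> norm (g x) * \<bar>1 - (norm (v x))\<^sup>2\<bar>" by simp
        ultimately show "norm (g x) * \<bar>1 - (norm (v x))\<^sup>2\<bar> \<le> (norm (g x))\<^sup>2 + (1 - (norm (v x))\<^sup>2)\<^sup>2"
          by (simp only: power2_abs)
      qed (use m in simp)
      finally show "norm (?f x) \<le> norm ((1/m) * ((norm (g x))\<^sup>2 + (1 - (norm (v x))\<^sup>2)\<^sup>2))" using m(1) by (simp add: abs_of_pos)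
    qed
  qed (use fm in simp)
  have "mseq v g n = cis (integral {- real n..real n} ?f)" for n
  proof -
    have "integral {- real n..real n} ?f = Im (L (real n)) + (- Im (L (- real n))) + (- integral {- real n..real n} (curr v g))"
      unfolding feq using Henstock_Kurzweil_Integration.integral_diff[OF L1_loc_Icc(2)[OF acD(1)[OF aI]] L1_loc_Icc(2)[OF Lc], of "- real n" "real n"]
        acD(2)[OF aI, of "- real n" "real n"] by simp
    then have "cis (integral {- real n..real n} ?f) = cis (Im (L (real n))) * cnj (cis (Im (L (- real n)))) * cis (- integral {- real n..real n} (curr v g))"
      by (simp only: cis_mult cis_cnj)
    moreover have "sgn (v x) = cis (Im (L x))" for x
    proof (rule sgn_polar[OF nz])
      show "v x = of_real (norm (v x)) * cis (Im (L x))" unfolding L(2)[symmetric] by (simp add: exp_eq_polar norm_mult)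
    qed
    ultimately show ?thesis by (simp add: mseq_def)
  qed
  then have eq: "mseq v g = (\<lambda>n. exp (\<i> * complex_of_real (integral {- real n..real n} ?f)))"
    by (simp add: fun_eq_iff cis_conv_exp)
  show "mseq v g \<longlonglongrightarrow> cis (LINT x|lborel. ?f x)"
    unfolding eq cis_conv_exp by (intro tendsto_intros integral_tendsto_Icc[OF fi])
qed

subsection \<open>Chords of the unit disc\<close>

text \<open>The dark soliton traces the chord at distance \<open>sin \<beta>\<close> from the origin. Its energy is \<open>chord_energy \<beta>\<close>
  and its momentum is, up to sign and modulo \<open>\<pi>\<close>, the area \<open>chord_area \<beta>\<close> of the circular segment that the chord cuts off.\<close>

definition chord_energy :: "real \<Rightarrow> real" where "chord_energy b = 2 * sqrt 2 / 3 * cos b ^ 3"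

definition chord_area :: "real \<Rightarrow> real" where "chord_area b = pi/2 - b - sin b * cos b"

lemma chord_area_DERIV: "DERIV chord_area b :> - 2 * (cos b)\<^sup>2"
proof -
  have "DERIV chord_area b :> - 1 - (cos b * cos b + sin b * (- sin b))"
    unfolding chord_area_def by (auto intro!: derivative_eq_intros)
  moreover have "- 1 - (cos b * cos b + sin b * (- sin b)) = - 2 * (cos b)\<^sup>2"
    using sin_cos_squared_add[of b] by (simp add: power2_eq_square algebra_simps)
  ultimately show ?thesis by simp
qed

lemma chord_area_strict_antimono:
  assumes "- (pi/2) \<le> a" "a < b" "b \<le> pi/2" shows "chord_area b < chord_area a"
proof -
  obtain z where z: "a < z" "z < b" "chord_area b - chord_area a = (b - a) * (- 2 * (cos z)\<^sup>2)"
    using MVT2[OF assms(2), of chord_area "\<lambda>z. - 2 * (cos z)\<^sup>2"] chord_area_DERIV by blast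
  have "cos z > 0" using z assms by (intro cos_gt_zero_pi) auto
  then have "0 < (b - a) * (2 * (cos z)\<^sup>2)" using assms by (intro mult_pos_pos) auto
  then show ?thesis using z(3) by simp
qed

text \<open>Strict concavity of the energy as a function of the area: its tangent at \<open>b\<close> has slope \<open>sqrt 2 * sin b\<close>.\<close>

lemma chord_tangent:
  assumes "0 \<le> b" "b \<le> pi/2" "0 \<le> c" "c \<le> pi/2" "b \<noteq> c"
  shows "chord_energy c < chord_energy b + sqrt 2 * sin b * (chord_area c - chord_area b)"
proof -
  \<comment> \<open>The number \<open>c\<close> stays fixed and the point of tangency moves. Since
    the derivative of \<open>chord_energy\<close> is \<open>sqrt 2 * sin b\<close> times that of
    \<open>chord_area\<close>, only the term with the derivative of the slope survives, and its sign
    shows that \<open>f\<close> has its strict minimum at \<open>c\<close>.\<close>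
  define f where "f b = chord_energy b + sqrt 2 * sin b * (chord_area c - chord_area b)" for b
  have D: "DERIV f x :> sqrt 2 * cos x * (chord_area c - chord_area x)" for x
  proof -
    have "DERIV f x :> 2 * sqrt 2 / 3 * (3 * (cos x)\<^sup>2 * (- sin x)) + (sqrt 2 * cos x * (chord_area c - chord_area x) + sqrt 2 * sin x * (0 - (- 2 * (cos x)\<^sup>2)))"
      unfolding f_def chord_energy_def
      by (auto intro!: derivative_eq_intros chord_area_DERIV simp: power2_eq_square)
    then show ?thesis by (simp add: algebra_simps)
  qed
  have fc: "f c = chord_energy c" by (simp add: f_def)
  have "f c < f b"
  proof (cases "b < c")
    case True
    obtain z where z: "b < z" "z < c" "f c - f b = (c - b) * (sqrt 2 * cos z * (chord_area c - chord_area z))"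
      using MVT2[OF True, of f "\<lambda>x. sqrt 2 * cos x * (chord_area c - chord_area x)"] D by blast
    have "cos z > 0" using z assms by (intro cos_gt_zero_pi) auto
    moreover have "chord_area c < chord_area z" by (intro chord_area_strict_antimono) (use z assms pi_gt_zero in linarith)+
    ultimately have "0 < (c - b) * (sqrt 2 * cos z * (chord_area z - chord_area c))" using True by (intro mult_pos_pos) auto
    then show ?thesis using z(3) by (simp add: algebra_simps)
  next
    case False
    then have lt: "c < b" using assms by simp
    obtain z where z: "c < z" "z < b" "f b - f c = (b - c) * (sqrt 2 * cos z * (chord_area c - chord_area z))"
      using MVT2[OF lt, of f "\<lambda>x. sqrt 2 * cos x * (chord_area c - chord_area x)"] D by blast
    have "cos z > 0" using z assms by (intro cos_gt_zero_pi) auto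
    moreover have "chord_area z < chord_area c" by (intro chord_area_strict_antimono) (use z assms pi_gt_zero in linarith)+
    ultimately have "0 < (b - c) * (sqrt 2 * cos z * (chord_area c - chord_area z))" using lt by (intro mult_pos_pos) auto
    then show ?thesis using z(3) by simp
  qed
  then show ?thesis using fc by (simp add: f_def)
qed

subsection \<open>Calibration by the field of lines tangent to a circle\<close>

text \<open>The energy density minus a multiple of the momentum density. The bracket integrates to
  twice the momentum, so the factor means slope \<open>sqrt 2 * h\<close> with respect to the
  momentum: in absolute value, the slope of the energy-area curve at the chord at distance
  \<open>|h|\<close>. The sign of \<open>h\<close> selects the orientation.\<close>

definition slack :: "real \<Rightarrow> (real \<Rightarrow> complex) \<Rightarrow> (real \<Rightarrow> complex) \<Rightarrow> real \<Rightarrow> real" where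
  "slack h v g x = dens v g x - h / sqrt 2 * ((1 - (norm (v x))\<^sup>2) * curr v g x / (norm (v x))\<^sup>2)"

text \<open>The length of the tangent segment from \<open>v x\<close> to the circle of radius
  \<open>|h|\<close> about 0.\<close>

definition rad :: "real \<Rightarrow> (real \<Rightarrow> complex) \<Rightarrow> real \<Rightarrow> real" where
  "rad h v x = sqrt ((norm (v x))\<^sup>2 - h\<^sup>2)"

text \<open>The derivative of \<open>chord_primitive h (rad h v x)\<close> along the path, in a form
  that still makes sense where \<open>rad\<close> vanishes.\<close>

definition flux :: "real \<Rightarrow> (real \<Rightarrow> complex) \<Rightarrow> (real \<Rightarrow> complex) \<Rightarrow> real \<Rightarrow> real" where
  "flux h v g x = rad h v x * (1 - (norm (v x))\<^sup>2) * Re (cnj (v x) * g x) / (norm (v x))\<^sup>2"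

text \<open>A primitive of \<open>s^2 (1 - s^2 - h^2) / (s^2 + h^2)\<close>. With \<open>s\<close>
  the position on a line at distance \<open>|h|\<close> from 0, this is the weight
  \<open>1 - |v|^2\<close> minus \<open>h\<close> times the contribution to the area. For
  \<open>h = 0\<close> the factor in front of \<open>arctan\<close> makes the quotient
  harmless.\<close>

definition chord_primitive :: "real \<Rightarrow> real \<Rightarrow> real" where
  "chord_primitive h s = s - s ^ 3 / 3 - h * arctan (s / h)"

text \<open>Completing the square. The vector \<open>v * Complex s h\<close> has length
  \<open>|v|^2\<close> and spans a line through \<open>v\<close> at distance \<open>|h|\<close> from
  0; the two signs of \<open>s\<close> are the two tangents. The real factor in front is such that
  equality means equipartition of the energy.\<close>

lemma slack_square:
  fixes s :: real
  assumes "v x \<noteq> 0" "s\<^sup>2 = (norm (v x))\<^sup>2 - h\<^sup>2"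
  shows "slack h v g x - s / sqrt 2 * ((1 - (norm (v x))\<^sup>2) * Re (cnj (v x) * g x) / (norm (v x))\<^sup>2)
    = (norm (g x - of_real ((1 - (norm (v x))\<^sup>2) / sqrt 2 / (norm (v x))\<^sup>2) * (v x * Complex s h)))\<^sup>2 / 2"
proof -
  define q where "q = (norm (v x))\<^sup>2"
  obtain a b where v: "v x = Complex a b" by (cases "v x")
  obtain c d where g: "g x = Complex c d" by (cases "g x")
  have q: "q = a\<^sup>2 + b\<^sup>2" by (simp add: q_def v cmod_power2)
  have q0: "q \<noteq> 0" using assms by (simp add: q_def)
  define k where "k = (1 - q) / sqrt 2 / q"
  have k2: "k\<^sup>2 * q\<^sup>2 = (1 - q)\<^sup>2 / 2" using q0 by (simp add: k_def power_divide power_mult_distrib)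
  have kq: "k = (1 - q) / (sqrt 2 * q)" by (simp add: k_def)
  have "(norm (g x - of_real k * (v x * Complex s h)))\<^sup>2 = (c - k * (a * s - b * h))\<^sup>2 + (d - k * (a * h + b * s))\<^sup>2"
    by (simp add: v g cmod_power2)
  also have "\<dots> = c\<^sup>2 + d\<^sup>2 - 2 * k * (s * (a * c + b * d) + h * (a * d - b * c)) + k\<^sup>2 * ((a\<^sup>2 + b\<^sup>2) * (s\<^sup>2 + h\<^sup>2))"
    by (simp add: power2_eq_square algebra_simps)
  also have "(a\<^sup>2 + b\<^sup>2) * (s\<^sup>2 + h\<^sup>2) = q\<^sup>2" 
  proof -
    have "s\<^sup>2 + h\<^sup>2 = q" using assms(2) by (simp add: q_def)
    then show ?thesis unfolding q[symmetric] by (simp add: power2_eq_square)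
  qed
  finally have 1: "(norm (g x - of_real k * (v x * Complex s h)))\<^sup>2 / 2 = (c\<^sup>2 + d\<^sup>2) / 2 - k * (s * (a * c + b * d) + h * (a * d - b * c)) + (1 - q)\<^sup>2 / 4"
    unfolding k2 by (simp add: field_simps)
  have "slack h v g x - s / sqrt 2 * ((1 - q) * Re (cnj (v x) * g x) / q) 
    = (c\<^sup>2 + d\<^sup>2) / 2 + (1 - q)\<^sup>2 / 4 - h / sqrt 2 * ((1 - q) * (a * d - b * c) / q) - s / sqrt 2 * ((1 - q) * (a * c + b * d) / q)"
    unfolding slack_def dens_def curr_def q_def[symmetric] by (simp add: v g cmod_power2)
  also have "\<dots> = (c\<^sup>2 + d\<^sup>2) / 2 - k * (s * (a * c + b * d) + h * (a * d - b * c)) + (1 - q)\<^sup>2 / 4"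
    unfolding kq by (simp add: add_divide_distrib diff_divide_distrib algebra_simps)
  finally show ?thesis using 1 unfolding k_def q_def by (simp only:)
qed

lemma rad_sq: "\<bar>h\<bar> \<le> norm (v x) \<Longrightarrow> (rad h v x)\<^sup>2 = (norm (v x))\<^sup>2 - h\<^sup>2"
  by (simp add: rad_def) (metis abs_le_square_iff abs_norm_cancel)

text \<open>The square is nonnegative for both tangents, that is for \<open>s = rad\<close> and for
  \<open>s = - rad\<close>, whence the absolute value.\<close>

lemma slack_flux:
  assumes "\<bar>h\<bar> \<le> norm (v x)"
  shows "\<bar>flux h v g x\<bar> / sqrt 2 \<le> slack h v g x"
proof (cases "v x = 0")
  case True
  then show ?thesis using assms by (simp add: flux_def slack_def dens_def)
next
  case False
  let ?w = "(1 - (norm (v x))\<^sup>2) * Re (cnj (v x) * g x) / (norm (v x))\<^sup>2"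
  have "0 \<le> slack h v g x - rad h v x / sqrt 2 * ?w"
    by (subst slack_square[where v=v and x=x and g=g and h=h, OF False rad_sq[where h=h and v=v and x=x, OF assms]]) simp
  moreover have "0 \<le> slack h v g x - (- rad h v x) / sqrt 2 * ?w"
    by (subst slack_square[where v=v and x=x and g=g and h=h, OF False]) (use rad_sq[where h=h and v=v and x=x, OF assms] in simp_all)
  moreover have "flux h v g x / sqrt 2 = rad h v x / sqrt 2 * ?w" by (simp add: flux_def mult_ac)
  ultimately show ?thesis by (auto simp: abs_if)
qed

lemma slack_nonneg: "\<bar>h\<bar> \<le> norm (v x) \<Longrightarrow> slack h v g x \<ge> 0"
  using slack_flux[of h v x g] by (smt (verit) divide_nonneg_nonneg real_sqrt_ge_zero abs_ge_zero)

lemma ac_norm_sq: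
  assumes "ac v g"
  shows "ac (\<lambda>x. (norm (v x))\<^sup>2) (\<lambda>x. 2 * Re (cnj (v x) * g x))"
proof -
  have "ac (\<lambda>x. v x \<bullet> v x) (\<lambda>x. g x \<bullet> v x + v x \<bullet> g x)"
    by (rule ac_bilinear[OF bounded_bilinear_inner assms assms])
  then show ?thesis by (simp add: power2_norm_eq_inner inner_complex_def algebra_simps)
qed

lemma chord_primitive_DERIV:
  assumes "s \<noteq> 0"
  shows "DERIV (chord_primitive h) s :> s\<^sup>2 * (1 - s\<^sup>2 - h\<^sup>2) / (s\<^sup>2 + h\<^sup>2)"
proof (cases "h = 0")
  case True
  have "DERIV (\<lambda>s::real. s - s ^ 3 / 3) s :> s\<^sup>2 * (1 - s\<^sup>2 - h\<^sup>2) / (s\<^sup>2 + h\<^sup>2)"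
    using assms True by (auto intro!: derivative_eq_intros simp: field_simps power2_eq_square)
  then show ?thesis using True by (simp add: chord_primitive_def[abs_def])
next
  case False
  have p: "s\<^sup>2 + h\<^sup>2 \<noteq> 0" using False by (simp add: sum_power2_eq_zero_iff)
  have "DERIV (\<lambda>s. s / h) s :> 1 / h" using False by (auto intro!: derivative_eq_intros)
  from DERIV_chain2[OF DERIV_arctan this]
  have a: "DERIV (\<lambda>s. arctan (s / h)) s :> (1 / (1 + (s / h)\<^sup>2)) * (1 / h)" by (simp add: inverse_eq_divide)
  have b: "DERIV (\<lambda>s. s - s ^ 3 / 3) s :> 1 - s\<^sup>2" by (auto intro!: derivative_eq_intros)
  have "DERIV (chord_primitive h) s :> 1 - s\<^sup>2 - h * ((1 / (1 + (s / h)\<^sup>2)) * (1 / h))"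
    unfolding chord_primitive_def[abs_def] by (rule DERIV_diff[OF b DERIV_cmult[OF a]])
  also have "1 - s\<^sup>2 - h * ((1 / (1 + (s / h)\<^sup>2)) * (1 / h)) = s\<^sup>2 * (1 - s\<^sup>2 - h\<^sup>2) / (s\<^sup>2 + h\<^sup>2)"
  proof -
    have "1 + (s / h)\<^sup>2 = (s\<^sup>2 + h\<^sup>2) / h\<^sup>2" using False by (simp add: field_simps)
    then have "h * ((1 / (1 + (s / h)\<^sup>2)) * (1 / h)) = h\<^sup>2 / (s\<^sup>2 + h\<^sup>2)" using False by simp
    then show ?thesis using p by (simp add: field_simps power2_eq_square)
  qed
  finally show ?thesis .
qed

lemma chord_primitive_0: "chord_primitive h 0 = 0" by (simp add: chord_primitive_def)

lemma isCont_chord_primitive: "isCont (chord_primitive h) s"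
  unfolding chord_primitive_def[abs_def]
  by (cases "h = 0") (auto intro!: continuous_intros)

text \<open>The argument \<open>cos b\<close> is half the length of the chord. The right-hand side
  is the value at area 0 of the tangent to the energy-area curve at \<open>b\<close>, so a lower
  bound for the slack becomes the equation of this tangent line.\<close>

lemma chord_primitive_value:
  assumes "0 \<le> b" "b < pi/2"
  shows "sqrt 2 * chord_primitive (sin b) (cos b) = chord_energy b - sqrt 2 * sin b * chord_area b"
    and "chord_primitive (- h) s = chord_primitive h s"
proof -
  show "chord_primitive (- h) s = chord_primitive h s" by (simp add: chord_primitive_def arctan_minus)
  have cp: "cos b > 0" using assms by (intro cos_gt_zero_pi) auto
  have a: "sin b * arctan (cos b / sin b) = sin b * (pi/2 - b)"
  proof (cases "sin b = 0")
    case False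
    have "arctan (tan (pi/2 - b)) = pi/2 - b"
    proof (rule arctan_tan)
      have "b \<noteq> 0" using False by auto
      then show "pi/2 - b < pi/2" using assms by simp
      show "- (pi/2) < pi/2 - b" using assms pi_gt_zero by linarith
    qed
    moreover have "tan (pi/2 - b) = cos b / sin b" by (simp add: tan_def sin_diff cos_diff)
    ultimately show ?thesis by simp
  qed simp
  have c3: "cos b ^ 3 = cos b * (1 - (sin b)\<^sup>2)" unfolding cos_squared_eq[symmetric] by (simp add: power3_eq_cube power2_eq_square)
  have "chord_primitive (sin b) (cos b) = cos b - cos b ^ 3 / 3 - sin b * (pi/2 - b)" unfolding chord_primitive_def a ..
  also have "sqrt 2 * \<dots> = chord_energy b - sqrt 2 * sin b * chord_area b"
    unfolding chord_energy_def chord_area_def c3 by (simp add: field_simps power2_eq_square)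
  finally show "sqrt 2 * chord_primitive (sin b) (cos b) = chord_energy b - sqrt 2 * sin b * chord_area b" .
qed

text \<open>The flux is an exact derivative by the chain rule. Strict inequality keeps the path off
  the circle, where the square root in \<open>rad\<close> is not differentiable.\<close>

lemma flux_integral:
  assumes v: "ac v g" and ab: "a \<le> b" and p: "\<And>x. x \<in> {a..b} \<Longrightarrow> \<bar>h\<bar> < norm (v x)"
  shows "set_integrable lborel {a..b} (flux h v g)"
    and "integral {a..b} (flux h v g) = chord_primitive h (rad h v b) - chord_primitive h (rad h v a)"
proof -
  let ?F = "\<lambda>q. chord_primitive h (sqrt (q - h\<^sup>2))"
  let ?F' = "\<lambda>q. sqrt (q - h\<^sup>2) * (1 - q) / (2 * q)"
  have q: "(norm (v x))\<^sup>2 > h\<^sup>2" if "x \<in> {a..b}" for x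
    using p[OF that] by (metis abs_norm_cancel abs_ge_zero power2_abs power_strict_mono zero_less_numeral)
  have D: "(?F has_field_derivative ?F' ((norm (v x))\<^sup>2)) (at ((norm (v x))\<^sup>2))" if "x \<in> {a..b}" for x
  proof -
    define q where "q = (norm (v x))\<^sup>2"
    have q0: "q - h\<^sup>2 > 0" using q[OF that] by (simp add: q_def)
    then have s0: "sqrt (q - h\<^sup>2) > 0" by simp
    then have s1: "sqrt (q - h\<^sup>2) \<noteq> 0" by linarith
    have s2: "(sqrt (q - h\<^sup>2))\<^sup>2 = q - h\<^sup>2" using q0 by simp
    have qp: "q > 0" using q0 zero_le_power2[of h] by linarith
    have "DERIV (\<lambda>q. sqrt (q - h\<^sup>2)) q :> inverse (sqrt (q - h\<^sup>2)) / 2 * 1"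
      by (rule DERIV_chain2[where f=sqrt and g="\<lambda>q. q - h\<^sup>2", OF DERIV_real_sqrt[OF q0]]) (auto intro!: derivative_eq_intros)
    moreover have "inverse (sqrt (q - h\<^sup>2)) / 2 * 1 = 1 / (2 * sqrt (q - h\<^sup>2))" by (simp add: inverse_eq_divide)
    ultimately have i: "DERIV (\<lambda>q. sqrt (q - h\<^sup>2)) q :> 1 / (2 * sqrt (q - h\<^sup>2))" by (simp only:)
    have "DERIV ?F q :> ((sqrt (q - h\<^sup>2))\<^sup>2 * (1 - (sqrt (q - h\<^sup>2))\<^sup>2 - h\<^sup>2) / ((sqrt (q - h\<^sup>2))\<^sup>2 + h\<^sup>2)) * (1 / (2 * sqrt (q - h\<^sup>2)))"
      by (rule DERIV_chain2[where f="chord_primitive h" and g="\<lambda>q. sqrt (q - h\<^sup>2)", OF chord_primitive_DERIV[OF s1] i])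
    also have "((sqrt (q - h\<^sup>2))\<^sup>2 * (1 - (sqrt (q - h\<^sup>2))\<^sup>2 - h\<^sup>2) / ((sqrt (q - h\<^sup>2))\<^sup>2 + h\<^sup>2)) * (1 / (2 * sqrt (q - h\<^sup>2))) = ?F' q"
    proof -
      define r where "r = sqrt (q - h\<^sup>2)"
      have r: "r \<noteq> 0" "h\<^sup>2 = q - r\<^sup>2" using s1 s2 by (auto simp: r_def)
      show ?thesis unfolding r_def[symmetric] r(2) using r(1) qp by (simp add: field_simps power2_eq_square)
    qed
    finally show ?thesis unfolding q_def .
  qed
  have C: "isCont ?F' ((norm (v x))\<^sup>2)" if "x \<in> {a..b}" for x
    using q[OF that] zero_le_power2[of h] by (intro continuous_intros) auto
  have eq: "?F' ((norm (v x))\<^sup>2) * (2 * Re (cnj (v x) * g x)) = flux h v g x" for x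
  proof -
    have "S * (1 - q) / (2 * q) * (2 * r) = S * (1 - q) * r / q" for S q r :: real by simp
    then show ?thesis unfolding flux_def rad_def .
  qed
  show "set_integrable lborel {a..b} (flux h v g)"
    using ac_chain(1)[OF ac_norm_sq[OF v] ab D C] unfolding eq .
  show "integral {a..b} (flux h v g) = chord_primitive h (rad h v b) - chord_primitive h (rad h v a)"
    using ac_chain(2)[OF ac_norm_sq[OF v] ab D C] unfolding eq by (simp add: rad_def)
qed

lemma continuous_rad: "continuous_on UNIV v \<Longrightarrow> continuous_on UNIV (rad h v)"
  unfolding rad_def[abs_def] by (intro continuous_intros)

lemma rad_tendsto:
  assumes f: "finen v g"
  shows "(rad h v \<longlongrightarrow> sqrt (1 - h\<^sup>2)) at_top"
proof -
  have "((\<lambda>x. norm (v x)) \<longlongrightarrow> 1) at_top"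
  proof (rule tendstoI)
    fix e :: real assume "e > 0"
    then obtain R where R: "\<And>x. \<bar>x\<bar> \<ge> R \<Longrightarrow> \<bar>norm (v x) - 1\<bar> < e" using finen_norm_tendsto[OF f] by blast
    then show "\<forall>\<^sub>F x in at_top. dist (norm (v x)) 1 < e" unfolding dist_real_def
      by (intro eventually_at_top_linorderI[of R]) auto
  qed
  then have "(rad h v \<longlongrightarrow> sqrt (1\<^sup>2 - h\<^sup>2)) at_top"
    unfolding rad_def[abs_def] by (intro tendsto_intros)
  then show ?thesis by simp
qed

lemma set_integrable_of_integrable:
  fixes f :: "'a::euclidean_space \<Rightarrow> 'b::{banach, second_countable_topology}"
  shows "integrable lborel f \<Longrightarrow> A \<in> sets borel \<Longrightarrow> set_integrable lborel A f"
  unfolding set_integrable_def by (intro integrable_mult_indicator) auto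

lemma set_integral_mono_set:
  fixes f :: "'a::euclidean_space \<Rightarrow> real"
  assumes "set_integrable lborel B f" "A \<in> sets borel" "A \<subseteq> B" "\<And>x. x \<in> B \<Longrightarrow> f x \<ge> 0"
  shows "(LINT x:A|lborel. f x) \<le> (LINT x:B|lborel. f x)"
proof -
  have "set_integrable lborel A f" using set_integrable_subset[OF assms(1) _ assms(3)] assms(2) by simp
  then show ?thesis unfolding set_lebesgue_integral_def
    by (intro integral_mono) (use assms in \<open>auto simp: set_integrable_def indicator_def\<close>)
qed

text \<open>After the last visit \<open>x1\<close> to the circle the slack dominates the exact
  derivative \<open>flux / sqrt 2\<close>, and \<open>rad\<close> runs from 0 to its limit
  \<open>sqrt (1 - h^2)\<close>. In the equality case the difference, half a square by
  \<open>slack_square\<close>, vanishes almost everywhere, which is a differential equation for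
  \<open>v\<close>.\<close>

lemma tail_slack:
  fixes h :: real
  defines "J \<equiv> chord_primitive h (sqrt (1 - h\<^sup>2))"
  assumes f: "finen v g" and m: "\<And>x. \<bar>h\<bar> \<le> norm (v x)" and x1: "norm (v x1) = \<bar>h\<bar>" "\<And>x. x > x1 \<Longrightarrow> \<bar>h\<bar> < norm (v x)"
    and i: "integrable lborel (slack h v g)"
  shows "J / sqrt 2 \<le> (LINT x:{x1<..}|lborel. slack h v g x)"
    and "(LINT x:{x1<..}|lborel. slack h v g x) \<le> J / sqrt 2 \<Longrightarrow>
      AE x in lborel. x > x1 \<longrightarrow> g x = of_real ((1 - (norm (v x))\<^sup>2) / sqrt 2 / (norm (v x))\<^sup>2) * (v x * Complex (rad h v x) h)"
proof -
  note F = finenD[OF f]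
  \<comment> \<open>The intervals \<open>[a n, b n]\<close> exhaust the open half-line but keep away
    from \<open>x1\<close>, where \<open>flux_integral\<close> does not apply.\<close>
  define a where "a n = x1 + 1 / real (Suc n)" for n
  define b where "b n = x1 + 1 + real n" for n
  have ab: "x1 < a n" "a n \<le> b n" for n by (auto simp: a_def b_def field_simps)
  have sub: "{a n..b n} \<subseteq> {x1<..}" for n using ab(1)[of n] by auto
  have mono: "{a k..b k} \<subseteq> {a n..b n}" if "k \<le> n" for k n
    using that by (auto simp: a_def b_def frac_le)
  define D where "D n = chord_primitive h (rad h v (b n)) - chord_primitive h (rad h v (a n))" for n
  have a_lim: "a \<longlonglongrightarrow> x1"
    unfolding a_def using tendsto_add[OF tendsto_const[of x1] LIMSEQ_Suc[OF lim_const_over_n[of 1]]] by simp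
  have b_lim: "filterlim b at_top sequentially"
    unfolding b_def by (rule filterlim_tendsto_add_at_top[OF tendsto_const filterlim_real_sequentially])
  have "D \<longlonglongrightarrow> J - 0"
    unfolding D_def J_def
  proof (rule tendsto_diff)
    show "(\<lambda>n. chord_primitive h (rad h v (b n))) \<longlonglongrightarrow> chord_primitive h (sqrt (1 - h\<^sup>2))"
      by (rule isCont_tendsto_compose[OF isCont_chord_primitive filterlim_compose[OF rad_tendsto[OF f] b_lim]])
    have "isCont (rad h v) x1" using continuous_rad[OF F(6)] continuous_on_eq_continuous_at open_UNIV by blast
    then have "(\<lambda>n. rad h v (a n)) \<longlonglongrightarrow> rad h v x1" by (rule isCont_tendsto_compose[OF _ a_lim])
    moreover have "rad h v x1 = 0" using x1(1) by (simp add: rad_def)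
    ultimately have "(\<lambda>n. rad h v (a n)) \<longlonglongrightarrow> 0" by simp
    from isCont_tendsto_compose[OF isCont_chord_primitive this, of h]
    show "(\<lambda>n. chord_primitive h (rad h v (a n))) \<longlonglongrightarrow> 0" by (simp add: chord_primitive_0)
  qed
  then have D: "(\<lambda>n. D n / sqrt 2) \<longlonglongrightarrow> J / sqrt 2" by (intro tendsto_divide) auto
  define Q where "Q x = slack h v g x - flux h v g x / sqrt 2" for x
  have Q0: "Q x \<ge> 0" for x using slack_flux[of h v x g, OF m] by (simp add: Q_def abs_le_iff field_simps)
  have pos: "\<bar>h\<bar> < norm (v x)" if "x \<in> {a n..b n}" for x n using x1(2) sub that by blast
  note Fl = flux_integral[OF F(1) ab(2) pos]
  have si: "set_integrable lborel A (slack h v g)" if "A \<in> sets borel" for A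
    using set_integrable_of_integrable[OF i that] .
  have Qi: "set_integrable lborel {a n..b n} Q" for n
    unfolding Q_def by (intro set_integral_diff set_integrable_divide si Fl(1)) auto
  have Qint: "(LINT x:{a n..b n}|lborel. Q x) = (LINT x:{a n..b n}|lborel. slack h v g x) - D n / sqrt 2" for n
  proof -
    have "(LINT x:{a n..b n}|lborel. flux h v g x / sqrt 2) = D n / sqrt 2"
      using set_borel_integral_eq_integral(2)[OF Fl(1)] Fl(2) by (simp add: D_def)
    then show ?thesis unfolding Q_def
      by (subst set_integral_diff(2)) (auto intro!: si Fl(1))
  qed
  have Qnn: "0 \<le> (LINT x:{a n..b n}|lborel. Q x)" for n
    unfolding set_lebesgue_integral_def by (intro Bochner_Integration.integral_nonneg) (auto simp: Q0)
  have le: "(LINT x:{a n..b n}|lborel. slack h v g x) \<le> (LINT x:{x1<..}|lborel. slack h v g x)" for n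
    by (rule set_integral_mono_set) (use si sub slack_nonneg m in auto)
  have "D n / sqrt 2 \<le> (LINT x:{x1<..}|lborel. slack h v g x)" for n
    using Qint[of n] Qnn[of n] le[of n] by linarith
  then show "J / sqrt 2 \<le> (LINT x:{x1<..}|lborel. slack h v g x)"
    using LIMSEQ_le_const2[OF D] by blast
  assume eq: "(LINT x:{x1<..}|lborel. slack h v g x) \<le> J / sqrt 2"
  have "AE x in lborel. x \<in> {a k..b k} \<longrightarrow> Q x = 0" for k
  proof -
    \<comment> \<open>The defect on a fixed interval is at most the defect on every larger one, and
      the latter is squeezed to 0 by the assumed equality.\<close>
    have "(LINT x:{a k..b k}|lborel. Q x) \<le> J / sqrt 2 - D n / sqrt 2" if "n \<ge> k" for n
    proof -
      have "(LINT x:{a k..b k}|lborel. Q x) \<le> (LINT x:{a n..b n}|lborel. Q x)"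
        by (rule set_integral_mono_set[OF Qi]) (use mono[OF that] Q0 in auto)
      then show ?thesis using Qint[of n] le[of n] eq by linarith
    qed
    then have ev: "\<forall>\<^sub>F n in sequentially. (LINT x:{a k..b k}|lborel. Q x) \<le> J / sqrt 2 - D n / sqrt 2"
      unfolding eventually_sequentially by blast
    have "(\<lambda>n. J / sqrt 2 - D n / sqrt 2) \<longlonglongrightarrow> J / sqrt 2 - J / sqrt 2" by (intro tendsto_diff tendsto_const D)
    from tendsto_lowerbound[OF this ev]
    have "(LINT x:{a k..b k}|lborel. Q x) \<le> 0" by simp
    then have "(LINT x|lborel. indicator {a k..b k} x *\<^sub>R Q x) = 0" using Qnn[of k] by (simp add: set_lebesgue_integral_def)
    moreover have "integrable lborel (\<lambda>x. indicator {a k..b k} x *\<^sub>R Q x)" using Qi by (simp add: set_integrable_def)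
    ultimately have "AE x in lborel. indicator {a k..b k} x *\<^sub>R Q x = 0"
      by (subst (asm) integral_nonneg_eq_0_iff_AE) (auto simp: Q0)
    then show ?thesis by eventually_elim (auto simp: indicator_def)
  qed
  then have "AE x in lborel. \<forall>k. x \<in> {a k..b k} \<longrightarrow> Q x = 0" unfolding AE_all_countable by blast
  then show "AE x in lborel. x > x1 \<longrightarrow> g x = of_real ((1 - (norm (v x))\<^sup>2) / sqrt 2 / (norm (v x))\<^sup>2) * (v x * Complex (rad h v x) h)"
  proof eventually_elim
    fix x assume *: "\<forall>k. x \<in> {a k..b k} \<longrightarrow> Q x = 0"
    show "x > x1 \<longrightarrow> g x = of_real ((1 - (norm (v x))\<^sup>2) / sqrt 2 / (norm (v x))\<^sup>2) * (v x * Complex (rad h v x) h)"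
    proof
      assume x: "x > x1"
      obtain k1 where k1: "1 / real (Suc k1) < x - x1" using x nat_approx_posE[of "x - x1"] by auto
      obtain k2 where k2: "x - x1 - 1 \<le> real k2" using real_arch_simple by blast
      define k where "k = max k1 k2"
      have "1 / real (Suc k) \<le> 1 / real (Suc k1)" by (rule divide_left_mono) (auto simp: k_def)
      moreover have "real k2 \<le> real k" by (simp add: k_def)
      ultimately have "x \<in> {a k..b k}" using k1 k2 by (auto simp: a_def b_def)
      then have "Q x = 0" using * by blast
      moreover have vx: "v x \<noteq> 0" using x1(2)[OF x] by auto
      have "Q x = (norm (g x - of_real ((1 - (norm (v x))\<^sup>2) / sqrt 2 / (norm (v x))\<^sup>2) * (v x * Complex (rad h v x) h)))\<^sup>2 / 2"
        unfolding Q_def by (subst slack_square[where v=v and x=x and g=g and h=h and s="rad h v x", OF vx rad_sq[OF m], symmetric])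
          (simp add: flux_def mult_ac)
      ultimately show "g x = of_real ((1 - (norm (v x))\<^sup>2) / sqrt 2 / (norm (v x))\<^sup>2) * (v x * Complex (rad h v x) h)" by simp
    qed
  qed
qed

text \<open>On a half-line where the calibration is sharp, the direction \<open>v / (rad - i h)\<close> is constant
  and \<open>rad\<close> solves the equation of the soliton profile.\<close>

lemma tail_solution:
  fixes h :: real
  defines "c \<equiv> sqrt (1 - h\<^sup>2)"
  assumes v: "ac v g" and h: "\<bar>h\<bar> < 1" and x1: "norm (v x1) = \<bar>h\<bar>" "\<And>x. x > x1 \<Longrightarrow> \<bar>h\<bar> < norm (v x)"
    and ode: "AE x in lborel. x > x1 \<longrightarrow> g x = of_real ((1 - (norm (v x))\<^sup>2) / sqrt 2 / (norm (v x))\<^sup>2) * (v x * Complex (rad h v x) h)"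
  obtains w where "norm w = 1" "\<And>x. x \<ge> x1 \<Longrightarrow> v x = w * Complex (c * tanh (c * (x - x1) / sqrt 2)) (- h)"
proof -
  have c2: "c\<^sup>2 = 1 - h\<^sup>2" using h abs_square_le_1[of h] by (simp add: c_def)
  have c0: "c \<ge> 0" by (simp add: c_def) (use h abs_square_le_1[of h] in simp)
  have cv: "continuous_on UNIV v" by (rule ac_continuous_on[OF v])
  have cr: "continuous_on UNIV (rad h v)" by (rule continuous_rad[OF cv])
  have rs: "(rad h v x)\<^sup>2 = (norm (v x))\<^sup>2 - h\<^sup>2" if "x \<ge> x1" for x
    using that x1(1) x1(2)[of x] by (intro rad_sq) (cases "x = x1", auto)
  have rp: "rad h v x > 0" if "x > x1" for x
  proof -
    have "\<bar>h\<bar>\<^sup>2 < (norm (v x))\<^sup>2" using x1(2)[OF that] by (intro power_strict_mono) auto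
    then show ?thesis by (simp add: rad_def)
  qed
  define N where "N x = v x * (1 / (of_real (rad h v x) - \<i> * of_real h))" for x
  have main: "N x = N a" "rad h v x - rad h v a = integral {a..x} (\<lambda>t. (c\<^sup>2 - (rad h v t)\<^sup>2) / sqrt 2)"
    if a: "x1 < a" "a \<le> x" for a x
  proof -
    \<comment> \<open>Freezing the function to the left of \<open>a\<close> keeps \<open>rad\<close>
      positive on the whole line, as the global chain rule requires.\<close>
    define v1 where "v1 x = v (max x a)" for x
    define g1 where "g1 x = indicator {a..} x *\<^sub>R g x" for x
    have a1: "ac v1 g1" unfolding v1_def g1_def by (rule ac_max[OF v])
    have p1: "rad h v1 x > 0" for x using rp[of "max x a"] a(1) by (simp add: v1_def rad_def)
    define s1' where "s1' x = 1 / (2 * rad h v1 x) * (2 * Re (cnj (v1 x) * g1 x))" for x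
    have as: "ac (rad h v1) s1'"
      unfolding rad_def[abs_def] s1'_def
    proof (rule ac_chain_UNIV[OF ac_norm_sq[OF a1], of "\<lambda>q. sqrt (q - h\<^sup>2)" "\<lambda>q. 1 / (2 * sqrt (q - h\<^sup>2))"])
      fix x
      have q0: "(norm (v1 x))\<^sup>2 - h\<^sup>2 > 0" using p1[of x] by (simp add: rad_def)
      have "DERIV (\<lambda>q. sqrt (q - h\<^sup>2)) ((norm (v1 x))\<^sup>2) :> inverse (sqrt ((norm (v1 x))\<^sup>2 - h\<^sup>2)) / 2 * 1"
        by (rule DERIV_chain2[where f=sqrt and g="\<lambda>q. q - h\<^sup>2", OF DERIV_real_sqrt[OF q0]]) (auto intro!: derivative_eq_intros)
      moreover have "inverse (sqrt ((norm (v1 x))\<^sup>2 - h\<^sup>2)) / 2 * 1 = 1 / (2 * sqrt ((norm (v1 x))\<^sup>2 - h\<^sup>2))" by (simp add: inverse_eq_divide)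
      ultimately show "DERIV (\<lambda>q. sqrt (q - h\<^sup>2)) ((norm (v1 x))\<^sup>2) :> 1 / (2 * sqrt ((norm (v1 x))\<^sup>2 - h\<^sup>2))" by (simp only:)
      show "isCont (\<lambda>q. 1 / (2 * sqrt (q - h\<^sup>2))) ((norm (v1 x))\<^sup>2)"
        using q0 by (intro continuous_intros) auto
    qed
    have az: "ac (\<lambda>x. complex_of_real (rad h v1 x)) (\<lambda>x. of_real (s1' x))"
      by (rule ac_linear[OF bounded_linear_of_real as])
    have nz: "complex_of_real (rad h v1 x) - \<i> * of_real h \<noteq> 0" for x
    proof
      assume z: "complex_of_real (rad h v1 x) - \<i> * of_real h = 0"
      show False using arg_cong[OF z, of Re] p1[of x] by simp
    qed
    let ?d = "\<lambda>x. complex_of_real (rad h v1 x) - \<i> * of_real h"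
    have ap: "ac (\<lambda>x. 1 / ?d x) (\<lambda>x. (- 1 / (?d x)\<^sup>2) * of_real (s1' x))"
    proof (rule ac_chain_UNIV[OF az, of "\<lambda>z. 1 / (z - \<i> * of_real h)" "\<lambda>z. - 1 / (z - \<i> * of_real h)\<^sup>2"])
      fix x
      show "((\<lambda>z. 1 / (z - \<i> * complex_of_real h)) has_field_derivative - 1 / (?d x)\<^sup>2) (at (complex_of_real (rad h v1 x)))"
        using nz[of x] by (auto intro!: derivative_eq_intros simp: power2_eq_square)
      show "isCont (\<lambda>z. - 1 / (z - \<i> * complex_of_real h)\<^sup>2) (complex_of_real (rad h v1 x))"
        using nz[of x] by (intro continuous_intros) auto
    qed
    have aN: "ac (\<lambda>x. v1 x * (1 / ?d x)) (\<lambda>x. g1 x * (1 / ?d x) + v1 x * ((- 1 / (?d x)\<^sup>2) * of_real (s1' x)))"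
      by (rule ac_bilinear[OF bounded_bilinear_mult a1 ap])
    have key: "AE x in lborel. g1 x * (1 / ?d x) + v1 x * ((- 1 / (?d x)\<^sup>2) * of_real (s1' x)) = 0 \<and>
        s1' x = indicator {a..} x *\<^sub>R ((c\<^sup>2 - (rad h v x)\<^sup>2) / sqrt 2)"
      using ode
    proof eventually_elim
      fix x assume o: "x > x1 \<longrightarrow> g x = of_real ((1 - (norm (v x))\<^sup>2) / sqrt 2 / (norm (v x))\<^sup>2) * (v x * Complex (rad h v x) h)"
      show "g1 x * (1 / ?d x) + v1 x * ((- 1 / (?d x)\<^sup>2) * of_real (s1' x)) = 0 \<and>
        s1' x = indicator {a..} x *\<^sub>R ((c\<^sup>2 - (rad h v x)\<^sup>2) / sqrt 2)"
      proof (cases "x \<ge> a")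
        case False
        then show ?thesis by (simp add: g1_def s1'_def)
      next
        case True
        then have x: "x > x1" using a by simp
        define s where "s = rad h v x"
        define q where "q = (norm (v x))\<^sup>2"
        define k where "k = (1 - q) / sqrt 2 / q"
        have s: "s > 0" "s\<^sup>2 = q - h\<^sup>2" using rp[OF x] rs[of x] x by (auto simp: s_def q_def)
        have q0: "q > 0" using s zero_le_power2[of h] zero_less_power[OF s(1), of 2] by linarith
        have v1: "v1 x = v x" "rad h v1 x = s" using True by (auto simp: v1_def rad_def s_def max_absorb1)
        have g1: "g1 x = of_real k * (v x * Complex s h)" using o x True by (simp add: g1_def k_def q_def s_def)
        have kq: "k * q = (1 - q) / sqrt 2" using q0 by (simp add: k_def)
        have "cnj (v x) * g1 x = of_real (k * q) * Complex s h"
        proof -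
          have "cnj (v x) * v x = of_real q" unfolding q_def complex_norm_square by (rule mult.commute)
          then have "of_real k * (cnj (v x) * v x) * Complex s h = of_real k * of_real q * Complex s h" by simp
          then show ?thesis unfolding g1 by (simp add: mult_ac)
        qed
        then have "Re (cnj (v x) * g1 x) = k * q * s" by simp
        then have s1: "s1' x = k * q" unfolding s1'_def v1 using s(1) by simp
        \<comment> \<open>This factorisation of \<open>|v|^2\<close> is why
          \<open>v / (rad - i h)\<close> is constant: the logarithmic derivatives of
          \<open>v\<close> and of \<open>rad - i h\<close> are both
          \<open>k * Complex s h\<close>.\<close>
        have fac: "complex_of_real q = Complex s h * (of_real s - \<i> * of_real h)"
          using s(2) by (simp add: complex_eq_iff power2_eq_square algebra_simps)
        have d0: "of_real s - \<i> * complex_of_real h \<noteq> 0" using nz[of x] by (simp add: v1)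
        have "g1 x * (1 / (of_real s - \<i> * of_real h)) = v x * (1 / (of_real s - \<i> * of_real h)\<^sup>2 * of_real (k * q))"
        proof -
          have "K * (V * S) * (1 / d) = V * (1 / d\<^sup>2 * (K * (S * d)))" if "d \<noteq> 0" for K V S d :: complex
            using that by (simp add: power2_eq_square)
          from this[OF d0] show ?thesis unfolding g1 of_real_mult fac .
        qed
        moreover have "c\<^sup>2 - s\<^sup>2 = 1 - q" using c2 s(2) by simp
        ultimately show ?thesis using True unfolding v1 s1 s_def[symmetric] by (simp add: kq)
      qed
    qed
    have "ac (\<lambda>x. v1 x * (1 / ?d x)) (\<lambda>x. 0)"
      by (rule ac_cong_AE[OF aN]) (use key in \<open>auto elim: eventually_mono\<close>)
    from acD(2)[OF this a(2)] have "v1 x * (1 / ?d x) = v1 a * (1 / ?d a)" by simp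
    then show "N x = N a" using a by (simp add: N_def v1_def rad_def max_absorb1)
    have cm: "continuous_on UNIV (\<lambda>x. (c\<^sup>2 - (rad h v x)\<^sup>2) / sqrt 2)" by (intro continuous_intros cr) auto
    have "ac (rad h v1) (\<lambda>x. indicator {a..} x *\<^sub>R ((c\<^sup>2 - (rad h v x)\<^sup>2) / sqrt 2))"
    proof (rule ac_cong_AE[OF as])
      show "(\<lambda>x. indicator {a..} x *\<^sub>R ((c\<^sup>2 - (rad h v x)\<^sup>2) / sqrt 2)) \<in> borel_measurable borel"
        using borel_measurable_continuous_onI[OF cm] by (intro borel_measurable_scaleR borel_measurable_indicator) auto
      show "AE x in lborel. indicator {a..} x *\<^sub>R ((c\<^sup>2 - (rad h v x)\<^sup>2) / sqrt 2) = s1' x"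
        using key by eventually_elim simp
    qed
    from acD(2)[OF this a(2)] 
    have "rad h v1 x - rad h v1 a = integral {a..x} (\<lambda>x. indicator {a..} x *\<^sub>R ((c\<^sup>2 - (rad h v x)\<^sup>2) / sqrt 2))" .
    also have "\<dots> = integral {a..x} (\<lambda>x. (c\<^sup>2 - (rad h v x)\<^sup>2) / sqrt 2)" by (rule integral_cong) simp
    finally show "rad h v x - rad h v a = integral {a..x} (\<lambda>t. (c\<^sup>2 - (rad h v t)\<^sup>2) / sqrt 2)"
      using a by (simp add: v1_def rad_def max_absorb1)
  qed
  \<comment> \<open>The integral equation has a continuous integrand, so \<open>rad\<close> is
    differentiable in the classical sense beyond \<open>x1\<close>.\<close>
  have dr: "DERIV (rad h v) x :> (c\<^sup>2 - (rad h v x)\<^sup>2) / sqrt 2" if x: "x > x1" for x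
  proof -
    define a where "a = (x1 + x) / 2"
    have a: "x1 < a" "a < x" using x by (auto simp: a_def)
    have "((\<lambda>u. integral {a..u} (\<lambda>t. (c\<^sup>2 - (rad h v t)\<^sup>2) / sqrt 2)) has_real_derivative (c\<^sup>2 - (rad h v x)\<^sup>2) / sqrt 2) (at x within {a..x+1})"
      by (rule integral_has_real_derivative) (use a in \<open>auto intro!: continuous_intros continuous_on_subset[OF cr]\<close>)
    then have "((\<lambda>u. integral {a..u} (\<lambda>t. (c\<^sup>2 - (rad h v t)\<^sup>2) / sqrt 2) + rad h v a) has_real_derivative (c\<^sup>2 - (rad h v x)\<^sup>2) / sqrt 2 + 0) (at x)"
      using a by (intro DERIV_add DERIV_const) (simp add: at_within_Icc_at[of a x "x + 1"])
    then have "((\<lambda>u. integral {a..u} (\<lambda>t. (c\<^sup>2 - (rad h v t)\<^sup>2) / sqrt 2) + rad h v a) has_real_derivative (c\<^sup>2 - (rad h v x)\<^sup>2) / sqrt 2) (at x)"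
      by simp
    then show ?thesis
    proof (rule has_field_derivative_transform_within_open[where S="{a<..}"])
      fix y assume "y \<in> {a<..}"
      then show "integral {a..y} (\<lambda>t. (c\<^sup>2 - (rad h v t)\<^sup>2) / sqrt 2) + rad h v a = rad h v y"
        using main(2)[of a y] a(1) by simp
    qed (use a in auto)
  qed
  define \<tau> where "\<tau> x = c * tanh (c * (x - x1) / sqrt 2)" for x
  have d\<tau>: "DERIV \<tau> x :> (c\<^sup>2 - (\<tau> x)\<^sup>2) / sqrt 2" for x
  proof -
    have "DERIV \<tau> x :> c * ((1 - (tanh (c * (x - x1) / sqrt 2))\<^sup>2) * (c / sqrt 2))"
    proof -
      have "DERIV (\<lambda>x. c * (x - x1) / sqrt 2) x :> c / sqrt 2"
        by (rule DERIV_cdivide) (auto intro!: derivative_eq_intros)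
      from has_field_derivative_tanh[OF _ this]
      have "DERIV (\<lambda>x. tanh (c * (x - x1) / sqrt 2)) x :> (1 - (tanh (c * (x - x1) / sqrt 2))\<^sup>2) * (c / sqrt 2)" by simp
      then show ?thesis unfolding \<tau>_def by (rule DERIV_cmult)
    qed
    moreover have "c * ((1 - (tanh (c * (x - x1) / sqrt 2))\<^sup>2) * (c / sqrt 2)) = (c\<^sup>2 - (\<tau> x)\<^sup>2) / sqrt 2"
    proof -
      have "c * ((1 - t\<^sup>2) * (c / r)) = (c\<^sup>2 - (c * t)\<^sup>2) / r" for t r :: real
        by (simp add: power2_eq_square right_diff_distrib left_diff_distrib diff_divide_distrib mult_ac)
      then show ?thesis unfolding \<tau>_def .
    qed
    ultimately show ?thesis by simp
  qed
  have r\<tau>: "rad h v x = \<tau> x" if x: "x \<ge> x1" for x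
  proof -
    \<comment> \<open>The right-hand side \<open>(c^2 - s^2) / sqrt 2\<close> decreases in
      \<open>s >= 0\<close>, so two nonnegative solutions cannot move apart. Both vanish at
      \<open>x1\<close>, and differentiability is used only beyond it.\<close>
    have "(rad h v x - \<tau> x)\<^sup>2 \<le> (rad h v x1 - \<tau> x1)\<^sup>2"
    proof (rule DERIV_nonpos_imp_decreasing_open[OF x, of "\<lambda>x. (rad h v x - \<tau> x)\<^sup>2"])
      fix y assume y: "x1 < y" "y < x"
      have "DERIV (\<lambda>x. (rad h v x - \<tau> x)\<^sup>2) y :> 2 * (rad h v y - \<tau> y) * ((c\<^sup>2 - (rad h v y)\<^sup>2) / sqrt 2 - (c\<^sup>2 - (\<tau> y)\<^sup>2) / sqrt 2)"
        using dr[OF y(1)] d\<tau>[of y] by (auto intro!: derivative_eq_intros)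
      moreover have "2 * (rad h v y - \<tau> y) * ((c\<^sup>2 - (rad h v y)\<^sup>2) / sqrt 2 - (c\<^sup>2 - (\<tau> y)\<^sup>2) / sqrt 2) = - ((2 / sqrt 2) * (rad h v y - \<tau> y)\<^sup>2 * (rad h v y + \<tau> y))"
      proof -
        have "2 * (r - t) * ((c\<^sup>2 - r\<^sup>2) / q - (c\<^sup>2 - t\<^sup>2) / q) = - ((2 / q) * (r - t)\<^sup>2 * (r + t))" if "q \<noteq> 0" for r t q :: real
          using that by (simp add: power2_eq_square field_simps)
        then show ?thesis by simp
      qed
      moreover have "0 \<le> \<tau> y" using c0 y(1) by (simp add: \<tau>_def)
      ultimately show "\<exists>z. DERIV (\<lambda>x. (rad h v x - \<tau> x)\<^sup>2) y :> z \<and> z \<le> 0"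
        using rp[OF y(1)] by (intro exI[of _ "- ((2 / sqrt 2) * (rad h v y - \<tau> y)\<^sup>2 * (rad h v y + \<tau> y))"]) auto
    next
      have "continuous_on {x1..x} \<tau>" using d\<tau> by (intro DERIV_continuous_on) (blast intro: DERIV_subset)
      then show "continuous_on {x1..x} (\<lambda>x. (rad h v x - \<tau> x)\<^sup>2)"
        by (intro continuous_intros continuous_on_subset[OF cr]) auto
    qed
    also have "(rad h v x1 - \<tau> x1)\<^sup>2 = 0" using x1(1) by (simp add: rad_def \<tau>_def)
    finally show ?thesis by simp
  qed
  define w where "w = N (x1 + 1)"
  have Nw: "N x = w" if "x > x1" for x
    using main(1)[of "x1 + 1" x] main(1)[of x "x1 + 1"] that unfolding w_def by (cases "x \<ge> x1 + 1") auto
  have vx: "v x = w * Complex (rad h v x) (- h)" if x: "x > x1" for x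
  proof -
    let ?D = "of_real (rad h v x) - \<i> * complex_of_real h"
    have "Complex (rad h v x) (- h) = ?D" by (simp add: complex_eq_iff)
    moreover have "?D \<noteq> 0" using rp[OF x] by (auto simp: complex_eq_iff)
    then have "v x = v x * (1 / ?D) * ?D" by simp
    then have "v x = w * ?D" using Nw[OF x] unfolding N_def by argo
    ultimately show ?thesis by simp
  qed
  have "(norm (v (x1 + 1)))\<^sup>2 = (norm w)\<^sup>2 * ((rad h v (x1+1))\<^sup>2 + h\<^sup>2)"
    using vx[of "x1 + 1"] by (simp add: norm_mult power_mult_distrib cmod_power2)
  moreover have "(rad h v (x1+1))\<^sup>2 + h\<^sup>2 = (norm (v (x1 + 1)))\<^sup>2" using rs[of "x1 + 1"] by simp
  moreover have "(norm (v (x1 + 1)))\<^sup>2 \<noteq> 0" using x1(2)[of "x1 + 1"] by auto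
  ultimately have "(norm w)\<^sup>2 = 1" by simp
  then have w1: "norm w = 1" by (smt (verit) norm_ge_zero power2_eq_1_iff)
  have vx1: "v x1 = w * Complex (rad h v x1) (- h)"
  proof (rule tendsto_unique[where F="at_right x1"])
    show "(v \<longlongrightarrow> v x1) (at_right x1)" using cv by (simp add: continuous_on_def) (meson filterlim_at_split)
    have "continuous_on UNIV (\<lambda>x. w * Complex (rad h v x) (- h))" by (intro continuous_intros continuous_on_Complex cr)
    then have "((\<lambda>x. w * Complex (rad h v x) (- h)) \<longlongrightarrow> w * Complex (rad h v x1) (- h)) (at_right x1)"
      by (simp add: continuous_on_def) (meson filterlim_at_split)
    then show "(v \<longlongrightarrow> w * Complex (rad h v x1) (- h)) (at_right x1)"
      by (rule Lim_transform_eventually) (auto simp: eventually_at_filter vx)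
  qed simp
  show ?thesis
  proof (rule that[OF w1])
    fix x assume x: "x \<ge> x1"
    then have "v x = w * Complex (rad h v x) (- h)" using vx vx1 by (cases "x = x1") auto
    then show "v x = w * Complex (c * tanh (c * (x - x1) / sqrt 2)) (- h)" using r\<tau>[OF x] by (simp add: \<tau>_def)
  qed
qed

subsection \<open>The sharp energy bound on the line\<close>

text \<open>As \<open>|v|\<close> tends to 1 at both ends, a value below 1 confines the search for
  the minimum to a compact interval.\<close>

lemma min_norm:
  assumes f: "finen v g" and y: "norm (v y) < 1"
  obtains x0 where "norm (v x0) < 1" "\<And>x. norm (v x0) \<le> norm (v x)"
proof -
  obtain R where R: "R > 0" "\<And>x. \<bar>x\<bar> \<ge> R \<Longrightarrow> \<bar>norm (v x) - 1\<bar> < 1 - norm (v y)"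
    using finen_norm_tendsto[OF f, of "1 - norm (v y)"] y by auto
  have yR: "y \<in> {-R..R}" 
  proof (rule ccontr)
    assume "y \<notin> {-R..R}"
    then have "\<bar>y\<bar> \<ge> R" by auto
    then show False using R(2)[of y] by auto
  qed
  have "continuous_on {-R..R} (\<lambda>x. norm (v x))" 
    by (intro continuous_intros continuous_on_subset[OF finenD(6)[OF f]]) auto
  then obtain x0 where x0: "x0 \<in> {-R..R}" "\<forall>x\<in>{-R..R}. norm (v x0) \<le> norm (v x)"
    using continuous_attains_inf[of "{-R..R}" "\<lambda>x. norm (v x)"] yR by auto
  show ?thesis
  proof (rule that)
    show "norm (v x0) < 1" using x0 yR y by force
    fix x show "norm (v x0) \<le> norm (v x)"
    proof (cases "x \<in> {-R..R}")
      case False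
      then have "\<bar>x\<bar> \<ge> R" by auto
      then have "norm (v y) < norm (v x)" using R(2)[of x] by (auto simp: abs_if split: if_splits)
      then show ?thesis using bspec[OF x0(2) yR] by linarith
    qed (use x0 in auto)
  qed
qed

text \<open>The set where \<open>|v|\<close> equals \<open>|h|\<close> is closed, and bounded
  because \<open>|v|\<close> tends to 1 and \<open>|h| < 1\<close>; its supremum is the point
  sought.\<close>

lemma last_min:
  assumes f: "finen v g" and h: "\<bar>h\<bar> < 1" and m: "\<And>x. \<bar>h\<bar> \<le> norm (v x)" and x0: "norm (v x0) = \<bar>h\<bar>"
  obtains x1 where "x0 \<le> x1" "norm (v x1) = \<bar>h\<bar>" "\<And>x. x > x1 \<Longrightarrow> \<bar>h\<bar> < norm (v x)"
proof -
  let ?Z = "{x. norm (v x) = \<bar>h\<bar>}"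
  obtain R where R: "R > 0" "\<And>x. \<bar>x\<bar> \<ge> R \<Longrightarrow> \<bar>norm (v x) - 1\<bar> < 1 - \<bar>h\<bar>"
    using finen_norm_tendsto[OF f, of "1 - \<bar>h\<bar>"] h by auto
  have bdd: "x \<le> R" if "x \<in> ?Z" for x
  proof (rule ccontr)
    assume "\<not> x \<le> R"
    then have "\<bar>norm (v x) - 1\<bar> < 1 - \<bar>h\<bar>" using R(1) by (intro R(2)) auto
    then show False using that h by auto
  qed
  have "closed ?Z" using finenD(6)[OF f] by (intro closed_Collect_eq continuous_intros) auto
  then have S: "Sup ?Z \<in> ?Z" using bdd x0 by (intro closed_contains_Sup) (auto intro!: bdd_aboveI[of _ R])
  have up: "x \<le> Sup ?Z" if "x \<in> ?Z" for x using that bdd by (intro cSup_upper) (auto intro!: bdd_aboveI[of _ R])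
  show ?thesis
  proof (rule that[of "Sup ?Z"])
    show "x0 \<le> Sup ?Z" using up x0 by simp
    show "norm (v (Sup ?Z)) = \<bar>h\<bar>" using S by simp
    fix x assume "Sup ?Z < x"
    then have "norm (v x) \<noteq> \<bar>h\<bar>" using up[of x] by auto
    then show "\<bar>h\<bar> < norm (v x)" using m[of x] by simp
  qed
qed

text \<open>Reflection of the line reverses the current and conjugation reverses it again. Hence
  slack and energy density are carried over with the same \<open>h\<close>, and statements on right
  tails apply to left tails.\<close>

definition mirror :: "(real \<Rightarrow> complex) \<Rightarrow> real \<Rightarrow> complex" where "mirror v x = cnj (v (- x))"
definition mirror' :: "(real \<Rightarrow> complex) \<Rightarrow> real \<Rightarrow> complex" where "mirror' g x = - cnj (g (- x))"

lemma mirror_finen: "finen v g \<Longrightarrow> finen (mirror v) (mirror' g)"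
proof -
  assume f: "finen v g"
  have "ac (\<lambda>x. cnj (v (- x))) (\<lambda>x. cnj (- g (- x)))"
    by (rule ac_linear[OF bounded_linear_cnj ac_reflect[OF finenD(1)[OF f]]])
  moreover have "integrable lborel (\<lambda>x. (norm (g (- x)))\<^sup>2)" "integrable lborel (\<lambda>x. (1 - (norm (v (- x)))\<^sup>2)\<^sup>2)"
    using lborel_integrable_real_affine[OF finenD(2)[OF f], of "-1" 0] lborel_integrable_real_affine[OF finenD(3)[OF f], of "-1" 0] by auto
  ultimately show ?thesis by (simp add: finen_def mirror_def[abs_def] mirror'_def[abs_def])
qed

lemma mirror_slack: "slack h (mirror v) (mirror' g) x = slack h v g (- x)"
  by (simp add: slack_def dens_def curr_def mirror_def mirror'_def algebra_simps)

lemma mirror_dens: "dens (mirror v) (mirror' g) x = dens v g (- x)"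
  by (simp add: dens_def mirror_def mirror'_def)

lemma set_integral_reflect:
  fixes f :: "real \<Rightarrow> real"
  shows "(LINT x:{..<a}|lborel. f x) = (LINT x:{- a<..}|lborel. f (- x))"
proof -
  have "(LINT x|lborel. indicator {..<a} x *\<^sub>R f x) = \<bar>-1\<bar> *\<^sub>R (LINT x|lborel. indicator {..<a} (0 + (-1) * x) *\<^sub>R f (0 + (-1) * x))"
    by (rule lborel_integral_real_affine) simp
  moreover have "indicator {..<a} (0 + (-1) * x) = (indicator {- a<..} x :: real)" for x by (auto simp: indicator_def)
  ultimately show ?thesis by (simp add: set_lebesgue_integral_def)
qed

lemma integral_two_tails:
  fixes f :: "real \<Rightarrow> real"
  assumes i: "integrable lborel f" and ab: "b \<le> a"
  shows "integral\<^sup>L lborel f = (LINT x:{..<b}|lborel. f x) + (LINT x:{b..a}|lborel. f x) + (LINT x:{a<..}|lborel. f x)"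
proof -
  note si = set_integrable_of_integrable[OF i]
  have U: "UNIV = ({..<b} \<union> {b..a}) \<union> {a<..}" using ab by auto
  have "integral\<^sup>L lborel f = (LINT x:UNIV|lborel. f x)" by (simp add: set_lebesgue_integral_def)
  also have "\<dots> = (LINT x:({..<b} \<union> {b..a})|lborel. f x) + (LINT x:{a<..}|lborel. f x)"
    unfolding U by (rule set_integral_Un) (use ab in \<open>auto intro!: si\<close>)
  also have "(LINT x:({..<b} \<union> {b..a})|lborel. f x) = (LINT x:{..<b}|lborel. f x) + (LINT x:{b..a}|lborel. f x)"
    by (rule set_integral_Un) (auto intro!: si)
  finally show ?thesis .
qed

text \<open>The equality case of \<open>tail_slack\<close> on the half-line beyond
  \<open>x1\<close>.\<close>

definition sharp_right :: "real \<Rightarrow> (real \<Rightarrow> complex) \<Rightarrow> (real \<Rightarrow> complex) \<Rightarrow> real \<Rightarrow> bool" where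
  "sharp_right h v g x1 \<longleftrightarrow> norm (v x1) = \<bar>h\<bar> \<and> (\<forall>x>x1. \<bar>h\<bar> < norm (v x)) \<and>
    (AE x in lborel. x > x1 \<longrightarrow> g x = of_real ((1 - (norm (v x))\<^sup>2) / sqrt 2 / (norm (v x))\<^sup>2) * (v x * Complex (rad h v x) h))"

text \<open>Each of the two outer half-lines contributes \<open>J / sqrt 2\<close>, and between the
  first and the last visit to the circle the slack is nonnegative. Equality gives information on the
  outer parts; the middle part is excluded later by its energy.\<close>

lemma slack_bound:
  fixes h :: real
  defines "J \<equiv> chord_primitive h (sqrt (1 - h\<^sup>2))"
  assumes f: "finen v g" and h: "\<bar>h\<bar> < 1" and m: "\<And>x. \<bar>h\<bar> \<le> norm (v x)" and x0: "norm (v x0) = \<bar>h\<bar>"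
    and i: "integrable lborel (slack h v g)"
  shows "sqrt 2 * J \<le> integral\<^sup>L lborel (slack h v g)"
    and "integral\<^sup>L lborel (slack h v g) \<le> sqrt 2 * J \<Longrightarrow> \<exists>x1 x2. - x2 \<le> x1 \<and> sharp_right h v g x1 \<and> sharp_right h (mirror v) (mirror' g) x2"
proof -
  obtain x1 where x1: "x0 \<le> x1" "norm (v x1) = \<bar>h\<bar>" "\<And>x. x > x1 \<Longrightarrow> \<bar>h\<bar> < norm (v x)" using last_min[OF f h m x0] by blast
  note mf = mirror_finen[OF f]
  have mm: "\<bar>h\<bar> \<le> norm (mirror v x)" for x using m by (simp add: mirror_def)
  have mx0: "norm (mirror v (- x0)) = \<bar>h\<bar>" using x0 by (simp add: mirror_def)
  obtain x2 where x2: "- x0 \<le> x2" "norm (mirror v x2) = \<bar>h\<bar>" "\<And>x. x > x2 \<Longrightarrow> \<bar>h\<bar> < norm (mirror v x)" 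
    using last_min[OF mf h mm mx0] by blast
  have mi: "integrable lborel (slack h (mirror v) (mirror' g))"
    unfolding mirror_slack[abs_def] using lborel_integrable_real_affine[OF i, of "-1" 0] by simp
  note T1 = tail_slack[OF f m x1(2,3) i, folded J_def]
  note T2 = tail_slack[OF mf mm x2(2,3) mi, folded J_def]
  have le: "- x2 \<le> x1" using x1(1) x2(1) by simp
  have split: "integral\<^sup>L lborel (slack h v g) = (LINT x:{x2<..}|lborel. slack h (mirror v) (mirror' g) x) + (LINT x:{- x2..x1}|lborel. slack h v g x) + (LINT x:{x1<..}|lborel. slack h v g x)"
    unfolding integral_two_tails[OF i le] set_integral_reflect by (simp add: mirror_slack)
  have mid: "0 \<le> (LINT x:{- x2..x1}|lborel. slack h v g x)"
    unfolding set_lebesgue_integral_def by (intro Bochner_Integration.integral_nonneg) (auto simp: slack_nonneg m)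
  have JJ: "J / sqrt 2 + J / sqrt 2 = sqrt 2 * J" by (simp add: real_div_sqrt field_simps)
  show "sqrt 2 * J \<le> integral\<^sup>L lborel (slack h v g)" using split mid T1(1) T2(1) JJ by linarith
  assume "integral\<^sup>L lborel (slack h v g) \<le> sqrt 2 * J"
  then have "(LINT x:{x1<..}|lborel. slack h v g x) \<le> J / sqrt 2" "(LINT x:{x2<..}|lborel. slack h (mirror v) (mirror' g) x) \<le> J / sqrt 2"
    using split mid T1(1) T2(1) JJ by linarith+
  then show "\<exists>x1 x2. - x2 \<le> x1 \<and> sharp_right h v g x1 \<and> sharp_right h (mirror v) (mirror' g) x2"
    using le T1(2) T2(2) x1 x2 unfolding sharp_right_def by blast
qed

definition profile :: "real \<Rightarrow> real \<Rightarrow> real" where "profile c x = c * tanh (c * x / sqrt 2)"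

lemma profile_DERIV: "DERIV (profile c) x :> (c\<^sup>2 - (profile c x)\<^sup>2) / sqrt 2"
proof -
  have "DERIV (\<lambda>x. c * x / sqrt 2) x :> c / sqrt 2"
    by (rule DERIV_cdivide) (auto intro!: derivative_eq_intros)
  from has_field_derivative_tanh[OF _ this]
  have "DERIV (\<lambda>x. tanh (c * x / sqrt 2)) x :> (1 - (tanh (c * x / sqrt 2))\<^sup>2) * (c / sqrt 2)" by simp
  then have D: "DERIV (profile c) x :> c * ((1 - (tanh (c * x / sqrt 2))\<^sup>2) * (c / sqrt 2))" 
    unfolding profile_def[abs_def] by (rule DERIV_cmult)
  have eq: "c * ((1 - t\<^sup>2) * (c / r)) = (c\<^sup>2 - (c * t)\<^sup>2) / r" for t r :: real
    by (simp add: power2_eq_square right_diff_distrib left_diff_distrib diff_divide_distrib mult_ac)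
  show ?thesis using D unfolding eq by (simp add: profile_def)
qed

text \<open>Along the profile \<open>p\<close>, the quantity \<open>c^2 - p^2\<close> is
  \<open>sqrt 2\<close> times the derivative of \<open>p\<close>, so the energy density of the
  soliton is the exact derivative of a polynomial in \<open>p\<close>.\<close>

lemma profile_primitive_DERIV:
  "DERIV (\<lambda>x. (c\<^sup>2 * profile c x - profile c x ^ 3 / 3) / sqrt 2) x :> (c\<^sup>2 - (profile c x)\<^sup>2)\<^sup>2 / 2"
proof -
  have D: "DERIV (\<lambda>x. (c\<^sup>2 * profile c x - profile c x ^ 3 / 3) / sqrt 2) x :>
     (c\<^sup>2 * ((c\<^sup>2 - (profile c x)\<^sup>2) / sqrt 2) - 3 * (profile c x)\<^sup>2 * ((c\<^sup>2 - (profile c x)\<^sup>2) / sqrt 2) / 3) / sqrt 2"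
    by (rule DERIV_cdivide) (auto intro!: derivative_eq_intros profile_DERIV simp: mult_ac)
  have eq: "(c\<^sup>2 * (w / r) - 3 * q * (w / r) / 3) / r = (c\<^sup>2 - q) * w / (r * r)" for w r q :: real
    by (simp add: diff_divide_distrib left_diff_distrib)
  show ?thesis using D unfolding eq by (simp add: power2_eq_square)
qed

lemma profile_tendsto:
  assumes "c > 0"
  shows "(profile c \<longlongrightarrow> c) at_top" "(profile c \<longlongrightarrow> - c) at_bot"
proof -
  have "filterlim (\<lambda>x. (c / sqrt 2) * x) at_top at_top"
    using assms by (intro filterlim_tendsto_pos_mult_at_top[OF tendsto_const _ filterlim_ident]) auto
  from filterlim_compose[OF tanh_real_at_top this] have "((\<lambda>x. tanh (c / sqrt 2 * x)) \<longlongrightarrow> 1) at_top" .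
  from tendsto_mult[OF tendsto_const[of c] this] show t: "(profile c \<longlongrightarrow> c) at_top" unfolding profile_def[abs_def] by simp
  have "((\<lambda>x. - profile c (- x)) \<longlongrightarrow> - c) at_bot"
    by (intro tendsto_minus filterlim_compose[OF t] filterlim_uminus_at_top_at_bot)
  then show "(profile c \<longlongrightarrow> - c) at_bot" unfolding profile_def[abs_def] by simp
qed

lemma profile_integral:
  assumes c: "c > 0"
  shows "integrable lborel (\<lambda>x. (c\<^sup>2 - (profile c x)\<^sup>2)\<^sup>2 / 2)"
    and "(LINT x|lborel. (c\<^sup>2 - (profile c x)\<^sup>2)\<^sup>2 / 2) = 2 * sqrt 2 / 3 * c ^ 3"
    and "(LINT x:{a<..}|lborel. (c\<^sup>2 - (profile c (x - a))\<^sup>2)\<^sup>2 / 2) = sqrt 2 / 3 * c ^ 3"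
proof -
  let ?f = "\<lambda>x. (c\<^sup>2 - (profile c x)\<^sup>2)\<^sup>2 / 2"
  let ?F = "\<lambda>x. (c\<^sup>2 * profile c x - profile c x ^ 3 / 3) / sqrt 2"
  have cp: "continuous_on UNIV (profile c)" using profile_DERIV by (intro DERIV_continuous_on) (blast intro: DERIV_subset)
  have ic: "isCont (profile c) x" for x using profile_DERIV DERIV_isCont by blast
  have C: "isCont ?f x" for x by (intro continuous_intros ic) simp_all
  have val: "(c\<^sup>2 * c - c ^ 3 / 3) / sqrt 2 = sqrt 2 / 3 * c ^ 3"
  proof -
    have "(c\<^sup>2 * c - c ^ 3 / 3) = 2 * (c ^ 3 / 3)" by (simp add: power2_eq_square power3_eq_cube)
    then have "(c\<^sup>2 * c - c ^ 3 / 3) / sqrt 2 = (2 / sqrt 2) * (c ^ 3 / 3)" by simp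
    also have "2 / sqrt 2 = sqrt 2" by (simp add: real_div_sqrt)
    finally show ?thesis by simp
  qed
  have val2: "(c\<^sup>2 * (- c) - (- c) ^ 3 / 3) / sqrt 2 = - (sqrt 2 / 3 * c ^ 3)"
    unfolding val[symmetric] by (simp add: power3_eq_cube diff_divide_distrib)
  have top: "((?F \<circ> real_of_ereal) \<longlongrightarrow> sqrt 2 / 3 * c ^ 3) (at_left \<infinity>)"
    unfolding ereal_tendsto_simps val[symmetric] by (intro tendsto_intros profile_tendsto c) simp_all
  have bot: "((?F \<circ> real_of_ereal) \<longlongrightarrow> - (sqrt 2 / 3 * c ^ 3)) (at_right (-\<infinity>))"
    unfolding ereal_tendsto_simps val2[symmetric] by (intro tendsto_intros profile_tendsto c) simp_all
  have zero: "((?F \<circ> real_of_ereal) \<longlongrightarrow> 0) (at_right (ereal 0))"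
  proof -
    have "isCont ?F 0" by (intro continuous_intros ic) simp_all
    then have "(?F \<longlongrightarrow> ?F 0) (at_right 0)" using filterlim_at_split isCont_def by blast
    then show ?thesis unfolding ereal_tendsto_simps by (simp add: profile_def)
  qed
  note I1 = interval_integral_FTC_nonneg[of "-\<infinity>" "\<infinity>" ?F ?f, OF _ profile_primitive_DERIV C _ bot top]
  note I2 = interval_integral_FTC_nonneg[of "ereal 0" "\<infinity>" ?F ?f, OF _ profile_primitive_DERIV C _ zero top]
  show "integrable lborel ?f" using I1(1) by (simp add: set_integrable_def)
  show "(LINT x|lborel. ?f x) = 2 * sqrt 2 / 3 * c ^ 3" 
    using I1(2) by (simp add: interval_lebesgue_integral_def set_lebesgue_integral_def)
  have "(LINT x:{0<..}|lborel. ?f x) = sqrt 2 / 3 * c ^ 3"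
    using I2(2) by (simp add: interval_lebesgue_integral_def einterval_def greaterThan_def)
  moreover have "(LINT x|lborel. indicator {a<..} x *\<^sub>R ?f (x - a)) = \<bar>1\<bar> *\<^sub>R (LINT x|lborel. indicator {a<..} (a + 1 * x) *\<^sub>R ?f (a + 1 * x - a))"
    by (rule lborel_integral_real_affine) simp
  moreover have "indicator {a<..} (a + 1 * x) = (indicator {0<..} x :: real)" for x by (auto simp: indicator_def)
  ultimately show "(LINT x:{a<..}|lborel. (c\<^sup>2 - (profile c (x - a))\<^sup>2)\<^sup>2 / 2) = sqrt 2 / 3 * c ^ 3"
    by (simp add: set_lebesgue_integral_def)
qed

text \<open>The differential equation implies equipartition,
  \<open>|g|^2 = (1 - |v|^2)^2 / 2\<close>, and fixes the current, so a sharp half-line carries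
  exactly half the energy of the chord.\<close>

lemma sharp_right_solution:
  fixes h :: real
  defines "c \<equiv> sqrt (1 - h\<^sup>2)"
  assumes f: "finen v g" and h: "\<bar>h\<bar> < 1" and s: "sharp_right h v g x1"
  obtains w where "norm w = 1" "\<And>x. x \<ge> x1 \<Longrightarrow> v x = w * Complex (profile c (x - x1)) (- h)"
    "(LINT x:{x1<..}|lborel. dens v g x) = sqrt 2 / 3 * c ^ 3"
    "AE x in lborel. x > x1 \<longrightarrow> curr v g x = h * (c\<^sup>2 - (profile c (x - x1))\<^sup>2) / sqrt 2"
proof -
  have c2: "c\<^sup>2 = 1 - h\<^sup>2" and c0: "c > 0" using h abs_square_less_1[of h] by (auto simp: c_def)
  note F = finenD[OF f]
  obtain w where w: "norm w = 1" "\<And>x. x \<ge> x1 \<Longrightarrow> v x = w * Complex (c * tanh (c * (x - x1) / sqrt 2)) (- h)"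
    by (rule tail_solution[OF F(1) h, of x1]) (use s in \<open>auto simp: sharp_right_def c_def\<close>)
  have vx: "v x = w * Complex (profile c (x - x1)) (- h)" if "x \<ge> x1" for x using w(2)[OF that] by (simp add: profile_def)
  have nv: "(norm (v x))\<^sup>2 = (profile c (x - x1))\<^sup>2 + h\<^sup>2" if "x \<ge> x1" for x
    using vx[OF that] w(1) by (simp add: norm_mult cmod_power2)
  have eta: "1 - (norm (v x))\<^sup>2 = c\<^sup>2 - (profile c (x - x1))\<^sup>2" if "x \<ge> x1" for x using nv[OF that] c2 by simp
  have key: "AE x in lborel. x > x1 \<longrightarrow> (norm (g x))\<^sup>2 = (1 - (norm (v x))\<^sup>2)\<^sup>2 / 2 \<and> curr v g x = h * (1 - (norm (v x))\<^sup>2) / sqrt 2"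
    using s[unfolded sharp_right_def, THEN conjunct2, THEN conjunct2]
  proof eventually_elim
    fix x assume o: "x > x1 \<longrightarrow> g x = of_real ((1 - (norm (v x))\<^sup>2) / sqrt 2 / (norm (v x))\<^sup>2) * (v x * Complex (rad h v x) h)"
    show "x > x1 \<longrightarrow> (norm (g x))\<^sup>2 = (1 - (norm (v x))\<^sup>2)\<^sup>2 / 2 \<and> curr v g x = h * (1 - (norm (v x))\<^sup>2) / sqrt 2"
    proof
      assume x: "x > x1"
      have hv: "\<bar>h\<bar> < norm (v x)" using s x by (auto simp: sharp_right_def)
      define q where "q = (norm (v x))\<^sup>2"
      have q0: "q > 0" using hv unfolding q_def by (smt (verit) zero_less_power)
      have rs: "(rad h v x)\<^sup>2 + h\<^sup>2 = q" using rad_sq[where h=h and v=v and x=x] hv by (simp add: q_def)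
      have "(norm (Complex (rad h v x) h))\<^sup>2 = q" using rs by (simp add: cmod_power2)
      then have "norm (v x * Complex (rad h v x) h) ^ 2 = q\<^sup>2"
        unfolding norm_mult power_mult_distrib q_def[symmetric] by (simp add: power2_eq_square[of q])
      moreover have gx: "g x = of_real ((1 - q) / sqrt 2 / q) * (v x * Complex (rad h v x) h)"
        using mp[OF o x] unfolding q_def .
      have "(norm (g x))\<^sup>2 = ((1 - q) / sqrt 2 / q)\<^sup>2 * norm (v x * Complex (rad h v x) h) ^ 2"
        unfolding gx norm_mult[of "of_real _"] power_mult_distrib norm_of_real power2_abs ..
      ultimately have "(norm (g x))\<^sup>2 = ((1 - q) / sqrt 2 / q)\<^sup>2 * q\<^sup>2" by simp
      also have "\<dots> = (1 - q)\<^sup>2 / 2" using q0 by (simp add: power_divide power_mult_distrib)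
      finally have 1: "(norm (g x))\<^sup>2 = (1 - q)\<^sup>2 / 2" .
      have "cnj (v x) * v x = of_real q" unfolding q_def complex_norm_square by (rule mult.commute)
      then have "of_real ((1 - q) / sqrt 2 / q) * (cnj (v x) * v x) * Complex (rad h v x) h = of_real ((1 - q) / sqrt 2 / q * q) * Complex (rad h v x) h" by simp
      moreover have "cnj (v x) * g x = of_real ((1 - q) / sqrt 2 / q) * (cnj (v x) * v x) * Complex (rad h v x) h"
        unfolding gx by (simp only: mult_ac)
      ultimately have "curr v g x = (1 - q) / sqrt 2 / q * q * h" unfolding curr_def by simp
      then have 2: "curr v g x = h * (1 - q) / sqrt 2" using q0 by simp
      show "(norm (g x))\<^sup>2 = (1 - (norm (v x))\<^sup>2)\<^sup>2 / 2 \<and> curr v g x = h * (1 - (norm (v x))\<^sup>2) / sqrt 2"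
        using 1 2 by (simp add: q_def)
    qed
  qed
  have "(LINT x:{x1<..}|lborel. dens v g x) = (LINT x:{x1<..}|lborel. (c\<^sup>2 - (profile c (x - x1))\<^sup>2)\<^sup>2 / 2)"
  proof (rule set_lebesgue_integral_cong_AE)
    show "AE x\<in>{x1<..} in lborel. dens v g x = (c\<^sup>2 - (profile c (x - x1))\<^sup>2)\<^sup>2 / 2"
      using key by eventually_elim (auto simp: dens_def eta)
    have cp: "continuous_on UNIV (profile c)" using profile_DERIV by (intro DERIV_continuous_on) (blast intro: DERIV_subset)
    have "continuous_on UNIV (\<lambda>x. (c\<^sup>2 - (profile c (x - x1))\<^sup>2)\<^sup>2 / 2)"
      by (intro continuous_intros continuous_on_compose2[OF cp]) auto
    then show "(\<lambda>x. (c\<^sup>2 - (profile c (x - x1))\<^sup>2)\<^sup>2 / 2) \<in> borel_measurable lborel" by (simp add: borel_measurable_continuous_onI)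
  qed (use F(7) in auto)
  then have A: "(LINT x:{x1<..}|lborel. dens v g x) = sqrt 2 / 3 * c ^ 3" by (simp only: profile_integral(3)[OF c0])
  have B: "AE x in lborel. x > x1 \<longrightarrow> curr v g x = h * (c\<^sup>2 - (profile c (x - x1))\<^sup>2) / sqrt 2"
    using key by eventually_elim (auto simp: eta)
  show ?thesis by (rule that[OF w(1) vx A B])
qed

text \<open>The two sharp half-lines already use up the energy allowed. An interval of positive
  length between them would have zero energy density, hence \<open>|v| = 1\<close> almost
  everywhere, against \<open>|v| = |h| < 1\<close> at its end; so it reduces to a point.\<close>

lemma sharp_imp_soliton:
  fixes h :: real
  defines "c \<equiv> sqrt (1 - h\<^sup>2)"
  assumes f: "finen v g" and h: "\<bar>h\<bar> < 1" and s1: "sharp_right h v g x1" and s2: "sharp_right h (mirror v) (mirror' g) x2"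
    and le: "- x2 \<le> x1" and E: "integral\<^sup>L lborel (dens v g) \<le> 2 * sqrt 2 / 3 * c ^ 3"
    and lim: "h = 0 \<Longrightarrow> mseq v g \<longlonglongrightarrow> - 1"
  obtains w where "norm w = 1" "\<And>x. v x = w * Complex (profile c (x - x1)) (- h)"
proof -
  have c2: "c\<^sup>2 = 1 - h\<^sup>2" and c0: "c > 0" using h abs_square_less_1[of h] by (auto simp: c_def)
  note F = finenD[OF f]
  obtain w1 where w1: "norm w1 = 1" "\<And>x. x \<ge> x1 \<Longrightarrow> v x = w1 * Complex (profile c (x - x1)) (- h)"
    "(LINT x:{x1<..}|lborel. dens v g x) = sqrt 2 / 3 * c ^ 3"
    "AE x in lborel. x > x1 \<longrightarrow> curr v g x = h * (c\<^sup>2 - (profile c (x - x1))\<^sup>2) / sqrt 2"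
    using sharp_right_solution[OF f h s1] unfolding c_def by blast
  obtain w2 where w2: "norm w2 = 1" "\<And>x. x \<ge> x2 \<Longrightarrow> mirror v x = w2 * Complex (profile c (x - x2)) (- h)"
    "(LINT x:{x2<..}|lborel. dens (mirror v) (mirror' g) x) = sqrt 2 / 3 * c ^ 3"
    "AE x in lborel. x > x2 \<longrightarrow> curr (mirror v) (mirror' g) x = h * (c\<^sup>2 - (profile c (x - x2))\<^sup>2) / sqrt 2"
    using sharp_right_solution[OF mirror_finen[OF f] h s2] unfolding c_def by blast
  have "(LINT x:{..<- x2}|lborel. dens v g x) = sqrt 2 / 3 * c ^ 3"
    unfolding set_integral_reflect using w2(3) by (simp add: mirror_dens)
  then have mid: "(LINT x:{- x2..x1}|lborel. dens v g x) \<le> 0"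
    using integral_two_tails[OF F(7) le] w1(3) E by simp
  have x12: "- x2 = x1"
  proof (rule ccontr)
    assume "- x2 \<noteq> x1"
    then have lt: "- x2 < x1" using le by simp
    have dn: "dens v g x \<ge> 0" for x by (simp add: dens_def)
    have "0 \<le> (LINT x|lborel. indicator {- x2..x1} x *\<^sub>R dens v g x)"
      by (intro Bochner_Integration.integral_nonneg) (auto simp: dn)
    then have "(LINT x|lborel. indicator {- x2..x1} x *\<^sub>R dens v g x) = 0"
      using mid unfolding set_lebesgue_integral_def by linarith
    moreover have "integrable lborel (\<lambda>x. indicator {- x2..x1} x *\<^sub>R dens v g x)"
      using set_integrable_of_integrable[OF F(7), of "{- x2..x1}"] by (simp add: set_integrable_def)
    ultimately have "AE x in lborel. indicator {- x2..x1} x *\<^sub>R dens v g x = 0"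
      by (subst (asm) integral_nonneg_eq_0_iff_AE) (auto simp: dn)
    then have AE0: "AE x in lborel. x \<in> {- x2..x1} \<longrightarrow> norm (v x) = 1"
    proof eventually_elim
      fix x assume "indicator {- x2..x1} x *\<^sub>R dens v g x = 0"
      then have "x \<in> {- x2..x1} \<longrightarrow> dens v g x = 0" by (auto simp: indicator_def split: if_splits)
      moreover have "dens v g x = 0 \<Longrightarrow> norm (v x) = 1"
      proof -
        assume "dens v g x = 0"
        then have "(1 - (norm (v x))\<^sup>2)\<^sup>2 = 0" unfolding dens_def by (simp add: add_nonneg_eq_0_iff)
        then have "(norm (v x))\<^sup>2 = 1" by simp
        then show "norm (v x) = 1" by (smt (verit) norm_ge_zero power2_eq_1_iff)
      qed
      ultimately show "x \<in> {- x2..x1} \<longrightarrow> norm (v x) = 1" by blast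
    qed
    have "isCont (\<lambda>x. norm (v x)) x1" using F(6) continuous_on_eq_continuous_at[OF open_UNIV] by (intro continuous_intros) blast
    then obtain d where d: "d > 0" "\<And>y. \<bar>y - x1\<bar> < d \<Longrightarrow> \<bar>norm (v y) - norm (v x1)\<bar> < 1 - \<bar>h\<bar>"
      using h unfolding continuous_at_eps_delta dist_real_def by (metis diff_gt_0_iff_gt)
    obtain y where y: "y \<in> {max (- x2) (x1 - d)<..<x1}" "y \<in> {- x2..x1} \<longrightarrow> norm (v y) = 1"
      using AE_dense[OF AE0, of "max (- x2) (x1 - d)" x1] lt d(1) by auto
    then have "norm (v y) = 1" "\<bar>y - x1\<bar> < d" by auto
    then show False using d(2)[of y] s1 by (auto simp: sharp_right_def)
  qed
  have pm: "profile c (- y) = - profile c y" for y by (simp add: profile_def)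
  have left: "v x = (- cnj w2) * Complex (profile c (x - x1)) (- h)" if "x \<le> x1" for x
  proof -
    have "cnj (v x) = w2 * Complex (profile c (- (x - x1))) (- h)" 
    proof -
      have "- x - x2 = - (x - x1)" using x12 by simp
      moreover have "mirror v (- x) = w2 * Complex (profile c (- x - x2)) (- h)" by (rule w2(2)) (use that x12 in simp)
      ultimately show ?thesis by (simp only: mirror_def minus_minus)
    qed
    then have "v x = cnj (w2 * Complex (- profile c (x - x1)) (- h))" unfolding pm by (metis complex_cnj_cnj)
    also have "\<dots> = cnj w2 * (- Complex (profile c (x - x1)) (- h))" by (simp add: complex_eq_iff)
    finally show ?thesis by simp
  qed
  \<comment> \<open>The phases of the two halves agree because the values at \<open>x1\<close> do,
    unless this value is 0. For \<open>h = 0\<close> the halves are radial segments with zero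
    current that could meet at any angle, and the momentum \<pi>/2, encoded in the limit -1, makes
    them a diameter.\<close>
  have "- cnj w2 = w1"
  proof (cases "h = 0")
    case False
    have "w1 * Complex 0 (- h) = - cnj w2 * Complex 0 (- h)" using w1(2)[of x1] left[of x1] by (simp add: profile_def)
    moreover have "Complex 0 (- h) \<noteq> 0" using False by (simp add: complex_eq_iff)
    ultimately show ?thesis by (metis mult_right_cancel)
  next
    case True
    have "AE x in lborel. - x > x2 \<longrightarrow> curr (mirror v) (mirror' g) (- x) = 0"
    proof -
      have "AE x in distr lborel borel (uminus :: real \<Rightarrow> real). x > x2 \<longrightarrow> curr (mirror v) (mirror' g) x = 0"
        unfolding lborel_distr_uminus using w2(4) True by simp
      from AE_distrD[OF _ this] show ?thesis by simp
    qed
    then have "AE x in lborel. curr v g x = 0"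
      using w1(4) AE_lborel_singleton[of x1]
    proof eventually_elim
      fix x assume "- x > x2 \<longrightarrow> curr (mirror v) (mirror' g) (- x) = 0" "x > x1 \<longrightarrow> curr v g x = h * (c\<^sup>2 - (profile c (x - x1))\<^sup>2) / sqrt 2" "x \<noteq> x1"
      then show "curr v g x = 0" using True x12 by (cases "x > x1") (auto simp: curr_def mirror_def mirror'_def algebra_simps)
    qed
    then have i0: "integral {a..b} (curr v g) = 0" for a b
      unfolding L1_loc_Icc(3)[OF curr_L1_loc[OF F(1)], symmetric] set_lebesgue_integral_def
      by (intro integral_eq_zero_AE) (auto elim: eventually_mono)
    obtain N where N: "\<bar>x1\<bar> < real N" using reals_Archimedean2 by blast
    have "mseq v g n = w1 * w2" if "n \<ge> N" for n
    proof -
      have n: "\<bar>x1\<bar> < real n" using N that by (meson less_le_trans of_nat_mono)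
      have p1: "profile c (real n - x1) > 0" using c0 n by (simp add: profile_def)
      have p2: "profile c (- real n - x1) < 0" using c0 n by (auto simp: profile_def mult_less_0_iff divide_less_0_iff mult_pos_neg)
      have "sgn (v (real n)) = w1" using w1(1) w1(2)[of "real n"] n p1 True
        by (simp add: sgn_eq norm_mult complex_of_real_def[symmetric])
      moreover have "sgn (v (- real n)) = cnj w2" using w2(1) left[of "- real n"] n p2 True
        by (simp add: sgn_eq norm_mult complex_of_real_def[symmetric] field_simps)
      ultimately show ?thesis by (simp add: mseq_def i0)
    qed
    then have "mseq v g \<longlonglongrightarrow> w1 * w2" by (intro tendsto_eventually) (auto simp: eventually_sequentially)
    then have "w1 * w2 = - 1" using lim[OF True] LIMSEQ_unique by blast
    moreover have "w2 * cnj w2 = 1" using w2(1) by (simp add: complex_norm_square[symmetric])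
    ultimately show ?thesis by (metis mult.assoc mult.right_neutral mult_minus1)
  qed
  then have "v x = w1 * Complex (profile c (x - x1)) (- h)" for x using w1(2)[of x] left[of x] by (cases "x \<ge> x1") auto
  then show ?thesis using that w1(1) by blast
qed

subsection \<open>Minimality and rigidity of dark solitons\<close>

text \<open>The representative in the interval from 0 to \<pi> of the momentum of the soliton with
  speed \<open>sqrt 2 * sin al\<close>, increasing in \<open>al\<close> for
  \<open>|al| < pi/2\<close>.\<close>

definition soliton_momentum :: "real \<Rightarrow> real" where "soliton_momentum al = pi - chord_area al"

lemma soliton_momentum_eq: "soliton_momentum al = pi/2 + al + sin al * cos al"
  by (simp add: soliton_momentum_def chord_area_def field_simps)

lemma chord_area_uminus: "chord_area (- b) = pi - chord_area b"
  by (simp add: chord_area_def field_simps)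

lemma chord_area_pos: "\<bar>b\<bar> < pi/2 \<Longrightarrow> 0 < chord_area b" 
  using chord_area_strict_antimono[of b "pi/2"] by (simp add: chord_area_def abs_less_iff)

text \<open>A class modulo \<pi> leaves open how often the path winds. Among all its representatives
  the least absolute value is the area of the smaller of the two segments cut off by the chord,
  since the two areas add up to \<pi>.\<close>

lemma area_le_momentum:
  assumes "\<bar>al\<bar> < pi/2" "cis (2 * P) = cis (2 * soliton_momentum al)"
  shows "chord_area \<bar>al\<bar> \<le> \<bar>P\<bar>"
proof -
  obtain n :: int where n: "P = soliton_momentum al + of_int n * pi"
    using assms(2) rcong_pi_iff[of "soliton_momentum al" P] by (auto simp: rcong_altdef)
  have *: "chord_area \<bar>al\<bar> \<le> chord_area al" "chord_area \<bar>al\<bar> \<le> chord_area (- al)"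
    using chord_area_strict_antimono[of al "\<bar>al\<bar>"] chord_area_strict_antimono[of "- al" "\<bar>al\<bar>"] assms(1)
    by (cases "al \<ge> 0"; cases "al = 0"; force)+
  show ?thesis
  proof (cases "n \<ge> 0")
    case True
    then have "0 \<le> of_int n * pi" by simp
    then show ?thesis using * n unfolding chord_area_uminus soliton_momentum_def by linarith
  next
    case False
    then have "of_int n \<le> (- 1 :: real)" by (metis int_one_le_iff_zero_less le_minus_iff linorder_not_le neg_0_less_iff_less of_int_1 of_int_le_iff of_int_minus)
    then have "of_int n * pi \<le> - 1 * pi" by (intro mult_right_mono) auto
    then show ?thesis using * n unfolding soliton_momentum_def by linarith
  qed
qed

lemma chord_energy_abs: "chord_energy \<bar>b\<bar> = chord_energy b"
  by (auto simp: chord_energy_def abs_if)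

lemma chord_tangent_le:
  assumes "0 \<le> b" "b \<le> pi/2" "0 \<le> c" "c \<le> pi/2"
  shows "chord_energy c \<le> chord_energy b + sqrt 2 * sin b * (chord_area c - chord_area b)"
  using chord_tangent[OF assms] by (cases "b = c") auto

text \<open>The error \<open>d\<close> is carried along for functions on the cylinder, whose means
  have the prescribed momentum only up to the contribution of the oscillation. All slopes of the
  tangents used are at most \<open>sqrt 2\<close>, so an error \<open>d\<close> costs at most
  \<open>sqrt 2 * |d|\<close>.\<close>

lemma line_main:
  assumes f: "finen v g" and lim: "mseq v g \<longlonglongrightarrow> cis (2 * q)" and al: "\<bar>al\<bar> < pi/2"
    and q: "cis (2 * (q + d)) = cis (2 * soliton_momentum al)"
  shows "chord_energy al \<le> integral\<^sup>L lborel (dens v g) + sqrt 2 * \<bar>d\<bar>"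
    and "d = 0 \<Longrightarrow> integral\<^sup>L lborel (dens v g) \<le> chord_energy al \<Longrightarrow>
      \<exists>w a be. norm w = 1 \<and> \<bar>be\<bar> < pi/2 \<and> (\<forall>x. v x = w * Complex (profile (cos be) (x - a)) (sin be))"
proof -
  note F = finenD[OF f]
  let ?E = "integral\<^sup>L lborel (dens v g)"
  let ?f = "\<lambda>x. (1 - (norm (v x))\<^sup>2) * curr v g x / (norm (v x))\<^sup>2"
  define I where "I = integral\<^sup>L lborel ?f"
  have ga: "0 \<le> \<bar>al\<bar>" "\<bar>al\<bar> \<le> pi/2" using al by auto
  have nv: "chord_area \<bar>al\<bar> \<le> \<bar>I\<bar> / 2 + \<bar>d\<bar>" "integrable lborel ?f" if m: "m > 0" "\<And>x. m \<le> norm (v x)" for m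
  proof -
    show "integrable lborel ?f" by (rule nonvanishing_momentum(1)[OF f m])
    have "cis (2 * q) = cis I" unfolding I_def by (rule LIMSEQ_unique[OF lim nonvanishing_momentum(2)[OF f m]])
    then have "cis (2 * q + 2 * d) = cis (I + 2 * d)" by (simp only: cis_mult[symmetric])
    then have "cis (2 * (I / 2 + d)) = cis (2 * soliton_momentum al)" using q by (simp add: distrib_left)
    from area_le_momentum[OF al this] show "chord_area \<bar>al\<bar> \<le> \<bar>I\<bar> / 2 + \<bar>d\<bar>" by linarith
  qed
  have slack_int: "integral\<^sup>L lborel (slack h v g) = ?E - h / sqrt 2 * I" "integrable lborel (slack h v g)"
    if "h = 0 \<or> integrable lborel ?f" for h
  proof -
    show "integrable lborel (slack h v g)" "integral\<^sup>L lborel (slack h v g) = ?E - h / sqrt 2 * I"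
      using that F(7) unfolding slack_def[abs_def] I_def by (auto simp del: times_divide_eq_left times_divide_eq_right)
  qed
  consider "\<And>x. 1 \<le> norm (v x)" | y where "norm (v y) < 1" by (meson not_le)
  then have "(chord_energy al \<le> ?E + sqrt 2 * \<bar>d\<bar>) \<and> (d = 0 \<longrightarrow> ?E \<le> chord_energy al \<longrightarrow>
      (\<exists>w a be. norm w = 1 \<and> \<bar>be\<bar> < pi/2 \<and> (\<forall>x. v x = w * Complex (profile (cos be) (x - a)) (sin be))))"
  proof cases
    case 1
    \<comment> \<open>A path that avoids the open unit disc is calibrated by the tangents to the
      unit circle itself. The sign of \<open>h\<close> makes the momentum enter through its absolute
      value.\<close>
    define h :: real where "h = (if I \<ge> 0 then 1 else - 1)"
    have h: "\<bar>h\<bar> = 1" "h * I = \<bar>I\<bar>" by (auto simp: h_def)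
    note n = nv[OF zero_less_one 1]
    have "0 \<le> integral\<^sup>L lborel (slack h v g)"
      by (intro Bochner_Integration.integral_nonneg slack_nonneg) (use h 1 in auto)
    then have "\<bar>I\<bar> / sqrt 2 \<le> ?E" using slack_int(1)[of h] n h by simp
    moreover have "\<bar>I\<bar> / sqrt 2 = sqrt 2 * (\<bar>I\<bar> / 2)" by (simp add: field_simps)
    moreover have "sqrt 2 * chord_area \<bar>al\<bar> \<le> sqrt 2 * (\<bar>I\<bar> / 2 + \<bar>d\<bar>)" using n(1) by (intro mult_left_mono) auto
    ultimately have E: "sqrt 2 * chord_area \<bar>al\<bar> \<le> ?E + sqrt 2 * \<bar>d\<bar>" by (simp add: distrib_left)
    \<comment> \<open>At \<open>b = pi/2\<close> energy and area vanish and the tangent has slope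
      \<open>sqrt 2\<close>. Strict concavity leaves a gap, so no minimizer arises in this
      case.\<close>
    have "chord_energy \<bar>al\<bar> < sqrt 2 * chord_area \<bar>al\<bar>"
      using chord_tangent[of "pi/2" "\<bar>al\<bar>"] ga al by (simp add: chord_energy_def chord_area_def)
    then show ?thesis using E by (auto simp: chord_energy_abs)
  next
    case (2 y)
    obtain x0 where x0: "norm (v x0) < 1" "\<And>x. norm (v x0) \<le> norm (v x)" using min_norm[OF f 2] by blast
    define m where "m = norm (v x0)"
    \<comment> \<open>The angle of the chord touching the circle whose radius is the smallest
      modulus.\<close>
    define b where "b = arcsin m"
    have m01: "0 \<le> m" "m < 1" using x0 by (auto simp: m_def)
    have b: "0 \<le> b" "b < pi/2" "sin b = m"
      using m01 arcsin_lt_bounded[of m] arcsin_le_arcsin[of 0 m] unfolding b_def by auto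
    have cb: "cos b = sqrt (1 - m\<^sup>2)" using b cos_arcsin[of m] m01 by (simp add: b_def)
    have cb0: "cos b > 0" using b by (intro cos_gt_zero_pi) auto
    define h where "h = (if I \<ge> 0 then m else - m)"
    have h: "\<bar>h\<bar> = m" "h * I = m * \<bar>I\<bar>" "h\<^sup>2 = m\<^sup>2" using m01 by (auto simp: h_def)
    have hc: "h = 0 \<or> integrable lborel ?f" using nv(2)[of m] m01 x0 h by (cases "m = 0") (auto simp: m_def)
    \<comment> \<open>If \<open>v\<close> vanishes somewhere, nothing is known about
      \<open>I\<close>, which is then multiplied by \<open>m = 0\<close>.\<close>
    have A: "m = 0 \<or> chord_area \<bar>al\<bar> \<le> \<bar>I\<bar> / 2 + \<bar>d\<bar>" using nv(1)[of m] m01 x0 by (cases "m = 0") (auto simp: m_def)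
    have hb: "\<bar>h\<bar> < 1" "\<And>x. \<bar>h\<bar> \<le> norm (v x)" "norm (v x0) = \<bar>h\<bar>" using h m01 x0 by (auto simp: m_def)
    note SB = slack_bound[OF f hb slack_int(2)[OF hc]]
    have Jh: "sqrt 2 * chord_primitive h (sqrt (1 - h\<^sup>2)) = chord_energy b - sqrt 2 * m * chord_area b"
      using chord_primitive_value(1)[OF b(1,2)] chord_primitive_value(2)[OF b(1,2), of m "sqrt (1 - m\<^sup>2)"] h(3) cb b(3) 
      by (auto simp: h_def)
    have sE: "integral\<^sup>L lborel (slack h v g) = ?E - sqrt 2 * m * (\<bar>I\<bar> / 2)"
      unfolding slack_int(1)[OF hc] using h(2) by (simp add: field_simps)
    have mA: "m * chord_area \<bar>al\<bar> \<le> m * (\<bar>I\<bar> / 2 + \<bar>d\<bar>)" using A m01 by (auto intro: mult_left_mono)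
    have md: "m * \<bar>d\<bar> \<le> \<bar>d\<bar>" using m01 by (simp add: mult_left_le_one_le)
    have mm: "sqrt 2 * m * chord_area \<bar>al\<bar> \<le> sqrt 2 * m * (\<bar>I\<bar> / 2) + sqrt 2 * \<bar>d\<bar>"
    proof -
      have "m * chord_area \<bar>al\<bar> \<le> m * (\<bar>I\<bar> / 2) + \<bar>d\<bar>" using mA md by (simp add: distrib_left)
      then have "sqrt 2 * (m * chord_area \<bar>al\<bar>) \<le> sqrt 2 * (m * (\<bar>I\<bar> / 2) + \<bar>d\<bar>)" by (intro mult_left_mono) auto
      then show ?thesis by (simp add: algebra_simps)
    qed
    have E: "chord_energy b + sqrt 2 * m * (chord_area \<bar>al\<bar> - chord_area b) \<le> ?E + sqrt 2 * \<bar>d\<bar>"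
      using SB(1) mm unfolding Jh sE by (simp add: algebra_simps)
    have tan: "chord_energy \<bar>al\<bar> \<le> chord_energy b + sqrt 2 * m * (chord_area \<bar>al\<bar> - chord_area b)"
      using chord_tangent_le[of b "\<bar>al\<bar>"] b ga by simp
    show ?thesis
    proof (intro conjI impI)
      show "chord_energy al \<le> ?E + sqrt 2 * \<bar>d\<bar>" using E tan by (simp add: chord_energy_abs)
      assume d0: "d = 0" and le: "?E \<le> chord_energy al"
      \<comment> \<open>By strict concavity, equality is possible only if the point of tangency is
        the prescribed chord.\<close>
      have bal: "b = \<bar>al\<bar>"
      proof (rule ccontr)
        assume "b \<noteq> \<bar>al\<bar>"
        then have "chord_energy \<bar>al\<bar> < chord_energy b + sqrt 2 * m * (chord_area \<bar>al\<bar> - chord_area b)"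
          using chord_tangent[of b "\<bar>al\<bar>"] b ga by simp
        then show False using E d0 le by (simp add: chord_energy_abs)
      qed
      have "integral\<^sup>L lborel (slack h v g) \<le> sqrt 2 * chord_primitive h (sqrt (1 - h\<^sup>2))"
      proof -
        have "chord_energy b = chord_energy al" "sqrt 2 * m * chord_area b = sqrt 2 * m * chord_area \<bar>al\<bar>" "sqrt 2 * \<bar>d\<bar> = 0"
          using bal d0 by (simp_all add: chord_energy_abs)
        then show ?thesis unfolding Jh sE using le mm by linarith
      qed
      then obtain x1 x2 where x12: "- x2 \<le> x1" "sharp_right h v g x1" "sharp_right h (mirror v) (mirror' g) x2" using SB(2) by blast
      have Ele: "?E \<le> 2 * sqrt 2 / 3 * sqrt (1 - h\<^sup>2) ^ 3"
      proof -
        have "sqrt (1 - h\<^sup>2) = cos al" unfolding h(3) cb[symmetric] bal by simp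
        then show ?thesis using le by (simp add: chord_energy_def)
      qed
      have lim0: "mseq v g \<longlonglongrightarrow> - 1" if "h = 0"
      proof -
        have "m = 0" using h(1) that by simp
        then have "al = 0" using bal by (simp add: b_def)
        then have "cis (2 * q) = cis pi" using q d0 by (simp add: soliton_momentum_eq)
        then show ?thesis using lim by simp
      qed
      obtain w where w: "norm w = 1" "\<And>x. v x = w * Complex (profile (sqrt (1 - h\<^sup>2)) (x - x1)) (- h)"
        using sharp_imp_soliton[OF f hb(1) x12(2,3,1) Ele lim0] by blast
      define be where "be = - arcsin h"
      have hh: "- 1 < h" "h < 1" using hb(1) by auto
      have "sin be = - h" "cos be = sqrt (1 - h\<^sup>2)" using hh by (auto simp: be_def cos_arcsin)
      moreover have "\<bar>be\<bar> < pi/2" using arcsin_lt_bounded[OF hh] by (auto simp: be_def abs_less_iff)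
      ultimately show "\<exists>w a be. norm w = 1 \<and> \<bar>be\<bar> < pi/2 \<and> (\<forall>x. v x = w * Complex (profile (cos be) (x - a)) (sin be))"
        using w by (intro exI[of _ w] exI[of _ x1] exI[of _ be]) auto
    qed
  qed
  then show "chord_energy al \<le> ?E + sqrt 2 * \<bar>d\<bar>"
    and "d = 0 \<Longrightarrow> ?E \<le> chord_energy al \<Longrightarrow>
      \<exists>w a be. norm w = 1 \<and> \<bar>be\<bar> < pi/2 \<and> (\<forall>x. v x = w * Complex (profile (cos be) (x - a)) (sin be))" by blast+
qed

definition sol :: "complex \<Rightarrow> real \<Rightarrow> real \<Rightarrow> real \<Rightarrow> complex" where
  "sol w a al x = w * Complex (profile (cos al) (x - a)) (sin al)"

definition sol' :: "complex \<Rightarrow> real \<Rightarrow> real \<Rightarrow> real \<Rightarrow> complex" where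
  "sol' w a al x = w * of_real (((cos al)\<^sup>2 - (profile (cos al) (x - a))\<^sup>2) / sqrt 2)"

lemma soliton_facts:
  assumes al: "\<bar>al\<bar> < pi/2" and w: "norm w = 1"
  shows "finen (sol w a al) (sol' w a al)"
    and "integral\<^sup>L lborel (dens (sol w 0 al) (sol' w 0 al)) = chord_energy al"
    and "mseq (sol w a al) (sol' w a al) \<longlonglongrightarrow> cis (2 * soliton_momentum al)"
proof -
  let ?c = "cos al" and ?p = "\<lambda>x. profile (cos al) (x - a)"
  have c0: "?c > 0" using al by (intro cos_gt_zero_pi) auto
  have dp: "DERIV ?p x :> (?c\<^sup>2 - (?p x)\<^sup>2) / sqrt 2" for x
  proof -
    have "DERIV (\<lambda>x. x - a) x :> 1" by (auto intro!: derivative_eq_intros)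
    from DERIV_chain2[where f="profile ?c" and g="\<lambda>x. x - a", OF profile_DERIV this] show ?thesis by simp
  qed
  have cp: "continuous_on UNIV ?p" using dp by (intro DERIV_continuous_on) (blast intro: DERIV_subset)
  have ap: "ac ?p (\<lambda>x. (?c\<^sup>2 - (?p x)\<^sup>2) / sqrt 2)"
    using dp by (intro ac_C1 continuous_intros cp) (auto simp: has_real_derivative_iff_has_vector_derivative)
  have "ac (\<lambda>x. complex_of_real (?p x) + \<i> * of_real (sin al)) (\<lambda>x. of_real ((?c\<^sup>2 - (?p x)\<^sup>2) / sqrt 2) + 0)"
    by (intro ac_add ac_const ac_linear[OF bounded_linear_of_real ap])
  from ac_linear[OF bounded_linear_mult_right[of w] this] have a1: "ac (sol w a al) (sol' w a al)"
    by (simp add: sol_def[abs_def] sol'_def[abs_def] complex_eq_iff Complex_eq)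
  have eta: "1 - (norm (sol w a al x))\<^sup>2 = ?c\<^sup>2 - (profile ?c (x - a))\<^sup>2" for x a
    using w by (simp add: sol_def norm_mult cmod_power2 cos_squared_eq)
  have ng: "(norm (sol' w a al x))\<^sup>2 = (?c\<^sup>2 - (profile ?c (x - a))\<^sup>2)\<^sup>2 / 2" for x a
    unfolding sol'_def norm_mult norm_of_real power_mult_distrib power2_abs w by (simp add: power_divide)
  have i: "integrable lborel (\<lambda>x. (?c\<^sup>2 - (profile ?c (x - a))\<^sup>2)\<^sup>2 / 2)"
    using lborel_integrable_real_affine[OF profile_integral(1)[OF c0], of 1 "- a"] by simp
  then have "integrable lborel (\<lambda>x. 2 * ((?c\<^sup>2 - (profile ?c (x - a))\<^sup>2)\<^sup>2 / 2))" by (rule integrable_mult_right)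
  then show fi: "finen (sol w a al) (sol' w a al)" using i a1 by (simp add: finen_def ng eta)
  have "dens (sol w 0 al) (sol' w 0 al) x = (?c\<^sup>2 - (profile ?c x)\<^sup>2)\<^sup>2 / 2" for x
    unfolding dens_def ng eta by simp
  then have d: "dens (sol w 0 al) (sol' w 0 al) = (\<lambda>x. (?c\<^sup>2 - (profile ?c x)\<^sup>2)\<^sup>2 / 2)" by blast
  show "integral\<^sup>L lborel (dens (sol w 0 al) (sol' w 0 al)) = chord_energy al"
    unfolding d chord_energy_def by (simp only: profile_integral(2)[OF c0])
  have ww: "w * cnj w = 1" using w by (simp add: complex_norm_square[symmetric])
  have cu: "curr (sol w a al) (sol' w a al) x = - sin al * ((?c\<^sup>2 - (?p x)\<^sup>2) / sqrt 2)" for x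
  proof -
    have "cnj (sol w a al x) * sol' w a al x = (w * cnj w) * (cnj (Complex (?p x) (sin al)) * of_real ((?c\<^sup>2 - (?p x)\<^sup>2) / sqrt 2))"
      by (simp add: sol_def sol'_def mult_ac)
    then show ?thesis unfolding curr_def ww by simp
  qed
  have ci: "integral {- real n..real n} (curr (sol w a al) (sol' w a al)) = - sin al * (?p (real n) - ?p (- real n))" for n
    unfolding cu[abs_def] using acD(2)[OF ap, of "- real n" "real n"] by simp
  have n1: "filterlim (\<lambda>n. real n - a) at_top sequentially"
    using filterlim_tendsto_add_at_top[OF tendsto_const[of "- a"] filterlim_real_sequentially] by simp
  have t1: "(\<lambda>n. ?p (real n)) \<longlonglongrightarrow> ?c" by (rule filterlim_compose[OF profile_tendsto(1)[OF c0] n1])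
  have n2: "filterlim (\<lambda>n. - real n - a) at_bot sequentially"
    using filterlim_tendsto_add_at_top[OF tendsto_const[of "a"] filterlim_real_sequentially]
    unfolding filterlim_uminus_at_bot by (simp add: add.commute)
  have t2: "(\<lambda>n. ?p (- real n)) \<longlonglongrightarrow> - ?c" by (rule filterlim_compose[OF profile_tendsto(2)[OF c0] n2])
  have w0: "w \<noteq> 0" using w by auto
  have ca: "w * Complex ?c (sin al) = w * cis al" "w * Complex (- ?c) (sin al) = w * - cnj (cis al)" by (auto simp: complex_eq_iff)
  have "(\<lambda>n. sgn (sol w a al (real n))) \<longlonglongrightarrow> sgn (w * Complex ?c (sin al))"
    unfolding sol_def by (intro tendsto_sgn tendsto_mult tendsto_const tendsto_Complex t1) (use w0 in \<open>simp add: ca\<close>)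
  then have s1: "(\<lambda>n. sgn (sol w a al (real n))) \<longlonglongrightarrow> w * cis al" unfolding ca using w by (simp add: sgn_eq norm_mult)
  have "(\<lambda>n. sgn (sol w a al (- real n))) \<longlonglongrightarrow> sgn (w * Complex (- ?c) (sin al))"
    unfolding sol_def by (intro tendsto_sgn tendsto_mult tendsto_const tendsto_Complex t2) (use w0 in \<open>simp add: ca\<close>)
  then have s2: "(\<lambda>n. sgn (sol w a al (- real n))) \<longlonglongrightarrow> w * - cnj (cis al)" unfolding ca using w by (simp add: sgn_eq norm_mult)
  have c1: "(\<lambda>n. cis (- (- sin al * (?p (real n) - ?p (- real n))))) \<longlonglongrightarrow> cis (- (- sin al * (?c - - ?c)))"
    unfolding cis_conv_exp by (intro tendsto_intros t1 t2)
  have "mseq (sol w a al) (sol' w a al) \<longlonglongrightarrow> (w * cis al) * cnj (w * - cnj (cis al)) * cis (- (- sin al * (?c - - ?c)))"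
    unfolding mseq_def[abs_def] ci by (intro tendsto_mult s1 c1 tendsto_cnj s2)
  also have "(w * cis al) * cnj (w * - cnj (cis al)) * cis (- (- sin al * (?c - - ?c))) = (w * cnj w) * (- (cis al * cis al * cis (2 * (sin al * ?c))))"
    by (simp add: mult_ac)
  also have "\<dots> = cis (2 * soliton_momentum al)"
  proof -
    have "2 * soliton_momentum al = al + al + 2 * (sin al * cos al) + pi" by (simp add: soliton_momentum_eq)
    then show ?thesis unfolding ww cis_mult by (simp add: minus_cis)
  qed
  finally show "mseq (sol w a al) (sol' w a al) \<longlonglongrightarrow> cis (2 * soliton_momentum al)" .
qed

lemma dark_soliton_sol:
  assumes "\<bar>al\<bar> < pi/2"
  shows "dark_soliton (sqrt 2 * sin al) x = sol 1 0 al x"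
proof -
  have c0: "cos al > 0" using assms by (intro cos_gt_zero_pi) auto
  have 1: "(2 - (sqrt 2 * sin al)\<^sup>2) / 2 = (cos al)\<^sup>2" by (simp add: power_mult_distrib cos_squared_eq)
  then have "sqrt ((2 - (sqrt 2 * sin al)\<^sup>2) / 2) = cos al" using c0 by simp
  moreover have "sqrt (2 - (sqrt 2 * sin al)\<^sup>2) / 2 * x = cos al * x / sqrt 2"
  proof -
    have "sqrt (2 - (sqrt 2 * sin al)\<^sup>2) = sqrt (2 * (cos al)\<^sup>2)" using 1 by simp
    also have "\<dots> = sqrt 2 * cos al" using c0 by (simp add: real_sqrt_mult)
    finally show ?thesis by (simp add: field_simps)
  qed
  ultimately show ?thesis unfolding dark_soliton_def sol_def profile_def by (simp add: complex_eq_iff)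
qed

lemma sol_borel: "\<bar>al\<bar> < pi/2 \<Longrightarrow> norm w = 1 \<Longrightarrow> sol w a al \<in> borel_measurable borel"
  using soliton_facts(1) finenD(4) by blast

lemma soliton_line:
  assumes "\<bar>al\<bar> < pi/2"
  shows "dark_soliton (sqrt 2 * sin al) \<in> X_line" "E_line (dark_soliton (sqrt 2 * sin al)) = chord_energy al"
    "[momentum_line (dark_soliton (sqrt 2 * sin al)) = soliton_momentum al] (rmod pi)"
proof -
  have eq: "dark_soliton (sqrt 2 * sin al) = sol 1 0 al" using dark_soliton_sol[OF assms] by blast
  note S = soliton_facts[OF assms norm_one]
  show "dark_soliton (sqrt 2 * sin al) \<in> X_line" "E_line (dark_soliton (sqrt 2 * sin al)) = chord_energy al"
    unfolding eq using X_lineI[OF S(1)[of 0] sol_borel[OF assms norm_one, of 0]] S(2) by auto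
  show "[momentum_line (dark_soliton (sqrt 2 * sin al)) = soliton_momentum al] (rmod pi)"
    unfolding eq by (rule momentum_cong[OF S(1)[of 0] sol_borel[OF assms norm_one] _ S(3)]) simp
qed

text \<open>The values stay in the open interval from 0 to \<pi>, so congruence modulo \<pi> means
  equality, and \<open>chord_area\<close> is strictly monotone.\<close>

lemma soliton_momentum_inj:
  assumes "\<bar>a\<bar> < pi/2" "\<bar>b\<bar> < pi/2" "[soliton_momentum a = soliton_momentum b] (rmod pi)"
  shows "a = b"
proof -
  obtain n :: int where n: "soliton_momentum b = soliton_momentum a + of_int n * pi" using assms(3) by (auto simp: rcong_altdef)
  have r: "0 < soliton_momentum x \<and> soliton_momentum x < pi" if "\<bar>x\<bar> < pi/2" for x
    using chord_area_pos[of x] chord_area_pos[of "- x"] that unfolding soliton_momentum_def chord_area_uminus by auto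
  have "\<bar>of_int n * pi\<bar> < pi" using r[OF assms(1)] r[OF assms(2)] n by linarith
  then have "n = 0" by (simp add: abs_mult)
  then have "chord_area a = chord_area b" using n by (simp add: soliton_momentum_def)
  moreover have "- (pi/2) \<le> a" "a \<le> pi/2" "- (pi/2) \<le> b" "b \<le> pi/2" using assms(1,2) by linarith+
  ultimately show "a = b"
    using chord_area_strict_antimono[of a b] chord_area_strict_antimono[of b a] by (cases a b rule: linorder_cases) auto
qed

text \<open>The substitution \<open>c = sqrt 2 * sin al\<close> turns the speed into the angle of
  the chord. Continuity and the boundary values 0 and \<pi> give existence, injectivity gives
  uniqueness, so the definite description in \<open>soliton_speed\<close> denotes.\<close>

lemma speed_param:
  assumes "\<not> [p = 0] (rmod pi)"
  obtains al where "\<bar>al\<bar> < pi/2" "[soliton_momentum al = p] (rmod pi)" "soliton_speed p = sqrt 2 * sin al"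
proof -
  define p0 where "p0 = p rmod pi"
  have p0: "0 < p0" "p0 < pi"
    using assms rmod_nonneg[of pi p] rmod_less[of pi p] by (auto simp: p0_def rcong_0_iff less_le)
  have cont: "continuous_on {- (pi/2)..pi/2} soliton_momentum"
    unfolding soliton_momentum_eq[abs_def] by (intro continuous_intros)
  obtain al where al: "- (pi/2) \<le> al" "al \<le> pi/2" "soliton_momentum al = p0"
    using IVT'[of soliton_momentum "- (pi/2)" p0 "pi/2", OF _ _ _ cont] p0 by (auto simp: soliton_momentum_eq)
  have "al \<noteq> pi/2" "al \<noteq> - (pi/2)" 
  proof -
    have "soliton_momentum (pi/2) = pi" "soliton_momentum (- (pi/2)) = 0" by (simp_all add: soliton_momentum_eq)
    then show "al \<noteq> pi/2" "al \<noteq> - (pi/2)" using al(3) p0 by force+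
  qed
  then have a: "\<bar>al\<bar> < pi/2" using al by auto
  have c: "[soliton_momentum al = p] (rmod pi)" using al(3) by (simp add: p0_def)
  have "soliton_speed p = sqrt 2 * sin al"
    unfolding soliton_speed_def
  proof (rule the_equality)
    have "\<bar>sin al\<bar> < 1"
    proof -
      have "cos al > 0" using a by (intro cos_gt_zero_pi) auto
      then have "(sin al)\<^sup>2 < 1" using sin_cos_squared_add[of al] zero_less_power[of "cos al" 2] by linarith
      then show ?thesis by (simp add: abs_square_less_1)
    qed
    then have "\<bar>sqrt 2 * sin al\<bar> < sqrt 2" by (simp add: abs_mult)
    then show "- sqrt 2 < sqrt 2 * sin al \<and> sqrt 2 * sin al < sqrt 2 \<and> [momentum_line (dark_soliton (sqrt 2 * sin al)) = p] (rmod pi)"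
      using rcong_trans[OF soliton_line(3)[OF a] c] by (auto simp: abs_less_iff)
  next
    fix c' assume c': "- sqrt 2 < c' \<and> c' < sqrt 2 \<and> [momentum_line (dark_soliton c') = p] (rmod pi)"
    define b where "b = arcsin (c' / sqrt 2)"
    have r: "- 1 < c' / sqrt 2" "c' / sqrt 2 < 1" using c' by (auto simp: field_simps)
    have b: "\<bar>b\<bar> < pi/2" using arcsin_lt_bounded[OF r] by (auto simp: b_def abs_less_iff)
    have cb: "c' = sqrt 2 * sin b" using r by (simp add: b_def)
    have "[soliton_momentum b = soliton_momentum al] (rmod pi)"
      using soliton_line(3)[OF b] c' c unfolding cb rcong_def by simp
    then show "c' = sqrt 2 * sin al" using soliton_momentum_inj[OF b a] cb by simp
  qed
  then show ?thesis using that a c by blast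
qed

lemma line_bound:
  assumes "\<psi> \<in> X_line" "\<bar>al\<bar> < pi/2" "[momentum_line \<psi> + d = soliton_momentum al] (rmod pi)"
  shows "chord_energy al \<le> E_line \<psi> + sqrt 2 * \<bar>d\<bar>"
proof -
  obtain v where v: "finen v (weak_deriv 1 \<psi>)" "AE x in lborel. \<psi> x = v x" "\<psi> \<in> borel_measurable borel"
    "E_line \<psi> = integral\<^sup>L lborel (dens v (weak_deriv 1 \<psi>))" by (rule X_line_rep[OF assms(1)])
  show ?thesis unfolding v(4)
    by (rule line_main(1)[OF v(1) mseq_tendsto[OF v(1,3,2)] assms(2)]) (use assms(3) in \<open>simp add: rcong_pi_iff\<close>)
qed

text \<open>The rigidity part of \<open>line_main\<close> leaves the angle of the chord open;
  comparing the momenta, which determine the angle, identifies it with \<open>al\<close>.\<close>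

lemma line_rigidity:
  assumes "\<psi> \<in> X_line" "\<bar>al\<bar> < pi/2" "[momentum_line \<psi> = soliton_momentum al] (rmod pi)" "E_line \<psi> \<le> chord_energy al"
  shows "\<exists>a \<theta>. AE x in lborel. \<psi> x = exp (\<i> * of_real \<theta>) * dark_soliton (sqrt 2 * sin al) (x - a)"
proof -
  obtain v where v: "finen v (weak_deriv 1 \<psi>)" "AE x in lborel. \<psi> x = v x" "\<psi> \<in> borel_measurable borel"
    "E_line \<psi> = integral\<^sup>L lborel (dens v (weak_deriv 1 \<psi>))" by (rule X_line_rep[OF assms(1)])
  obtain w a be where w: "norm w = 1" "\<bar>be\<bar> < pi/2" "\<And>x. v x = w * Complex (profile (cos be) (x - a)) (sin be)"
    using line_main(2)[OF v(1) mseq_tendsto[OF v(1,3,2)] assms(2), of 0] assms(3,4) by (auto simp: rcong_pi_iff v(4))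
  have vs: "v = sol w a be" using w(3) by (auto simp: sol_def)
  note S = soliton_facts[OF w(2,1)]
  have "[momentum_line \<psi> = soliton_momentum be] (rmod pi)"
    by (rule momentum_cong[OF S(1) v(3) _ S(3), of a]) (use v(2) vs in simp)
  then have "be = al" using soliton_momentum_inj[OF w(2) assms(2)] assms(3) by (simp add: rcong_def)
  moreover obtain \<theta> where "w = exp (\<i> * of_real \<theta>)" using w(1) by (metis complex_norm_eq_1_exp)
  moreover have "sol w a al x = w * dark_soliton (sqrt 2 * sin al) (x - a)" for x
    unfolding dark_soliton_sol[OF assms(2)] by (simp add: sol_def)
  ultimately show ?thesis using v(2) vs by auto
qed

lemma I_line_eq:
  assumes "\<bar>al\<bar> < pi/2" "[soliton_momentum al = p] (rmod pi)"
  shows "I_line p = chord_energy al"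
  unfolding I_line_def
proof (rule cInf_eq_minimum)
  show "chord_energy al \<in> {E_line \<psi> |\<psi>. \<psi> \<in> X_line \<and> [momentum_line \<psi> = p] (rmod pi)}"
    using soliton_line[OF assms(1)] rcong_trans[OF _ assms(2)] by force
  fix e assume "e \<in> {E_line \<psi> |\<psi>. \<psi> \<in> X_line \<and> [momentum_line \<psi> = p] (rmod pi)}"
  then obtain \<psi> where "e = E_line \<psi>" "\<psi> \<in> X_line" "[momentum_line \<psi> = p] (rmod pi)" by blast
  then show "chord_energy al \<le> e" using line_bound[of \<psi> al 0] assms by (simp add: rcong_def)
qed

subsection \<open>Weak derivatives in the plane\<close>

lemma fubini_plane:
  fixes f :: "real \<times> real \<Rightarrow> 'b::{banach, second_countable_topology}"
  assumes "integrable lborel f"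
  shows "AE x in lborel. integrable lborel (\<lambda>y. f (x, y))" "integrable lborel (\<lambda>x. LINT y|lborel. f (x, y))"
    "(LINT x|lborel. LINT y|lborel. f (x, y)) = integral\<^sup>L lborel f"
    "AE y in lborel. integrable lborel (\<lambda>x. f (x, y))" "integrable lborel (\<lambda>y. LINT x|lborel. f (x, y))"
    "(LINT y|lborel. LINT x|lborel. f (x, y)) = integral\<^sup>L lborel f"
proof -
  have f: "integrable (lborel \<Otimes>\<^sub>M lborel) (case_prod (\<lambda>x y. f (x, y)))" using assms by (simp add: lborel_prod)
  have e: "integral\<^sup>L (lborel \<Otimes>\<^sub>M lborel) (case_prod (\<lambda>x y. f (x, y))) = integral\<^sup>L lborel f" by (simp add: lborel_prod)
  show "AE x in lborel. integrable lborel (\<lambda>y. f (x, y))" by (rule lborel_pair.AE_integrable_fst[OF f])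
  show "integrable lborel (\<lambda>x. LINT y|lborel. f (x, y))" by (rule lborel_pair.integrable_fst[OF f])
  show "(LINT x|lborel. LINT y|lborel. f (x, y)) = integral\<^sup>L lborel f" using lborel_pair.integral_fst[OF f] e by simp
  show "AE y in lborel. integrable lborel (\<lambda>x. f (x, y))" by (rule lborel_pair.AE_integrable_snd[OF f])
  show "integrable lborel (\<lambda>y. LINT x|lborel. f (x, y))" by (rule lborel_pair.integrable_snd[OF f])
  show "(LINT y|lborel. LINT x|lborel. f (x, y)) = integral\<^sup>L lborel f" using lborel_pair.integral_snd[OF f] e by simp
qed

lemma measurable_fst_snd_borel:
  fixes u :: "real \<Rightarrow> 'b::topological_space"
  assumes "u \<in> borel_measurable borel"
  shows "(\<lambda>z::real \<times> real. u (fst z)) \<in> borel_measurable borel" "(\<lambda>z::real \<times> real. u (snd z)) \<in> borel_measurable borel"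
proof -
  have "fst \<in> (borel :: (real \<times> real) measure) \<rightarrow>\<^sub>M borel" "snd \<in> (borel :: (real \<times> real) measure) \<rightarrow>\<^sub>M borel"
    by (simp_all add: borel_prod[symmetric])
  then show "(\<lambda>z::real \<times> real. u (fst z)) \<in> borel_measurable borel" "(\<lambda>z::real \<times> real. u (snd z)) \<in> borel_measurable borel"
    using measurable_compose[OF _ assms] by auto
qed

lemma tensor_integrable:
  fixes u :: "real \<Rightarrow> 'b::{banach, second_countable_topology}" and w :: "real \<Rightarrow> real"
  assumes u: "integrable lborel u" and w: "integrable lborel w"
  shows "integrable lborel (\<lambda>z::real \<times> real. w (snd z) *\<^sub>R u (fst z))"
    and "(LINT z|lborel. w (snd z) *\<^sub>R u (fst z)) = integral\<^sup>L lborel w *\<^sub>R integral\<^sup>L lborel u"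
proof -
  have m: "(\<lambda>z::real \<times> real. w (snd z) *\<^sub>R u (fst z)) \<in> borel_measurable borel"
    using measurable_fst_snd_borel(2)[of w] measurable_fst_snd_borel(1)[of u] u w by (intro borel_measurable_scaleR) auto
  have "integrable (lborel \<Otimes>\<^sub>M lborel) (\<lambda>z::real \<times> real. w (snd z) *\<^sub>R u (fst z))"
  proof (rule lborel_pair.Fubini_integrable)
    show "(\<lambda>z::real \<times> real. w (snd z) *\<^sub>R u (fst z)) \<in> borel_measurable (lborel \<Otimes>\<^sub>M lborel)" using m by (simp add: lborel_prod)
    show "integrable lborel (\<lambda>x. LINT y|lborel. norm (w (snd (x, y)) *\<^sub>R u (fst (x, y))))" using u by simp
    show "AE x in lborel. integrable lborel (\<lambda>y. w (snd (x, y)) *\<^sub>R u (fst (x, y)))" using w by simp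
  qed
  then show i: "integrable lborel (\<lambda>z::real \<times> real. w (snd z) *\<^sub>R u (fst z))" by (simp add: lborel_prod)
  show "(LINT z|lborel. w (snd z) *\<^sub>R u (fst z)) = integral\<^sup>L lborel w *\<^sub>R integral\<^sup>L lborel u"
    using fubini_plane(3)[OF i] w by simp
qed

lemma AE_fst: "AE x in lborel. P x \<Longrightarrow> AE z in (lborel :: (real \<times> real) measure). P (fst z)"
  and AE_snd: "AE x in lborel. P x \<Longrightarrow> AE z in (lborel :: (real \<times> real) measure). P (snd z)"
proof -
  assume A: "AE x in lborel. P x"
  obtain N where N0: "\<And>x. x \<in> space lborel - N \<Longrightarrow> P x" and N1: "N \<in> null_sets lborel" using AE_E3[OF A] by blast
  then have N: "N \<in> null_sets lborel" "\<And>x. \<not> P x \<Longrightarrow> x \<in> N" by auto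
  have nb: "N \<in> sets lborel" "emeasure lborel N = 0" using N by auto
  have "emeasure (lborel \<Otimes>\<^sub>M lborel) (N \<times> (UNIV::real set)) = 0" "emeasure (lborel \<Otimes>\<^sub>M lborel) ((UNIV::real set) \<times> N) = 0"
    using nb by (simp_all add: lborel.emeasure_pair_measure_Times)
  moreover have "N \<times> (UNIV::real set) \<in> sets (lborel \<Otimes>\<^sub>M lborel)" "(UNIV::real set) \<times> N \<in> sets (lborel \<Otimes>\<^sub>M lborel)" using nb by auto
  ultimately have n: "N \<times> (UNIV::real set) \<in> null_sets lborel" "(UNIV::real set) \<times> N \<in> null_sets lborel"
    unfolding null_sets_def lborel_prod by auto
  show "AE z in (lborel :: (real \<times> real) measure). P (fst z)" by (rule AE_I'[OF n(1)]) (auto dest: N(2))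
  show "AE z in (lborel :: (real \<times> real) measure). P (snd z)" by (rule AE_I'[OF n(2)]) (auto dest: N(2))
qed

lemma AE_plane: "AE z in (lborel :: (real \<times> real) measure). P z \<Longrightarrow> AE x in lborel. AE y in lborel. P (x, y)"
proof -
  assume "AE z in (lborel :: (real \<times> real) measure). P z"
  then have "AE z in lborel \<Otimes>\<^sub>M lborel. P z" unfolding lborel_prod .
  then show ?thesis by (rule lborel_pair.AE_pair)
qed

text \<open>Exceptional null sets can be united only over countably many squares; these exhaust the
  plane, and every compact subset of a line lies in one of the corresponding intervals.\<close>

lemma L1_loc_slice:
  fixes f :: "real \<times> real \<Rightarrow> 'b::{banach, second_countable_topology}"
  assumes f: "L1_loc f"
  shows "AE x in lborel. L1_loc (\<lambda>y. f (x, y))"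
proof -
  have *: "L1_loc g" if "\<And>n::nat. set_integrable lborel {- real n..real n} g" for g :: "real \<Rightarrow> 'b"
    unfolding L1_loc_def
  proof (intro allI impI)
    fix K :: "real set" assume K: "compact K"
    then obtain M where "\<forall>x\<in>K. norm x \<le> M" using compact_imp_bounded bounded_iff by metis
    moreover obtain n where "M \<le> real n" using real_arch_simple by blast
    ultimately have "K \<subseteq> {- real n..real n}" by (force simp: abs_le_iff)
    then show "set_integrable lborel K g" using set_integrable_subset[OF that[of n]] borel_compact[OF K] by simp
  qed
  have "AE x in lborel. \<forall>n::nat. integrable lborel (\<lambda>y. indicator (cbox (- real n, - real n) (real n, real n)) (x, y) *\<^sub>R f (x, y))"
    unfolding AE_all_countable
  proof
    fix n :: nat
    have "integrable lborel (\<lambda>z. indicator (cbox (- real n, - real n) (real n, real n)) z *\<^sub>R f z)"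
      using L1_locD[OF f compact_cbox] by (simp add: set_integrable_def)
    from fubini_plane(1)[OF this]
    show "AE x in lborel. integrable lborel (\<lambda>y. indicator (cbox (- real n, - real n) (real n, real n)) (x, y) *\<^sub>R f (x, y))" .
  qed
  then show ?thesis
  proof eventually_elim
    fix x assume i: "\<forall>n::nat. integrable lborel (\<lambda>y. indicator (cbox (- real n, - real n) (real n, real n)) (x, y) *\<^sub>R f (x, y))"
    show "L1_loc (\<lambda>y. f (x, y))"
    proof (rule *)
      fix n :: nat
      obtain k where k: "\<bar>x\<bar> \<le> real k" using real_arch_simple by blast
      define N where "N = max n k"
      have kn: "real k \<le> real N" "real n \<le> real N" by (auto simp: N_def)
      have "set_integrable lborel {- real N..real N} (\<lambda>y. f (x, y))"
        using i[rule_format, of N] k kn by (simp add: set_integrable_def cbox_Pair_eq indicator_times abs_le_iff)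
      then show "set_integrable lborel {- real n..real n} (\<lambda>y. f (x, y))"
        by (rule set_integrable_subset) (use kn in auto)
    qed
  qed
qed

lemma compact_in_square:
  fixes K :: "(real \<times> real) set"
  assumes "compact K" obtains M where "M > 0" "K \<subseteq> {-M..M} \<times> {-M..M}"
proof -
  obtain M where M: "M > 0" "\<forall>z\<in>K. norm z \<le> M" using assms compact_imp_bounded bounded_pos by metis
  have "z \<in> {-M..M} \<times> {-M..M}" if "z \<in> K" for z
  proof -
    have "norm (fst z) \<le> M" "norm (snd z) \<le> M" using M(2) that norm_fst_le[of "fst z" "snd z"] norm_snd_le[of "snd z" "fst z"] by force+
    then show ?thesis by (cases z) (auto simp: abs_le_iff)
  qed
  then show ?thesis using that M(1) by blast
qed

lemma L1_loc_fst_snd: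
  fixes u :: "real \<Rightarrow> 'b::{banach, second_countable_topology}"
  assumes u: "L1_loc u"
  shows "L1_loc (\<lambda>z::real \<times> real. u (fst z))" "L1_loc (\<lambda>z::real \<times> real. u (snd z))"
proof -
  note mu = measurable_fst_snd_borel[OF L1_loc_measurable[OF u]]
  have "set_integrable lborel K (\<lambda>z. u (fst z)) \<and> set_integrable lborel K (\<lambda>z. u (snd z))" if K: "compact K" for K :: "(real \<times> real) set"
  proof -
    obtain M where M: "M > 0" "K \<subseteq> {-M..M} \<times> {-M..M}" using compact_in_square[OF K] by blast
    have i1: "integrable lborel (\<lambda>x. indicator {-M..M} x *\<^sub>R u x)" using L1_locD[OF u, of "{-M..M}"] by (simp add: set_integrable_def)
    have i2: "integrable lborel (indicator {-M..M} :: real \<Rightarrow> real)" 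
      using L1_locD[OF L1_loc_continuous[of "\<lambda>x. 1::real"], of "{-M..M}"] by (simp add: set_integrable_def)
    have "set_integrable lborel ({-M..M} \<times> {-M..M}) (\<lambda>z. u (fst z))"
      using tensor_integrable(1)[OF i1 i2] by (simp add: set_integrable_def indicator_times mult.commute)
    moreover have "set_integrable lborel ({-M..M} \<times> {-M..M}) (\<lambda>z. u (snd z))"
    proof -
      have "integrable (lborel \<Otimes>\<^sub>M lborel) (\<lambda>z::real \<times> real. indicator {-M..M} (snd z) *\<^sub>R (indicator {-M..M} (fst z) *\<^sub>R u (fst z)))"
        using tensor_integrable(1)[OF i1 i2] by (simp add: lborel_prod)
      from lborel_pair.integrable_product_swap[OF this]
      have "integrable lborel (\<lambda>(x, y). indicator {-M..M} x *\<^sub>R (indicator {-M..M} y *\<^sub>R u y))" by (simp add: lborel_prod)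
      then show ?thesis by (simp add: set_integrable_def indicator_times case_prod_beta')
    qed
    ultimately show ?thesis using set_integrable_subset M(2) borel_compact[OF K] by (metis sets_lborel)
  qed
  then show "L1_loc (\<lambda>z::real \<times> real. u (fst z))" "L1_loc (\<lambda>z::real \<times> real. u (snd z))" by (auto simp: L1_loc_def)
qed

lemma test_tensor:
  assumes t: "test_function \<phi>" "test_function \<xi>"
  shows "test_function (\<lambda>z::real \<times> real. \<phi> (fst z) * \<xi> (snd z))"
    "frechet_derivative (\<lambda>z::real \<times> real. \<phi> (fst z) * \<xi> (snd z)) (at z) (1, 0) = deriv \<phi> (fst z) * \<xi> (snd z)"
    "frechet_derivative (\<lambda>z::real \<times> real. \<phi> (fst z) * \<xi> (snd z)) (at z) (0, 1) = \<phi> (fst z) * deriv \<xi> (snd z)"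
proof -
  let ?b = "\<lambda>b::real \<times> real. if b = (1, 0) then \<phi> else \<xi>"
  have "test_function (\<lambda>z::real \<times> real. \<Prod>b\<in>Basis. ?b b (z \<bullet> b))" using t by (intro test_function_prod) auto
  moreover have "(\<Prod>b\<in>Basis. ?b b (z \<bullet> b)) = \<phi> (fst z) * \<xi> (snd z)" for z :: "real \<times> real"
    by (simp add: Basis_prod_def inner_prod_def)
  ultimately show "test_function (\<lambda>z::real \<times> real. \<phi> (fst z) * \<xi> (snd z))" by simp
  have d: "(\<phi> has_derivative (*) (deriv \<phi> x)) (at x)" "(\<xi> has_derivative (*) (deriv \<xi> x)) (at x)" for x
    using test_deriv_real(1)[OF t(1)] test_deriv_real(1)[OF t(2)] by (auto simp: has_field_derivative_def)
  have d1: "((\<lambda>z. \<phi> (fst z)) has_derivative (\<lambda>h. deriv \<phi> (fst z) * fst h)) (at z)" 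
    "((\<lambda>z. \<xi> (snd z)) has_derivative (\<lambda>h. deriv \<xi> (snd z) * snd h)) (at z)" for z :: "real \<times> real"
    by (rule has_derivative_compose[OF has_derivative_fst[OF has_derivative_ident] d(1)],
        rule has_derivative_compose[OF has_derivative_snd[OF has_derivative_ident] d(2)])
  have "((\<lambda>z::real \<times> real. \<phi> (fst z) * \<xi> (snd z)) has_derivative (\<lambda>h. \<phi> (fst z) * (deriv \<xi> (snd z) * snd h) + (deriv \<phi> (fst z) * fst h) * \<xi> (snd z))) (at z)"
    by (rule has_derivative_mult[OF d1])
  then have e: "frechet_derivative (\<lambda>z::real \<times> real. \<phi> (fst z) * \<xi> (snd z)) (at z) = (\<lambda>h. \<phi> (fst z) * (deriv \<xi> (snd z) * snd h) + (deriv \<phi> (fst z) * fst h) * \<xi> (snd z))"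
    by (rule frechet_derivative_at[OF _, symmetric])
  show "frechet_derivative (\<lambda>z::real \<times> real. \<phi> (fst z) * \<xi> (snd z)) (at z) (1, 0) = deriv \<phi> (fst z) * \<xi> (snd z)"
    "frechet_derivative (\<lambda>z::real \<times> real. \<phi> (fst z) * \<xi> (snd z)) (at z) (0, 1) = \<phi> (fst z) * deriv \<xi> (snd z)"
    unfolding e by auto
qed

text \<open>By Fubini the weak derivative in one direction may be computed line by line, where
  integration by parts for absolutely continuous functions is available.\<close>

lemma slices_weak_deriv_snd:
  fixes f g :: "real \<times> real \<Rightarrow> 'b::euclidean_space"
  assumes L: "L1_loc f" "L1_loc g" and s: "AE x in lborel. ac (\<lambda>y. f (x, y)) (\<lambda>y. g (x, y))"
  shows "has_weak_deriv (0, 1) f g"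
  unfolding has_weak_deriv_def
proof (intro conjI L allI impI)
  fix \<phi> :: "real \<times> real \<Rightarrow> real" assume t: "test_function \<phi>"
  obtain G M where G: "\<And>x. (\<phi> has_derivative (\<lambda>h. h \<bullet> G x)) (at x)" "\<And>x b. frechet_derivative \<phi> (at x) b = G x \<bullet> b"
    "\<And>b. b \<in> Basis \<Longrightarrow> continuous_on UNIV (\<lambda>x. G x \<bullet> b)"
    "M > 0" "\<And>x. norm x > M \<Longrightarrow> \<phi> x = 0" "\<And>x. norm x > M \<Longrightarrow> G x = 0" using test_gradient[OF t] by blast
  have ap: "ac (\<lambda>y. \<phi> (x, y)) (\<lambda>y. G (x, y) \<bullet> (0, 1))" for x
  proof (rule ac_C1)
    show "continuous_on UNIV (\<lambda>y. G (x, y) \<bullet> (0, 1))"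
      by (rule continuous_on_compose2[OF G(3)]) (auto simp: Basis_prod_def intro!: continuous_intros)
    fix y :: real
    have "((\<lambda>y. (x, y)) has_derivative (\<lambda>h. (0, h))) (at y)" by (auto intro!: derivative_eq_intros)
    from diff_chain_at[OF this G(1)] have "((\<lambda>y. \<phi> (x, y)) has_derivative (\<lambda>h. (0, h) \<bullet> G (x, y))) (at y)" by (simp add: o_def)
    then show "((\<lambda>y. \<phi> (x, y)) has_vector_derivative G (x, y) \<bullet> (0, 1)) (at y)"
      by (simp add: has_vector_derivative_def inner_prod_def mult.commute)
  qed
  have z: "\<phi> (x, y) = 0 \<and> G (x, y) \<bullet> (0, 1) = 0" if "\<bar>y\<bar> > M" for x y
    using G(5,6)[of "(x, y)"] that norm_snd_le[of y x] by force
  have b: "(0, 1) \<in> (Basis :: (real \<times> real) set)" by (simp add: Basis_prod_def)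
  note i1 = test_deriv_integrable[OF t L(1) b] and i2 = test_integrable[OF t L(2)]
  have "(LINT x|lborel. LINT y|lborel. frechet_derivative \<phi> (at (x, y)) (0, 1) *\<^sub>R f (x, y)) = (LINT x|lborel. - (LINT y|lborel. \<phi> (x, y) *\<^sub>R g (x, y)))"
  proof (rule integral_cong_AE)
    show "AE x in lborel. (LINT y|lborel. frechet_derivative \<phi> (at (x, y)) (0, 1) *\<^sub>R f (x, y)) = - (LINT y|lborel. \<phi> (x, y) *\<^sub>R g (x, y))"
      using s
    proof eventually_elim
      fix x assume "ac (\<lambda>y. f (x, y)) (\<lambda>y. g (x, y))"
      then show "(LINT y|lborel. frechet_derivative \<phi> (at (x, y)) (0, 1) *\<^sub>R f (x, y)) = - (LINT y|lborel. \<phi> (x, y) *\<^sub>R g (x, y))"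
        unfolding G(2) by (rule ac_parts(3)[OF _ ap G(4) z])
    qed
  qed (use fubini_plane(2)[OF i1] fubini_plane(2)[OF i2] in auto)
  then show "(LINT x|lborel. frechet_derivative \<phi> (at x) (0, 1) *\<^sub>R f x) = - (LINT x|lborel. \<phi> x *\<^sub>R g x)"
    using fubini_plane(3)[OF i1] fubini_plane(3)[OF i2] by simp
qed

lemma slices_weak_deriv_fst:
  fixes f g :: "real \<times> real \<Rightarrow> 'b::euclidean_space"
  assumes L: "L1_loc f" "L1_loc g" and s: "AE y in lborel. ac (\<lambda>x. f (x, y)) (\<lambda>x. g (x, y))"
  shows "has_weak_deriv (1, 0) f g"
  unfolding has_weak_deriv_def
proof (intro conjI L allI impI)
  fix \<phi> :: "real \<times> real \<Rightarrow> real" assume t: "test_function \<phi>"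
  obtain G M where G: "\<And>x. (\<phi> has_derivative (\<lambda>h. h \<bullet> G x)) (at x)" "\<And>x b. frechet_derivative \<phi> (at x) b = G x \<bullet> b"
    "\<And>b. b \<in> Basis \<Longrightarrow> continuous_on UNIV (\<lambda>x. G x \<bullet> b)"
    "M > 0" "\<And>x. norm x > M \<Longrightarrow> \<phi> x = 0" "\<And>x. norm x > M \<Longrightarrow> G x = 0" using test_gradient[OF t] by blast
  have ap: "ac (\<lambda>x. \<phi> (x, y)) (\<lambda>x. G (x, y) \<bullet> (1, 0))" for y
  proof (rule ac_C1)
    show "continuous_on UNIV (\<lambda>x. G (x, y) \<bullet> (1, 0))"
      by (rule continuous_on_compose2[OF G(3)]) (auto simp: Basis_prod_def intro!: continuous_intros)
    fix x :: real
    have "((\<lambda>x. (x, y)) has_derivative (\<lambda>h. (h, 0))) (at x)" by (auto intro!: derivative_eq_intros)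
    from diff_chain_at[OF this G(1)] have "((\<lambda>x. \<phi> (x, y)) has_derivative (\<lambda>h. (h, 0) \<bullet> G (x, y))) (at x)" by (simp add: o_def)
    then show "((\<lambda>x. \<phi> (x, y)) has_vector_derivative G (x, y) \<bullet> (1, 0)) (at x)"
      by (simp add: has_vector_derivative_def inner_prod_def mult.commute)
  qed
  have z: "\<phi> (x, y) = 0 \<and> G (x, y) \<bullet> (1, 0) = 0" if "\<bar>x\<bar> > M" for x y
    using G(5,6)[of "(x, y)"] that norm_fst_le[of x y] by force
  have b: "(1, 0) \<in> (Basis :: (real \<times> real) set)" by (simp add: Basis_prod_def)
  note i1 = test_deriv_integrable[OF t L(1) b] and i2 = test_integrable[OF t L(2)]
  have "(LINT y|lborel. LINT x|lborel. frechet_derivative \<phi> (at (x, y)) (1, 0) *\<^sub>R f (x, y)) = (LINT y|lborel. - (LINT x|lborel. \<phi> (x, y) *\<^sub>R g (x, y)))"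
  proof (rule integral_cong_AE)
    show "AE y in lborel. (LINT x|lborel. frechet_derivative \<phi> (at (x, y)) (1, 0) *\<^sub>R f (x, y)) = - (LINT x|lborel. \<phi> (x, y) *\<^sub>R g (x, y))"
      using s
    proof eventually_elim
      fix y assume "ac (\<lambda>x. f (x, y)) (\<lambda>x. g (x, y))"
      then show "(LINT x|lborel. frechet_derivative \<phi> (at (x, y)) (1, 0) *\<^sub>R f (x, y)) = - (LINT x|lborel. \<phi> (x, y) *\<^sub>R g (x, y))"
        unfolding G(2) by (rule ac_parts(3)[OF _ ap G(4) z])
    qed
  qed (use fubini_plane(5)[OF i1] fubini_plane(5)[OF i2] in auto)
  then show "(LINT x|lborel. frechet_derivative \<phi> (at x) (1, 0) *\<^sub>R f x) = - (LINT x|lborel. \<phi> x *\<^sub>R g x)"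
    using fubini_plane(6)[OF i1] fubini_plane(6)[OF i2] by simp
qed

lemma product_weak_deriv:
  fixes F :: "real \<Rightarrow> 'b::euclidean_space" and A :: "real \<Rightarrow> real"
  assumes F: "ac F F'" and A: "ac A A'"
  shows "has_weak_deriv (1, 0) (\<lambda>z. A (snd z) *\<^sub>R F (fst z)) (\<lambda>z. A (snd z) *\<^sub>R F' (fst z))"
    and "has_weak_deriv (0, 1) (\<lambda>z. A (snd z) *\<^sub>R F (fst z)) (\<lambda>z. A' (snd z) *\<^sub>R F (fst z))"
proof -
  have cA: "continuous_on UNIV (\<lambda>z::real \<times> real. A (snd z))" and cF: "continuous_on UNIV (\<lambda>z::real \<times> real. F (fst z))"
    by (auto intro!: continuous_on_compose2[OF ac_continuous_on[OF A]] continuous_on_compose2[OF ac_continuous_on[OF F]] continuous_intros)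
  have L: "L1_loc (\<lambda>z::real \<times> real. A (snd z) *\<^sub>R F (fst z))" by (intro L1_loc_continuous continuous_intros cA cF)
  have L1: "L1_loc (\<lambda>z::real \<times> real. A (snd z) *\<^sub>R F' (fst z))" by (intro L1_loc_scaleR cA L1_loc_fst_snd acD(1)[OF F])
  have L2: "L1_loc (\<lambda>z::real \<times> real. A' (snd z) *\<^sub>R F (fst z))"
    by (rule L1_loc_bilinear[OF bounded_bilinear.flip[OF bounded_bilinear_scaleR] cF L1_loc_fst_snd(2)[OF acD(1)[OF A]]])
  show "has_weak_deriv (1, 0) (\<lambda>z. A (snd z) *\<^sub>R F (fst z)) (\<lambda>z. A (snd z) *\<^sub>R F' (fst z))"
    by (rule slices_weak_deriv_fst[OF L L1]) (use ac_linear[OF bounded_linear_scaleR_right F] in simp)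
  show "has_weak_deriv (0, 1) (\<lambda>z. A (snd z) *\<^sub>R F (fst z)) (\<lambda>z. A' (snd z) *\<^sub>R F (fst z))"
    by (rule slices_weak_deriv_snd[OF L L2]) (intro AE_I2, use ac_linear[OF bounded_linear_scaleR_left A] in simp)
qed

lemma mean_y_L1_loc:
  assumes "L1_loc \<psi>" shows "L1_loc (mean_y \<psi>)"
  unfolding L1_loc_def set_integrable_def
proof (intro allI impI)
  fix K :: "real set" assume "compact K"
  then have "compact (K \<times> {0..1::real})" by (intro compact_Times) auto
  from L1_locD[OF assms this] have "integrable lborel (\<lambda>z. indicator (K \<times> {0..1}) z *\<^sub>R \<psi> z)" by (simp add: set_integrable_def)
  from fubini_plane(2)[OF this]
  show "integrable lborel (\<lambda>x. indicator K x *\<^sub>R mean_y \<psi> x)"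
    by (simp add: mean_y_def set_lebesgue_integral_def indicator_times flip: scaleR_scaleR)
qed

text \<open>These windows equal 1 on \<open>[0, 1]\<close> and shrink to it from outside. They are
  the smooth approximations of the fundamental domain against which the mean over \<open>y\<close>
  is tested.\<close>

lemma wide_window_tendsto:
  "(\<lambda>n. step (real (Suc n) * (t - - (1 / real (Suc n)))) * step (real (Suc n) * ((1 + 1 / real (Suc n)) - t))) \<longlonglongrightarrow> indicator {0..1} t"
proof -
  have e: "real (Suc n) * (t - - (1 / real (Suc n))) = real (Suc n) * t + 1" 
    "real (Suc n) * ((1 + 1 / real (Suc n)) - t) = real (Suc n) * (1 - t) + 1" for n
    by (simp_all add: field_simps)
  have ev: "eventually (\<lambda>n. step (real (Suc n) * d + 1) = 0) sequentially" if "d < 0" for d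
  proof -
    obtain N where N: "1 / (- d) < real N" using reals_Archimedean2 by blast
    have "step (real (Suc n) * d + 1) = 0" if "n \<ge> N" for n
    proof (rule step_0)
      have "real N \<le> real (Suc n)" using that by simp
      then have "1 / (- d) < real (Suc n)" using N by linarith
      then show "real (Suc n) * d + 1 \<le> 0" using \<open>d < 0\<close> by (simp add: field_simps)
    qed
    then show ?thesis unfolding eventually_sequentially by blast
  qed
  show ?thesis unfolding e
  proof (cases "t \<in> {0..1}")
    case True
    then have "step (real (Suc n) * t + 1) = 1" "step (real (Suc n) * (1 - t) + 1) = 1" for n by (auto intro!: step_1)
    then show "(\<lambda>n. step (real (Suc n) * t + 1) * step (real (Suc n) * (1 - t) + 1)) \<longlonglongrightarrow> indicator {0..1} t" using True by simp
  next
    case False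
    then have "t < 0 \<or> 1 - t < 0" by auto
    then consider "t < 0" | "1 - t < 0" by blast
    then have "eventually (\<lambda>n. step (real (Suc n) * t + 1) * step (real (Suc n) * (1 - t) + 1) = 0) sequentially"
    proof cases
      case 1 from ev[OF this] show ?thesis by eventually_elim (simp only: mult_zero_left)
    next
      case 2 from ev[OF this] show ?thesis by eventually_elim (simp only: mult_zero_right)
    qed
    then show "(\<lambda>n. step (real (Suc n) * t + 1) * step (real (Suc n) * (1 - t) + 1)) \<longlonglongrightarrow> indicator {0..1} t" using False by (intro tendsto_eventually) simp
  qed
qed

lemma window_mean_limit:
  fixes \<psi> :: "real \<times> real \<Rightarrow> complex"
  assumes L: "L1_loc \<psi>" and c: "continuous_on UNIV \<phi>" and s: "\<And>x. \<bar>x\<bar> > M \<Longrightarrow> \<phi> x = (0::real)"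
  shows "(\<lambda>n. LINT z|lborel. (\<phi> (fst z) * (step (real (Suc n) * (snd z - - (1 / real (Suc n)))) * step (real (Suc n) * ((1 + 1 / real (Suc n)) - snd z)))) *\<^sub>R \<psi> z)
    \<longlonglongrightarrow> (LINT x|lborel. \<phi> x *\<^sub>R mean_y \<psi> x)"
proof -
  let ?w = "\<lambda>n t. step (real (Suc n) * (t - - (1 / real (Suc n)))) * step (real (Suc n) * ((1 + 1 / real (Suc n)) - t))"
  let ?K = "cbox (-M, -1) (M, 2::real)"
  have cf: "continuous_on UNIV (\<lambda>z::real \<times> real. \<phi> (fst z))" by (rule continuous_on_compose2[OF c]) (auto intro!: continuous_intros)
  have L1: "L1_loc (\<lambda>z. \<phi> (fst z) *\<^sub>R \<psi> z)" by (rule L1_loc_scaleR[OF cf L])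
  have dom: "integrable lborel (\<lambda>z. indicator ?K z *\<^sub>R norm (\<phi> (fst z) *\<^sub>R \<psi> z))"
    using L1_locD[OF L1_loc_norm[OF L1] compact_cbox] by (simp add: set_integrable_def)
  have w01: "0 \<le> ?w n t" "?w n t \<le> 1" for n t by (auto intro!: mult_nonneg_nonneg mult_le_one step_range)
  have w0: "?w n t = 0" if tn: "t \<notin> {-1..2}" for n t
  proof -
    have n1: "1 / real (Suc n) \<le> 1" by simp
    have "t < -1 \<or> t > 2" using tn by auto
    then consider "t < -1" | "t > 2" by blast
    then show ?thesis
    proof cases
      case 1
      then have "real (Suc n) * (t - - (1 / real (Suc n))) \<le> 0" by (intro mult_nonneg_nonpos) (simp, use n1 in linarith)
      then show ?thesis by (simp only: step_0 mult_zero_left)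
    next
      case 2
      then have "real (Suc n) * ((1 + 1 / real (Suc n)) - t) \<le> 0" by (intro mult_nonneg_nonpos) (simp, use n1 in linarith)
      then show ?thesis by (simp only: step_0 mult_zero_right)
    qed
  qed
  have wm: "(\<lambda>z::real \<times> real. ?w n (snd z)) \<in> borel_measurable borel" for n
    by (rule measurable_fst_snd_borel(2)) (rule borel_measurable_continuous_onI[OF smooth_continuous[OF smooth_window]])
  have m: "(\<lambda>z. \<phi> (fst z)) \<in> borel_measurable (borel :: (real \<times> real) measure)" by (rule borel_measurable_continuous_onI[OF cf])
  have pm: "\<psi> \<in> borel_measurable borel" by (rule L1_loc_measurable[OF L])
  have im: "(\<lambda>z::real \<times> real. indicator {0..1} (snd z) :: real) \<in> borel_measurable borel" by (rule measurable_fst_snd_borel(2)) simp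
  have lim: "(\<lambda>n. LINT z|lborel. (\<phi> (fst z) * ?w n (snd z)) *\<^sub>R \<psi> z) \<longlonglongrightarrow> (LINT z|lborel. (\<phi> (fst z) * indicator {0..1} (snd z)) *\<^sub>R \<psi> z)"
  proof (rule integral_dominated_convergence[OF _ _ dom])
    show "AE z in lborel. (\<lambda>n. (\<phi> (fst z) * ?w n (snd z)) *\<^sub>R \<psi> z) \<longlonglongrightarrow> (\<phi> (fst z) * indicator {0..1} (snd z)) *\<^sub>R \<psi> z"
      by (intro AE_I2 tendsto_scaleR tendsto_mult tendsto_const wide_window_tendsto)
    show "AE z in lborel. norm ((\<phi> (fst z) * ?w n (snd z)) *\<^sub>R \<psi> z) \<le> indicator ?K z *\<^sub>R norm (\<phi> (fst z) *\<^sub>R \<psi> z)" for n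
    proof (rule AE_I2)
      fix z :: "real \<times> real"
      show "norm ((\<phi> (fst z) * ?w n (snd z)) *\<^sub>R \<psi> z) \<le> indicator ?K z *\<^sub>R norm (\<phi> (fst z) *\<^sub>R \<psi> z)"
      proof (cases "z \<in> ?K")
        case True
        have "norm ((\<phi> (fst z) * ?w n (snd z)) *\<^sub>R \<psi> z) = ?w n (snd z) * norm (\<phi> (fst z) *\<^sub>R \<psi> z)"
          by (simp only: norm_scaleR abs_mult[of "\<phi> (fst z)"] abs_of_nonneg[OF w01(1)] mult_ac)
        also have "\<dots> \<le> 1 * norm (\<phi> (fst z) *\<^sub>R \<psi> z)" by (intro mult_right_mono w01) simp
        finally show ?thesis using True by simp
      next
        case False
        then have "\<bar>fst z\<bar> > M \<or> snd z \<notin> {-1..2}" by (cases z) (auto simp: cbox_Pair_eq)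
        then have "\<phi> (fst z) * ?w n (snd z) = 0"
        proof
          assume "\<bar>fst z\<bar> > M" show ?thesis by (simp only: s[OF \<open>\<bar>fst z\<bar> > M\<close>] mult_zero_left)
        next
          assume "snd z \<notin> {-1..2}" show ?thesis by (simp only: w0[OF \<open>snd z \<notin> {-1..2}\<close>] mult_zero_right)
        qed
        then show ?thesis by (simp only: scaleR_zero_left norm_zero) simp
      qed
    qed
    show "(\<lambda>z. (\<phi> (fst z) * ?w n (snd z)) *\<^sub>R \<psi> z) \<in> borel_measurable lborel" for n
      using borel_measurable_scaleR[OF borel_measurable_times[OF m wm] pm] by simp
    show "(\<lambda>z. (\<phi> (fst z) * indicator {0..1} (snd z)) *\<^sub>R \<psi> z) \<in> borel_measurable lborel"
      using borel_measurable_scaleR[OF borel_measurable_times[OF m im] pm] by simp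
  qed
  have i: "integrable lborel (\<lambda>z. (\<phi> (fst z) * indicator {0..1} (snd z)) *\<^sub>R \<psi> z)"
  proof (rule Bochner_Integration.integrable_bound[OF dom])
    show "(\<lambda>z. (\<phi> (fst z) * indicator {0..1} (snd z)) *\<^sub>R \<psi> z) \<in> borel_measurable lborel"
      using borel_measurable_scaleR[OF borel_measurable_times[OF m im] pm] by simp
    show "AE z in lborel. norm ((\<phi> (fst z) * indicator {0..1} (snd z)) *\<^sub>R \<psi> z) \<le> norm (indicator ?K z *\<^sub>R norm (\<phi> (fst z) *\<^sub>R \<psi> z))"
    proof (rule AE_I2)
      fix z :: "real \<times> real"
      show "norm ((\<phi> (fst z) * indicator {0..1} (snd z)) *\<^sub>R \<psi> z) \<le> norm (indicator ?K z *\<^sub>R norm (\<phi> (fst z) *\<^sub>R \<psi> z))"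
        using s[of "fst z"] by (cases z) (auto simp: indicator_def cbox_Pair_eq)
    qed
  qed
  have "(LINT z|lborel. (\<phi> (fst z) * indicator {0..1} (snd z)) *\<^sub>R \<psi> z) = (LINT x|lborel. \<phi> x *\<^sub>R mean_y \<psi> x)"
    using fubini_plane(3)[OF i] by (simp add: mean_y_def set_lebesgue_integral_def flip: scaleR_scaleR)
  then show ?thesis using lim by simp
qed

text \<open>The test function is a product of \<phi> in \<open>x\<close> and a window in
  \<open>y\<close>. Differentiation in \<open>x\<close> does not touch the window, which can
  therefore be replaced by the indicator of \<open>[0, 1]\<close> in the limit.\<close>

lemma mean_y_weak_deriv:
  fixes \<psi> :: "real \<times> real \<Rightarrow> complex"
  assumes w: "has_weak_deriv (1, 0) \<psi> g"
  shows "has_weak_deriv 1 (mean_y \<psi>) (mean_y g)"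
  unfolding has_weak_deriv_def
proof (intro conjI allI impI mean_y_L1_loc has_weak_derivD(1,2)[OF w])
  fix \<phi> :: "real \<Rightarrow> real" assume t: "test_function \<phi>"
  let ?w = "\<lambda>n t. step (real (Suc n) * (t - - (1 / real (Suc n)))) * step (real (Suc n) * ((1 + 1 / real (Suc n)) - t))"
  obtain M where M: "\<And>x. norm x > M \<Longrightarrow> \<phi> x = 0" using test_function_support[OF t] by blast
  obtain M' where M': "\<And>x. norm x > M' \<Longrightarrow> deriv \<phi> x = 0" using test_function_support[OF test_deriv_real(3)[OF t]] by blast
  note l1 = window_mean_limit[OF has_weak_derivD(1)[OF w] test_continuous[OF test_deriv_real(3)[OF t]], of M']
  note l2 = window_mean_limit[OF has_weak_derivD(2)[OF w] test_continuous[OF t], of M]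
  have tw: "test_function (?w n)" for n by (rule test_window) simp
  have "(LINT z|lborel. (deriv \<phi> (fst z) * ?w n (snd z)) *\<^sub>R \<psi> z) = - (LINT z|lborel. (\<phi> (fst z) * ?w n (snd z)) *\<^sub>R g z)" for n
    using has_weak_derivD(3)[OF w test_tensor(1)[OF t tw]] unfolding test_tensor(2)[OF t tw] .
  then have "(\<lambda>n. - (LINT z|lborel. (\<phi> (fst z) * ?w n (snd z)) *\<^sub>R g z)) \<longlonglongrightarrow> (LINT x|lborel. deriv \<phi> x *\<^sub>R mean_y \<psi> x)"
    using l1 M' by simp
  moreover have "(\<lambda>n. - (LINT z|lborel. (\<phi> (fst z) * ?w n (snd z)) *\<^sub>R g z)) \<longlonglongrightarrow> - (LINT x|lborel. \<phi> x *\<^sub>R mean_y g x)"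
    using l2 M by (intro tendsto_minus) simp
  ultimately have "(LINT x|lborel. deriv \<phi> x *\<^sub>R mean_y \<psi> x) = - (LINT x|lborel. \<phi> x *\<^sub>R mean_y g x)" by (rule LIMSEQ_unique)
  then show "(LINT x|lborel. frechet_derivative \<phi> (at x) 1 *\<^sub>R mean_y \<psi> x) = - (LINT x|lborel. \<phi> x *\<^sub>R mean_y g x)"
    unfolding test_deriv_real(2)[OF t] .
qed

text \<open>The kernel that expresses \<open>antider\<close> as an integral over the whole line.
  Being jointly measurable in both arguments, it makes the primitive along vertical lines a
  measurable function on the plane.\<close>

definition sgn_ind :: "real \<Rightarrow> real \<Rightarrow> real" where
  "sgn_ind y t = (if 0 \<le> t \<and> t \<le> y then 1 else 0) - (if y \<le> t \<and> t \<le> 0 then 1 else 0)"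

lemma sgn_ind_antider:
  fixes g :: "real \<Rightarrow> 'b::euclidean_space"
  assumes "L1_loc g"
  shows "integrable lborel (\<lambda>t. sgn_ind y t *\<^sub>R g t)" "(LINT t|lborel. sgn_ind y t *\<^sub>R g t) = antider g y"
proof -
  have i: "integrable lborel (\<lambda>t. indicator {a..b} t *\<^sub>R g t)" "(LINT t|lborel. indicator {a..b} t *\<^sub>R g t) = integral {a..b} g" for a b
    using L1_loc_Icc(1,3)[OF assms, of a b] by (auto simp: set_integrable_def set_lebesgue_integral_def)
  have e: "sgn_ind y t *\<^sub>R g t = indicator {0..y} t *\<^sub>R g t - indicator {y..0} t *\<^sub>R g t" for t
    by (auto simp: sgn_ind_def indicator_def)
  show "integrable lborel (\<lambda>t. sgn_ind y t *\<^sub>R g t)" unfolding e using i(1) by (intro Bochner_Integration.integrable_diff)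
  have "(LINT t|lborel. sgn_ind y t *\<^sub>R g t) = integral {0..y} g - integral {y..0} g"
    unfolding e using Bochner_Integration.integral_diff[OF i(1) i(1)] i(2) by simp
  also have "\<dots> = antider g y" by (cases "y = 0") (auto simp: antider_def)
  finally show "(LINT t|lborel. sgn_ind y t *\<^sub>R g t) = antider g y" .
qed

text \<open>The primitive of the weak derivative along vertical lines differs from the function by something whose weak
  derivative vanishes, hence by a function of the first variable.\<close>

lemma weak_deriv_snd_slices:
  fixes f g :: "real \<times> real \<Rightarrow> 'b::euclidean_space"
  assumes w: "has_weak_deriv (0, 1) f g"
  shows "AE x in lborel. L1_loc (\<lambda>y. g (x, y)) \<and> (\<exists>c. AE y in lborel. f (x, y) = c + antider (\<lambda>t. g (x, t)) y)"
proof -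
  note L = has_weak_derivD(1,2)[OF w]
  have gm [measurable]: "g \<in> borel_measurable (borel \<Otimes>\<^sub>M borel)" using L1_loc_measurable[OF L(2)] by (simp add: borel_prod)
  define G where "G z = (LINT t|lborel. sgn_ind (snd z) t *\<^sub>R g (fst z, t))" for z :: "real \<times> real"
  have Gm: "G \<in> borel_measurable borel"
  proof -
    have "(\<lambda>(z, t). sgn_ind (snd z) t *\<^sub>R g (fst z, t)) \<in> borel_measurable ((borel \<Otimes>\<^sub>M borel) \<Otimes>\<^sub>M lborel)"
      unfolding sgn_ind_def by measurable
    from lborel.borel_measurable_lebesgue_integral[OF this] show ?thesis by (simp add: G_def[abs_def] borel_prod)
  qed
  have sl: "AE x in lborel. L1_loc (\<lambda>y. g (x, y))" by (rule L1_loc_slice[OF L(2)])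
  have Gs: "G (x, y) = antider (\<lambda>t. g (x, t)) y" if "L1_loc (\<lambda>y. g (x, y))" for x y
    using sgn_ind_antider(2)[OF that] by (simp add: G_def)
  \<comment> \<open>On a square the primitive is bounded by the integral of
    \<open>|g (x, t)|\<close> over \<open>-M <= t <= M\<close>, which is integrable in
    \<open>x\<close> by Fubini.\<close>
  have LG: "L1_loc G"
    unfolding L1_loc_def
  proof (intro allI impI)
    fix K :: "(real \<times> real) set" assume K: "compact K"
    obtain M where M: "M > 0" "K \<subseteq> {-M..M} \<times> {-M..M}" using compact_in_square[OF K] by blast
    have "compact ({-M..M} \<times> {-M..M})" by (intro compact_Times) auto
    from L1_locD[OF L1_loc_norm[OF L(2)] this]
    have "integrable lborel (\<lambda>z. indicator ({-M..M} \<times> {-M..M}) z *\<^sub>R norm (g z))" by (simp add: set_integrable_def)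
    from fubini_plane(2)[OF this]
    have i1: "integrable lborel (\<lambda>x. indicator {-M..M} x *\<^sub>R (LINT t|lborel. indicator {-M..M} t *\<^sub>R norm (g (x, t))))"
      by (simp add: indicator_times mult.assoc)
    have i2: "integrable lborel (indicator {-M..M} :: real \<Rightarrow> real)"
      using L1_locD[OF L1_loc_continuous[of "\<lambda>x. 1::real"], of "{-M..M}"] by (simp add: set_integrable_def)
    note ti = tensor_integrable(1)[OF i1 i2]
    have "set_integrable lborel ({-M..M} \<times> {-M..M}) G"
      unfolding set_integrable_def
    proof (rule Bochner_Integration.integrable_bound[OF ti])
      show "(\<lambda>z. indicator ({-M..M} \<times> {-M..M}) z *\<^sub>R G z) \<in> borel_measurable lborel"
        using Gm by (simp add: borel_measurable_indicator borel_measurable_scaleR borel_compact compact_Times)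
      show "AE z in lborel. norm (indicator ({-M..M} \<times> {-M..M}) z *\<^sub>R G z) \<le>
         norm (indicator {-M..M} (snd z) *\<^sub>R (indicator {-M..M} (fst z) *\<^sub>R (LINT t|lborel. indicator {-M..M} t *\<^sub>R norm (g (fst z, t)))))"
        using AE_fst[OF sl]
      proof eventually_elim
        fix z :: "real \<times> real" assume z: "L1_loc (\<lambda>y. g (fst z, y))"
        show "norm (indicator ({-M..M} \<times> {-M..M}) z *\<^sub>R G z) \<le>
         norm (indicator {-M..M} (snd z) *\<^sub>R (indicator {-M..M} (fst z) *\<^sub>R (LINT t|lborel. indicator {-M..M} t *\<^sub>R norm (g (fst z, t)))))"
        proof (cases "z \<in> {-M..M} \<times> {-M..M}")
          case True
          have "norm (G z) \<le> (LINT t|lborel. norm (sgn_ind (snd z) t *\<^sub>R g (fst z, t)))"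
            unfolding G_def by (rule integral_norm_bound)
          also have "\<dots> \<le> (LINT t|lborel. indicator {-M..M} t *\<^sub>R norm (g (fst z, t)))"
          proof (rule integral_mono)
            show "integrable lborel (\<lambda>t. norm (sgn_ind (snd z) t *\<^sub>R g (fst z, t)))" 
              by (rule Bochner_Integration.integrable_norm[OF sgn_ind_antider(1)[OF z]])
            show "integrable lborel (\<lambda>t. indicator {-M..M} t *\<^sub>R norm (g (fst z, t)))"
              using L1_loc_Icc(1)[OF L1_loc_norm[OF z]] by (simp add: set_integrable_def)
            fix t show "norm (sgn_ind (snd z) t *\<^sub>R g (fst z, t)) \<le> indicator {-M..M} t *\<^sub>R norm (g (fst z, t))"
              using True by (auto simp: sgn_ind_def indicator_def)
          qed
          finally have "norm (G z) \<le> \<bar>LINT t|lborel. indicator {-M..M} t *\<^sub>R norm (g (fst z, t))\<bar>" by linarith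
          then show ?thesis using True by (cases z) auto
        qed simp
      qed
    qed
    then show "set_integrable lborel K G" by (rule set_integrable_subset) (use M(2) borel_compact[OF K] in auto)
  qed
  have wG: "has_weak_deriv (0, 1) G g"
  proof (rule slices_weak_deriv_snd[OF LG L(2)])
    show "AE x in lborel. ac (\<lambda>y. G (x, y)) (\<lambda>y. g (x, y))"
      using sl by eventually_elim (simp add: Gs ac_antider)
  qed
  have b01: "(0, 1) \<in> (Basis :: (real \<times> real) set)" by (simp add: Basis_prod_def)
  define h where "h z = f z - G z" for z
  have wh: "has_weak_deriv (0, 1) h (\<lambda>z. g z - g z)"
    unfolding h_def[abs_def] by (rule has_weak_deriv_diff[OF w wG b01])
  note Lh = has_weak_derivD(1)[OF wh]
  \<comment> \<open>The candidate for the function of the first variable: the vertical average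
    against the normalised \<open>bump\<close>, as on the line.\<close>
  define c where "c x = (LINT y|lborel. bump y *\<^sub>R h (x, y)) /\<^sub>R bump_int" for x
  have cI: "bump_int *\<^sub>R c x = (LINT y|lborel. bump y *\<^sub>R h (x, y))" for x using bump_int_pos by (simp add: c_def)
  have cb: "continuous_on UNIV (\<lambda>z::real \<times> real. bump (snd z))"
    by (rule continuous_on_compose2[OF continuous_bump[of UNIV]]) (auto intro!: continuous_intros)
  have Lc: "L1_loc c"
    unfolding L1_loc_def set_integrable_def
  proof (intro allI impI)
    fix K :: "real set" assume "compact K"
    then have "compact (K \<times> {0..1::real})" by (intro compact_Times) auto
    from L1_locD[OF L1_loc_scaleR[OF cb Lh] this]
    have "integrable lborel (\<lambda>z. indicator (K \<times> {0..1}) z *\<^sub>R bump (snd z) *\<^sub>R h z)" by (simp add: set_integrable_def)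
    moreover have "indicator (K \<times> {0..1}) z *\<^sub>R bump (snd z) *\<^sub>R h z = indicator K (fst z) *\<^sub>R bump (snd z) *\<^sub>R h z" for z
      using bump_zero[of "snd z"] by (cases z) (auto simp: indicator_def not_le intro: ccontr)
    ultimately have "integrable lborel (\<lambda>z. indicator K (fst z) *\<^sub>R bump (snd z) *\<^sub>R h z)" by (simp only:)
    from fubini_plane(2)[OF this]
    have "integrable lborel (\<lambda>x. indicator K x *\<^sub>R (LINT y|lborel. bump y *\<^sub>R h (x, y)))" by (simp flip: scaleR_scaleR)
    from integrable_scaleR_right[OF this, of "inverse bump_int"]
    show "integrable lborel (\<lambda>x. indicator K x *\<^sub>R c x)" by (simp add: c_def mult.commute)
  qed
  have "AE z in lborel. h z - c (fst z) = 0"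
  proof (rule AE_zero_test)
    note Lcf = L1_loc_fst_snd(1)[OF Lc]
    show "L1_loc (\<lambda>z. h z - c (fst z))" by (rule L1_loc_diff[OF Lh Lcf])
    fix \<beta> :: "real \<times> real \<Rightarrow> real \<Rightarrow> real" assume "\<And>b. b \<in> Basis \<Longrightarrow> test_function (\<beta> b)"
    then have t: "test_function (\<beta> (1, 0))" "test_function (\<beta> (0, 1))" by (simp_all add: Basis_prod_def)
    define \<phi> where "\<phi> = \<beta> (1, 0)"
    define \<xi> where "\<xi> = \<beta> (0, 1)"
    note t = t[folded \<phi>_def \<xi>_def]
    define k where "k = integral\<^sup>L lborel \<xi>"
    obtain X where X: "test_function X" "\<And>y. deriv X y = \<xi> y - k * (bump y / bump_int)"
      using test_primitive[OF t(2)] unfolding k_def by blast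
    note T1 = test_integrable[OF test_tensor(1)[OF t] Lh] and T2 = test_integrable[OF test_tensor(1)[OF t(1) test_bump] Lh]
    have "0 = (LINT z|lborel. (\<phi> (fst z) * deriv X (snd z)) *\<^sub>R h z)"
      using has_weak_derivD(3)[OF wh test_tensor(1)[OF t(1) X(1)]] unfolding test_tensor(3)[OF t(1) X(1)] by simp
    also have "\<dots> = (LINT z|lborel. (\<phi> (fst z) * \<xi> (snd z)) *\<^sub>R h z - (k / bump_int) *\<^sub>R ((\<phi> (fst z) * bump (snd z)) *\<^sub>R h z))"
      unfolding X(2) by (simp add: scaleR_diff_left right_diff_distrib mult_ac)
    also have "\<dots> = (LINT z|lborel. (\<phi> (fst z) * \<xi> (snd z)) *\<^sub>R h z) - (k / bump_int) *\<^sub>R (LINT z|lborel. (\<phi> (fst z) * bump (snd z)) *\<^sub>R h z)"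
      by (simp only: Bochner_Integration.integral_diff[OF T1 integrable_scaleR_right[OF T2]] integral_scaleR_right)
    also have "(LINT z|lborel. (\<phi> (fst z) * bump (snd z)) *\<^sub>R h z) = (LINT x|lborel. \<phi> x *\<^sub>R (bump_int *\<^sub>R c x))"
      unfolding fubini_plane(3)[OF T2, symmetric] cI by (simp flip: scaleR_scaleR)
    also have "\<dots> = bump_int *\<^sub>R (LINT x|lborel. \<phi> x *\<^sub>R c x)"
      unfolding integral_scaleR_right[symmetric] by (simp only: scaleR_scaleR mult.commute)
    finally have 1: "(LINT z|lborel. (\<phi> (fst z) * \<xi> (snd z)) *\<^sub>R h z) = k *\<^sub>R (LINT x|lborel. \<phi> x *\<^sub>R c x)" using bump_int_pos by simp
    have xi: "integrable lborel \<xi>" using test_integrable[OF t(2), of "\<lambda>x. 1::real"] L1_loc_continuous[of "\<lambda>x::real. 1::real"] by simp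
    have 2: "(LINT z|lborel. (\<phi> (fst z) * \<xi> (snd z)) *\<^sub>R c (fst z)) = k *\<^sub>R (LINT x|lborel. \<phi> x *\<^sub>R c x)"
      using tensor_integrable(2)[OF test_integrable[OF t(1) Lc] xi] unfolding k_def by (simp add: mult.commute)
    have "(LINT z|lborel. (\<phi> (fst z) * \<xi> (snd z)) *\<^sub>R (h z - c (fst z))) = 0"
      using T1 test_integrable[OF test_tensor(1)[OF t] Lcf] 1 2 by (simp add: scaleR_diff_right)
    moreover have "(\<Prod>b\<in>Basis. \<beta> b (z \<bullet> b)) = \<phi> (fst z) * \<xi> (snd z)" for z :: "real \<times> real"
      by (simp add: Basis_prod_def inner_prod_def \<phi>_def \<xi>_def)
    ultimately show "(LINT z|lborel. (\<Prod>b\<in>Basis. \<beta> b (z \<bullet> b)) *\<^sub>R (h z - c (fst z))) = 0" by simp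
  qed
  from AE_plane[OF this] sl show ?thesis
  proof eventually_elim
    fix x assume "AE y in lborel. h (x, y) - c (fst (x, y)) = 0" and gx: "L1_loc (\<lambda>y. g (x, y))"
    then have "AE y in lborel. f (x, y) = c x + antider (\<lambda>t. g (x, t)) y"
      by (auto elim!: eventually_mono simp: h_def Gs[OF gx] algebra_simps)
    then show "L1_loc (\<lambda>y. g (x, y)) \<and> (\<exists>c. AE y in lborel. f (x, y) = c + antider (\<lambda>t. g (x, t)) y)" using gx by blast
  qed
qed

subsection \<open>Means over the circle\<close>

lemma jensen_unit:
  fixes q :: "real \<Rightarrow> real"
  assumes "set_integrable lborel {0..1} q" "set_integrable lborel {0..1} (\<lambda>y. (q y)\<^sup>2)"
  shows "(LINT y:{0..1}|lborel. q y)\<^sup>2 \<le> (LINT y:{0..1}|lborel. (q y)\<^sup>2)"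
proof -
  define m where "m = (LINT y:{0..1}|lborel. q y)"
  have c: "set_integrable lborel {0..1::real} (\<lambda>y. r)" "(LINT y:{0..1::real}|lborel. r) = r" for r :: real
    using borel_integrable_atLeastAtMost'[of 0 1 "\<lambda>y::real. r"] set_integral_const[of "{0..1::real}" lborel r] by auto
  have "0 \<le> (LINT y:{0..1}|lborel. (q y - m)\<^sup>2)"
    unfolding set_lebesgue_integral_def by (intro Bochner_Integration.integral_nonneg) auto
  also have "\<dots> = (LINT y:{0..1}|lborel. (q y)\<^sup>2 - 2 * m * q y + m\<^sup>2)"
    by (simp add: power2_diff algebra_simps)
  also have "\<dots> = (LINT y:{0..1}|lborel. (q y)\<^sup>2) - 2 * m * m + m\<^sup>2"
    using assms c by (simp add: set_integral_add set_integral_diff m_def)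
  finally show ?thesis by (simp add: m_def power2_eq_square)
qed

lemma pythagoras_unit:
  fixes q :: "real \<Rightarrow> complex"
  assumes q: "set_integrable lborel {0..1} q" "set_integrable lborel {0..1} (\<lambda>y. (norm (q y))\<^sup>2)"
  defines "m \<equiv> (LINT y:{0..1}|lborel. q y)"
  shows "set_integrable lborel {0..1} (\<lambda>y. (norm (q y - m))\<^sup>2)"
    and "(LINT y:{0..1}|lborel. (norm (q y - m))\<^sup>2) = (LINT y:{0..1}|lborel. (norm (q y))\<^sup>2) - (norm m)\<^sup>2"
proof -
  have c: "set_integrable lborel {0..1::real} (\<lambda>y. r)" "(LINT y:{0..1::real}|lborel. r) = r" for r :: real
    using borel_integrable_atLeastAtMost'[of 0 1 "\<lambda>y::real. r"] set_integral_const[of "{0..1::real}" lborel r] by auto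
  have e: "(norm (q y - m))\<^sup>2 = (norm (q y))\<^sup>2 - 2 * Re (cnj m * q y) + (norm m)\<^sup>2" for y
    unfolding cmod_power2 by (simp add: power2_eq_square algebra_simps)
  have i0: "integrable lborel (\<lambda>y. indicator {0..1} y *\<^sub>R q y)" using q(1) by (simp add: set_integrable_def)
  have bl: "bounded_linear (\<lambda>z. Re (cnj m * z))"
    by (rule bounded_linear_compose[OF bounded_linear_Re bounded_linear_mult_right])
  have i1: "set_integrable lborel {0..1} (\<lambda>y. Re (cnj m * q y))"
    using integrable_bounded_linear[OF bl i0] by (simp add: set_integrable_def algebra_simps)
  have "(LINT y:{0..1}|lborel. Re (cnj m * q y)) = Re (cnj m * m)"
    using integral_bounded_linear[OF bl i0] by (simp add: set_lebesgue_integral_def m_def algebra_simps)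
  also have "\<dots> = (norm m)\<^sup>2" unfolding cmod_power2 by (simp add: power2_eq_square)
  finally have i2: "(LINT y:{0..1}|lborel. Re (cnj m * q y)) = (norm m)\<^sup>2" .
  note i3 = set_integrable_mult_right[OF i1, of 2]
  show "set_integrable lborel {0..1} (\<lambda>y. (norm (q y - m))\<^sup>2)" unfolding e by (intro set_integral_add(1) set_integral_diff(1) q(2) i3 c)
  show "(LINT y:{0..1}|lborel. (norm (q y - m))\<^sup>2) = (LINT y:{0..1}|lborel. (norm (q y))\<^sup>2) - (norm m)\<^sup>2"
    unfolding e by (simp only: set_integral_add(2)[OF set_integral_diff(1)[OF q(2) i3] c(1)] set_integral_diff(2)[OF q(2) i3]
      set_integral_mult_right i2 c(2))
qed

text \<open>On \<open>[0, 1]\<close> a primitive of \<open>g\<close> deviates from its mean by at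
  most the integral of \<open>|g|\<close>, whose square is at most the integral of
  \<open>|g|^2\<close>. The constant 1 is far from the sharp one for periodic functions,
  \<open>1 / (4 pi^2)\<close>, but only the existence of a threshold is at stake.\<close>

lemma poincare_unit:
  fixes F g :: "real \<Rightarrow> complex"
  assumes g: "L1_loc g" and g2: "set_integrable lborel {0..1} (\<lambda>t. (norm (g t))\<^sup>2)"
    and F: "F \<in> borel_measurable borel" "AE y in lborel. F y = c + antider g y"
  shows "(LINT y:{0..1}|lborel. (norm (F y - (LINT t:{0..1}|lborel. F t)))\<^sup>2) \<le> (LINT t:{0..1}|lborel. (norm (g t))\<^sup>2)"
proof -
  define f where "f y = c + antider g y" for y
  have af: "ac f g" using ac_add[OF ac_const ac_antider[OF g], of c] by (simp add: f_def[abs_def])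
  define B where "B = integral {0..1} (\<lambda>t. norm (g t))"
  define m where "m = (LINT t:{0..1}|lborel. f t)"
  have cf: "continuous_on S f" for S using ac_continuous_on[OF af] continuous_on_subset by blast
  have fi: "f integrable_on {0..1}" by (rule integrable_continuous_interval[OF cf])
  have mi: "m = integral {0..1} f" unfolding m_def using L1_loc_Icc(3)[OF L1_loc_continuous[OF cf]] .
  have "set_integrable lborel {0..1} (\<lambda>t. norm (g t))" using L1_loc_Icc(1)[OF L1_loc_norm[OF g]] .
  then have BB: "B\<^sup>2 \<le> (LINT t:{0..1}|lborel. (norm (g t))\<^sup>2)"
    using jensen_unit[of "\<lambda>t. norm (g t)"] g2 L1_loc_Icc(3)[OF L1_loc_norm[OF g]] by (simp add: B_def)
  have inc: "norm (f y - f t) \<le> B" if "y \<in> {0..1}" "t \<in> {0..1}" for y t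
  proof -
    have "norm (f b - f a) \<le> B" if "0 \<le> a" "a \<le> b" "b \<le> 1" for a b
    proof -
      have "norm (f b - f a) \<le> integral {a..b} (\<lambda>t. norm (g t))" by (rule ac_increment_bound[OF af that(2)])
      also have "\<dots> \<le> B" unfolding B_def by (rule integral_subset_le) (use that L1_loc_Icc(4)[OF g] in auto)
      finally show ?thesis .
    qed
    from this[of t y] this[of y t] show ?thesis using that by (cases "t \<le> y") (auto simp: norm_minus_commute[of "f t"])
  qed
  have dev: "norm (f y - m) \<le> B" if y: "y \<in> {0..1}" for y
  proof -
    have "f y - m = integral {0..1} (\<lambda>t. f y - f t)"
      unfolding mi using Henstock_Kurzweil_Integration.integral_diff[OF integrable_const_ivl[of "f y" 0 1] fi] by simp
    also have "norm \<dots> \<le> integral {0..1::real} (\<lambda>t. B)"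
      by (rule Henstock_Kurzweil_Integration.integral_norm_bound_integral)
        (use inc y in \<open>auto intro!: Henstock_Kurzweil_Integration.integrable_diff fi\<close>)
    finally show ?thesis by simp
  qed
  have fb: "f \<in> borel_measurable lborel" and Fb: "F \<in> borel_measurable lborel"
    using borel_measurable_continuous_onI[OF cf] F(1) by auto
  have FF: "(LINT t:{0..1}|lborel. q (F t)) = (LINT t:{0..1}|lborel. q (f t))"
    if "q \<in> borel_measurable borel" for q :: "complex \<Rightarrow> 'z::{banach, second_countable_topology}"
    unfolding set_lebesgue_integral_def
  proof (rule integral_cong_AE)
    show "AE t in lborel. indicator {0..1} t *\<^sub>R q (F t) = indicator {0..1} t *\<^sub>R q (f t)"
      using F(2) by eventually_elim (simp add: f_def)
  qed (use that fb Fb in measurable)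
  have mF: "(LINT t:{0..1}|lborel. F t) = m" using FF[of "\<lambda>z. z"] by (simp add: m_def)
  have c: "set_integrable lborel {0..1::real} (\<lambda>y. r)" "(LINT y:{0..1::real}|lborel. r) = r" for r :: real
    using borel_integrable_atLeastAtMost'[of 0 1 "\<lambda>y::real. r"] set_integral_const[of "{0..1::real}" lborel r] by auto
  have "(LINT y:{0..1}|lborel. (norm (F y - m))\<^sup>2) = (LINT y:{0..1}|lborel. (norm (f y - m))\<^sup>2)"
    by (rule FF[of "\<lambda>z. (norm (z - m))\<^sup>2"]) measurable
  also have "\<dots> \<le> (LINT y:{0..1::real}|lborel. B\<^sup>2)"
  proof (rule set_integral_mono[OF _ c(1)])
    show "set_integrable lborel {0..1} (\<lambda>y. (norm (f y - m))\<^sup>2)"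
      by (intro borel_integrable_atLeastAtMost' continuous_intros cf)
    show "(norm (f y - m))\<^sup>2 \<le> B\<^sup>2" if "y \<in> {0..1}" for y
      by (rule power_mono[OF dev[OF that]]) simp
  qed
  also have "\<dots> = B\<^sup>2" by (rule c(2))
  finally show ?thesis unfolding mF using BB by simp
qed

lemma AE_translate:
  fixes c :: "'a::euclidean_space"
  assumes "AE z in lborel. P z" shows "AE z in lborel. P (c + z)"
proof -
  have "AE z in distr lborel borel ((+) c). P z" unfolding lborel_distr_plus by (rule assms)
  then show ?thesis by (rule AE_distrD[rotated]) simp
qed

subsection \<open>Integrals over the cylinder\<close>

text \<open>The fundamental domain \<open>cyl\<close> is half-open while \<open>mean_y\<close>
  integrates over the closed interval; the two strips differ by a null line.\<close>

lemma cyl_strip: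
  fixes f :: "real \<times> real \<Rightarrow> 'b::{banach, second_countable_topology}"
  assumes f: "f \<in> borel_measurable borel"
  shows "set_integrable lborel cyl f \<longleftrightarrow> integrable lborel (\<lambda>z. indicator {0..1} (snd z) *\<^sub>R f z)"
    and "(LINT z:cyl|lborel. f z) = (LINT z|lborel. indicator {0..1} (snd z) *\<^sub>R f z)"
proof -
  have "AE y in lborel. y \<noteq> (1::real)" by (rule AE_lborel_singleton)
  then have ae: "AE z in lborel. indicator cyl z *\<^sub>R f z = indicator {0..1} (snd z) *\<^sub>R f z"
    by (rule eventually_mono[OF AE_snd]) (auto simp: cyl_def indicator_def less_le)
  have c: "cyl \<in> sets borel" unfolding cyl_def by (simp add: borel_prod[symmetric])
  have m1: "(\<lambda>z. indicator cyl z *\<^sub>R f z) \<in> borel_measurable lborel" using f c by (simp add: borel_measurable_indicator borel_measurable_scaleR)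
  have "(\<lambda>z::real \<times> real. indicator {0..1} (snd z) :: real) \<in> borel_measurable borel" by (rule measurable_fst_snd_borel(2)) measurable
  then have m2: "(\<lambda>z. indicator {0..1} (snd z) *\<^sub>R f z) \<in> borel_measurable lborel" using f by (simp add: borel_measurable_scaleR)
  show "set_integrable lborel cyl f \<longleftrightarrow> integrable lborel (\<lambda>z. indicator {0..1} (snd z) *\<^sub>R f z)"
    unfolding set_integrable_def by (rule integrable_cong_AE[OF m1 m2 ae])
  show "(LINT z:cyl|lborel. f z) = (LINT z|lborel. indicator {0..1} (snd z) *\<^sub>R f z)"
    unfolding set_lebesgue_integral_def by (rule integral_cong_AE[OF m1 m2 ae])
qed

lemma cyl_fubini:
  fixes f :: "real \<times> real \<Rightarrow> 'b::{banach, second_countable_topology}"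
  assumes f: "f \<in> borel_measurable borel" and i: "set_integrable lborel cyl f"
  shows "AE x in lborel. set_integrable lborel {0..1} (\<lambda>y. f (x, y))"
    and "integrable lborel (\<lambda>x. (LINT y:{0..1}|lborel. f (x, y)))"
    and "(LINT z:cyl|lborel. f z) = (LINT x|lborel. (LINT y:{0..1}|lborel. f (x, y)))"
  using fubini_plane(1-3)[OF i[unfolded cyl_strip(1)[OF f]]]
  unfolding cyl_strip(2)[OF f] by (simp_all add: set_integrable_def set_lebesgue_integral_def)

text \<open>Square integrability of the oscillation is known only slice by slice, with a bound by an
  integrable function of \<open>x\<close>; Tonelli's theorem turns this into integrability on the
  cylinder.\<close>

lemma cyl_integrableI:
  fixes f :: "real \<times> real \<Rightarrow> real"
  assumes f: "f \<in> borel_measurable borel" "\<And>z. f z \<ge> 0"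
    and s: "AE x in lborel. set_integrable lborel {0..1} (\<lambda>y. f (x, y)) \<and> (LINT y:{0..1}|lborel. f (x, y)) \<le> P x"
    and P: "integrable lborel P"
  shows "set_integrable lborel cyl f"
proof -
  have mi: "(\<lambda>z::real \<times> real. indicator {0..1} (snd z) :: real) \<in> borel_measurable borel" by (rule measurable_fst_snd_borel(2)) measurable
  have m: "(\<lambda>z. indicator {0..1} (snd z) *\<^sub>R f z) \<in> borel_measurable (lborel \<Otimes>\<^sub>M lborel)"
    using borel_measurable_scaleR[OF mi f(1)] by (simp add: lborel_prod)
  have "(\<lambda>(x, y). norm (indicator {0..1} (snd (x, y)) *\<^sub>R f (x, y))) \<in> borel_measurable (lborel \<Otimes>\<^sub>M lborel)"
    using measurable_compose[OF m borel_measurable_norm] by (simp add: split_def)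
  from lborel.borel_measurable_lebesgue_integral[OF this]
  have m': "(\<lambda>x. LINT y|lborel. norm (indicator {0..1} (snd (x, y)) *\<^sub>R f (x, y))) \<in> borel_measurable lborel" .
  have "integrable (lborel \<Otimes>\<^sub>M lborel) (\<lambda>z. indicator {0..1} (snd z) *\<^sub>R f z)"
  proof (rule lborel_pair.Fubini_integrable[OF m])
    show "AE x in lborel. integrable lborel (\<lambda>y. indicator {0..1} (snd (x, y)) *\<^sub>R f (x, y))"
      using s by eventually_elim (simp add: set_integrable_def)
    show "integrable lborel (\<lambda>x. LINT y|lborel. norm (indicator {0..1} (snd (x, y)) *\<^sub>R f (x, y)))"
    proof (rule Bochner_Integration.integrable_bound[OF P m'])
      show "AE x in lborel. norm (LINT y|lborel. norm (indicator {0..1} (snd (x, y)) *\<^sub>R f (x, y))) \<le> norm (P x)"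
        using s
      proof eventually_elim
        case (elim x)
        have e: "norm (indicator {0..1} y *\<^sub>R f (x, y)) = indicator {0..1} y *\<^sub>R f (x, y)" for y using f(2) by (simp add: indicator_def)
        have "0 \<le> (LINT y:{0..1}|lborel. f (x, y))" unfolding set_lebesgue_integral_def by (intro Bochner_Integration.integral_nonneg) (simp add: f(2))
        then show ?case using elim unfolding snd_conv e by (simp add: set_lebesgue_integral_def)
      qed
    qed
  qed
  then show ?thesis unfolding cyl_strip(1)[OF f(1)] by (simp add: lborel_prod)
qed

lemma Basis_plane: "(1, 0) \<in> (Basis :: (real \<times> real) set)" "(0, 1) \<in> (Basis :: (real \<times> real) set)"
  by (simp_all add: Basis_prod_def)

lemma unit_const: "set_integrable lborel {0..1::real} (\<lambda>y. r)" "(LINT y:{0..1::real}|lborel. r) = r" for r :: real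
  using borel_integrable_atLeastAtMost'[of 0 1 "\<lambda>y::real. r"] set_integral_const[of "{0..1::real}" lborel r] by auto

lemma cdot_le: "\<bar>cdot (\<i> * a) b\<bar> \<le> norm a * norm b"
proof -
  have "\<bar>cdot (\<i> * a) b\<bar> \<le> norm (\<i> * a * cnj b)" unfolding cdot_def by (rule abs_Re_le_cmod)
  then show ?thesis by (simp add: norm_mult)
qed

text \<open>Young's inequality with the weights for which, after the factor 1/2 in the momentum, the
  term in \<open>x\<close> is exactly the kinetic energy of the oscillation.\<close>

lemma sqrt2_product_le: "sqrt 2 * (x * y) \<le> x\<^sup>2 + y\<^sup>2 / 2" for x y :: real
proof -
  have "0 \<le> (x - y * (sqrt 2 / 2))\<^sup>2" by simp
  then show ?thesis by (simp add: power2_diff power_mult_distrib power_divide algebra_simps)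
qed

text \<open>Almost everywhere the periodicity holds for all integer translates at once, as these are
  countably many, and the translate by minus the floor of the second coordinate lies in the
  strip.\<close>

lemma strip_periodic_AE:
  fixes P :: "real \<times> real \<Rightarrow> bool"
  assumes s: "AE z in lborel. snd z \<in> {0..1} \<longrightarrow> P z"
    and p: "AE z in lborel. P (fst z, snd z + 1) \<longleftrightarrow> P z"
  shows "AE z in lborel. P z"
proof -
  have p': "AE z in lborel. P (fst z, snd z + of_int k + 1) \<longleftrightarrow> P (fst z, snd z + of_int k)" for k :: int
    using AE_translate[OF p, of "(0, of_int k)"] by (simp add: add_ac plus_prod_def)
  have *: "AE z in lborel. \<forall>k::int. (P (fst z, snd z + of_int k + 1) \<longleftrightarrow> P (fst z, snd z + of_int k)) \<and>
      (snd z + of_int k \<in> {0..1} \<longrightarrow> P (fst z, snd z + of_int k))"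
    unfolding AE_all_countable
  proof (intro allI)
    fix k :: int
    have "AE z in lborel. snd z + of_int k \<in> {0..1} \<longrightarrow> P (fst z, snd z + of_int k)"
      using AE_translate[OF s, of "(0, of_int k)"] by (simp add: add_ac plus_prod_def)
    with p'[of k] show "AE z in lborel. (P (fst z, snd z + of_int k + 1) \<longleftrightarrow> P (fst z, snd z + of_int k)) \<and>
      (snd z + of_int k \<in> {0..1} \<longrightarrow> P (fst z, snd z + of_int k))" by eventually_elim blast
  qed
  then show ?thesis
  proof eventually_elim
    case (elim z)
    have step: "P (fst z, snd z + of_int (k + 1)) \<longleftrightarrow> P (fst z, snd z + of_int k)" for k :: int
      using elim[rule_format, of k] by (simp add: add_ac)
    have all: "P (fst z, snd z + of_int k) \<longleftrightarrow> P z" for k :: int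
    proof (induction k rule: int_induct[of _ 0])
      case base show ?case by simp
    next
      case (step1 i) then show ?case using step[of i] by simp
    next
      case (step2 i) then show ?case using step[of "i - 1"] by simp
    qed
    have "snd z + of_int (- \<lfloor>snd z\<rfloor>) \<in> {0..1}" by (simp; linarith)
    then show ?case using elim all by blast
  qed
qed

lemma integrable_nonneg_le:
  fixes f g :: "real \<Rightarrow> real"
  assumes "integrable lborel g" "f \<in> borel_measurable borel" "AE x in lborel. 0 \<le> f x \<and> f x \<le> g x"
  shows "integrable lborel f"
proof (rule Bochner_Integration.integrable_bound[OF assms(1)])
  show "AE x in lborel. norm (f x) \<le> norm (g x)" using assms(3) by eventually_elim auto
qed (use assms(2) in simp)

section \<open>Comparison of a function on the cylinder with its mean\<close>

lemma X_cyl_facts: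
  assumes "\<psi> \<in> X_cyl"
  defines "g1 \<equiv> weak_deriv (1, 0) \<psi>" and "g2 \<equiv> weak_deriv (0, 1) \<psi>"
  shows "has_weak_deriv (1, 0) \<psi> g1" "has_weak_deriv (0, 1) \<psi> g2" "L1_loc (\<lambda>z. (norm (\<psi> z))\<^sup>2)"
    "AE z in lborel. \<psi> (fst z, snd z + 1) = \<psi> z"
    "set_integrable lborel cyl (\<lambda>z. (norm (g1 z))\<^sup>2)" "set_integrable lborel cyl (\<lambda>z. (norm (g2 z))\<^sup>2)"
    "set_integrable lborel cyl (\<lambda>z. (1 - (norm (\<psi> z))\<^sup>2)\<^sup>2)"
    "E_cyl lam \<psi> = 1/2 * (LINT z:cyl|lborel. (norm (g1 z))\<^sup>2) + lam\<^sup>2 / 2 * (LINT z:cyl|lborel. (norm (g2 z))\<^sup>2)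
      + 1/4 * (LINT z:cyl|lborel. (1 - (norm (\<psi> z))\<^sup>2)\<^sup>2)"
proof -
  have h: "\<psi> \<in> H1_loc" "AE z in lborel. \<psi> (fst z, snd z + 1) = \<psi> z"
    and i1: "set_integrable lborel cyl (\<lambda>z. (norm (g1 z))\<^sup>2)" and i2: "set_integrable lborel cyl (\<lambda>z. (norm (g2 z))\<^sup>2)"
    and i3: "set_integrable lborel cyl (\<lambda>z. (1 - (norm (\<psi> z))\<^sup>2)\<^sup>2)"
    using assms by (auto simp: X_cyl_def H1_loc_cyl_def)
  from h(1) have "L2_loc \<psi>" and "\<And>b. b \<in> Basis \<Longrightarrow> \<exists>g. has_weak_deriv b \<psi> g" by (auto simp: H1_loc_def)
  then show "has_weak_deriv (1, 0) \<psi> g1" "has_weak_deriv (0, 1) \<psi> g2" "L1_loc (\<lambda>z. (norm (\<psi> z))\<^sup>2)"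
    using weak_deriv_works Basis_plane unfolding g1_def g2_def L2_loc_def L1_loc_def by blast+
  show "AE z in lborel. \<psi> (fst z, snd z + 1) = \<psi> z" by (rule h(2))
  show "set_integrable lborel cyl (\<lambda>z. (norm (g1 z))\<^sup>2)" "set_integrable lborel cyl (\<lambda>z. (norm (g2 z))\<^sup>2)"
    "set_integrable lborel cyl (\<lambda>z. (1 - (norm (\<psi> z))\<^sup>2)\<^sup>2)" by fact+
  show "E_cyl lam \<psi> = 1/2 * (LINT z:cyl|lborel. (norm (g1 z))\<^sup>2) + lam\<^sup>2 / 2 * (LINT z:cyl|lborel. (norm (g2 z))\<^sup>2)
      + 1/4 * (LINT z:cyl|lborel. (1 - (norm (\<psi> z))\<^sup>2)\<^sup>2)"
    unfolding E_cyl_def g1_def[symmetric] g2_def[symmetric]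
    using i1 set_integrable_mult_right[OF i2, of "lam\<^sup>2"] by (simp add: set_integral_add(2) algebra_simps)
qed

text \<open>The mean is replaced by its absolutely continuous version, which lifts to the plane as a
  function of \<open>x\<close>, and is put back almost everywhere.\<close>

lemma osc_y_weak_deriv:
  assumes w: "has_weak_deriv (1, 0) \<psi> g"
  shows "has_weak_deriv (1, 0) (osc_y \<psi>) (\<lambda>z. g z - mean_y g (fst z))"
    and "\<exists>v. ac v (mean_y g) \<and> (AE x in lborel. mean_y \<psi> x = v x)"
proof -
  have wu: "has_weak_deriv 1 (mean_y \<psi>) (mean_y g)" by (rule mean_y_weak_deriv[OF w])
  then obtain v where v: "ac v (mean_y g)" "AE x in lborel. mean_y \<psi> x = v x" using weak_deriv_ac by blast
  then show "\<exists>v. ac v (mean_y g) \<and> (AE x in lborel. mean_y \<psi> x = v x)" by blast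
  note L = has_weak_derivD(1,2)[OF w] and Lu = has_weak_derivD(1,2)[OF wu]
  have "has_weak_deriv (1, 0) (\<lambda>z::real \<times> real. 1 *\<^sub>R v (fst z)) (\<lambda>z. 1 *\<^sub>R mean_y g (fst z))"
    by (rule product_weak_deriv(1)[where A="\<lambda>_. 1", OF v(1) ac_const])
  from has_weak_deriv_diff[OF w this Basis_plane(1)]
  show "has_weak_deriv (1, 0) (osc_y \<psi>) (\<lambda>z. g z - mean_y g (fst z))"
  proof (rule has_weak_deriv_cong_AE[OF _ _ _ _ _ Basis_plane(1)])
    show "AE z in lborel. osc_y \<psi> z = \<psi> z - 1 *\<^sub>R v (fst z)" using AE_fst[OF v(2)] by eventually_elim (simp add: osc_y_def)
    show "osc_y \<psi> \<in> borel_measurable borel"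
      unfolding osc_y_def[abs_def] using L1_loc_measurable[OF L(1)] L1_loc_measurable[OF L1_loc_fst_snd(1)[OF Lu(1)]] by measurable
    show "(\<lambda>z. g z - mean_y g (fst z)) \<in> borel_measurable borel"
      using L1_loc_measurable[OF L(2)] L1_loc_measurable[OF L1_loc_fst_snd(1)[OF Lu(2)]] by measurable
  qed simp
qed

text \<open>The numbers \<open>a\<close>, \<open>b\<close>, \<open>D\<close> are the squared norms
  of the x-derivative of the oscillation, of the y-derivative of \<psi>, and of the oscillation. The
  conclusions contain all that the final argument uses about \<psi>. The kinetic energy splits
  exactly, by Pythagoras on each circle; the potential does not, and \<open>D / 2\<close> is the
  price of replacing \<psi> by its mean.\<close>

lemma cyl_reduction:
  assumes X: "\<psi> \<in> X_cyl"
  obtains d a b D where "mean_y \<psi> \<in> X_line" "momentum_cyl \<psi> = momentum_line (mean_y \<psi>) + d"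
    "sqrt 2 * \<bar>d\<bar> \<le> a / 2 + D / 4" "0 \<le> a" "0 \<le> D" "D \<le> b" "D = 0 \<Longrightarrow> d = 0"
    "D = 0 \<Longrightarrow> AE z in lborel. \<psi> z = mean_y \<psi> (fst z)"
    "\<And>u. AE z in lborel. \<psi> z = u (fst z) \<Longrightarrow> D = 0"
    "\<And>lam. E_line (mean_y \<psi>) + a / 2 + lam\<^sup>2 / 2 * b - D / 2 \<le> E_cyl lam \<psi>"
    "\<And>lam lam'. E_cyl lam \<psi> - E_cyl lam' \<psi> = (lam\<^sup>2 - lam'\<^sup>2) / 2 * b"
proof -
  define g1 where "g1 = weak_deriv (1, 0) \<psi>"
  define g2 where "g2 = weak_deriv (0, 1) \<psi>"
  note F = X_cyl_facts[OF X, folded g1_def g2_def]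
  define u where "u = mean_y \<psi>"
  define U where "U = mean_y g1"
  define w where "w = osc_y \<psi>"
  define w1 where "w1 z = g1 z - U (fst z)" for z
  have we: "w (x, y) = \<psi> (x, y) - u x" "w1 (x, y) = g1 (x, y) - U x" for x y by (simp_all add: w_def osc_y_def u_def w1_def)
  have ww: "has_weak_deriv (1, 0) w w1" using osc_y_weak_deriv(1)[OF F(1)] by (simp add: w_def w1_def[abs_def] U_def)
  obtain v where v: "ac v U" "AE x in lborel. u x = v x" using osc_y_weak_deriv(2)[OF F(1)] unfolding U_def u_def by blast
  note L = has_weak_derivD(1,2)[OF F(1)] has_weak_derivD(2)[OF F(2)] has_weak_derivD(1,2)[OF ww]
  have um: "u \<in> borel_measurable borel" "U \<in> borel_measurable borel"
    using L1_loc_measurable[OF mean_y_L1_loc[OF L(1)]] L1_loc_measurable[OF mean_y_L1_loc[OF L(2)]] by (simp_all add: u_def U_def)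
  have M [measurable]: "\<psi> \<in> borel_measurable borel" "g1 \<in> borel_measurable borel" "g2 \<in> borel_measurable borel"
    "w \<in> borel_measurable borel" "w1 \<in> borel_measurable borel" using L[THEN L1_loc_measurable] by auto
  define N1 where "N1 x = (LINT y:{0..1}|lborel. (norm (g1 (x, y)))\<^sup>2)" for x
  define N2 where "N2 x = (LINT y:{0..1}|lborel. (norm (g2 (x, y)))\<^sup>2)" for x
  define H where "H x = (LINT y:{0..1}|lborel. (1 - (norm (\<psi> (x, y)))\<^sup>2)\<^sup>2)" for x
  define B where "B x = (LINT y:{0..1}|lborel. (norm (w (x, y)))\<^sup>2)" for x
  define a1 where "a1 x = (LINT y:{0..1}|lborel. (norm (w1 (x, y)))\<^sup>2)" for x
  have FN1: "integrable lborel N1" "(LINT z:cyl|lborel. (norm (g1 z))\<^sup>2) = integral\<^sup>L lborel N1"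
    and sN1: "AE x in lborel. set_integrable lborel {0..1} (\<lambda>y. (norm (g1 (x, y)))\<^sup>2)"
    using cyl_fubini[OF _ F(5)] unfolding N1_def by simp_all
  have FN2: "integrable lborel N2" "(LINT z:cyl|lborel. (norm (g2 z))\<^sup>2) = integral\<^sup>L lborel N2"
    and sN2: "AE x in lborel. set_integrable lborel {0..1} (\<lambda>y. (norm (g2 (x, y)))\<^sup>2)"
    using cyl_fubini[OF _ F(6)] unfolding N2_def by simp_all
  have FH: "integrable lborel H" "(LINT z:cyl|lborel. (1 - (norm (\<psi> z))\<^sup>2)\<^sup>2) = integral\<^sup>L lborel H"
    and sH: "AE x in lborel. set_integrable lborel {0..1} (\<lambda>y. (1 - (norm (\<psi> (x, y)))\<^sup>2)\<^sup>2)"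
    using cyl_fubini[OF _ F(7)] unfolding H_def by simp_all
  have nn: "0 \<le> N1 x" "0 \<le> N2 x" "0 \<le> H x" "0 \<le> B x" "0 \<le> a1 x" for x
    unfolding N1_def N2_def H_def B_def a1_def set_lebesgue_integral_def by (intro Bochner_Integration.integral_nonneg; simp)+
  have s1: "AE x in lborel. set_integrable lborel {0..1} (\<lambda>y. (norm (w1 (x, y)))\<^sup>2) \<and> a1 x = N1 x - (norm (U x))\<^sup>2"
    using L1_loc_slice[OF L(2)] sN1
  proof eventually_elim
    case (elim x)
    have U: "U x = (LINT y:{0..1}|lborel. g1 (x, y))" by (simp add: U_def mean_y_def)
    from pythagoras_unit[OF L1_loc_Icc(1)[OF elim(1)] elim(2)] show ?case by (simp add: a1_def N1_def we U)
  qed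
  have s0: "AE x in lborel. set_integrable lborel {0..1} (\<lambda>y. (norm (w (x, y)))\<^sup>2) \<and> B x \<le> N2 x \<and>
      (1 - (norm (u x))\<^sup>2)\<^sup>2 \<le> H x + 2 * B x"
    using L1_loc_slice[OF L(1)] L1_loc_slice[OF F(3)] sN2 sH weak_deriv_snd_slices[OF F(2)]
  proof eventually_elim
    case (elim x)
    have u: "u x = (LINT y:{0..1}|lborel. \<psi> (x, y))" by (simp add: u_def mean_y_def)
    have i: "set_integrable lborel {0..1} (\<lambda>y. \<psi> (x, y))" "set_integrable lborel {0..1} (\<lambda>y. (norm (\<psi> (x, y)))\<^sup>2)"
      by (rule L1_loc_Icc(1)[OF elim(1)], rule L1_loc_Icc(1)[OF elim(2)])
    note py = pythagoras_unit[OF i, folded u]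
    have B: "B x = (LINT y:{0..1}|lborel. (norm (\<psi> (x, y)))\<^sup>2) - (norm (u x))\<^sup>2" using py(2) by (simp add: B_def we)
    define A where "A = (LINT y:{0..1}|lborel. 1 - (norm (\<psi> (x, y)))\<^sup>2)"
    have "A = 1 - (LINT y:{0..1}|lborel. (norm (\<psi> (x, y)))\<^sup>2)"
      unfolding A_def using set_integral_diff(2)[OF unit_const(1)[of 1] i(2)] unit_const(2)[of 1] by simp
    \<comment> \<open>Here \<open>A\<close> is the mean of \<open>1 - |\<psi>|^2\<close> on the
      circle and \<open>B x\<close> the variance of \<psi>. As \<open>A + B x <= 1\<close>, the
      square of \<open>A + B x\<close> is at most \<open>A^2 + 2 * B x\<close>, and Jensen bounds
      \<open>A^2\<close>. The factor 1/4 of the potential turns \<open>2 * D\<close> into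
      \<open>D / 2\<close>.\<close>
    then have AB: "1 - (norm (u x))\<^sup>2 = A + B x" using B by simp
    have "A\<^sup>2 \<le> H x" unfolding A_def H_def by (rule jensen_unit[OF set_integral_diff(1)[OF unit_const(1) i(2)] elim(4)])
    moreover have "(A + B x)\<^sup>2 = A\<^sup>2 + 2 * (B x * (A + B x)) - (B x)\<^sup>2" by (simp add: power2_eq_square algebra_simps)
    moreover have "A + B x \<le> 1" unfolding AB[symmetric] by simp
    then have "B x * (A + B x) \<le> B x * 1" by (rule mult_left_mono) (rule nn)
    ultimately have 2: "(1 - (norm (u x))\<^sup>2)\<^sup>2 \<le> H x + 2 * B x" unfolding AB using zero_le_power2[of "B x"] by linarith
    obtain c where "AE y in lborel. \<psi> (x, y) = c + antider (\<lambda>t. g2 (x, t)) y" using elim(5) by blast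
    from poincare_unit[OF _ elim(3) L1_loc_measurable[OF elim(1)] this] elim(5)
    have "B x \<le> N2 x" by (simp add: B_def N2_def we u)
    with 2 py(1) show ?case by (simp add: we)
  qed
  have cw1: "set_integrable lborel cyl (\<lambda>z. (norm (w1 z))\<^sup>2)"
  proof (rule cyl_integrableI[OF _ _ _ FN1(1)])
    show "AE x in lborel. set_integrable lborel {0..1} (\<lambda>y. (norm (w1 (x, y)))\<^sup>2) \<and> (LINT y:{0..1}|lborel. (norm (w1 (x, y)))\<^sup>2) \<le> N1 x"
      using s1 by eventually_elim (simp add: a1_def)
  qed simp_all
  have cw: "set_integrable lborel cyl (\<lambda>z. (norm (w z))\<^sup>2)"
  proof (rule cyl_integrableI[OF _ _ _ FN2(1)])
    show "AE x in lborel. set_integrable lborel {0..1} (\<lambda>y. (norm (w (x, y)))\<^sup>2) \<and> (LINT y:{0..1}|lborel. (norm (w (x, y)))\<^sup>2) \<le> N2 x"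
      using s0 by eventually_elim (simp add: B_def)
  qed simp_all
  have Fa: "integrable lborel a1" "(LINT z:cyl|lborel. (norm (w1 z))\<^sup>2) = integral\<^sup>L lborel a1"
    using cyl_fubini[OF _ cw1] unfolding a1_def by simp_all
  have FB: "integrable lborel B" "(LINT z:cyl|lborel. (norm (w z))\<^sup>2) = integral\<^sup>L lborel B"
    using cyl_fubini[OF _ cw] unfolding B_def by simp_all
  define a where "a = integral\<^sup>L lborel a1"
  define b where "b = integral\<^sup>L lborel N2"
  define D where "D = integral\<^sup>L lborel B"
  have sgn: "0 \<le> a" "0 \<le> D" unfolding a_def D_def using nn by simp_all
  have Db: "D \<le> b" unfolding D_def b_def by (rule integral_mono_AE[OF FB(1) FN2(1)]) (use s0 in \<open>auto elim: eventually_mono\<close>)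
  have U2: "integrable lborel (\<lambda>x. (norm (U x))\<^sup>2)"
  proof (rule integrable_nonneg_le[OF FN1(1)])
    show "AE x in lborel. 0 \<le> (norm (U x))\<^sup>2 \<and> (norm (U x))\<^sup>2 \<le> N1 x" using s1
    proof eventually_elim
      case (elim x) then show ?case using nn(5)[of x] by simp
    qed
  qed (use um in measurable)
  have eq1: "(LINT x|lborel. (norm (U x))\<^sup>2) = integral\<^sup>L lborel N1 - a"
  proof -
    have "a = (LINT x|lborel. N1 x - (norm (U x))\<^sup>2)"
      unfolding a_def by (rule integral_cong_AE) (use s1 um Fa(1) FN1(1) in \<open>auto elim!: eventually_mono\<close>)
    then show ?thesis using FN1(1) U2 by simp
  qed
  note HB = Bochner_Integration.integrable_add[OF FH(1) integrable_mult_right[OF FB(1), of 2]]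
  have vm: "v \<in> borel_measurable borel" using borel_measurable_continuous_onI[OF ac_continuous_on[OF v(1)]] .
  have v2: "AE x in lborel. (1 - (norm (v x))\<^sup>2)\<^sup>2 \<le> H x + 2 * B x"
    using s0 v(2) by eventually_elim simp
  have V: "integrable lborel (\<lambda>x. (1 - (norm (v x))\<^sup>2)\<^sup>2)"
  proof (rule integrable_nonneg_le[OF HB])
    show "AE x in lborel. 0 \<le> (1 - (norm (v x))\<^sup>2)\<^sup>2 \<and> (1 - (norm (v x))\<^sup>2)\<^sup>2 \<le> H x + 2 * B x"
      using v2 by eventually_elim simp
  qed (use vm in measurable)
  have V': "(LINT x|lborel. (1 - (norm (v x))\<^sup>2)\<^sup>2) \<le> integral\<^sup>L lborel H + 2 * D"
    using integral_mono_AE[OF V HB v2] FH(1) FB(1) by (simp add: D_def)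
  have fin: "finen v U" using v(1) U2 V by (simp add: finen_def)
  note XL = X_lineI[OF fin um(1) v(2)]
  have EL: "E_line u = 1/2 * (integral\<^sup>L lborel N1 - a) + 1/4 * (LINT x|lborel. (1 - (norm (v x))\<^sup>2)\<^sup>2)"
    unfolding XL(3) dens_def using U2 V by (simp add: eq1 add_divide_distrib)
  define q where "q z = cdot (\<i> * w1 z) (w z)" for z
  have qm: "q \<in> borel_measurable borel" unfolding q_def[abs_def] cdot_def by measurable
  define d where "d = 1/2 * (LINT z:cyl|lborel. q z)"
  have dd: "momentum_cyl \<psi> = momentum_line u + d"
  proof -
    have wd: "weak_deriv (1, 0) w \<in> borel_measurable borel"
      using L1_loc_measurable[OF has_weak_derivD(2)[OF weak_deriv_works[OF ww]]] .
    have c: "cyl \<in> sets borel" unfolding cyl_def by (simp add: borel_prod[symmetric])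
    have "(LINT z:cyl|lborel. cdot (\<i> * weak_deriv (1, 0) w z) (w z)) = (LINT z:cyl|lborel. q z)"
      by (rule set_lebesgue_integral_cong_AE)
        (use weak_deriv_AE[OF ww] wd c qm in \<open>auto simp: q_def cdot_def elim!: eventually_mono\<close>)
    then show ?thesis by (simp add: momentum_cyl_def u_def w_def d_def)
  qed
  have cb: "set_integrable lborel cyl (\<lambda>z. (norm (w1 z))\<^sup>2 + (norm (w z))\<^sup>2 / 2)"
    by (intro set_integral_add(1) cw1 set_integrable_divide cw)
  have qb: "sqrt 2 * \<bar>q z\<bar> \<le> (norm (w1 z))\<^sup>2 + (norm (w z))\<^sup>2 / 2" for z
  proof -
    have "sqrt 2 * \<bar>q z\<bar> \<le> sqrt 2 * (norm (w1 z) * norm (w z))" unfolding q_def by (rule mult_left_mono[OF cdot_le]) simp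
    then show ?thesis using sqrt2_product_le[of "norm (w1 z)" "norm (w z)"] by linarith
  qed
  have dbd: "sqrt 2 * \<bar>d\<bar> \<le> a / 2 + D / 4"
  proof -
    have "sqrt 2 * \<bar>LINT z:cyl|lborel. q z\<bar> = \<bar>LINT z:cyl|lborel. sqrt 2 * q z\<bar>" by (simp add: abs_mult)
    also have "\<dots> \<le> (LINT z:cyl|lborel. (norm (w1 z))\<^sup>2 + (norm (w z))\<^sup>2 / 2)"
      unfolding set_lebesgue_integral_def real_norm_def[symmetric]
    proof (rule Bochner_Integration.integral_norm_bound_integral[OF _ cb[unfolded set_integrable_def]])
      have b: "norm (indicator cyl z *\<^sub>R (sqrt 2 * q z)) \<le> indicator cyl z *\<^sub>R ((norm (w1 z))\<^sup>2 + (norm (w z))\<^sup>2 / 2)" for z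
        using qb[of z] by (simp add: abs_mult indicator_def)
      then show "norm (indicator cyl z *\<^sub>R (sqrt 2 * q z)) \<le> indicator cyl z *\<^sub>R ((norm (w1 z))\<^sup>2 + (norm (w z))\<^sup>2 / 2)" for z .
      have c: "cyl \<in> sets borel" unfolding cyl_def by (simp add: borel_prod[symmetric])
      show "integrable lborel (\<lambda>z. indicator cyl z *\<^sub>R (sqrt 2 * q z))"
      proof (rule Bochner_Integration.integrable_bound[OF cb[unfolded set_integrable_def]])
        show "AE z in lborel. norm (indicator cyl z *\<^sub>R (sqrt 2 * q z)) \<le> norm (indicator cyl z *\<^sub>R ((norm (w1 z))\<^sup>2 + (norm (w z))\<^sup>2 / 2))"
          using order_trans[OF b abs_ge_self] by simp
        show "(\<lambda>z. indicator cyl z *\<^sub>R (sqrt 2 * q z)) \<in> borel_measurable lborel"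
          using c qm by (simp add: borel_measurable_indicator borel_measurable_scaleR)
      qed
    qed
    also have "\<dots> = a + D / 2"
      using cw1 cw by (simp add: set_integral_add(2) set_integrable_divide Fa(2) FB(2) a_def D_def)
    finally show ?thesis by (simp add: d_def abs_mult)
  qed
  have D0: "AE x in lborel. B x = 0" if "D = 0"
    using integral_nonneg_eq_0_iff_AE[OF FB(1)] nn(4) that by (simp add: D_def)
  \<comment> \<open>\<open>D\<close> sees the fundamental domain only; periodicity extends the
    conclusion to the plane.\<close>
  have per: "AE z in lborel. w z = 0" if "D = 0"
  proof (rule strip_periodic_AE)
    show "AE z in lborel. (w (fst z, snd z + 1) = 0) = (w z = 0)" using F(4) by eventually_elim (simp add: w_def osc_y_def)
    have "(\<lambda>z::real \<times> real. indicator {0..1} (snd z) :: real) \<in> borel_measurable borel" by (rule measurable_fst_snd_borel(2)) measurable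
    have "(LINT z|lborel. indicator {0..1} (snd z) *\<^sub>R (norm (w z))\<^sup>2) = 0"
      using cyl_strip(2)[of "\<lambda>z. (norm (w z))\<^sup>2"] FB(2) that by (simp add: D_def)
    moreover have "integrable lborel (\<lambda>z. indicator {0..1} (snd z) *\<^sub>R (norm (w z))\<^sup>2)"
      using cyl_strip(1)[of "\<lambda>z. (norm (w z))\<^sup>2"] cw by simp
    ultimately have "AE z in lborel. indicator {0..1} (snd z) *\<^sub>R (norm (w z))\<^sup>2 = 0"
      using integral_nonneg_eq_0_iff_AE[of lborel "\<lambda>z. indicator {0..1} (snd z) *\<^sub>R (norm (w z))\<^sup>2"] by simp
    then show "AE z in lborel. snd z \<in> {0..1} \<longrightarrow> w z = 0" by eventually_elim (auto simp: indicator_def split: if_splits)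
  qed
  have arith: "1/2 * (n - a) + 1/4 * v + a / 2 + l - D / 2 \<le> 1/2 * n + l + 1/4 * h" if "v \<le> h + 2 * D" for n v l h :: real
    using that by (simp add: field_simps)
  show ?thesis
  proof (rule that[of d a D b, folded u_def])
    show "u \<in> X_line" by (rule XL(1))
    show "momentum_cyl \<psi> = momentum_line u + d" "sqrt 2 * \<bar>d\<bar> \<le> a / 2 + D / 4" "0 \<le> a" "0 \<le> D" "D \<le> b" by fact+
    show "d = 0" if "D = 0"
    proof -
      have "AE z in lborel. indicator cyl z *\<^sub>R q z = 0" using per[OF that] by eventually_elim (simp add: q_def cdot_def)
      from integral_eq_zero_AE[OF this] show ?thesis by (simp add: d_def set_lebesgue_integral_def)
    qed
    show "AE z in lborel. \<psi> z = u (fst z)" if "D = 0"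
      using per[OF that] by eventually_elim (simp add: w_def osc_y_def u_def)
    show "D = 0" if "AE z in lborel. \<psi> z = u0 (fst z)" for u0
    proof -
      have "AE x in lborel. B x = 0" using AE_plane[OF that] L1_loc_slice[OF L(1)]
      proof eventually_elim
        case (elim x)
        have "(LINT y:{0..1}|lborel. \<psi> (x, y)) = (LINT y:{0..1::real}|lborel. u0 x)"
          unfolding set_lebesgue_integral_def
          by (rule integral_cong_AE) (use elim(1) L1_loc_measurable[OF elim(2)] in \<open>auto elim!: eventually_mono\<close>)
        also have "\<dots> = u0 x" by (simp add: set_integral_const)
        finally have "u x = u0 x" by (simp add: u_def mean_y_def)
        then have "AE y in lborel. indicator {0..1} y *\<^sub>R (norm (w (x, y)))\<^sup>2 = 0" using elim(1) by (auto simp: we elim!: eventually_mono)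
        from integral_eq_zero_AE[OF this] show ?case by (simp add: B_def set_lebesgue_integral_def)
      qed
      from integral_eq_zero_AE[OF this] show ?thesis by (simp add: D_def)
    qed
    show "E_line u + a / 2 + lam\<^sup>2 / 2 * b - D / 2 \<le> E_cyl lam \<psi>" for lam
      unfolding EL F(8) FN1(2) FN2(2) FH(2) b_def[symmetric] by (rule arith[OF V'])
    show "E_cyl lam \<psi> - E_cyl lam' \<psi> = (lam\<^sup>2 - lam'\<^sup>2) / 2 * b" for lam lam'
      unfolding F(8) FN2(2) b_def by (simp add: algebra_simps diff_divide_distrib)
  qed
qed

section \<open>Explicit functions on the cylinder: lifted solitons and functions of small
  energy\<close>

lemma X_cylI:
  assumes w: "has_weak_deriv (1, 0) \<psi> g1" "has_weak_deriv (0, 1) \<psi> g2"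
    and L: "L1_loc (\<lambda>z. (norm (\<psi> z))\<^sup>2)" "L1_loc (\<lambda>z. (norm (g1 z))\<^sup>2)" "L1_loc (\<lambda>z. (norm (g2 z))\<^sup>2)"
    and p: "\<And>x y. \<psi> (x, y + 1) = \<psi> (x, y)"
    and i: "set_integrable lborel cyl (\<lambda>z. (norm (g1 z))\<^sup>2)" "set_integrable lborel cyl (\<lambda>z. (norm (g2 z))\<^sup>2)"
      "set_integrable lborel cyl (\<lambda>z. (1 - (norm (\<psi> z))\<^sup>2)\<^sup>2)"
  shows "\<psi> \<in> X_cyl"
    and "E_cyl lam \<psi> = 1/2 * (LINT z:cyl|lborel. (norm (g1 z))\<^sup>2) + lam\<^sup>2 / 2 * (LINT z:cyl|lborel. (norm (g2 z))\<^sup>2)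
      + 1/4 * (LINT z:cyl|lborel. (1 - (norm (\<psi> z))\<^sup>2)\<^sup>2)"
proof -
  have c: "cyl \<in> sets borel" unfolding cyl_def by (simp add: borel_prod[symmetric])
  have wm: "set_integrable lborel cyl (\<lambda>z. (norm (weak_deriv b \<psi> z))\<^sup>2)"
    "(LINT z:cyl|lborel. (norm (weak_deriv b \<psi> z))\<^sup>2) = (LINT z:cyl|lborel. (norm (g z))\<^sup>2)"
    if b: "has_weak_deriv b \<psi> g" and g: "set_integrable lborel cyl (\<lambda>z. (norm (g z))\<^sup>2)" for b g
  proof -
    have ae: "AE z in lborel. (norm (weak_deriv b \<psi> z))\<^sup>2 = (norm (g z))\<^sup>2" using weak_deriv_AE[OF b] by eventually_elim simp
    have [measurable]: "g \<in> borel_measurable borel" "weak_deriv b \<psi> \<in> borel_measurable borel"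
      using L1_loc_measurable[OF has_weak_derivD(2)[OF b]] L1_loc_measurable[OF has_weak_derivD(2)[OF weak_deriv_works[OF b]]] by auto
    have m: "(\<lambda>z. indicator cyl z *\<^sub>R (norm (g z))\<^sup>2) \<in> borel_measurable lborel"
      "(\<lambda>z. indicator cyl z *\<^sub>R (norm (weak_deriv b \<psi> z))\<^sup>2) \<in> borel_measurable lborel"
      using c by (auto intro!: borel_measurable_scaleR borel_measurable_indicator)
    have ae': "AE z in lborel. indicator cyl z *\<^sub>R (norm (weak_deriv b \<psi> z))\<^sup>2 = indicator cyl z *\<^sub>R (norm (g z))\<^sup>2"
      using ae by eventually_elim simp
    show "set_integrable lborel cyl (\<lambda>z. (norm (weak_deriv b \<psi> z))\<^sup>2)"
      using g integrable_cong_AE[OF m(2,1) ae'] by (simp add: set_integrable_def)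
    show "(LINT z:cyl|lborel. (norm (weak_deriv b \<psi> z))\<^sup>2) = (LINT z:cyl|lborel. (norm (g z))\<^sup>2)"
      unfolding set_lebesgue_integral_def by (rule integral_cong_AE[OF m(2,1) ae'])
  qed
  have L2: "L2_loc h" if "f \<in> borel_measurable borel" "L1_loc (\<lambda>z. (norm (f z))\<^sup>2)" "h = f" for f h :: "real \<times> real \<Rightarrow> complex"
    using that by (simp add: L2_loc_def L1_loc_def)
  note m = has_weak_derivD(1)[OF w(1), THEN L1_loc_measurable] has_weak_derivD(2)[OF w(1), THEN L1_loc_measurable]
    has_weak_derivD(2)[OF w(2), THEN L1_loc_measurable]
  have "\<psi> \<in> H1_loc"
    unfolding H1_loc_def using L2[OF m(1) L(1)] L2[OF m(2) L(2)] L2[OF m(3) L(3)] w by (auto simp: Basis_prod_def)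
  then show X: "\<psi> \<in> X_cyl" using wm(1)[OF w(1) i(1)] wm(1)[OF w(2) i(2)] i(3) p by (simp add: X_cyl_def H1_loc_cyl_def)
  show "E_cyl lam \<psi> = 1/2 * (LINT z:cyl|lborel. (norm (g1 z))\<^sup>2) + lam\<^sup>2 / 2 * (LINT z:cyl|lborel. (norm (g2 z))\<^sup>2)
      + 1/4 * (LINT z:cyl|lborel. (1 - (norm (\<psi> z))\<^sup>2)\<^sup>2)"
    unfolding X_cyl_facts(8)[OF X] wm(2)[OF w(1) i(1)] wm(2)[OF w(2) i(2)] by simp
qed

lemma cyl_tensor:
  fixes A k :: "real \<Rightarrow> real"
  assumes A: "continuous_on UNIV A" and k: "integrable lborel k"
  shows "set_integrable lborel cyl (\<lambda>z. A (snd z) * k (fst z))"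
    and "(LINT z:cyl|lborel. A (snd z) * k (fst z)) = (LINT y:{0..1}|lborel. A y) * integral\<^sup>L lborel k"
proof -
  have "A \<in> borel_measurable borel" "k \<in> borel_measurable borel" using borel_measurable_continuous_onI[OF A] k by auto
  then have m: "(\<lambda>z. A (snd z) * k (fst z)) \<in> borel_measurable borel"
    using measurable_fst_snd_borel by (intro borel_measurable_times) blast+
  have iA: "integrable lborel (\<lambda>y. indicator {0..1} y *\<^sub>R A y)"
    using L1_loc_Icc(1)[OF L1_loc_continuous[OF A], of 0 1] by (simp add: set_integrable_def)
  note t = tensor_integrable[OF k iA]
  have e: "indicator {0..1} (snd z) *\<^sub>R (A (snd z) * k (fst z)) = (indicator {0..1} (snd z) *\<^sub>R A (snd z)) *\<^sub>R k (fst z)" for z :: "real \<times> real"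
    by simp
  show "set_integrable lborel cyl (\<lambda>z. A (snd z) * k (fst z))" unfolding cyl_strip(1)[OF m] e by (rule t(1))
  show "(LINT z:cyl|lborel. A (snd z) * k (fst z)) = (LINT y:{0..1}|lborel. A y) * integral\<^sup>L lborel k"
    unfolding cyl_strip(2)[OF m] e t(2) by (simp add: set_lebesgue_integral_def)
qed

lemma lift_line:
  assumes f: "finen v g"
  defines "\<psi> \<equiv> (\<lambda>z::real \<times> real. v (fst z))"
  shows "\<psi> \<in> X_cyl" "E_cyl lam \<psi> = integral\<^sup>L lborel (dens v g)" "momentum_cyl \<psi> = momentum_line v"
proof -
  note F = finenD[OF f]
  have c1: "continuous_on UNIV (\<lambda>y::real. 1::real)" by simp
  have w: "has_weak_deriv (1, 0) \<psi> (\<lambda>z. g (fst z))" "has_weak_deriv (0, 1) \<psi> (\<lambda>z. 0)"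
    using product_weak_deriv[where A="\<lambda>_. 1", OF F(1) ac_const] by (simp_all add: \<psi>_def)
  note t1 = cyl_tensor[OF c1 F(2)] and t2 = cyl_tensor[OF c1 F(3)]
  have cv: "continuous_on UNIV (\<lambda>z::real \<times> real. v (fst z))"
    by (rule continuous_on_compose2[OF F(6)]) (auto intro!: continuous_intros)
  have L0: "L1_loc (\<lambda>z. (norm (\<psi> z))\<^sup>2)" unfolding \<psi>_def by (intro L1_loc_continuous continuous_intros cv)
  have L1: "L1_loc (\<lambda>z::real \<times> real. (norm (g (fst z)))\<^sup>2)" by (rule L1_loc_fst_snd(1)[OF L1_loc_integrable[OF F(2)]])
  have L2: "L1_loc (\<lambda>z::real \<times> real. (norm (0::complex))\<^sup>2)" by (rule L1_loc_continuous) simp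
  have z: "set_integrable lborel cyl (\<lambda>z. (norm (0::complex))\<^sup>2)" by (simp add: set_integrable_def)
  have X: "\<psi> \<in> X_cyl \<and> E_cyl lam \<psi> = 1/2 * (LINT z:cyl|lborel. (norm (g (fst z)))\<^sup>2) + lam\<^sup>2 / 2 * (LINT z:cyl|lborel. (norm (0::complex))\<^sup>2)
      + 1/4 * (LINT z:cyl|lborel. (1 - (norm (\<psi> z))\<^sup>2)\<^sup>2)" for lam
    using t1(1) t2(1) by (intro conjI X_cylI[OF w L0 L1 L2 _ _ z]) (simp_all add: \<psi>_def)
  then show "\<psi> \<in> X_cyl" by simp
  have "integral\<^sup>L lborel (dens v g) = 1/2 * (LINT x|lborel. (norm (g x))\<^sup>2) + 1/4 * (LINT x|lborel. (1 - (norm (v x))\<^sup>2)\<^sup>2)"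
    unfolding dens_def using F(2,3) by simp
  then show "E_cyl lam \<psi> = integral\<^sup>L lborel (dens v g)"
    using X[of lam] t1(2) t2(2) unit_const(2)[of 1] by (simp add: \<psi>_def)
  have m: "mean_y \<psi> = v" by (simp add: mean_y_def \<psi>_def set_integral_const fun_eq_iff)
  then have "osc_y \<psi> = (\<lambda>z. 0)" by (simp add: osc_y_def \<psi>_def fun_eq_iff)
  then show "momentum_cyl \<psi> = momentum_line v" by (simp add: momentum_cyl_def m cdot_def)
qed

text \<open>\<open>A\<close> imitates the indicator of an arc of length \<open>s\<close>. The weight
  \<open>A^2 (1 - A)^2\<close> vanishes at the values 0 and 1, so its integral tends to 0 as the
  transition zones become thin and the height of the plateau tends to 1. The integral of
  \<open>A^2\<close> has to be exactly \<open>s\<close>, since it will be the momentum up to a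
  factor. The size of \<open>A'\<close> is left uncontrolled: its cost carries \<open>lam^2\<close>,
  which is chosen last.\<close>

lemma plateau:
  assumes s: "0 < s" "s < 1" and e: "e > 0"
  obtains A A' :: "real \<Rightarrow> real" where "ac A A'" "continuous_on UNIV A" "continuous_on UNIV A'" "\<And>y. A (y + 1) = A y"
    "(LINT y:{0..1}|lborel. (A y)\<^sup>2) = s" "(LINT y:{0..1}|lborel. (A y)\<^sup>2 * (1 - A y)\<^sup>2) < e"
proof -
  \<comment> \<open>Periodic, and positive exactly on the arc of length \<open>s\<close> centred at
    0 modulo 1; \<open>step (n * c)\<close> then tends to the indicator of this arc.\<close>
  define c where "c y = cos (2 * pi * y) - cos (pi * s)" for y
  define h where "h n y = step (real n * c y)" for n y
  have st: "continuous_on UNIV step" by (rule smooth_continuous[OF smooth_step])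
  have ch: "continuous_on S (h n)" for S n
    unfolding h_def[abs_def] c_def by (rule continuous_on_compose2[OF st]) (auto intro!: continuous_intros)
  have hr: "0 \<le> h n y" "h n y \<le> 1" for n y unfolding h_def by (rule step_range)+
  define g where "g y = (if c y > 0 then 1 else 0::real)" for y
  have hl: "(\<lambda>n. h n y) \<longlonglongrightarrow> g y" for y
  proof (cases "c y > 0")
    case True
    obtain m :: nat where m: "1 / c y < real m" using reals_Archimedean2 by blast
    have "h n y = 1" if "n \<ge> m" for n
    proof -
      have "1 \<le> real m * c y" using m True by (simp add: divide_less_eq)
      also have "\<dots> \<le> real n * c y" using that True by simp
      finally show ?thesis unfolding h_def by (rule step_1)
    qed
    then have "\<forall>\<^sub>F n in sequentially. h n y = g y" using True by (auto simp: g_def eventually_sequentially)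
    then show ?thesis by (rule tendsto_eventually)
  next
    case False
    then have "h n y = g y" for n unfolding h_def g_def by (auto intro!: step_0 mult_nonneg_nonpos)
    then show ?thesis by simp
  qed
  have g: "indicator {0..1} y * g y = indicator {0..<s/2} y + indicator {1 - s/2<..1} y" for y
  proof (cases "0 \<le> y \<and> y \<le> 1")
    case True
    have *: "cos (2 * pi * t) > cos (pi * s) \<longleftrightarrow> t < s / 2" if "0 \<le> t" "t \<le> 1/2" for t
    proof -
      have "cos (pi * s) < cos (2 * pi * t) \<longleftrightarrow> 2 * pi * t < pi * s"
        by (rule cos_mono_less_eq) (use that s in auto)
      also have "\<dots> \<longleftrightarrow> t < s / 2" using mult_less_cancel_left_pos[OF pi_gt_zero, of "2 * t" s] by (auto simp: mult_ac)
      finally show ?thesis .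
    qed
    have cy: "cos (2 * pi * y) = cos (2 * pi * (1 - y))"
      using cos_2pi_minus[of "2 * pi * y"] by (simp add: right_diff_distrib)
    show ?thesis
    proof (cases "y \<le> 1/2")
      case le: True
      then show ?thesis using *[of y] True s by (auto simp: g_def c_def indicator_def)
    next
      case False
      then show ?thesis using *[of "1 - y"] True s by (auto simp: g_def c_def indicator_def cy)
    qed
  qed (use s in \<open>auto simp: indicator_def\<close>)
  have lim: "(\<lambda>n. LINT y:{0..1}|lborel. h n y ^ Suc k) \<longlonglongrightarrow> s" for k
  proof -
    have i1: "integrable lborel (indicator {0..<s/2} :: real \<Rightarrow> real)" "integrable lborel (indicator {1 - s/2<..1} :: real \<Rightarrow> real)"
      using s by simp_all
    have "(\<lambda>n. LINT y|lborel. indicator {0..1} y *\<^sub>R h n y ^ Suc k) \<longlonglongrightarrow> (LINT y|lborel. indicator {0..1} y * g y)"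
    proof (rule integral_dominated_convergence[where w="indicator {0..1}"])
      show "(\<lambda>y. indicator {0..1} y * g y) \<in> borel_measurable lborel" unfolding g using i1 by measurable
      show "(\<lambda>y. indicator {0..1} y *\<^sub>R h n y ^ Suc k) \<in> borel_measurable lborel" for n
        using borel_measurable_continuous_onI[OF ch[of UNIV n]] by measurable
      show "integrable lborel (indicator {0..1} :: real \<Rightarrow> real)" by simp
      have "(\<lambda>n. indicator {0..1} y *\<^sub>R h n y ^ Suc k) \<longlonglongrightarrow> indicator {0..1} y *\<^sub>R g y ^ Suc k" for y
        by (intro tendsto_intros hl)
      moreover have "indicator {0..1} y *\<^sub>R g y ^ Suc k = indicator {0..1} y * g y" for y by (simp add: g_def)
      ultimately have "(\<lambda>n. indicator {0..1} y *\<^sub>R h n y ^ Suc k) \<longlonglongrightarrow> indicator {0..1} y * g y" for y by (simp only:)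
      then show "AE y in lborel. (\<lambda>n. indicator {0..1} y *\<^sub>R h n y ^ Suc k) \<longlonglongrightarrow> indicator {0..1} y * g y" by (rule AE_I2)
      show "AE y in lborel. norm (indicator {0..1} y *\<^sub>R h n y ^ Suc k) \<le> indicator {0..1} y" for n
      proof (rule AE_I2)
        fix y
        have "h n y ^ Suc k \<le> 1" "0 \<le> h n y ^ Suc k" by (rule power_le_one[OF hr]) (rule zero_le_power[OF hr(1)])
        then show "norm (indicator {0..1} y *\<^sub>R h n y ^ Suc k) \<le> indicator {0..1} y" by (auto simp: indicator_def simp del: power_Suc)
      qed
    qed
    also have "(LINT y|lborel. indicator {0..1} y * g y) = s"
      unfolding g using Bochner_Integration.integral_add[OF i1] s by simp
    finally show ?thesis by (simp add: set_lebesgue_integral_def)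
  qed
  define J where "J n = (LINT y:{0..1}|lborel. (h n y)\<^sup>2)" for n
  \<comment> \<open>The normalisation that makes the integral of \<open>A^2\<close> exact. It tends
    to 1.\<close>
  define r where "r n = sqrt (s / J n)" for n
  define Q where "Q n = (r n)\<^sup>2 * (LINT y:{0..1}|lborel. h n y ^ 2) - 2 * r n ^ 3 * (LINT y:{0..1}|lborel. h n y ^ 3)
      + r n ^ 4 * (LINT y:{0..1}|lborel. h n y ^ 4)" for n
  have l2: "J \<longlonglongrightarrow> s" using lim[of 1] by (simp add: J_def[abs_def] numeral_2_eq_2)
  have l3: "(\<lambda>n. LINT y:{0..1}|lborel. h n y ^ 3) \<longlonglongrightarrow> s" using lim[of 2] by (simp add: eval_nat_numeral)
  have l4: "(\<lambda>n. LINT y:{0..1}|lborel. h n y ^ 4) \<longlonglongrightarrow> s" using lim[of 3] by (simp add: eval_nat_numeral)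
  have "(\<lambda>n. sqrt (s / J n)) \<longlonglongrightarrow> sqrt (s / s)" by (intro tendsto_intros l2) (use s in simp)
  then have lr: "r \<longlonglongrightarrow> 1" using s by (simp add: r_def[abs_def])
  \<comment> \<open>\<open>Q n\<close> expands the weight in powers of \<open>h n\<close>. All these
    powers have integrals tending to \<open>s\<close>, and the coefficients 1, -2, 1 cancel in the
    limit.\<close>
  have "Q \<longlonglongrightarrow> 1\<^sup>2 * s - 2 * 1 ^ 3 * s + 1 ^ 4 * s"
    unfolding Q_def by (intro tendsto_intros lr l2[unfolded J_def] l3 l4)
  then have "Q \<longlonglongrightarrow> 0" by simp
  then have "\<forall>\<^sub>F n in sequentially. Q n < e" by (rule order_tendstoD(2)) (rule e)
  moreover have "\<forall>\<^sub>F n in sequentially. J n > 0" by (rule order_tendstoD(1)[OF l2 s(1)])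
  ultimately have "\<forall>\<^sub>F n in sequentially. Q n < e \<and> J n > 0" by eventually_elim simp
  then obtain n where n: "Q n < e" "J n > 0" by (auto simp: eventually_sequentially)
  define A where "A y = r n * h n y" for y
  define A' where "A' y = r n * (deriv step (real n * c y) * (real n * (- sin (2 * pi * y) * (2 * pi))))" for y
  have cA': "continuous_on UNIV A'"
  proof -
    have "continuous_on UNIV (\<lambda>y. deriv step (real n * c y))"
      by (rule continuous_on_compose2[OF smooth_continuous[OF smooth_deriv(2)[OF smooth_step]]]) (auto simp: c_def intro!: continuous_intros)
    then show ?thesis unfolding A'_def by (intro continuous_intros)
  qed
  have dA: "DERIV A y :> A' y" for y
  proof -
    have d: "DERIV (\<lambda>y. real n * c y) y :> real n * (- sin (2 * pi * y) * (2 * pi))"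
      unfolding c_def by (auto intro!: derivative_eq_intros)
    from DERIV_chain2[where f=step and g="\<lambda>y. real n * c y", OF smooth_deriv(1)[OF smooth_step] d]
    show ?thesis unfolding A_def[abs_def] A'_def h_def by (rule DERIV_cmult)
  qed
  have r2: "(r n)\<^sup>2 = s / J n" using n(2) s by (simp add: r_def)
  show ?thesis
  proof (rule that[of A A'])
    show "ac A A'" by (rule ac_C1[OF _ cA']) (use dA in \<open>simp add: has_real_derivative_iff_has_vector_derivative\<close>)
    show "continuous_on UNIV A" unfolding A_def by (intro continuous_intros ch)
    show "continuous_on UNIV A'" by (rule cA')
    show "A (y + 1) = A y" for y
      by (simp add: A_def h_def c_def distrib_left)
    show "(LINT y:{0..1}|lborel. (A y)\<^sup>2) = s" using n(2) by (simp add: A_def power_mult_distrib r2 J_def[symmetric])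
    have i: "set_integrable lborel {0..1} (\<lambda>y. h n y ^ k)" for k
      by (intro borel_integrable_atLeastAtMost' continuous_intros ch)
    have "(LINT y:{0..1}|lborel. (A y)\<^sup>2 * (1 - A y)\<^sup>2) =
        (LINT y:{0..1}|lborel. (r n)\<^sup>2 * h n y ^ 2 - 2 * r n ^ 3 * h n y ^ 3 + r n ^ 4 * h n y ^ 4)"
      by (simp add: A_def power2_diff power_mult_distrib algebra_simps eval_nat_numeral)
    also have "\<dots> = Q n"
      unfolding Q_def by (simp add: set_integral_add(2) set_integral_diff(2) set_integral_diff(1) i)
    finally show "(LINT y:{0..1}|lborel. (A y)\<^sup>2 * (1 - A y)\<^sup>2) < e" using n(1) by simp
  qed
qed

lemma compact_support_integrable:
  fixes k :: "real \<Rightarrow> 'b::euclidean_space"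
  assumes k: "continuous_on UNIV k" and z: "\<And>x. x < 0 \<or> x > l \<Longrightarrow> k x = 0" and l: "0 \<le> l"
  shows "integrable lborel k" "integral\<^sup>L lborel k = integral {0..l} k"
proof -
  have e: "indicator {0..l} x *\<^sub>R k x = k x" for x using z[of x] by (auto simp: indicator_def)
  show "integrable lborel k" using L1_loc_Icc(1)[OF L1_loc_continuous[OF k], of 0 l] by (simp add: set_integrable_def e)
  show "integral\<^sup>L lborel k = integral {0..l} k"
    using L1_loc_Icc(3)[OF L1_loc_continuous[OF k], of 0 l] by (simp add: set_lebesgue_integral_def e)
qed

lemma compact_support_bound:
  fixes k :: "real \<Rightarrow> real"
  assumes k: "continuous_on UNIV k" and z: "\<And>x. x < 0 \<or> x > l \<Longrightarrow> k x = 0" and l: "0 \<le> l" and b: "\<And>x. k x \<le> c"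
  shows "integral\<^sup>L lborel k \<le> l * c"
proof -
  have "integral {0..l} k \<le> integral {0..l} (\<lambda>x. c)"
    by (rule Henstock_Kurzweil_Integration.integral_le)
      (use b in \<open>auto intro: integrable_continuous_interval continuous_on_subset[OF k]\<close>)
  then show ?thesis using compact_support_integrable(2)[OF k z l] l by (simp add: mult.commute)
qed

text \<open>A rescaled \<open>step\<close>. As \<open>K\<close> does not depend on \<open>l\<close>,
  the integral of the squared derivative is at most \<open>K^2 / l\<close> and becomes small for
  long ramps.\<close>

lemma phase_ramp:
  obtains K where "K > 0" "\<And>l. l > 0 \<Longrightarrow> \<exists>\<theta> \<theta>'. (\<forall>x. DERIV \<theta> x :> \<theta>' x) \<and> continuous_on UNIV \<theta>' \<and> (\<forall>x\<le>0. \<theta> x = 0) \<and>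
      (\<forall>x\<ge>l. \<theta> x = 2 * pi) \<and> (\<forall>x. x < 0 \<or> x > l \<longrightarrow> \<theta>' x = 0) \<and> (\<forall>x. \<bar>\<theta>' x\<bar> \<le> K / l)"
proof -
  define s' where "s' x = bump x / bump_int" for x
  have c: "continuous_on S s'" for S unfolding s'_def using bump_int_pos by (intro continuous_intros continuous_bump) auto
  obtain B where B: "B > 0" "\<And>x. x \<in> {0..1} \<Longrightarrow> norm (s' x) \<le> B"
    using compact_imp_bounded[OF compact_continuous_image[OF c compact_Icc[of 0 1]]] by (auto simp: bounded_pos)
  have bd: "\<bar>s' x\<bar> \<le> B" for x
    using B(1) B(2)[of x] bump_zero[of x] by (cases "x \<in> {0..1}") (auto simp: s'_def)
  have ds: "DERIV step x :> s' x" for x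
    unfolding step_def[abs_def] s'_def using DERIV_cdivide[OF antider_deriv[OF continuous_bump]] .
  show ?thesis
  proof (rule that[of "2 * pi * B"])
    show "2 * pi * B > 0" using B(1) by simp
    fix l :: real assume l: "l > 0"
    define \<theta> where "\<theta> x = 2 * pi * step (x / l)" for x
    define \<theta>' where "\<theta>' x = 2 * pi * (s' (x / l) * (1 / l))" for x
    have "DERIV \<theta> x :> \<theta>' x" for x
    proof -
      have d: "DERIV (\<lambda>x. x / l) x :> 1 / l" by (rule DERIV_cdivide[OF DERIV_ident])
      from DERIV_chain2[where f=step and g="\<lambda>x. x / l", OF ds d] show ?thesis unfolding \<theta>_def[abs_def] \<theta>'_def by (rule DERIV_cmult)
    qed
    moreover have "continuous_on UNIV \<theta>'"
      unfolding \<theta>'_def by (intro continuous_intros continuous_on_compose2[OF c[of UNIV]]) (use l in auto)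
    moreover have "\<theta> x = 0" if "x \<le> 0" for x using that l by (simp add: \<theta>_def step_0 divide_nonpos_pos)
    moreover have "\<theta> x = 2 * pi" if "x \<ge> l" for x using that l by (simp add: \<theta>_def step_1)
    moreover have "\<theta>' x = 0" if "x < 0 \<or> x > l" for x
      using that l bump_zero[of "x / l"] by (auto simp: \<theta>'_def s'_def divide_nonpos_pos)
    moreover have "\<bar>\<theta>' x\<bar> \<le> 2 * pi * B / l" for x
      using bd[of "x / l"] l by (simp add: \<theta>'_def abs_mult divide_right_mono)
    ultimately show "\<exists>\<theta> \<theta>'. (\<forall>x. DERIV \<theta> x :> \<theta>' x) \<and> continuous_on UNIV \<theta>' \<and> (\<forall>x\<le>0. \<theta> x = 0) \<and>
      (\<forall>x\<ge>l. \<theta> x = 2 * pi) \<and> (\<forall>x. x < 0 \<or> x > l \<longrightarrow> \<theta>' x = 0) \<and> (\<forall>x. \<bar>\<theta>' x\<bar> \<le> 2 * pi * B / l)" by blast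
  qed
qed

text \<open>On the arc where \<open>A = 1\<close> the function winds once around the circle, where \<open>A = 0\<close> it is constant:
  its momentum is minus \<open>\<pi>\<close> times the length of that arc, and the potential energy is only paid between the arcs.\<close>

lemma winding_strip:
  assumes A: "ac A A'" "continuous_on UNIV A" "continuous_on UNIV A'" "\<And>y. A (y + 1) = A y"
    and l: "l > 0" and d\<theta>: "\<And>x. DERIV \<theta> x :> \<theta>' x" and c\<theta>': "continuous_on UNIV \<theta>'"
    and \<theta>0: "\<And>x. x \<le> 0 \<Longrightarrow> \<theta> x = 0" and \<theta>1: "\<And>x. x \<ge> l \<Longrightarrow> \<theta> x = 2 * pi"
    and \<theta>'0: "\<And>x. x < 0 \<or> x > l \<Longrightarrow> \<theta>' x = 0" and K: "\<And>x. \<bar>\<theta>' x\<bar> \<le> k"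
  defines "\<psi> \<equiv> (\<lambda>z. 1 - A (snd z) *\<^sub>R (1 - cis (\<theta> (fst z))))"
  shows "\<psi> \<in> X_cyl"
    "[momentum_cyl \<psi> = - pi * (LINT y:{0..1}|lborel. (A y)\<^sup>2)] (rmod pi)"
    "E_cyl lam \<psi> \<le> l * k\<^sup>2 / 2 * (LINT y:{0..1}|lborel. (A y)\<^sup>2) + lam\<^sup>2 * (2 * l) * (LINT y:{0..1}|lborel. (A' y)\<^sup>2)
      + 4 * l * (LINT y:{0..1}|lborel. (A y)\<^sup>2 * (1 - A y)\<^sup>2)"
proof -
  define f where "f x = 1 - cis (\<theta> x)" for x
  define f' where "f' x = - (of_real (\<theta>' x) * (\<i> * cis (\<theta> x)))" for x
  have c\<theta>: "continuous_on S \<theta>" for S by (rule DERIV_continuous_on) (use d\<theta> has_field_derivative_at_within in blast)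
  have cf: "continuous_on S f" "continuous_on UNIV f'" for S
    unfolding f_def f'_def by (intro continuous_intros c\<theta> c\<theta>')+
  have df: "(f has_vector_derivative f' x) (at x)" for x
  proof -
    have "((\<lambda>x. cis (\<theta> x)) has_vector_derivative of_real (\<theta>' x) * (\<i> * cis (\<theta> x))) (at x)"
      using has_derivative_cis[OF d\<theta>[of x, unfolded has_field_derivative_def]]
      by (simp add: has_vector_derivative_def scaleR_conv_of_real mult_ac)
    from has_vector_derivative_diff[OF has_vector_derivative_const this, of 1] show ?thesis by (simp add: f_def[abs_def] f'_def)
  qed
  have af: "ac f f'" by (rule ac_C1[OF df cf(2)])
  have f0: "f x = 0" if "x < 0 \<or> x > l" for x using that \<theta>0[of x] \<theta>1[of x] by (auto simp: f_def)
  have f'0: "f' x = 0" if "x < 0 \<or> x > l" for x using \<theta>'0[OF that] by (simp add: f'_def)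
  \<comment> \<open>For \<open>f = 1 - cis \<theta>\<close> the identity
    \<open>|f|^2 = 2 * Re f\<close> makes \<open>1 - |\<psi>|^2\<close> a multiple of
    \<open>A (1 - A)\<close>, so no potential energy is paid where \<open>A\<close> is 0 or
    1.\<close>
  have nf: "(norm (f x))\<^sup>2 = 2 * Re (f x)" "Re (f x) = 1 - cos (\<theta> x)" for x
    using sin_cos_squared_add[of "\<theta> x"] unfolding cmod_power2 by (auto simp: f_def power2_eq_square algebra_simps)
  have Ref: "0 \<le> Re (f x)" "Re (f x) \<le> 2" for x using cos_le_one[of "\<theta> x"] cos_ge_minus_one[of "\<theta> x"] unfolding nf(2) by linarith+
  have nf': "(norm (f' x))\<^sup>2 = (\<theta>' x)\<^sup>2" for x by (simp add: f'_def norm_mult)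
  have \<psi>: "\<psi> z = 1 - A (snd z) *\<^sub>R f (fst z)" for z by (simp add: \<psi>_def f_def)
  have one: "ac (\<lambda>x::real. 1::real) (\<lambda>x. 0)" "ac (\<lambda>x::real. 1::complex) (\<lambda>x. 0)" by (rule ac_const)+
  have w1: "has_weak_deriv (1, 0) \<psi> (\<lambda>z. - (A (snd z) *\<^sub>R f' (fst z)))" and w2: "has_weak_deriv (0, 1) \<psi> (\<lambda>z. - (A' (snd z) *\<^sub>R f (fst z)))"
    using has_weak_deriv_diff[OF product_weak_deriv(1)[OF one(2,1)] product_weak_deriv(1)[OF af A(1)] Basis_plane(1)]
      has_weak_deriv_diff[OF product_weak_deriv(2)[OF one(2,1)] product_weak_deriv(2)[OF af A(1)] Basis_plane(2)]
    by (simp_all add: \<psi>[abs_def])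
  have cc: "continuous_on UNIV (\<lambda>z::real \<times> real. B (snd z) *\<^sub>R k (fst z))" if "continuous_on UNIV B" "continuous_on UNIV k"
    for B :: "real \<Rightarrow> real" and k :: "real \<Rightarrow> complex"
    by (intro continuous_intros continuous_on_compose2[OF that(1)] continuous_on_compose2[OF that(2)]) auto
  have L: "L1_loc (\<lambda>z. (norm (\<psi> z))\<^sup>2)" "L1_loc (\<lambda>z. (norm (- (A (snd z) *\<^sub>R f' (fst z))))\<^sup>2)" "L1_loc (\<lambda>z. (norm (- (A' (snd z) *\<^sub>R f (fst z))))\<^sup>2)"
    unfolding \<psi> by (intro L1_loc_continuous continuous_intros cc A(2,3) cf)+
  have n1: "(norm (- (A (snd z) *\<^sub>R f' (fst z))))\<^sup>2 = (A (snd z))\<^sup>2 * (\<theta>' (fst z))\<^sup>2" for z :: "real \<times> real"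
    by (simp add: power_mult_distrib nf')
  have n2: "(norm (- (A' (snd z) *\<^sub>R f (fst z))))\<^sup>2 = (A' (snd z))\<^sup>2 * (2 * Re (f (fst z)))" for z :: "real \<times> real"
    by (simp add: power_mult_distrib nf(1))
  have n3: "(1 - (norm (\<psi> z))\<^sup>2)\<^sup>2 = (A (snd z))\<^sup>2 * (1 - A (snd z))\<^sup>2 * (4 * (Re (f (fst z)))\<^sup>2)" for z :: "real \<times> real"
  proof -
    have q: "(norm (1 - a *\<^sub>R c))\<^sup>2 = 1 - 2 * a * Re c + a\<^sup>2 * (norm c)\<^sup>2" for a c
      unfolding cmod_power2 by (simp add: power2_eq_square algebra_simps)
    have "1 - (norm (\<psi> z))\<^sup>2 = 2 * (A (snd z) * (1 - A (snd z)) * Re (f (fst z)))"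
      unfolding \<psi> q nf(1) by (simp add: power2_eq_square algebra_simps)
    then show ?thesis by (simp add: power_mult_distrib)
  qed
  have cR: "continuous_on UNIV (\<lambda>x. Re (f x))" by (intro continuous_intros cf)
  have l0: "0 \<le> l" using l by simp
  have k1: "continuous_on UNIV (\<lambda>x. (\<theta>' x)\<^sup>2)" "continuous_on UNIV (\<lambda>x. 2 * Re (f x))" "continuous_on UNIV (\<lambda>x. 4 * (Re (f x))\<^sup>2)"
    by (intro continuous_intros c\<theta>' cR)+
  have I: "integrable lborel (\<lambda>x. (\<theta>' x)\<^sup>2)" "integrable lborel (\<lambda>x. 2 * Re (f x))" "integrable lborel (\<lambda>x. 4 * (Re (f x))\<^sup>2)"
    by (rule compact_support_integrable(1)[OF k1(1) _ l0], simp add: \<theta>'0, rule compact_support_integrable(1)[OF k1(2) _ l0], simp add: f0,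
      rule compact_support_integrable(1)[OF k1(3) _ l0], simp add: f0)
  have bd: "(LINT x|lborel. (\<theta>' x)\<^sup>2) \<le> l * k\<^sup>2" "(LINT x|lborel. 2 * Re (f x)) \<le> l * 4" "(LINT x|lborel. 4 * (Re (f x))\<^sup>2) \<le> l * 16"
  proof -
    have "(\<theta>' x)\<^sup>2 \<le> k\<^sup>2" for x using power_mono[OF K[of x], of 2] by simp
    then show "(LINT x|lborel. (\<theta>' x)\<^sup>2) \<le> l * k\<^sup>2" by (intro compact_support_bound[OF k1(1) _ l0]) (simp_all add: \<theta>'0)
    show "(LINT x|lborel. 2 * Re (f x)) \<le> l * 4" by (rule compact_support_bound[OF k1(2) _ l0]) (use Ref(2) in \<open>simp_all add: f0\<close>)
    have "4 * (Re (f x))\<^sup>2 \<le> 16" for x using power_mono[OF Ref(2)[of x] Ref(1)[of x], of 2] by simp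
    then show "(LINT x|lborel. 4 * (Re (f x))\<^sup>2) \<le> l * 16" by (intro compact_support_bound[OF k1(3) _ l0]) (simp_all add: f0)
  qed
  have cA: "continuous_on UNIV (\<lambda>y. (A y)\<^sup>2)" "continuous_on UNIV (\<lambda>y. (A' y)\<^sup>2)" "continuous_on UNIV (\<lambda>y. (A y)\<^sup>2 * (1 - A y)\<^sup>2)"
    by (intro continuous_intros A(2,3))+
  note t1 = cyl_tensor[OF cA(1) I(1)] and t2 = cyl_tensor[OF cA(2) I(2)] and t3 = cyl_tensor[OF cA(3) I(3)]
  have X: "\<psi> \<in> X_cyl \<and> E_cyl lam \<psi> = 1/2 * (LINT z:cyl|lborel. (norm (- (A (snd z) *\<^sub>R f' (fst z))))\<^sup>2) + lam\<^sup>2 / 2 * (LINT z:cyl|lborel. (norm (- (A' (snd z) *\<^sub>R f (fst z))))\<^sup>2)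
      + 1/4 * (LINT z:cyl|lborel. (1 - (norm (\<psi> z))\<^sup>2)\<^sup>2)"
    by (intro conjI X_cylI[OF w1 w2 L]) (unfold n1 n2 n3, use t1(1) t2(1) t3(1) A(4) in \<open>simp_all add: \<psi>_def\<close>)
  then show XX: "\<psi> \<in> X_cyl" by simp
  have nnA: "0 \<le> (LINT y:{0..1}|lborel. (A y)\<^sup>2)" "0 \<le> (LINT y:{0..1}|lborel. (A' y)\<^sup>2)" "0 \<le> (LINT y:{0..1}|lborel. (A y)\<^sup>2 * (1 - A y)\<^sup>2)"
    unfolding set_lebesgue_integral_def by (intro Bochner_Integration.integral_nonneg; simp)+
  have "E_cyl lam \<psi> = 1/2 * ((LINT y:{0..1}|lborel. (A y)\<^sup>2) * (LINT x|lborel. (\<theta>' x)\<^sup>2))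
      + lam\<^sup>2 / 2 * ((LINT y:{0..1}|lborel. (A' y)\<^sup>2) * (LINT x|lborel. 2 * Re (f x)))
      + 1/4 * ((LINT y:{0..1}|lborel. (A y)\<^sup>2 * (1 - A y)\<^sup>2) * (LINT x|lborel. 4 * (Re (f x))\<^sup>2))"
    using X unfolding n1 n2 n3 t1(2) t2(2) t3(2) by blast
  also have "\<dots> \<le> 1/2 * ((LINT y:{0..1}|lborel. (A y)\<^sup>2) * (l * k\<^sup>2)) + lam\<^sup>2 / 2 * ((LINT y:{0..1}|lborel. (A' y)\<^sup>2) * (l * 4))
      + 1/4 * ((LINT y:{0..1}|lborel. (A y)\<^sup>2 * (1 - A y)\<^sup>2) * (l * 16))"
    by (intro add_mono mult_left_mono bd nnA) auto
  also have "\<dots> = l * k\<^sup>2 / 2 * (LINT y:{0..1}|lborel. (A y)\<^sup>2) + lam\<^sup>2 * (2 * l) * (LINT y:{0..1}|lborel. (A' y)\<^sup>2)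
      + 4 * l * (LINT y:{0..1}|lborel. (A y)\<^sup>2 * (1 - A y)\<^sup>2)" by (simp add: algebra_simps)
  finally show "E_cyl lam \<psi> \<le> l * k\<^sup>2 / 2 * (LINT y:{0..1}|lborel. (A y)\<^sup>2) + lam\<^sup>2 * (2 * l) * (LINT y:{0..1}|lborel. (A' y)\<^sup>2)
      + 4 * l * (LINT y:{0..1}|lborel. (A y)\<^sup>2 * (1 - A y)\<^sup>2)" .
  define m where "m = (LINT y:{0..1}|lborel. A y)"
  have iA: "set_integrable lborel {0..1} A" "set_integrable lborel {0..1} (\<lambda>y. (A y)\<^sup>2)"
    using L1_loc_Icc(1)[OF L1_loc_continuous[OF A(2)]] L1_loc_Icc(1)[OF L1_loc_continuous[OF cA(1)]] by blast+
  define u where "u x = 1 - m *\<^sub>R f x" for x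
  define u' where "u' x = - (m *\<^sub>R f' x)" for x
  have mean: "mean_y \<psi> = u"
  proof
    fix x
    have i: "set_integrable lborel {0..1} (\<lambda>y. A y *\<^sub>R f x)" "(LINT y:{0..1}|lborel. A y *\<^sub>R f x) = m *\<^sub>R f x"
      using iA(1) integral_scaleR_left[of "f x" lborel "\<lambda>y. indicator {0..1} y *\<^sub>R A y"]
      by (simp_all add: m_def set_lebesgue_integral_def set_integrable_def)
    have "set_integrable lborel {0..1::real} (\<lambda>y. 1::complex)" using borel_integrable_atLeastAtMost'[of 0 1 "\<lambda>y::real. 1::complex"] by simp
    from set_integral_diff(2)[OF this i(1)] show "mean_y \<psi> x = u x"
      using i(2) by (simp add: mean_y_def u_def \<psi> set_integral_const)
  qed
  have au: "ac u u'"
    using ac_add[OF one(2) ac_linear[OF bounded_linear_scaleR_right[of "- m"] af]] by (simp add: u_def[abs_def] u'_def[abs_def])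
  have cu: "continuous_on UNIV u" "continuous_on UNIV u'" unfolding u_def u'_def by (intro continuous_intros cf)+
  have "finen u u'"
    unfolding finen_def
  proof (intro conjI au)
    show "integrable lborel (\<lambda>x. (norm (u' x))\<^sup>2)"
      by (rule compact_support_integrable(1)[OF _ _ l0]) (intro continuous_intros cu, simp add: u'_def f'0)
    show "integrable lborel (\<lambda>x. (1 - (norm (u x))\<^sup>2)\<^sup>2)"
      by (rule compact_support_integrable(1)[OF _ _ l0]) (intro continuous_intros cu, simp add: u_def f0)
  qed
  \<comment> \<open>Both the current of the mean and the momentum density of the oscillation have
    this form in \<theta>, with different \<open>p\<close> and \<open>q\<close>.\<close>
  have FTC: "integral {a..b} (\<lambda>x. \<theta>' x * (p * cos (\<theta> x) + q)) = (p * sin (\<theta> b) + q * \<theta> b) - (p * sin (\<theta> a) + q * \<theta> a)" if "a \<le> b" for a b p q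
  proof (rule integral_unique[OF fundamental_theorem_of_calculus[OF that]])
    fix x assume "x \<in> {a..b}"
    have "DERIV (\<lambda>x. p * sin (\<theta> x) + q * \<theta> x) x :> \<theta>' x * (p * cos (\<theta> x) + q)"
      by (auto intro!: derivative_eq_intros d\<theta> simp: algebra_simps)
    then show "((\<lambda>x. p * sin (\<theta> x) + q * \<theta> x) has_vector_derivative \<theta>' x * (p * cos (\<theta> x) + q)) (at x within {a..b})"
      unfolding has_real_derivative_iff_has_vector_derivative by (rule has_vector_derivative_at_within)
  qed
  have sc: "sin (\<theta> x) * sin (\<theta> x) = 1 - cos (\<theta> x) * cos (\<theta> x)" for x
    using sin_cos_squared_add[of "\<theta> x"] by (simp add: power2_eq_square)
  have cu: "curr u u' x = \<theta>' x * ((m * (1 - m)) * cos (\<theta> x) + m\<^sup>2)" for x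
    by (simp add: curr_def u_def u'_def f_def f'_def sc power2_eq_square algebra_simps)
  obtain n0 :: nat where n0: "l < real n0" using reals_Archimedean2 by blast
  have "mseq u u' n = cis (2 * (- pi * m\<^sup>2))" if "n \<ge> n0" for n
  proof -
    have n: "l < real n" using n0 that by linarith
    have "u (real n) = 1" "u (- real n) = 1" using f0[of "real n"] f0[of "- real n"] n l by (simp_all add: u_def)
    moreover have "integral {- real n..real n} (curr u u') = 2 * pi * m\<^sup>2"
      using FTC[of "- real n" "real n" "m * (1 - m)" "m\<^sup>2"] \<theta>1[of "real n"] \<theta>0[of "- real n"] n by (simp add: cu[abs_def] mult.commute)
    ultimately show ?thesis by (simp add: mseq_def sgn_div_norm mult_ac)
  qed
  then have "mseq u u' \<longlonglongrightarrow> cis (2 * (- pi * m\<^sup>2))"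
    by (intro tendsto_eventually) (auto simp: eventually_sequentially)
  from momentum_cong[OF \<open>finen u u'\<close> _ _ this, of u] finenD(4)[OF \<open>finen u u'\<close>]
  have mu: "[momentum_line u = - pi * m\<^sup>2] (rmod pi)" by simp
  define B where "B y = m - A y" for y
  have aB: "ac B (\<lambda>y. - A' y)" using ac_add[OF ac_const ac_linear[OF bounded_linear_minus[OF bounded_linear_ident] A(1)], of m] by (simp add: B_def[abs_def])
  have osc: "osc_y \<psi> = (\<lambda>z. B (snd z) *\<^sub>R f (fst z))" by (simp add: fun_eq_iff osc_y_def mean u_def \<psi> B_def algebra_simps)
  have wo: "has_weak_deriv (1, 0) (osc_y \<psi>) (\<lambda>z. B (snd z) *\<^sub>R f' (fst z))" unfolding osc by (rule product_weak_deriv(1)[OF af aB])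
  have dot: "cdot (\<i> * (B (snd z) *\<^sub>R f' (fst z))) (osc_y \<psi> z) = (B (snd z))\<^sup>2 * (\<theta>' (fst z) * (1 * cos (\<theta> (fst z)) + - 1))" for z
    unfolding osc by (simp add: cdot_def f_def f'_def sc power2_eq_square algebra_simps)
  have cq: "continuous_on UNIV (\<lambda>x. \<theta>' x * (1 * cos (\<theta> x) + - 1))" by (intro continuous_intros c\<theta> c\<theta>')
  have iq: "integrable lborel (\<lambda>x. \<theta>' x * (1 * cos (\<theta> x) + - 1))" "(LINT x|lborel. \<theta>' x * (1 * cos (\<theta> x) + - 1)) = - 2 * pi"
    using compact_support_integrable[OF cq _ l0] \<theta>'0 FTC[OF l0, of 1 "-1"] \<theta>0[of 0] \<theta>1[of l] by simp_all
  have cB: "continuous_on UNIV (\<lambda>y. (B y)\<^sup>2)" unfolding B_def by (intro continuous_intros A(2))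
  have B2: "(LINT y:{0..1}|lborel. (B y)\<^sup>2) = (LINT y:{0..1}|lborel. (A y)\<^sup>2) - m\<^sup>2"
  proof -
    have i2: "set_integrable lborel {0..1} (\<lambda>y. 2 * m * A y)" by (rule set_integrable_mult_right) (rule iA(1))
    have "(LINT y:{0..1}|lborel. (B y)\<^sup>2) = (LINT y:{0..1}|lborel. (A y)\<^sup>2 - 2 * m * A y + m\<^sup>2)"
      by (simp add: B_def power2_diff algebra_simps)
    also have "\<dots> = (LINT y:{0..1}|lborel. (A y)\<^sup>2) - 2 * m * m + m\<^sup>2"
      by (simp only: set_integral_add(2)[OF set_integral_diff(1)[OF iA(2) i2] unit_const(1)] set_integral_diff(2)[OF iA(2) i2]
        set_integral_mult_right unit_const(2) m_def[symmetric])
    finally show ?thesis by (simp add: power2_eq_square)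
  qed
  have "(LINT z:cyl|lborel. cdot (\<i> * weak_deriv (1, 0) (osc_y \<psi>) z) (osc_y \<psi> z)) = (LINT z:cyl|lborel. (B (snd z))\<^sup>2 * (\<theta>' (fst z) * (1 * cos (\<theta> (fst z)) + - 1)))"
  proof (rule set_lebesgue_integral_cong_AE)
    have c: "cyl \<in> sets borel" unfolding cyl_def by (simp add: borel_prod[symmetric])
    then show "cyl \<in> sets lborel" by simp
    have [measurable]: "weak_deriv (1, 0) (osc_y \<psi>) \<in> borel_measurable borel" "osc_y \<psi> \<in> borel_measurable borel"
      using L1_loc_measurable[OF has_weak_derivD(2)[OF weak_deriv_works[OF wo]]] L1_loc_measurable[OF has_weak_derivD(1)[OF wo]] by auto
    show "(\<lambda>z. cdot (\<i> * weak_deriv (1, 0) (osc_y \<psi>) z) (osc_y \<psi> z)) \<in> borel_measurable lborel" unfolding cdot_def by measurable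
    have "(\<lambda>z::real \<times> real. (B (snd z))\<^sup>2 * (\<theta>' (fst z) * (1 * cos (\<theta> (fst z)) + - 1))) \<in> borel_measurable borel"
      by (intro borel_measurable_continuous_onI continuous_intros continuous_on_compose2[OF cB] continuous_on_compose2[OF cq]) auto
    then show "(\<lambda>z::real \<times> real. (B (snd z))\<^sup>2 * (\<theta>' (fst z) * (1 * cos (\<theta> (fst z)) + - 1))) \<in> borel_measurable lborel" by simp
    show "AE z\<in>cyl in lborel. cdot (\<i> * weak_deriv (1, 0) (osc_y \<psi>) z) (osc_y \<psi> z) = (B (snd z))\<^sup>2 * (\<theta>' (fst z) * (1 * cos (\<theta> (fst z)) + - 1))"
      using weak_deriv_AE[OF wo] by eventually_elim (simp only: dot simp_thms)
  qed
  also have "\<dots> = ((LINT y:{0..1}|lborel. (A y)\<^sup>2) - m\<^sup>2) * (- 2 * pi)"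
    unfolding cyl_tensor(2)[OF cB iq(1)] B2 iq(2) ..
  \<comment> \<open>The mean contributes \<open>- pi * m^2\<close> and the oscillation
    \<open>- pi\<close> times the variance of \<open>A\<close>; the mean value \<open>m\<close>
    cancels, and only the integral of \<open>A^2\<close> remains.\<close>
  finally have "momentum_cyl \<psi> = momentum_line u + (- pi * (LINT y:{0..1}|lborel. (A y)\<^sup>2) - - pi * m\<^sup>2)"
    by (simp add: momentum_cyl_def mean algebra_simps)
  moreover have "[momentum_line u + (- pi * (LINT y:{0..1}|lborel. (A y)\<^sup>2) - - pi * m\<^sup>2) = - pi * m\<^sup>2 + (- pi * (LINT y:{0..1}|lborel. (A y)\<^sup>2) - - pi * m\<^sup>2)] (rmod pi)"
    using mu unfolding rcong_pi_iff by (simp only: distrib_left cis_mult[symmetric])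
  ultimately show "[momentum_cyl \<psi> = - pi * (LINT y:{0..1}|lborel. (A y)\<^sup>2)] (rmod pi)" by simp
qed

text \<open>The choices are made in the order \<open>s\<close> from \<open>p\<close>, the length
  \<open>l\<close> of the ramp, the plateau function \<open>A\<close>, and finally
  \<open>lam\<close>, so that each of the three energy terms is at most
  \<open>e / 4\<close>.\<close>

lemma cheap_momentum:
  assumes p: "\<not> [p = 0] (rmod pi)" and e: "e > 0"
  shows "\<exists>lam>0. \<exists>\<psi>\<in>X_cyl. [momentum_cyl \<psi> = p] (rmod pi) \<and> E_cyl lam \<psi> < e"
proof -
  \<comment> \<open>The momentum of the winding function is \<open>- pi * s\<close> with
    \<open>s\<close> strictly between 0 and 1, which reaches every nonzero class.\<close>
  define s where "s = frac (- p / pi)"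
  have "s \<noteq> 0"
  proof
    assume "s = 0"
    then have "- p / pi \<in> \<int>" by (simp add: s_def)
    then obtain k where "- p / pi = of_int k" by (rule Ints_cases)
    then have pk: "2 * p = 2 * pi * of_int (- k)" by (simp add: field_simps)
    have "cis (2 * p) = 1" unfolding pk by (rule cis_multiple_2pi) simp
    then show False using p by (simp add: rcong_pi_iff)
  qed
  then have s: "0 < s" "s < 1" using frac_ge_0[of "- p / pi"] frac_lt_1[of "- p / pi"] by (auto simp: s_def)
  have sp: "[- pi * s = p] (rmod pi)"
  proof -
    have "2 * (- pi * s) = 2 * p + 2 * pi * of_int \<lfloor>- p / pi\<rfloor>" by (simp add: s_def frac_def field_simps)
    moreover have "cis (2 * pi * of_int \<lfloor>- p / pi\<rfloor>) = 1" by (rule cis_multiple_2pi) simp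
    ultimately show ?thesis unfolding rcong_pi_iff by (simp only: cis_mult[symmetric] mult_1_right)
  qed
  obtain K where K: "K > 0" "\<And>l. l > 0 \<Longrightarrow> \<exists>\<theta> \<theta>'. (\<forall>x. DERIV \<theta> x :> \<theta>' x) \<and> continuous_on UNIV \<theta>' \<and> (\<forall>x\<le>0. \<theta> x = 0) \<and>
      (\<forall>x\<ge>l. \<theta> x = 2 * pi) \<and> (\<forall>x. x < 0 \<or> x > l \<longrightarrow> \<theta>' x = 0) \<and> (\<forall>x. \<bar>\<theta>' x\<bar> \<le> K / l)"
    using phase_ramp by blast
  \<comment> \<open>With this length a full turn on all of the circle would cost
    \<open>K^2 / (2 * l) = e / 4\<close>.\<close>
  define l where "l = 2 * K\<^sup>2 / e"
  have l: "l > 0" using K(1) e by (simp add: l_def)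
  obtain \<theta> \<theta>' where \<theta>: "\<And>x. DERIV \<theta> x :> \<theta>' x" "continuous_on UNIV \<theta>'" "\<And>x. x \<le> 0 \<Longrightarrow> \<theta> x = 0"
      "\<And>x. x \<ge> l \<Longrightarrow> \<theta> x = 2 * pi" "\<And>x. x < 0 \<or> x > l \<Longrightarrow> \<theta>' x = 0" "\<And>x. \<bar>\<theta>' x\<bar> \<le> K / l"
    using K(2)[OF l] by blast
  have e': "e / (16 * l) > 0" using e l by simp
  obtain A A' where A: "ac A A'" "continuous_on UNIV A" "continuous_on UNIV A'" "\<And>y. A (y + 1) = A y"
    "(LINT y:{0..1}|lborel. (A y)\<^sup>2) = s" "(LINT y:{0..1}|lborel. (A y)\<^sup>2 * (1 - A y)\<^sup>2) < e / (16 * l)"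
    using plateau[OF s e'] by blast
  define C where "C = (LINT y:{0..1}|lborel. (A' y)\<^sup>2)"
  have C: "C \<ge> 0" unfolding C_def set_lebesgue_integral_def by (intro Bochner_Integration.integral_nonneg) simp
  \<comment> \<open>Balances the transverse term to \<open>e / 4\<close> times
    \<open>C / (C + 1)\<close>; the summand 1 keeps the denominator positive.\<close>
  define lam where "lam = sqrt (e / (8 * l * (C + 1)))"
  have lam: "lam > 0" "lam\<^sup>2 = e / (8 * l * (C + 1))" using e l C by (simp_all add: lam_def)
  define \<psi> where "\<psi> = (\<lambda>z. 1 - A (snd z) *\<^sub>R (1 - cis (\<theta> (fst z))))"
  note W = winding_strip[OF A(1-4) l \<theta>, folded \<psi>_def, unfolded A(5), folded C_def]
  have "l * (K / l)\<^sup>2 / 2 * s \<le> l * (K / l)\<^sup>2 / 2 * 1" using s l by (intro mult_left_mono) auto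
  also have "\<dots> = e / 4" using l K(1) e by (simp add: l_def power2_eq_square)
  finally have 1: "l * (K / l)\<^sup>2 / 2 * s \<le> e / 4" .
  have "e / (8 * l * q) * (2 * l) * C = e / 4 * (C / q)" if "q > 0" for q using that l by (simp add: field_simps)
  then have "lam\<^sup>2 * (2 * l) * C = e / 4 * (C / (C + 1))" using C unfolding lam(2) by simp
  also have "\<dots> \<le> e / 4 * 1" using e C by (intro mult_left_mono) auto
  finally have 2: "lam\<^sup>2 * (2 * l) * C \<le> e / 4" by simp
  have 3: "4 * l * (LINT y:{0..1}|lborel. (A y)\<^sup>2 * (1 - A y)\<^sup>2) \<le> e / 4"
    using A(6) l by (simp add: field_simps)
  have "[momentum_cyl \<psi> = p] (rmod pi)" using W(2) sp unfolding rcong_pi_iff by simp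
  moreover have "E_cyl lam \<psi> < e" using W(3)[of lam] 1 2 3 e by linarith
  ultimately show ?thesis using W(1) lam(1) by blast
qed

section \<open>The threshold value of \<open>lam\<close>\<close>

lemma E_cyl_nonneg: "\<psi> \<in> X_cyl \<Longrightarrow> 0 \<le> E_cyl lam \<psi>"
  unfolding X_cyl_facts(8) set_lebesgue_integral_def
  by (intro add_nonneg_nonneg mult_nonneg_nonneg Bochner_Integration.integral_nonneg) auto

theorem theorem1:
  fixes p :: real
  assumes "\<not> [p = 0] (rmod pi)"
  shows "\<exists>lam_p>0.
    (\<forall>lam\<ge>lam_p. I_cyl lam p = I_line p \<and>
        is_minimizer_cyl lam p (\<lambda>z. dark_soliton (soliton_speed p) (fst z))) \<and>
    (\<forall>lam>lam_p. \<forall>\<psi>. is_minimizer_cyl lam p \<psi> \<longrightarrow>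
        (\<exists>a \<theta>. AE z in lborel.
           \<psi> z = exp (\<i> * of_real \<theta>) * dark_soliton (soliton_speed p) (fst z - a))) \<and>
    (\<forall>lam. 0 < lam \<and> lam < lam_p \<longrightarrow> I_cyl lam p < I_line p \<and>
        \<not> (\<exists>\<psi> u. is_minimizer_cyl lam p \<psi> \<and> (AE z in lborel. \<psi> z = u (fst z))))"
proof -
  obtain al where al: "\<bar>al\<bar> < pi/2" "[soliton_momentum al = p] (rmod pi)" and sp: "soliton_speed p = sqrt 2 * sin al"
    using speed_param[OF assms] by blast
  define E0 where "E0 = chord_energy al"
  have I0: "I_line p = E0" unfolding E0_def by (rule I_line_eq[OF al])
  define adm where "adm \<psi> \<longleftrightarrow> \<psi> \<in> X_cyl \<and> [momentum_cyl \<psi> = p] (rmod pi)" for \<psi>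
  define S where "S = (\<lambda>z::real \<times> real. dark_soliton (soliton_speed p) (fst z))"
  have Ssol: "S = (\<lambda>z. sol 1 0 al (fst z))" by (simp add: S_def sp dark_soliton_sol[OF al(1)])
  note SF = soliton_facts[OF al(1), of 1, simplified]
  have S: "adm S" "E_cyl lam S = E0" for lam
  proof -
    note lift = lift_line[OF SF(1)[of 0], folded Ssol]
    show "E_cyl lam S = E0" using lift(2) SF(2) by (simp add: E0_def)
    have "sol 1 0 al = dark_soliton (sqrt 2 * sin al)" using dark_soliton_sol[OF al(1)] by (simp add: fun_eq_iff)
    then have "[momentum_cyl S = soliton_momentum al] (rmod pi)" using lift(3) soliton_line(3)[OF al(1)] by simp
    then show "adm S" using al(2) lift(1) by (simp add: adm_def rcong_pi_iff)
  qed
  have I_le: "I_cyl lam p \<le> E_cyl lam \<psi>" if "adm \<psi>" for lam \<psi>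
    unfolding I_cyl_def
  proof (rule cInf_lower)
    show "bdd_below {E_cyl lam \<psi> |\<psi>. \<psi> \<in> X_cyl \<and> [momentum_cyl \<psi> = p] (rmod pi)}"
      by (rule bdd_belowI[of _ 0]) (use E_cyl_nonneg in blast)
  qed (use that in \<open>auto simp: adm_def\<close>)
  \<comment> \<open>Stated for each competitor separately, so that monotonicity and continuity of
    the energy in \<open>lam\<close> for a fixed \<psi> carry over.\<close>
  define good where "good lam \<longleftrightarrow> 0 < lam \<and> (\<forall>\<psi>. adm \<psi> \<longrightarrow> E0 \<le> E_cyl lam \<psi>)" for lam
  have I_eq: "I_cyl lam p = E0" if g: "good lam" for lam
  proof (rule antisym)
    show "I_cyl lam p \<le> E0" using I_le[OF S(1)] S(2) by simp
    show "E0 \<le> I_cyl lam p" unfolding I_cyl_def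
      by (rule cInf_greatest) (use S(1) g in \<open>auto simp: adm_def good_def\<close>)
  qed
  have I_less: "I_cyl lam p < E0" if ng: "0 < lam" "\<not> good lam" for lam
  proof -
    obtain \<psi> where \<psi>: "adm \<psi>" "E_cyl lam \<psi> < E0" using ng by (auto simp: good_def not_le)
    show ?thesis using I_le[OF \<psi>(1)] \<psi>(2) by (rule le_less_trans)
  qed
  have sol_mom: "[m = soliton_momentum al] (rmod pi)" if "[m = p] (rmod pi)" for m using that al(2) by (simp add: rcong_pi_iff)
  have diff: "\<exists>b\<ge>0. \<forall>lam lam'. E_cyl lam \<psi> - E_cyl lam' \<psi> = (lam\<^sup>2 - lam'\<^sup>2) / 2 * b" if ad: "adm \<psi>" for \<psi>
  proof -
    from ad have "\<psi> \<in> X_cyl" by (simp add: adm_def)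
    then show ?thesis by (rule cyl_reduction) (meson order_trans)
  qed
  have good_mono: "good lam'" if g: "good lam" "lam \<le> lam'" for lam lam'
    unfolding good_def
  proof (intro conjI allI impI)
    show "0 < lam'" using g by (simp add: good_def)
    fix \<psi> assume ad: "adm \<psi>"
    obtain b where b: "b \<ge> 0" "E_cyl lam' \<psi> - E_cyl lam \<psi> = (lam'\<^sup>2 - lam\<^sup>2) / 2 * b" using diff[OF ad] by blast
    have "lam\<^sup>2 \<le> lam'\<^sup>2" using g by (intro power_mono) (auto simp: good_def)
    then have "0 \<le> (lam'\<^sup>2 - lam\<^sup>2) / 2 * b" using b(1) by (intro mult_nonneg_nonneg) auto
    then show "E0 \<le> E_cyl lam' \<psi>" using b(2) g(1) ad unfolding good_def by fastforce
  qed
  \<comment> \<open>Any value with \<open>lam^2 >= 3/2\<close> serves: the gain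
    \<open>lam^2 / 2 * b\<close>, at least \<open>lam^2 / 2 * D\<close>, has to cover the losses
    \<open>D / 2\<close> and \<open>D / 4\<close>.\<close>
  have good2: "good 2"
    unfolding good_def
  proof (intro conjI allI impI)
    fix \<psi> assume ad: "adm \<psi>"
    then have X: "\<psi> \<in> X_cyl" and mom: "[momentum_cyl \<psi> = p] (rmod pi)" by (simp_all add: adm_def)
    from X show "E0 \<le> E_cyl 2 \<psi>"
    proof (rule cyl_reduction)
      fix d a b D
      assume u: "mean_y \<psi> \<in> X_line" and m: "momentum_cyl \<psi> = momentum_line (mean_y \<psi>) + d"
        and d: "sqrt 2 * \<bar>d\<bar> \<le> a / 2 + D / 4" and D: "0 \<le> D" "D \<le> b"
        and E: "\<And>lam. E_line (mean_y \<psi>) + a / 2 + lam\<^sup>2 / 2 * b - D / 2 \<le> E_cyl lam \<psi>"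
      have "E0 \<le> E_line (mean_y \<psi>) + sqrt 2 * \<bar>d\<bar>"
        unfolding E0_def by (rule line_bound[OF u al(1)]) (use sol_mom[OF mom] m in simp)
      then show "E0 \<le> E_cyl 2 \<psi>" using E[of 2] d D by simp
    qed
  qed simp
  define G where "G = Collect good"
  define lp where "lp = Inf G"
  have "2 \<in> G" using good2 by (simp add: G_def)
  moreover have "bdd_below G" by (rule bdd_belowI[of _ 0]) (simp add: G_def good_def)
  ultimately have G: "G \<noteq> {}" "bdd_below G" by auto
  have E0: "E0 > 0" using cos_gt_zero_pi[of al] al(1) by (simp add: E0_def chord_energy_def abs_less_iff)
  \<comment> \<open>A competitor cheaper than the soliton for one positive \<open>lam\<close> keeps
    the threshold away from 0, by monotonicity.\<close>
  obtain l1 \<psi>1 where l1: "l1 > 0" "\<psi>1 \<in> X_cyl" "[momentum_cyl \<psi>1 = p] (rmod pi)" "E_cyl l1 \<psi>1 < E0"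
    using cheap_momentum[OF assms E0] by blast
  have ng1: "\<not> good l1" using l1 by (auto simp: good_def adm_def not_le)
  have "l1 \<le> lp" unfolding lp_def
  proof (rule cInf_greatest[OF G(1)])
    fix g assume "g \<in> G"
    then show "l1 \<le> g" using good_mono[of g l1] ng1 by (cases "l1 \<le> g") (auto simp: G_def)
  qed
  then have lp0: "lp > 0" using l1(1) by linarith
  have good_gt: "good lam" if gt: "lp < lam" for lam
  proof -
    obtain g where "g \<in> G" "g < lam" using cInf_lessD[OF G(1)] gt unfolding lp_def by blast
    then show ?thesis using good_mono[of g lam] by (simp add: G_def)
  qed
  \<comment> \<open>The energy of a fixed competitor is continuous in \<open>lam\<close>, so the
    inequality survives at the threshold itself.\<close>
  have good_lp: "good lp"
    unfolding good_def
  proof (intro conjI allI impI lp0)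
    fix \<psi> assume ad: "adm \<psi>"
    obtain b where b: "\<And>lam lam'. E_cyl lam \<psi> - E_cyl lam' \<psi> = (lam\<^sup>2 - lam'\<^sup>2) / 2 * b" using diff[OF ad] by blast
    have "E0 \<le> E_cyl lp \<psi> + ((lp + inverse (real (Suc n)))\<^sup>2 - lp\<^sup>2) / 2 * b" for n
    proof -
      have "E0 \<le> E_cyl (lp + inverse (real (Suc n))) \<psi>" using good_gt[of "lp + inverse (real (Suc n))"] ad by (simp add: good_def)
      then show ?thesis using b[of "lp + inverse (real (Suc n))" lp] by linarith
    qed
    moreover have "(\<lambda>n. E_cyl lp \<psi> + ((lp + inverse (real (Suc n)))\<^sup>2 - lp\<^sup>2) / 2 * b) \<longlonglongrightarrow> E_cyl lp \<psi> + ((lp + 0)\<^sup>2 - lp\<^sup>2) / 2 * b"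
      by (intro tendsto_intros LIMSEQ_inverse_real_of_nat) simp
    ultimately have "E0 \<le> E_cyl lp \<psi> + ((lp + 0)\<^sup>2 - lp\<^sup>2) / 2 * b" by (intro LIMSEQ_le_const) blast+
    then show "E0 \<le> E_cyl lp \<psi>" by simp
  qed
  have good_iff: "good lam \<longleftrightarrow> lp \<le> lam" for lam
    using good_mono[OF good_lp] cInf_lower[OF _ G(2), of lam] by (auto simp: G_def lp_def)
  \<comment> \<open>A minimizer above the threshold has energy at least \<open>E0\<close> at the
    threshold too. As its energy grows in \<open>lam^2\<close> with slope \<open>b / 2\<close>, this
    forces \<open>b = 0\<close>, hence \<open>D = 0\<close>: the function equals its mean, and
    rigidity on the line applies.\<close>
  have rigid: "\<exists>a \<theta>. AE z in lborel. \<psi> z = exp (\<i> * of_real \<theta>) * dark_soliton (soliton_speed p) (fst z - a)"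
    if lam: "lp < lam" and mi: "is_minimizer_cyl lam p \<psi>" for lam \<psi>
  proof -
    have X: "\<psi> \<in> X_cyl" and mom: "[momentum_cyl \<psi> = p] (rmod pi)" and e: "E_cyl lam \<psi> = E0"
      using mi I_eq[of lam] lam good_iff[of lam] by (simp_all add: is_minimizer_cyl_def)
    from X show ?thesis
    proof (rule cyl_reduction)
      fix d a b D
      assume u: "mean_y \<psi> \<in> X_line" and m: "momentum_cyl \<psi> = momentum_line (mean_y \<psi>) + d"
        and D: "0 \<le> a" "0 \<le> D" "D \<le> b" and D0: "D = 0 \<Longrightarrow> d = 0" "D = 0 \<Longrightarrow> AE z in lborel. \<psi> z = mean_y \<psi> (fst z)"
        and E: "\<And>lam. E_line (mean_y \<psi>) + a / 2 + lam\<^sup>2 / 2 * b - D / 2 \<le> E_cyl lam \<psi>"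
        and ed: "\<And>lam lam'. E_cyl lam \<psi> - E_cyl lam' \<psi> = (lam\<^sup>2 - lam'\<^sup>2) / 2 * b"
      have "E0 \<le> E_cyl lp \<psi>" using good_lp X mom by (simp add: good_def adm_def)
      then have "(lam\<^sup>2 - lp\<^sup>2) / 2 * b \<le> 0" using ed[of lam lp] e by linarith
      moreover have "lam\<^sup>2 - lp\<^sup>2 > 0" using lam lp0 by (simp add: power_strict_mono)
      ultimately have b: "b = 0" "D = 0" using D by (auto simp: mult_le_0_iff)
      have "E_line (mean_y \<psi>) \<le> chord_energy al" using E[of lam] e D b by (simp add: E0_def)
      moreover have "[momentum_line (mean_y \<psi>) = soliton_momentum al] (rmod pi)" using sol_mom[OF mom] m D0(1)[OF b(2)] by simp
      ultimately obtain a \<theta> where r: "AE x in lborel. mean_y \<psi> x = exp (\<i> * of_real \<theta>) * dark_soliton (sqrt 2 * sin al) (x - a)"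
        using line_rigidity[OF u al(1)] by blast
      have "AE z in lborel. \<psi> z = exp (\<i> * of_real \<theta>) * dark_soliton (soliton_speed p) (fst z - a)"
        using D0(2)[OF b(2)] AE_fst[OF r] by eventually_elim (simp add: sp)
      then show ?thesis by blast
    qed
  qed
  \<comment> \<open>A function of \<open>x\<close> alone has no oscillation and obeys the bound on
    the line, so its energy is at least \<open>E0\<close>, which exceeds the infimum below the
    threshold.\<close>
  have no_1d: False if lam: "0 < lam" "lam < lp" and mi: "is_minimizer_cyl lam p \<psi>" and u0: "AE z in lborel. \<psi> z = u0 (fst z)" for lam \<psi> u0
  proof -
    have X: "\<psi> \<in> X_cyl" and mom: "[momentum_cyl \<psi> = p] (rmod pi)" and e: "E_cyl lam \<psi> < E0"
      using mi I_less[of lam] lam good_iff[of lam] by (simp_all add: is_minimizer_cyl_def)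
    from X show False
    proof (rule cyl_reduction)
      fix d a b D
      assume u: "mean_y \<psi> \<in> X_line" and m: "momentum_cyl \<psi> = momentum_line (mean_y \<psi>) + d"
        and D: "0 \<le> a" "0 \<le> D" "D \<le> b" and D0: "D = 0 \<Longrightarrow> d = 0" "\<And>u. AE z in lborel. \<psi> z = u (fst z) \<Longrightarrow> D = 0"
        and E: "\<And>lam. E_line (mean_y \<psi>) + a / 2 + lam\<^sup>2 / 2 * b - D / 2 \<le> E_cyl lam \<psi>"
      have z: "D = 0" "d = 0" using D0(2)[OF u0] D0(1) by simp_all
      have "E0 \<le> E_line (mean_y \<psi>) + sqrt 2 * \<bar>d\<bar>"
        unfolding E0_def by (rule line_bound[OF u al(1)]) (use sol_mom[OF mom] m in simp)
      moreover have "0 \<le> lam\<^sup>2 / 2 * b" using D by (intro mult_nonneg_nonneg) auto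
      ultimately show False using E[of lam] D z e by simp
    qed
  qed
  show ?thesis
  proof (rule exI[of _ lp], intro conjI allI impI lp0)
    fix lam assume lam: "lp \<le> lam"
    then have g: "I_cyl lam p = E0" using good_iff I_eq by blast
    then show "I_cyl lam p = I_line p" by (simp add: I0)
    show "is_minimizer_cyl lam p (\<lambda>z. dark_soliton (soliton_speed p) (fst z))"
      using S g by (simp add: is_minimizer_cyl_def adm_def S_def)
  next
    fix lam \<psi> assume "lp < lam" "is_minimizer_cyl lam p \<psi>"
    then show "\<exists>a \<theta>. AE z in lborel. \<psi> z = exp (\<i> * of_real \<theta>) * dark_soliton (soliton_speed p) (fst z - a)" by (rule rigid)
  next
    fix lam assume "0 < lam \<and> lam < lp"
    then have lam: "0 < lam" "lam < lp" by auto
    show "I_cyl lam p < I_line p" unfolding I0 by (rule I_less[OF lam(1)]) (use lam(2) good_iff[of lam] in simp)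
    show "\<not> (\<exists>\<psi> u. is_minimizer_cyl lam p \<psi> \<and> (AE z in lborel. \<psi> z = u (fst z)))" using no_1d[OF lam] by blast
  qed
qed

end
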